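(* Let $\mathbb{X}$ be an exact Mal'tsev category and $n\geq 1$. The adjunction $\mathrm{CoeqFork}^n\dashv\mathrm{grph}^n$, where $\mathrm{grph}^n\colon\mathsf{Fork}^n(\mathbb{X})\to\mathsf{RGrph}^n(\mathbb{X})$ and $\mathrm{CoeqFork}^n\colon\mathsf{RGrph}^n(\mathbb{X})\to\mathsf{Fork}^n(\mathbb{X})$, restricts to an adjoint equivalence $\mathsf{EFork}^n(\mathbb{X})\simeq\mathsf{DPERel}^n(\mathbb{X})$ between the category of exact $n$-forks ($3^n$-diagrams) and the category of distributive parallelistic $n$-fold equivalence relations.
   Context: An exact Mal'tsev category is a Barr exact category in which every (internal) reflexive relation is an equivalence relation; in it every reflexive graph has a coequaliser, and equivalence relations on an object form a lattice with $R\vee S=RS=SR$. We write $n=\{0,\dots,n-1\}$. Forks: a (reflexive) fork $F$ in a category consists of arrows $d,c\colon F_2\rightrightarrows F_1$, $e\colon F_1\to F_2$, $f\colon F_1\to F_0$ with $fd=fc$ and $de=1_{F_1}=ce$; equivalently, it is a functor $(\mathsf{3}^+)^{\mathrm{op}}\to\mathbb{X}$ where $\mathsf{3}^+$ is the full subcategory of the category of finite ordinals and order-preserving maps on the objects $0,1,2$. The fork is exact when $(d,c)$ is the kernel pair of $f$ (with $e$ the diagonal) and $f$ is the coequaliser of $(d,c)$. $\mathsf{Fork}^n(\mathbb{X})=\mathsf{Fork}(\mathsf{Fork}^{n-1}(\mathbb{X}))\simeq \mathrm{Fun}(((\mathsf{3}^+)^{\mathrm{op}})^n,\mathbb{X})$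 is the category of $n$-forks. An $n$-fork is exact, also called a $3^n$-diagram, when for each of the $n$ directions and each choice of values in $\{0,1,2\}$ for the other coordinates, the resulting fork in $\mathbb{X}$ is exact. $\mathsf{EFork}^n(\mathbb{X})$ is the full subcategory of exact $n$-forks. Functors: $\mathsf{RGrph}(\mathbb{X})$ is the category of reflexive graphs, $\mathsf{RGrph}^n(\mathbb{X})=\mathsf{RGrph}(\mathsf{RGrph}^{n-1}(\mathbb{X}))$. $\mathrm{grph}$ sends a fork to its underlying reflexive graph $(F_2,d,c,e)$; its left adjoint $\mathrm{CoeqFork}$ sends a reflexive graph to the fork obtained by adding the coequaliser of $d$ and $c$. The $n$-fold versions are obtained by iteration: $\mathrm{grph}^n=\mathrm{grph}\circ\mathsf{Fork}(\mathrm{grph}^{n-1})$ restricts an $n$-fork to the objects whose coordinates are all in $\{1,2\}$, and $\mathrm{CoeqFork}^n=\mathsf{Fork}(\mathrm{CoeqFork}^{n-1})\circ\mathrm{CoeqFork}$ completes an $n$-fold reflexive graph to an $n$-fork by taking coequalisers successively in all directions. Parallelistic: given equivalence relations $R_0,\dots,R_{n-1}$ on an object $X$, $\square_{i\in n}R_i$ denotes the largest $n$-fold equivalence relation on them (an $n$-fold equivalence relation being an object of $\mathsf{ERel}^n(\mathbb{X})=\mathsf{ERel}(\mathsf{ERel}^{n-1}(\mathbb{X}))\subseteq\mathsf{RGrph}^n(\mathbb{X})$); its top object is the subobject of $X^{2^n}$ of families $(x_a)_{a\in\{0,1\}^n}$ such that $x_aR_ix_b$ whenever $a$ and $b$ differ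 only in coordinate $i$. Equivalently, $\square$ is the right adjoint of the functor sending an $n$-fold equivalence relation to its $n$-tuple of underlying equivalence relations on $X$. An $n$-fold equivalence relation is parallelistic when it is isomorphic to some $\square_{i\in n}R_i$. Distributive: a collection $(R_i)_{i\in n}$ of equivalence relations on $X$ is distributive when, for all $k\geq 1$ and all $J_0,J_1,\dots,J_k\subseteq n$ with $J_i\cap J_j=\emptyset$ for $i\neq j$, $$\Big(\bigwedge_{j\in J_0}R_j\Big)\wedge\bigvee_{i=1}^k\Big(\bigwedge_{j\in J_i}R_j\Big)=\bigvee_{i=1}^k\Big(\bigwedge_{j\in J_0\cup J_i}R_j\Big)$$ (an empty meet being the largest relation). $\square_{i\in n}R_i$ is distributive when $(R_i)_{i\in n}$ is. $\mathsf{DPERel}^n(\mathbb{X})$ is the full subcategory of $\mathsf{RGrph}^n(\mathbb{X})$ of distributive parallelistic $n$-fold equivalence relations. *)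

theory Defs
  imports Main "HOL-Algebra.Lattice"
begin

section \<open>Categories, functors, adjunctions\<close>

text \<open>
  Hom-sets are indexed by their domain and codomain and need not be disjoint. Hence a morphism of
  reflexive graphs or of forks can be recorded by its components alone, and the arrow part of a
  functor takes the domain and the codomain as arguments.
\<close>

record ('o, 'm) category =
  Ob :: "'o set"
  Hom :: "'o \<Rightarrow> 'o \<Rightarrow> 'm set"
  Id :: "'o \<Rightarrow> 'm"
  Comp :: "'m \<Rightarrow> 'm \<Rightarrow> 'm" (infixl \<open>\<cdot>\<index>\<close> 70)

locale category =
  fixes C :: "('o, 'm) category" (structure)
  assumes hom_ob: "f \<in> Hom C A B \<Longrightarrow> A \<in> Ob C \<and> B \<in> Ob C"
    and id_hom: "A \<in> Ob C \<Longrightarrow> Id C A \<in> Hom C A A"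
    and comp_hom: "f \<in> Hom C A B \<Longrightarrow> g \<in> Hom C B D \<Longrightarrow> g \<cdot> f \<in> Hom C A D"
    and comp_id_right: "f \<in> Hom C A B \<Longrightarrow> f \<cdot> Id C A = f"
    and comp_id_left: "f \<in> Hom C A B \<Longrightarrow> Id C B \<cdot> f = f"
    and comp_assoc: "f \<in> Hom C A B \<Longrightarrow> g \<in> Hom C B D \<Longrightarrow> h \<in> Hom C D E
      \<Longrightarrow> (h \<cdot> g) \<cdot> f = h \<cdot> (g \<cdot> f)"

definition full_subcategory :: "('o, 'm) category \<Rightarrow> ('o \<Rightarrow> bool) \<Rightarrow> ('o, 'm) category" where
  "full_subcategory C P =
    \<lparr>Ob = {A \<in> Ob C. P A}, Hom = (\<lambda>A B. {f \<in> Hom C A B. P A \<and> P B}), Id = Id C, Comp = Comp C\<rparr>"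

definition iso :: "('o, 'm) category \<Rightarrow> 'o \<Rightarrow> 'o \<Rightarrow> 'm \<Rightarrow> bool" where
  "iso C A B f \<longleftrightarrow> f \<in> Hom C A B \<and>
    (\<exists>g \<in> Hom C B A. g \<cdot>\<^bsub>C\<^esub> f = Id C A \<and> f \<cdot>\<^bsub>C\<^esub> g = Id C B)"

definition isomorphic :: "('o, 'm) category \<Rightarrow> 'o \<Rightarrow> 'o \<Rightarrow> bool" where
  "isomorphic C A B \<longleftrightarrow> (\<exists>f. iso C A B f)"

record ('o, 'm, 'p, 'k) functr =
  FOb :: "'o \<Rightarrow> 'p"
  FAr :: "'o \<Rightarrow> 'o \<Rightarrow> 'm \<Rightarrow> 'k"

definition is_functor ::
    "('o, 'm) category \<Rightarrow> ('p, 'k) category \<Rightarrow> ('o, 'm, 'p, 'k) functr \<Rightarrow> bool" where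
  "is_functor C D F \<longleftrightarrow>
    (\<forall>A \<in> Ob C. FOb F A \<in> Ob D) \<and>
    (\<forall>A B. \<forall>f \<in> Hom C A B. FAr F A B f \<in> Hom D (FOb F A) (FOb F B)) \<and>
    (\<forall>A \<in> Ob C. FAr F A A (Id C A) = Id D (FOb F A)) \<and>
    (\<forall>A B E. \<forall>f \<in> Hom C A B. \<forall>g \<in> Hom C B E.
      FAr F A E (g \<cdot>\<^bsub>C\<^esub> f) = FAr F B E g \<cdot>\<^bsub>D\<^esub> FAr F A B f)"

definition id_functor :: "('o, 'm, 'o, 'm) functr" where
  "id_functor = \<lparr>FOb = (\<lambda>A. A), FAr = (\<lambda>A B f. f)\<rparr>"

definition comp_functor ::
    "('p, 'k, 'q, 'l) functr \<Rightarrow> ('o, 'm, 'p, 'k) functr \<Rightarrow> ('o, 'm, 'q, 'l) functr" where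
  "comp_functor G F = \<lparr>FOb = (\<lambda>A. FOb G (FOb F A)),
    FAr = (\<lambda>A B f. FAr G (FOb F A) (FOb F B) (FAr F A B f))\<rparr>"

definition natural_transformation :: "('o, 'm) category \<Rightarrow> ('p, 'k) category \<Rightarrow>
    ('o, 'm, 'p, 'k) functr \<Rightarrow> ('o, 'm, 'p, 'k) functr \<Rightarrow> ('o \<Rightarrow> 'k) \<Rightarrow> bool" where
  "natural_transformation C D F G \<tau> \<longleftrightarrow>
    (\<forall>A \<in> Ob C. \<tau> A \<in> Hom D (FOb F A) (FOb G A)) \<and>
    (\<forall>A B. \<forall>f \<in> Hom C A B. \<tau> B \<cdot>\<^bsub>D\<^esub> FAr F A B f = FAr G A B f \<cdot>\<^bsub>D\<^esub> \<tau> A)"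

definition adjunction :: "('o, 'm) category \<Rightarrow> ('p, 'k) category \<Rightarrow>
    ('o, 'm, 'p, 'k) functr \<Rightarrow> ('p, 'k, 'o, 'm) functr \<Rightarrow> ('o \<Rightarrow> 'm) \<Rightarrow> ('p \<Rightarrow> 'k) \<Rightarrow> bool" where
  "adjunction C D L R \<eta> \<epsilon> \<longleftrightarrow>
    category C \<and> category D \<and> is_functor C D L \<and> is_functor D C R \<and>
    natural_transformation C C id_functor (comp_functor R L) \<eta> \<and>
    natural_transformation D D (comp_functor L R) id_functor \<epsilon> \<and>
    (\<forall>A \<in> Ob C. \<epsilon> (FOb L A) \<cdot>\<^bsub>D\<^esub> FAr L A (FOb R (FOb L A)) (\<eta> A) = Id D (FOb L A)) \<and>
    (\<forall>B \<in> Ob D. FAr R (FOb L (FOb R B)) B (\<epsilon> B) \<cdot>\<^bsub>C\<^esub> \<eta> (FOb R B) = Id C (FOb R B))"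

definition adjoint_equivalence :: "('o, 'm) category \<Rightarrow> ('p, 'k) category \<Rightarrow>
    ('o, 'm, 'p, 'k) functr \<Rightarrow> ('p, 'k, 'o, 'm) functr \<Rightarrow> ('o \<Rightarrow> 'm) \<Rightarrow> ('p \<Rightarrow> 'k) \<Rightarrow> bool" where
  "adjoint_equivalence C D L R \<eta> \<epsilon> \<longleftrightarrow> adjunction C D L R \<eta> \<epsilon> \<and>
    (\<forall>A \<in> Ob C. iso C A (FOb R (FOb L A)) (\<eta> A)) \<and>
    (\<forall>B \<in> Ob D. iso D (FOb L (FOb R B)) B (\<epsilon> B))"


section \<open>Exact Mal'tsev categories\<close>

definition terminal :: "('o, 'm) category \<Rightarrow> 'o \<Rightarrow> bool" where
  "terminal C T \<longleftrightarrow> T \<in> Ob C \<and> (\<forall>A \<in> Ob C. \<exists>!f. f \<in> Hom C A T)"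

definition is_pullback :: "('o, 'm) category \<Rightarrow> 'o \<Rightarrow> 'o \<Rightarrow> 'o \<Rightarrow> 'm \<Rightarrow> 'm \<Rightarrow> 'o \<Rightarrow> 'm \<Rightarrow> 'm \<Rightarrow> bool" where
  "is_pullback C A B D f g P p q \<longleftrightarrow>
    f \<in> Hom C A D \<and> g \<in> Hom C B D \<and> p \<in> Hom C P A \<and> q \<in> Hom C P B \<and> f \<cdot>\<^bsub>C\<^esub> p = g \<cdot>\<^bsub>C\<^esub> q \<and>
    (\<forall>T. \<forall>x \<in> Hom C T A. \<forall>y \<in> Hom C T B. f \<cdot>\<^bsub>C\<^esub> x = g \<cdot>\<^bsub>C\<^esub> y \<longrightarrow>
      (\<exists>!h. h \<in> Hom C T P \<and> p \<cdot>\<^bsub>C\<^esub> h = x \<and> q \<cdot>\<^bsub>C\<^esub> h = y))"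

definition is_kernel_pair :: "('o, 'm) category \<Rightarrow> 'o \<Rightarrow> 'o \<Rightarrow> 'm \<Rightarrow> 'o \<Rightarrow> 'm \<Rightarrow> 'm \<Rightarrow> bool" where
  "is_kernel_pair C A B f K d c \<longleftrightarrow> is_pullback C A A B f f K d c"

definition is_coequaliser :: "('o, 'm) category \<Rightarrow> 'o \<Rightarrow> 'o \<Rightarrow> 'm \<Rightarrow> 'm \<Rightarrow> 'o \<Rightarrow> 'm \<Rightarrow> bool" where
  "is_coequaliser C A B x y Q q \<longleftrightarrow>
    x \<in> Hom C A B \<and> y \<in> Hom C A B \<and> q \<in> Hom C B Q \<and> q \<cdot>\<^bsub>C\<^esub> x = q \<cdot>\<^bsub>C\<^esub> y \<and>
    (\<forall>Z. \<forall>h \<in> Hom C B Z. h \<cdot>\<^bsub>C\<^esub> x = h \<cdot>\<^bsub>C\<^esub> y \<longrightarrow> (\<exists>!k. k \<in> Hom C Q Z \<and> k \<cdot>\<^bsub>C\<^esub> q = h))"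

definition regular_epi :: "('o, 'm) category \<Rightarrow> 'o \<Rightarrow> 'o \<Rightarrow> 'm \<Rightarrow> bool" where
  "regular_epi C A B f \<longleftrightarrow> (\<exists>K x y. is_coequaliser C K A x y B f)"

definition jointly_monic :: "('o, 'm) category \<Rightarrow> 'o \<Rightarrow> 'm \<Rightarrow> 'm \<Rightarrow> bool" where
  "jointly_monic C R d c \<longleftrightarrow> (\<forall>T. \<forall>x \<in> Hom C T R. \<forall>y \<in> Hom C T R.
    d \<cdot>\<^bsub>C\<^esub> x = d \<cdot>\<^bsub>C\<^esub> y \<and> c \<cdot>\<^bsub>C\<^esub> x = c \<cdot>\<^bsub>C\<^esub> y \<longrightarrow> x = y)"

definition is_relation :: "('o, 'm) category \<Rightarrow> 'o \<Rightarrow> 'o \<Rightarrow> 'm \<Rightarrow> 'm \<Rightarrow> bool" where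
  "is_relation C A R d c \<longleftrightarrow> d \<in> Hom C R A \<and> c \<in> Hom C R A \<and> jointly_monic C R d c"

definition is_reflexive_relation :: "('o, 'm) category \<Rightarrow> 'o \<Rightarrow> 'o \<Rightarrow> 'm \<Rightarrow> 'm \<Rightarrow> bool" where
  "is_reflexive_relation C A R d c \<longleftrightarrow> is_relation C A R d c \<and>
    (\<exists>e \<in> Hom C A R. d \<cdot>\<^bsub>C\<^esub> e = Id C A \<and> c \<cdot>\<^bsub>C\<^esub> e = Id C A)"

text \<open>Reflexivity, symmetry and transitivity are expressed by generalised elements.\<close>

definition is_equivalence_relation :: "('o, 'm) category \<Rightarrow> 'o \<Rightarrow> 'o \<Rightarrow> 'm \<Rightarrow> 'm \<Rightarrow> bool" where
  "is_equivalence_relation C A R d c \<longleftrightarrow> is_relation C A R d c \<and>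
    (\<forall>T \<in> Ob C. equiv (Hom C T A) ((\<lambda>x. (d \<cdot>\<^bsub>C\<^esub> x, c \<cdot>\<^bsub>C\<^esub> x)) ` Hom C T R))"

locale finitely_complete_category = category C for C :: "('o, 'm) category" (structure) +
  assumes ex_terminal: "\<exists>T. terminal C T"
    and ex_pullback: "f \<in> Hom C A D \<Longrightarrow> g \<in> Hom C B D \<Longrightarrow> \<exists>P p q. is_pullback C A B D f g P p q"

locale regular_category = finitely_complete_category C for C :: "('o, 'm) category" (structure) +
  assumes ex_coequaliser_kernel_pair:
      "is_kernel_pair C A B f K d c \<Longrightarrow> \<exists>Q q. is_coequaliser C K A d c Q q"
    and regular_epi_pullback_stable:
      "is_pullback C A B D f g P p q \<Longrightarrow> regular_epi C A D f \<Longrightarrow> regular_epi C P B q"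

locale exact_category = regular_category C for C :: "('o, 'm) category" (structure) +
  assumes equivalence_relation_effective:
      "is_equivalence_relation C A R d c \<Longrightarrow> \<exists>B f. is_kernel_pair C A B f R d c"

locale exact_maltsev_category = exact_category C for C :: "('o, 'm) category" (structure) +
  assumes reflexive_relation_equivalence:
      "is_reflexive_relation C A R d c \<Longrightarrow> is_equivalence_relation C A R d c"


section \<open>Iterated reflexive graphs, equivalence relations and forks\<close>

text \<open>
  The iterated categories are all carved out of one type of objects and one type of arrows, so that
  the constructions \<open>RGrph\<close>, \<open>ERel\<close> and \<open>Fork\<close> can be iterated \<open>n\<close> times for a variable \<open>n\<close>.

  \<open>RG G1 G2 d c e\<close> is the reflexive graph with \<open>d, c : G2 \<rightarrow> G1\<close> and \<open>e : G1 \<rightarrow> G2\<close>;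
  \<open>Fk F0 F1 F2 d c e f\<close> is the fork with \<open>d, c : F2 \<rightarrow> F1\<close>, \<open>e : F1 \<rightarrow> F2\<close> and \<open>f : F1 \<rightarrow> F0\<close>.
  \<open>RGA m1 m2\<close> and \<open>FkA m0 m1 m2\<close> are morphisms given by their components.
\<close>

datatype 'm arr = BaseA 'm | RGA "'m arr" "'m arr" | FkA "'m arr" "'m arr" "'m arr"

datatype ('o, 'm) obj =
    Base 'o
  | RG "('o, 'm) obj" "('o, 'm) obj" "'m arr" "'m arr" "'m arr"
  | Fk "('o, 'm) obj" "('o, 'm) obj" "('o, 'm) obj" "'m arr" "'m arr" "'m arr" "'m arr"

type_synonym ('o, 'm) tcat = "(('o, 'm) obj, 'm arr) category"
type_synonym ('o, 'm) tfun = "(('o, 'm) obj, 'm arr, ('o, 'm) obj, 'm arr) functr"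

definition base :: "('o, 'm) category \<Rightarrow> ('o, 'm) tcat" where
  "base X = \<lparr>Ob = Base ` Ob X,
    Hom = (\<lambda>A B. {BaseA f |f a b. A = Base a \<and> B = Base b \<and> f \<in> Hom X a b}),
    Id = (\<lambda>A. case A of Base a \<Rightarrow> BaseA (Id X a)),
    Comp = (\<lambda>g f. case (g, f) of (BaseA g', BaseA f') \<Rightarrow> BaseA (g' \<cdot>\<^bsub>X\<^esub> f'))\<rparr>"

subsection \<open>Reflexive graphs\<close>

definition rgrph_ob :: "('o, 'm) tcat \<Rightarrow> ('o, 'm) obj set" where
  "rgrph_ob C = {RG G1 G2 d c e |G1 G2 d c e.
    G1 \<in> Ob C \<and> G2 \<in> Ob C \<and> d \<in> Hom C G2 G1 \<and> c \<in> Hom C G2 G1 \<and> e \<in> Hom C G1 G2 \<and>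
    d \<cdot>\<^bsub>C\<^esub> e = Id C G1 \<and> c \<cdot>\<^bsub>C\<^esub> e = Id C G1}"

definition rgrph_hom :: "('o, 'm) tcat \<Rightarrow> ('o, 'm) obj \<Rightarrow> ('o, 'm) obj \<Rightarrow> 'm arr set" where
  "rgrph_hom C G H = {RGA m1 m2 |m1 m2 G1 G2 d c e H1 H2 d' c' e'.
    G = RG G1 G2 d c e \<and> H = RG H1 H2 d' c' e' \<and> G \<in> rgrph_ob C \<and> H \<in> rgrph_ob C \<and>
    m1 \<in> Hom C G1 H1 \<and> m2 \<in> Hom C G2 H2 \<and>
    d' \<cdot>\<^bsub>C\<^esub> m2 = m1 \<cdot>\<^bsub>C\<^esub> d \<and> c' \<cdot>\<^bsub>C\<^esub> m2 = m1 \<cdot>\<^bsub>C\<^esub> c \<and> e' \<cdot>\<^bsub>C\<^esub> m1 = m2 \<cdot>\<^bsub>C\<^esub> e}"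

definition RGrph :: "('o, 'm) tcat \<Rightarrow> ('o, 'm) tcat" where
  "RGrph C = \<lparr>Ob = rgrph_ob C, Hom = rgrph_hom C,
    Id = (\<lambda>G. case G of RG G1 G2 d c e \<Rightarrow> RGA (Id C G1) (Id C G2)),
    Comp = (\<lambda>n m. case (n, m) of
      (RGA n1 n2, RGA m1 m2) \<Rightarrow> RGA (n1 \<cdot>\<^bsub>C\<^esub> m1) (n2 \<cdot>\<^bsub>C\<^esub> m2))\<rparr>"

definition RGrphN :: "nat \<Rightarrow> ('o, 'm) category \<Rightarrow> ('o, 'm) tcat" where
  "RGrphN n X = (RGrph ^^ n) (base X)"

subsection \<open>Equivalence relations\<close>

definition ERel :: "('o, 'm) tcat \<Rightarrow> ('o, 'm) tcat" where
  "ERel C = full_subcategory (RGrph C)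
    (\<lambda>G. \<exists>A R d c e. G = RG A R d c e \<and> is_equivalence_relation C A R d c)"

definition ERelN :: "nat \<Rightarrow> ('o, 'm) category \<Rightarrow> ('o, 'm) tcat" where
  "ERelN n X = (ERel ^^ n) (base X)"

subsection \<open>Forks\<close>

definition fork_ob :: "('o, 'm) tcat \<Rightarrow> ('o, 'm) obj set" where
  "fork_ob C = {Fk F0 F1 F2 d c e f |F0 F1 F2 d c e f.
    F0 \<in> Ob C \<and> F1 \<in> Ob C \<and> F2 \<in> Ob C \<and>
    d \<in> Hom C F2 F1 \<and> c \<in> Hom C F2 F1 \<and> e \<in> Hom C F1 F2 \<and> f \<in> Hom C F1 F0 \<and>
    f \<cdot>\<^bsub>C\<^esub> d = f \<cdot>\<^bsub>C\<^esub> c \<and> d \<cdot>\<^bsub>C\<^esub> e = Id C F1 \<and> c \<cdot>\<^bsub>C\<^esub> e = Id C F1}"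

definition fork_hom :: "('o, 'm) tcat \<Rightarrow> ('o, 'm) obj \<Rightarrow> ('o, 'm) obj \<Rightarrow> 'm arr set" where
  "fork_hom C F H = {FkA m0 m1 m2 |m0 m1 m2 F0 F1 F2 d c e f H0 H1 H2 d' c' e' f'.
    F = Fk F0 F1 F2 d c e f \<and> H = Fk H0 H1 H2 d' c' e' f' \<and> F \<in> fork_ob C \<and> H \<in> fork_ob C \<and>
    m0 \<in> Hom C F0 H0 \<and> m1 \<in> Hom C F1 H1 \<and> m2 \<in> Hom C F2 H2 \<and>
    d' \<cdot>\<^bsub>C\<^esub> m2 = m1 \<cdot>\<^bsub>C\<^esub> d \<and> c' \<cdot>\<^bsub>C\<^esub> m2 = m1 \<cdot>\<^bsub>C\<^esub> c \<and> e' \<cdot>\<^bsub>C\<^esub> m1 = m2 \<cdot>\<^bsub>C\<^esub> e \<and>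
    f' \<cdot>\<^bsub>C\<^esub> m1 = m0 \<cdot>\<^bsub>C\<^esub> f}"

definition Fork :: "('o, 'm) tcat \<Rightarrow> ('o, 'm) tcat" where
  "Fork C = \<lparr>Ob = fork_ob C, Hom = fork_hom C,
    Id = (\<lambda>F. case F of Fk F0 F1 F2 d c e f \<Rightarrow> FkA (Id C F0) (Id C F1) (Id C F2)),
    Comp = (\<lambda>n m. case (n, m) of
      (FkA n0 n1 n2, FkA m0 m1 m2) \<Rightarrow> FkA (n0 \<cdot>\<^bsub>C\<^esub> m0) (n1 \<cdot>\<^bsub>C\<^esub> m1) (n2 \<cdot>\<^bsub>C\<^esub> m2))\<rparr>"

definition ForkN :: "nat \<Rightarrow> ('o, 'm) category \<Rightarrow> ('o, 'm) tcat" where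
  "ForkN n X = (Fork ^^ n) (base X)"

text \<open>The functor \<open>Fork(G) : Fork(C) \<rightarrow> Fork(D)\<close> applies \<open>G : C \<rightarrow> D\<close> to a whole fork.\<close>

definition Fork_functor :: "('o, 'm) tfun \<Rightarrow> ('o, 'm) tfun" where
  "Fork_functor G = \<lparr>
    FOb = (\<lambda>F. case F of Fk F0 F1 F2 d c e f \<Rightarrow>
      Fk (FOb G F0) (FOb G F1) (FOb G F2)
        (FAr G F2 F1 d) (FAr G F2 F1 c) (FAr G F1 F2 e) (FAr G F1 F0 f)),
    FAr = (\<lambda>F H m. case (F, H, m) of
      (Fk F0 F1 F2 _ _ _ _, Fk H0 H1 H2 _ _ _ _, FkA m0 m1 m2) \<Rightarrow>
        FkA (FAr G F0 H0 m0) (FAr G F1 H1 m1) (FAr G F2 H2 m2))\<rparr>"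

section \<open>The functors between forks and reflexive graphs\<close>

definition grph :: "('o, 'm) tfun" where
  "grph = \<lparr>FOb = (\<lambda>F. case F of Fk F0 F1 F2 d c e f \<Rightarrow> RG F1 F2 d c e),
    FAr = (\<lambda>F H m. case m of FkA m0 m1 m2 \<Rightarrow> RGA m1 m2)\<rparr>"

primrec grphN :: "nat \<Rightarrow> ('o, 'm) tfun" where
  "grphN 0 = id_functor"
| "grphN (Suc n) = comp_functor grph (Fork_functor (grphN n))"

definition coeq :: "('o, 'm) category \<Rightarrow> 'o \<Rightarrow> 'o \<Rightarrow> 'm \<Rightarrow> 'm \<Rightarrow> 'o \<times> 'm" where
  "coeq C A B x y = (SOME z. is_coequaliser C A B x y (fst z) (snd z))"

definition CoeqFork :: "('o, 'm) tcat \<Rightarrow> ('o, 'm) tfun" where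
  "CoeqFork C = \<lparr>
    FOb = (\<lambda>G. case G of RG G1 G2 d c e \<Rightarrow>
      Fk (fst (coeq C G2 G1 d c)) G1 G2 d c e (snd (coeq C G2 G1 d c))),
    FAr = (\<lambda>G H m. case (G, H, m) of (RG G1 G2 d c e, RG H1 H2 d' c' e', RGA m1 m2) \<Rightarrow>
      FkA (THE m0. m0 \<in> Hom C (fst (coeq C G2 G1 d c)) (fst (coeq C H2 H1 d' c')) \<and>
                   m0 \<cdot>\<^bsub>C\<^esub> snd (coeq C G2 G1 d c) = snd (coeq C H2 H1 d' c') \<cdot>\<^bsub>C\<^esub> m1) m1 m2)\<rparr>"

primrec CoeqForkN :: "nat \<Rightarrow> ('o, 'm) category \<Rightarrow> ('o, 'm) tfun" where
  "CoeqForkN 0 X = id_functor"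
| "CoeqForkN (Suc n) X = comp_functor (Fork_functor (CoeqForkN n X)) (CoeqFork (RGrphN n X))"


section \<open>Exact forks\<close>

definition exact_fork :: "('o, 'm) tcat \<Rightarrow> ('o, 'm) obj \<Rightarrow> bool" where
  "exact_fork C F \<longleftrightarrow> F \<in> Ob (Fork C) \<and>
    (\<exists>F0 F1 F2 d c e f. F = Fk F0 F1 F2 d c e f \<and>
      is_kernel_pair C F1 F0 f F2 d c \<and> is_coequaliser C F2 F1 d c F0 f)"

text \<open>
  The value of an \<open>n\<close>-fork, and the component of a morphism of \<open>n\<close>-forks, at the coordinates \<open>a\<close>
  (a list of numbers at most 2). Coordinate \<open>0\<close> belongs to the outermost fork structure.
\<close>

fun vertex :: "nat list \<Rightarrow> ('o, 'm) obj \<Rightarrow> ('o, 'm) obj" where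
  "vertex [] F = F"
| "vertex (x # a) (Fk F0 F1 F2 d c e f) = vertex a ([F0, F1, F2] ! x)"

fun component :: "nat list \<Rightarrow> 'm arr \<Rightarrow> 'm arr" where
  "component [] m = m"
| "component (x # a) (FkA m0 m1 m2) = component a ([m0, m1, m2] ! x)"

text \<open>
  \<open>line i a F\<close> is the fork of the \<open>n\<close>-fork \<open>F\<close> in direction \<open>i\<close> whose other \<open>n - 1\<close> coordinates
  are listed in \<open>a\<close>.
\<close>

fun line :: "nat \<Rightarrow> nat list \<Rightarrow> ('o, 'm) obj \<Rightarrow> ('o, 'm) obj" where
  "line 0 a (Fk F0 F1 F2 d c e f) = Fk (vertex a F0) (vertex a F1) (vertex a F2)
     (component a d) (component a c) (component a e) (component a f)"
| "line (Suc i) (x # a) (Fk F0 F1 F2 d c e f) = line i a ([F0, F1, F2] ! x)"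

definition exact_nfork :: "nat \<Rightarrow> ('o, 'm) category \<Rightarrow> ('o, 'm) obj \<Rightarrow> bool" where
  "exact_nfork n X F \<longleftrightarrow> F \<in> Ob (ForkN n X) \<and>
    (\<forall>i<n. \<forall>a. length a = n - 1 \<and> set a \<subseteq> {0, 1, 2} \<longrightarrow> exact_fork (base X) (line i a F))"

definition EFork :: "nat \<Rightarrow> ('o, 'm) category \<Rightarrow> ('o, 'm) tcat" where
  "EFork n X = full_subcategory (ForkN n X) (exact_nfork n X)"


section \<open>Distributive parallelistic equivalence relations\<close>

text \<open>
  The object on which an \<open>n\<close>-fold equivalence relation lives (all coordinates equal to 1), the
  corresponding component of a morphism, and the \<open>i\<close>-th underlying equivalence relation
  (coordinate \<open>i\<close> varies, the others equal 1).
\<close>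

fun corner :: "('o, 'm) obj \<Rightarrow> ('o, 'm) obj" where
  "corner (Base A) = Base A"
| "corner (RG G1 G2 d c e) = corner G1"

fun corner_arr :: "'m arr \<Rightarrow> 'm arr" where
  "corner_arr (BaseA f) = BaseA f"
| "corner_arr (RGA m1 m2) = corner_arr m1"

fun underlying_rel :: "nat \<Rightarrow> ('o, 'm) obj \<Rightarrow> ('o, 'm) obj" where
  "underlying_rel 0 (RG G1 G2 d c e) =
     RG (corner G1) (corner G2) (corner_arr d) (corner_arr c) (corner_arr e)"
| "underlying_rel (Suc i) (RG G1 G2 d c e) = underlying_rel i G1"

text \<open>
  \<open>erel_order C A\<close> is the preorder of equivalence relations on \<open>A\<close>; the lattice of equivalence
  relations is its quotient by mutual inclusion. Its meets and joins are those of HOL-Algebra, which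
  work with orders up to such an equivalence; the empty meet is the largest equivalence relation.
\<close>

definition erel_le :: "('o, 'm) tcat \<Rightarrow> ('o, 'm) obj \<Rightarrow> ('o, 'm) obj \<Rightarrow> bool" where
  "erel_le C R S \<longleftrightarrow> (\<exists>A R' d c e S' d' c' e'. R = RG A R' d c e \<and> S = RG A S' d' c' e' \<and>
    (\<exists>h \<in> Hom C R' S'. d' \<cdot>\<^bsub>C\<^esub> h = d \<and> c' \<cdot>\<^bsub>C\<^esub> h = c))"

definition erel_order :: "('o, 'm) tcat \<Rightarrow> ('o, 'm) obj \<Rightarrow> ('o, 'm) obj gorder" where
  "erel_order C A = \<lparr>carrier = {R \<in> Ob (ERel C). \<exists>R' d c e. R = RG A R' d c e},
    eq = (\<lambda>R S. erel_le C R S \<and> erel_le C S R), le = erel_le C\<rparr>"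

definition distributive ::
    "nat \<Rightarrow> ('o, 'm) tcat \<Rightarrow> ('o, 'm) obj \<Rightarrow> (nat \<Rightarrow> ('o, 'm) obj) \<Rightarrow> bool" where
  "distributive n C A R \<longleftrightarrow> (let L = erel_order C A in
    \<forall>k\<ge>1. \<forall>J :: nat \<Rightarrow> nat set.
      (\<forall>i\<le>k. J i \<subseteq> {..<n}) \<and> (\<forall>i\<le>k. \<forall>j\<le>k. i \<noteq> j \<longrightarrow> J i \<inter> J j = {}) \<longrightarrow>
      (\<Sqinter>\<^bsub>L\<^esub>(R ` J 0)) \<sqinter>\<^bsub>L\<^esub> (\<Squnion>\<^bsub>L\<^esub>((\<lambda>i. \<Sqinter>\<^bsub>L\<^esub>(R ` J i)) ` {1..k}))
        .=\<^bsub>L\<^esub> (\<Squnion>\<^bsub>L\<^esub>((\<lambda>i. \<Sqinter>\<^bsub>L\<^esub>(R ` (J 0 \<union> J i))) ` {1..k})))"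

text \<open>
  \<open>is_box n X R E\<close>: \<open>E\<close> is the largest \<open>n\<close>-fold equivalence relation on \<open>R 0, \<dots>, R (n - 1)\<close>. Since
  the structure arrows of equivalence relations are jointly monic, a morphism of \<open>n\<close>-fold equivalence
  relations over \<open>R 0, \<dots>, R (n - 1)\<close> is one whose component at the common object is the identity.
\<close>

definition is_nfold_erel_on ::
    "nat \<Rightarrow> ('o, 'm) category \<Rightarrow> (nat \<Rightarrow> ('o, 'm) obj) \<Rightarrow> ('o, 'm) obj \<Rightarrow> bool" where
  "is_nfold_erel_on n X R E \<longleftrightarrow> E \<in> Ob (ERelN n X) \<and> (\<forall>i<n. underlying_rel i E = R i)"

definition is_box ::
    "nat \<Rightarrow> ('o, 'm) category \<Rightarrow> (nat \<Rightarrow> ('o, 'm) obj) \<Rightarrow> ('o, 'm) obj \<Rightarrow> bool" where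
  "is_box n X R E \<longleftrightarrow> is_nfold_erel_on n X R E \<and>
    (\<forall>E'. is_nfold_erel_on n X R E' \<longrightarrow>
      (\<exists>m \<in> Hom (ERelN n X) E' E. corner_arr m = Id (base X) (corner E)))"

definition distributive_parallelistic :: "nat \<Rightarrow> ('o, 'm) category \<Rightarrow> ('o, 'm) obj \<Rightarrow> bool" where
  "distributive_parallelistic n X D \<longleftrightarrow> D \<in> Ob (ERelN n X) \<and>
    (\<exists>A R E. (\<forall>i<n. R i \<in> carrier (erel_order (base X) A)) \<and> distributive n (base X) A R \<and>
      is_box n X R E \<and> isomorphic (RGrphN n X) D E)"

definition DPERel :: "nat \<Rightarrow> ('o, 'm) category \<Rightarrow> ('o, 'm) tcat" where
  "DPERel n X = full_subcategory (RGrphN n X) (distributive_parallelistic n X)"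

end

theory Submission
  imports Defs
begin

text \<open>
  Adding coequalisers does not change the underlying reflexive graphs, so \<open>CoeqForkN n X\<close> is left adjoint
  to \<open>grphN n\<close> with identity unit, and the unit of every adjunction between the two is invertible. The
  counit at \<open>F\<close> becomes invertible under \<open>grphN n\<close>; for a morphism between exact forks this suffices,
  since the remaining objects are quotients of those in \<open>grphN n\<close>. It remains to show that the exact forks
  and the distributive parallelistic equivalence relations correspond.

  An equivalence relation is identified with its set of pairs of generalised elements. On each object these
  sets form a modular lattice of sets, whose joins are local composites. In a modular lattice, distributivity
  of a family amounts to \<open>\<And>\<^bsub>s\<in>S\<^esub> (\<Or>Z \<or> s) \<le> \<Or>Z \<or> \<And>S\<close> for all finite subfamilies \<open>S\<close>, \<open>Z\<close>; this
  condition is inherited by the images of the family under a quotient by one of its members and, by the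
  Chinese remainder theorem, by the family of relations that the others induce on one of its members.

  Cutting \<open>\<square>(R\<^sub>0, \<dots>, R\<^sub>k)\<close> in its outermost direction exhibits it as an equivalence relation on
  \<open>\<square>(R\<^sub>1, \<dots>, R\<^sub>k)\<close> with top object \<open>\<square>\<close> of the relations induced on \<open>R\<^sub>0\<close>. It is levelwise the kernel
  pair of the map to \<open>\<square>\<close> of the images in \<open>A/R\<^sub>0\<close>, and in the distributive case this map is levelwise a
  regular epimorphism. By induction the completion is exact where all coordinates are positive, and the
  \<open>3 \<times> 3\<close> lemma extends this to coordinates \<open>0\<close>. Conversely, the outermost fork of an exact \<open>n\<close>-fork is
  given by a levelwise regular epimorphism between distributive boxes. Such a map preserves meets of
  subfamilies because equivalence relations permute, and so its kernel can be added to the family.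
\<close>

section \<open>Distributive families in modular lattices of sets\<close>

text \<open>A relation in \<open>X\<close> is a choice of a span, so equivalence relations on an
  object form only a preorder, whose meets and joins are again choices. Replacing a span by its set
  of generalised pairs turns inclusion of relations into inclusion of sets and leaves a purely
  lattice-theoretic problem, in a lattice where finite joins exist but infinite ones need not.
  Distributivity as defined ranges over indexed families of disjoint index sets, which is awkward to
  carry through an induction. The predicate \<open>dist\<close> speaks of the set of members alone,
  and therefore passes easily to subfamilies, images and extensions. Its form, with the joins inside
  the meet, is the one that a map between boxes verifies: a pair that is related modulo the kernel
  by each of several relations has to be lifted to one pair that is related by all of them. Boxes
  and coequalisers are chosen, so no construction returns a box on the nose. The inductions are
  therefore about all objects isomorphic to a box, and boxes are handled through their maps, which
  are determined by one component.\<close>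

text \<open>In the modular law the join of \<open>a\<close> and \<open>b\<close> is the intersection of their upper bounds.\<close>

locale modular_set_lattice =
  fixes L :: "'a set set"
  assumes Int_closed: "a \<in> L \<Longrightarrow> b \<in> L \<Longrightarrow> a \<inter> b \<in> L"
    and ex_top: "\<exists>t \<in> L. \<forall>a \<in> L. a \<subseteq> t"
    and ex_bot: "\<exists>t \<in> L. \<forall>a \<in> L. t \<subseteq> a"
    and ex_join: "a \<in> L \<Longrightarrow> b \<in> L \<Longrightarrow> \<exists>j \<in> L. a \<subseteq> j \<and> b \<subseteq> j \<and> (\<forall>u \<in> L. a \<subseteq> u \<longrightarrow> b \<subseteq> u \<longrightarrow> j \<subseteq> u)"
    and modular_ex: "a \<in> L \<Longrightarrow> b \<in> L \<Longrightarrow> c \<in> L \<Longrightarrow> a \<subseteq> c \<Longrightarrow> u \<in> L \<Longrightarrow> a \<subseteq> u \<Longrightarrow> b \<inter> c \<subseteq> u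
      \<Longrightarrow> c \<inter> \<Inter>{v \<in> L. a \<subseteq> v \<and> b \<subseteq> v} \<subseteq> u"
begin

text \<open>As an intersection of upper bounds this is monotone and idempotent for every set
  \<open>U\<close>, without any choice. It is a member of \<open>L\<close> only where the join
  exists there, in particular for finite unions of members.\<close>

definition cl :: "'a set \<Rightarrow> 'a set" where
  "cl U = \<Inter>{u \<in> L. U \<subseteq> u}"

abbreviation (input) join where "join Z a \<equiv> cl (\<Union>Z \<union> a)"

text \<open>The factor \<open>\<Union>L\<close> is the largest element of \<open>L\<close>, so that
  the empty meet is the top of the lattice and not the set of all pairs.\<close>

definition mt :: "'a set set \<Rightarrow> 'a set" where
  "mt S = \<Union>L \<inter> \<Inter>S"

section \<open>Closure properties of finite joins and meets\<close>

lemma cl_least: "U \<subseteq> u \<Longrightarrow> u \<in> L \<Longrightarrow> cl U \<subseteq> u"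
  by (auto simp: cl_def)

lemma cl_extensive: "U \<subseteq> cl U"
  by (auto simp: cl_def)

lemma cl_mono: "U \<subseteq> V \<Longrightarrow> cl U \<subseteq> cl V"
  by (auto simp: cl_def)

lemma cl_eq: "u \<in> L \<Longrightarrow> cl u = u"
  by (auto simp: cl_def)

lemma top_in: "\<Union>L \<in> L"
proof -
  obtain t where "t \<in> L" "\<forall>a \<in> L. a \<subseteq> t" using ex_top by blast
  then have "\<Union>L = t" by blast
  then show ?thesis using \<open>t \<in> L\<close> by simp
qed

lemma cl_empty_in: "cl {} \<in> L"
proof -
  obtain t where "t \<in> L" "\<forall>a \<in> L. t \<subseteq> a" using ex_bot by blast
  then have "cl {} = t" by (auto simp: cl_def)
  then show ?thesis using \<open>t \<in> L\<close> by simp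
qed

lemma cl_Un_in:
  assumes "a \<in> L" "b \<in> L"
  shows "cl (a \<union> b) \<in> L"
proof -
  obtain j where "j \<in> L" "a \<subseteq> j" "b \<subseteq> j" "\<forall>u \<in> L. a \<subseteq> u \<longrightarrow> b \<subseteq> u \<longrightarrow> j \<subseteq> u"
    using ex_join[OF assms] by blast
  then have "cl (a \<union> b) = j" by (auto simp: cl_def)
  then show ?thesis using \<open>j \<in> L\<close> by simp
qed

lemma cl_cl_Un: "cl (cl U \<union> V) = cl (U \<union> V)"
  by (fastforce simp: cl_def)

lemma cl_Un_cl: "cl (U \<union> cl V) = cl (U \<union> V)"
  by (fastforce simp: cl_def)

lemma cl_Union_in: "finite Z \<Longrightarrow> Z \<subseteq> L \<Longrightarrow> cl (\<Union>Z) \<in> L"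
proof (induction Z rule: finite_induct)
  case (insert a Z)
  then have "cl (a \<union> cl (\<Union>Z)) \<in> L" using cl_Un_in by auto
  then show ?case by (simp add: cl_Un_cl)
qed (simp add: cl_empty_in)

lemma mt_in: "finite S \<Longrightarrow> S \<subseteq> L \<Longrightarrow> mt S \<in> L"
proof (induction S rule: finite_induct)
  case (insert a Z)
  then have "a \<inter> mt Z \<in> L" using Int_closed by auto
  moreover have "mt (insert a Z) = a \<inter> mt Z" using insert by (auto simp: mt_def)
  ultimately show ?case by simp
qed (simp add: mt_def top_in)

lemma mt_image_mono: "(\<And>s. s \<in> S \<Longrightarrow> f s \<subseteq> g s) \<Longrightarrow> mt (f ` S) \<subseteq> mt (g ` S)"
  by (fastforce simp: mt_def)

lemma mt_insert: "mt (insert a S) = a \<inter> mt S"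
  by (auto simp: mt_def)

text \<open>In the locale the law is stated against an arbitrary upper bound \<open>u\<close>, since
  joins are not named there; here \<open>u\<close> is the join itself.\<close>

lemma modular:
  assumes "a \<in> L" "b \<in> L" "c \<in> L" "a \<subseteq> c"
  shows "c \<inter> cl (a \<union> b) \<subseteq> cl (a \<union> (b \<inter> c))"
proof -
  have "cl (a \<union> (b \<inter> c)) \<in> L" using assms cl_Un_in Int_closed by simp
  then show ?thesis
    using modular_ex[OF assms, of "cl (a \<union> (b \<inter> c))"] cl_extensive[of "a \<union> (b \<inter> c)"]
    by (auto simp: cl_def)
qed

text \<open>In a modular lattice a single triple that satisfies one distributive law also satisfies
  the dual one. As \<open>b\<close> lies below \<open>cl (b \<union> c)\<close>, modularity replaces
  \<open>a\<close> by \<open>a \<inter> cl (b \<union> c)\<close>; the hypothesis splits this meet,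
  and \<open>b\<close> absorbs \<open>a \<inter> b\<close>.\<close>

lemma triple_meet_to_join:
  assumes "a \<in> L" "b \<in> L" "c \<in> L" "a \<inter> cl (b \<union> c) \<subseteq> cl ((a \<inter> b) \<union> (a \<inter> c))"
  shows "cl (b \<union> a) \<inter> cl (b \<union> c) \<subseteq> cl (b \<union> (a \<inter> c))"
proof -
  have "cl (b \<union> c) \<inter> cl (b \<union> a) \<subseteq> cl (b \<union> (a \<inter> cl (b \<union> c)))"
    using modular[of b a "cl (b \<union> c)"] assms cl_Un_in cl_extensive[of "b \<union> c"] by auto
  also have "\<dots> \<subseteq> cl (b \<union> cl ((a \<inter> b) \<union> (a \<inter> c)))"
    using assms(4) by (intro cl_mono) auto
  also have "\<dots> = cl (b \<union> (a \<inter> c))"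
    by (simp add: cl_Un_cl) (rule arg_cong[where f = cl], auto)
  finally show ?thesis by (simp add: Int_commute)
qed

text \<open>Since \<open>a\<close> lies below the join of \<open>c\<close> and \<open>a\<close>, the
  hypothesis shrinks \<open>b\<close> to \<open>a \<inter> b\<close> inside the join; modularity
  then moves the meet with \<open>a\<close> past \<open>a \<inter> b\<close>.\<close>

lemma triple_join_to_meet:
  assumes "a \<in> L" "b \<in> L" "c \<in> L" "cl (c \<union> a) \<inter> cl (c \<union> b) \<subseteq> cl (c \<union> (a \<inter> b))"
  shows "a \<inter> cl (b \<union> c) \<subseteq> cl ((a \<inter> b) \<union> (a \<inter> c))"
proof -
  have "a \<inter> cl (b \<union> c) \<subseteq> a \<inter> cl ((a \<inter> b) \<union> c)"
    using assms(4) cl_extensive[of "c \<union> a"] by (auto simp: Un_commute)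
  also have "\<dots> \<subseteq> cl ((a \<inter> b) \<union> (c \<inter> a))"
    using modular[of "a \<inter> b" c a] assms Int_closed by auto
  finally show ?thesis by (simp add: Int_commute)
qed

text \<open>Passing to the meet form and back moves the distinguished element from \<open>c\<close>
  to \<open>b\<close>: in a modular lattice distributivity of a triple is symmetric in its
  members.\<close>

lemma triple_join_rotate:
  assumes "a \<in> L" "b \<in> L" "c \<in> L" "cl (c \<union> a) \<inter> cl (c \<union> b) \<subseteq> cl (c \<union> (a \<inter> b))"
  shows "cl (b \<union> a) \<inter> cl (b \<union> c) \<subseteq> cl (b \<union> (a \<inter> c))"
  using triple_meet_to_join[OF assms(1-3) triple_join_to_meet[OF assms]] .

text \<open>
  The family of all \<open>r \<in> F\<close> generates a distributive sublattice iff this holds; overlapping \<open>S\<close> and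
  \<open>Z\<close> give nothing new.
\<close>

definition dist :: "'a set set \<Rightarrow> bool" where
  "dist F \<longleftrightarrow> F \<subseteq> L \<and> (\<forall>S Z. finite S \<longrightarrow> finite Z \<longrightarrow> S \<subseteq> F \<longrightarrow> Z \<subseteq> F \<longrightarrow>
    mt (join Z ` S) \<subseteq> join Z (mt S))"

lemma dist_subset: "dist F \<Longrightarrow> F \<subseteq> L"
  by (simp add: dist_def)

lemma dist_mono: "dist F \<Longrightarrow> G \<subseteq> F \<Longrightarrow> dist G"
  unfolding dist_def by (meson order_trans)

lemma distD: "dist F \<Longrightarrow> finite S \<Longrightarrow> finite Z \<Longrightarrow> S \<subseteq> F \<Longrightarrow> Z \<subseteq> F \<Longrightarrow>
    mt (join Z ` S) \<subseteq> join Z (mt S)"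
  by (simp add: dist_def)

lemma dist_eq: "dist F \<Longrightarrow> finite S \<Longrightarrow> finite Z \<Longrightarrow> S \<subseteq> F \<Longrightarrow> Z \<subseteq> F \<Longrightarrow>
    mt (join Z ` S) = join Z (mt S)"
proof (rule antisym)
  assume a: "dist F" "finite S" "finite Z" "S \<subseteq> F" "Z \<subseteq> F"
  then have L: "S \<subseteq> L" "Z \<subseteq> L" using dist_subset by auto
  have "join Z (mt S) \<subseteq> \<Union>L"
    using cl_least[of "\<Union>Z \<union> mt S" "\<Union>L"] top_in L mt_in[OF a(2) L(1)] by auto
  moreover have "join Z (mt S) \<subseteq> join Z s" if "s \<in> S" for s
    using that by (intro cl_mono) (auto simp: mt_def)
  ultimately show "join Z (mt S) \<subseteq> mt (join Z ` S)"
    by (auto simp: mt_def)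
qed (rule distD)

lemma distI:
  assumes "F \<subseteq> L" "\<And>S Z. finite S \<Longrightarrow> finite Z \<Longrightarrow> S \<subseteq> F \<Longrightarrow> Z \<subseteq> F \<Longrightarrow> S \<inter> Z = {} \<Longrightarrow>
    mt (join Z ` S) \<subseteq> join Z (mt S)"
  shows "dist F"
  unfolding dist_def
proof (intro conjI allI impI)
  fix S Z assume a: "finite S" "finite Z" "S \<subseteq> F" "Z \<subseteq> F"
  show "mt (join Z ` S) \<subseteq> join Z (mt S)"
  proof (cases "S \<inter> Z = {}")
    case False
    then obtain s where s: "s \<in> S" "s \<in> Z" by blast
    then have "mt (join Z ` S) \<subseteq> join Z s" by (auto simp: mt_def)
    also have "\<dots> = cl (\<Union>Z)" using s by (intro arg_cong[where f = cl]) auto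
    also have "\<dots> \<subseteq> join Z (mt S)" by (rule cl_mono) auto
    finally show ?thesis .
  qed (use assms a in auto)
qed (rule assms(1))

text \<open>The instances for \<open>S\<close> and for \<open>insert a S\<close> combine into a
  binary law in which the whole meet of \<open>S\<close> plays the part of one element. This is the
  form in which triples enter the modular arguments.\<close>

lemma dist_triple:
  assumes "dist F" "finite Z" "Z \<subseteq> F" "a \<in> F" "finite S" "S \<subseteq> F"
  shows "join Z a \<inter> join Z (mt S) \<subseteq> cl (\<Union>Z \<union> (a \<inter> mt S))"
proof -
  have "join Z a \<inter> join Z (mt S) \<subseteq> mt (join Z ` insert a S)"
    using assms dist_eq[of F S Z] by (simp add: mt_insert)
  also have "\<dots> \<subseteq> cl (\<Union>Z \<union> mt (insert a S))"
    using assms by (intro distD[of F]) auto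
  finally show ?thesis by (simp add: mt_insert)
qed

section \<open>Adjoining meets to a distributive family\<close>

lemma mt_singleton: "a \<in> L \<Longrightarrow> mt {a} = a"
  by (auto simp: mt_def)

lemma mt_empty: "mt {} = \<Union>L"
  by (simp add: mt_def)

text \<open>The top is the meet of the empty subfamily, hence the base case of
  \<open>dist_mt\<close>.\<close>

lemma dist_top:
  assumes "dist F"
  shows "dist (insert (\<Union>L) F)"
proof (rule distI)
  show "insert (\<Union>L) F \<subseteq> L" using assms top_in dist_subset by auto
  fix S Z assume a: "finite S" "finite Z" "S \<subseteq> insert (\<Union>L) F" "Z \<subseteq> insert (\<Union>L) F"
  show "mt (join Z ` S) \<subseteq> join Z (mt S)"
  proof (cases "\<Union>L \<in> Z")
    case True
    then have "\<Union>L \<subseteq> \<Union>Z \<union> mt S" by blast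
    then have "\<Union>L \<subseteq> join Z (mt S)" using cl_extensive by blast
    then show ?thesis unfolding mt_def[of "_ ` S"] by blast
  next
    case False
    have "mt (join Z ` S) \<subseteq> mt (join Z ` (S - {\<Union>L}))"
      by (auto simp: mt_def)
    also have "\<dots> \<subseteq> cl (\<Union>Z \<union> mt (S - {\<Union>L}))"
      using a False by (intro distD[OF assms]) auto
    also have "mt (S - {\<Union>L}) = mt S" by (auto simp: mt_def)
    finally show ?thesis .
  qed
qed

text \<open>If \<open>a \<inter> b\<close> occurs in \<open>S\<close> it can be replaced by
  \<open>a\<close> and \<open>b\<close> without changing the meet, and joins with \<open>Z\<close>
  respect this. The work lies in the case where it occurs in \<open>Z\<close>.\<close>

lemma dist_Int:
  assumes D: "dist F" and a: "a \<in> F" and b: "b \<in> F"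
  shows "dist (insert (a \<inter> b) F)"
proof (rule distI)
  have FL: "F \<subseteq> L" using D by (simp add: dist_subset)
  show "insert (a \<inter> b) F \<subseteq> L" using FL a b Int_closed by auto
  fix S Z assume h: "finite S" "finite Z" "S \<subseteq> insert (a \<inter> b) F" "Z \<subseteq> insert (a \<inter> b) F" "S \<inter> Z = {}"
  let ?m = "a \<inter> b"
  consider "?m \<in> Z" "S \<subseteq> F" | "Z \<subseteq> F" using h by blast
  then show "mt (join Z ` S) \<subseteq> join Z (mt S)"
  proof cases
    case 2
    have 1: "cl (\<Union>Z \<union> ?m) = join Z a \<inter> join Z b"
    proof
      show "cl (\<Union>Z \<union> ?m) \<subseteq> join Z a \<inter> join Z b"
        by (intro Int_greatest cl_mono) auto
      show "join Z a \<inter> join Z b \<subseteq> cl (\<Union>Z \<union> ?m)"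
        using dist_triple[OF D h(2) 2 a, of "{b}"] b mt_singleton[of b] subsetD[OF FL b] by simp
    qed
    let ?S = "if ?m \<in> S then insert a (insert b (S - {?m})) else S"
    have "mt (join Z ` S) \<subseteq> mt (join Z ` ?S)"
      using 1 by (auto simp: mt_def)
    also have "\<dots> \<subseteq> cl (\<Union>Z \<union> mt ?S)"
      using h 2 a b by (intro distD[OF D]) auto
    also have "mt ?S = mt S" by (auto simp: mt_def)
    finally show ?thesis .
  next
    case 1
    \<comment> \<open>With \<open>e\<close> the join of the remaining \<open>Y\<close> and
      \<open>t\<close> the meet of \<open>S\<close>, replacing \<open>a \<inter> b\<close> by the
      larger \<open>a\<close> or \<open>b\<close> makes the hypothesis on \<open>F\<close>
      applicable. It bounds the left side by \<open>e \<or> a \<or> t\<close> and by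
      \<open>e \<or> b \<or> t\<close>; their meet still has to be brought below
      \<open>e \<or> (a \<and> b) \<or> t\<close>.\<close>
    define Y where "Y = Z - {?m}"
    have Y: "finite Y" "Y \<subseteq> F" "\<Union>Z = \<Union>Y \<union> ?m" using h 1 by (auto simp: Y_def)
    define e where "e = cl (\<Union>Y)"
    define t where "t = mt S"
    have eL: "e \<in> L" unfolding e_def using Y FL by (intro cl_Union_in) auto
    have tL: "t \<in> L" unfolding t_def using h(1) 1 FL by (intro mt_in) auto
    have aL: "a \<in> L" and bL: "b \<in> L" using a b FL by auto
    have La: "cl (e \<union> a) \<in> L" using eL aL by (intro cl_Un_in)
    have e_cl: "cl (\<Union>Y \<union> x) = cl (e \<union> x)" for x by (simp add: e_def cl_cl_Un)
    have x1: "mt (join Z ` S) \<subseteq> cl ((e \<union> a) \<union> t)"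
    proof -
      have "mt (join Z ` S) \<subseteq> mt ((\<lambda>s. cl (\<Union>(insert a Y) \<union> s)) ` S)"
        using Y(3) by (intro mt_image_mono cl_mono) auto
      also have "\<dots> \<subseteq> cl (\<Union>(insert a Y) \<union> t)"
        unfolding t_def using h 1 Y a by (intro distD[OF D]) auto
      also have "\<dots> = cl ((e \<union> a) \<union> t)" using e_cl[of "a \<union> t"] by (simp add: Un_ac)
      finally show ?thesis .
    qed
    have x2: "mt (join Z ` S) \<subseteq> cl ((e \<union> b) \<union> t)"
    proof -
      have "mt (join Z ` S) \<subseteq> mt ((\<lambda>s. cl (\<Union>(insert b Y) \<union> s)) ` S)"
        using Y(3) by (intro mt_image_mono cl_mono) auto
      also have "\<dots> \<subseteq> cl (\<Union>(insert b Y) \<union> t)"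
        unfolding t_def using h 1 Y b by (intro distD[OF D]) auto
      also have "\<dots> = cl ((e \<union> b) \<union> t)" using e_cl[of "b \<union> t"] by (simp add: Un_ac)
      finally show ?thesis .
    qed
    \<comment> \<open>Modularity over \<open>e \<or> t\<close> reduces the meet of the two bounds to
      \<open>b \<and> (e \<or> a \<or> t)\<close>. Here distributivity of \<open>F\<close> shrinks
      \<open>t\<close> to \<open>b \<and> t\<close>, modularity over \<open>b \<and> t\<close>
      leaves \<open>(e \<or> a) \<and> b\<close>, and distributivity puts the latter below
      \<open>e \<or> (a \<and> b)\<close>.\<close>
    have x3: "b \<inter> cl (e \<union> a \<union> t) \<subseteq> cl (?m \<union> e \<union> t)"
    proof -
      have "b \<inter> cl (e \<union> a \<union> t) \<subseteq> cl (e \<union> a \<union> b) \<inter> cl (e \<union> a \<union> t)"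
        using cl_extensive[of "e \<union> a \<union> b"] by auto
      also have "\<dots> = cl (\<Union>(insert a Y) \<union> b) \<inter> cl (\<Union>(insert a Y) \<union> t)"
        using e_cl[of "a \<union> b"] e_cl[of "a \<union> t"] by (simp add: Un_ac)
      also have "\<dots> \<subseteq> cl (\<Union>(insert a Y) \<union> (b \<inter> t))"
        unfolding t_def using h 1 Y a b by (intro dist_triple[OF D]) auto
      also have "\<dots> = cl (e \<union> a \<union> (b \<inter> t))" using e_cl[of "a \<union> (b \<inter> t)"] by (simp add: Un_ac)
      finally have "b \<inter> cl (e \<union> a \<union> t) \<subseteq> b \<inter> cl ((b \<inter> t) \<union> cl (e \<union> a))"
        by (simp add: cl_Un_cl Un_ac)
      also have "\<dots> \<subseteq> cl ((b \<inter> t) \<union> (cl (e \<union> a) \<inter> b))"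
        using modular[of "b \<inter> t" "cl (e \<union> a)" b] La bL tL Int_closed by auto
      also have "\<dots> \<subseteq> cl (t \<union> cl (e \<union> ?m))"
      proof (rule cl_mono)
        have "cl (e \<union> a) \<inter> b \<subseteq> cl (e \<union> a) \<inter> cl (e \<union> b)" using cl_extensive[of "e \<union> b"] by auto
        also have "\<dots> \<subseteq> cl (e \<union> ?m)"
          using dist_triple[OF D Y(1,2) a, of "{b}"] b bL mt_singleton[of b] e_cl by auto
        finally show "b \<inter> t \<union> cl (e \<union> a) \<inter> b \<subseteq> t \<union> cl (e \<union> ?m)" by auto
      qed
      also have "\<dots> = cl (?m \<union> e \<union> t)" by (simp add: cl_Un_cl Un_ac)
      finally show ?thesis .
    qed
    have et: "cl (e \<union> t) \<in> L" using eL tL by (rule cl_Un_in)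
    have at: "cl (e \<union> a \<union> t) \<in> L"
      using cl_Un_in[OF aL et] by (simp only: cl_Un_cl) (simp add: Un_ac)
    have "cl (e \<union> a \<union> t) \<inter> cl (e \<union> b \<union> t) = cl (e \<union> a \<union> t) \<inter> cl (cl (e \<union> t) \<union> b)"
      by (simp only: cl_cl_Un) (simp add: Un_ac)
    also have "\<dots> \<subseteq> cl (cl (e \<union> t) \<union> (b \<inter> cl (e \<union> a \<union> t)))"
      using at et bL by (intro modular cl_mono) auto
    also have "\<dots> \<subseteq> cl (cl (e \<union> t) \<union> cl (?m \<union> e \<union> t))"
      using x3 by (intro cl_mono) auto
    also have "\<dots> = cl (?m \<union> e \<union> t)"
      by (simp only: cl_cl_Un cl_Un_cl) (rule arg_cong[where f = cl], auto)
    also have "\<dots> = join Z t"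
      using e_cl[of "?m \<union> t"] Y(3) by (simp add: Un_ac)
    finally show ?thesis using x1 x2 unfolding t_def by blast
  qed
qed

lemma dist_mt:
  assumes "dist F" "finite J" "J \<subseteq> F"
  shows "dist (insert (mt J) F)"
  using assms(2,3)
proof (induction J rule: finite_induct)
  case empty
  then show ?case using dist_top[OF assms(1)] by (simp add: mt_empty)
next
  case (insert a J)
  then have "dist (insert (a \<inter> mt J) (insert (mt J) F))" by (intro dist_Int) auto
  then show ?case unfolding mt_insert by (rule dist_mono) auto
qed

text \<open>Connects with \<open>distributive\<close>, whose joinands are meets of subfamilies and
  not single members.\<close>

lemma dist_meets:
  assumes "dist F" "finite K" "\<And>k. k \<in> K \<Longrightarrow> finite (J k) \<and> J k \<subseteq> F"
  shows "dist ((\<lambda>k. mt (J k)) ` K \<union> F)"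
  using assms(2,3)
proof (induction K rule: finite_induct)
  case (insert k K)
  then have "dist (insert (mt (J k)) ((\<lambda>k. mt (J k)) ` K \<union> F))" by (intro dist_mt) auto
  then show ?case by simp
qed (use assms(1) in simp)

text \<open>Induction on \<open>W\<close>: by \<open>dist_triple\<close> the elements
  \<open>a\<close>, \<open>w\<close> and the join of the rest of \<open>W\<close> form a
  distributive triple, and modularity turns its join form into the meet form.\<close>

lemma dist_meet_join:
  assumes "dist F" "a \<in> F" "finite W" "W \<subseteq> F"
  shows "a \<inter> cl (\<Union>W) \<subseteq> cl (\<Union>w\<in>W. a \<inter> w)"
  using assms(3,4)
proof (induction W rule: finite_induct)
  case empty
  have "a \<inter> cl {} \<subseteq> cl {}" by auto
  then show ?case by simp
next
  case (insert w W)
  have FL: "F \<subseteq> L" using assms(1) by (rule dist_subset)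
  have L: "a \<in> L" "w \<in> L" "cl (\<Union>W) \<in> L" using assms FL insert cl_Union_in[of W] by auto
  have "cl (\<Union>W \<union> a) \<inter> cl (\<Union>W \<union> w) \<subseteq> cl (\<Union>W \<union> (a \<inter> w))"
    using dist_triple[OF assms(1) insert(1) _ assms(2), of "{w}"] insert L mt_singleton by simp
  then have "a \<inter> cl (w \<union> cl (\<Union>W)) \<subseteq> cl ((a \<inter> w) \<union> (a \<inter> cl (\<Union>W)))"
    using L by (intro triple_join_to_meet) (simp_all add: cl_cl_Un)
  also have "\<dots> \<subseteq> cl ((a \<inter> w) \<union> cl (\<Union>w\<in>W. a \<inter> w))"
    using insert by (intro cl_mono) auto
  finally show ?case by (simp add: cl_Un_cl)
qed

text \<open>The hypothesis is the special case of \<open>distributive\<close> in which the outer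
  meet is one member, and the joinands are single members and one meet. It suffices because
  \<open>S\<close> can be peeled off one member at a time, each step being a triple to which
  \<open>triple_meet_to_join\<close> applies.\<close>

lemma dist_from_meet_join:
  assumes FL: "F \<subseteq> L" and h: "\<And>m S Z. m \<in> F \<Longrightarrow> finite S \<Longrightarrow> finite Z \<Longrightarrow> S \<subseteq> F \<Longrightarrow> Z \<subseteq> F \<Longrightarrow>
      m \<notin> S \<Longrightarrow> m \<notin> Z \<Longrightarrow> S \<inter> Z = {} \<Longrightarrow> m \<inter> join Z (mt S) \<subseteq> cl ((\<Union>z\<in>Z. m \<inter> z) \<union> (m \<inter> mt S))"
  shows "dist F"
proof (rule distI[OF FL])
  fix S Z assume "finite S" "finite Z" "S \<subseteq> F" "Z \<subseteq> F" "S \<inter> Z = {}"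
  then show "mt (join Z ` S) \<subseteq> join Z (mt S)"
  proof (induction S rule: finite_induct)
    case empty
    then show ?case using cl_extensive[of "\<Union>Z \<union> mt {}"] by (auto simp: mt_def)
  next
    case (insert m S)
    have c: "cl (\<Union>Z) \<in> L" using insert FL by (intro cl_Union_in) auto
    have mS: "mt S \<in> L" using insert FL by (intro mt_in) auto
    have mL: "m \<in> L" using insert FL by auto
    have "m \<inter> join Z (mt S) \<subseteq> cl ((\<Union>z\<in>Z. m \<inter> z) \<union> (m \<inter> mt S))"
      using insert by (intro h) auto
    also have "\<dots> \<subseteq> cl ((m \<inter> cl (\<Union>Z)) \<union> (m \<inter> mt S))"
      using cl_extensive[of "\<Union>Z"] by (intro cl_mono) auto
    finally have "cl (cl (\<Union>Z) \<union> m) \<inter> cl (cl (\<Union>Z) \<union> mt S) \<subseteq> cl (cl (\<Union>Z) \<union> (m \<inter> mt S))"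
      by (intro triple_meet_to_join mL c mS) (simp add: cl_cl_Un)
    then show ?case using insert by (auto simp: mt_insert cl_cl_Un)
  qed
qed

text \<open>
  The last hypothesis is what the exactness of an \<open>n\<close>-fork gives about the kernel pair \<open>r\<close> of its
  outermost direction.
\<close>

lemma dist_insert:
  assumes D: "dist F" and r: "r \<in> L" and DQ: "dist ((\<lambda>a. cl (a \<union> r)) ` F)"
    and h: "\<And>K. finite K \<Longrightarrow> K \<subseteq> F \<Longrightarrow> mt ((\<lambda>a. cl (a \<union> r)) ` K) \<subseteq> cl (r \<union> mt K)"
  shows "dist (insert r F)"
proof (rule distI)
  let ?q = "\<lambda>a. cl (a \<union> r)"
  have FL: "F \<subseteq> L" using D by (rule dist_subset)
  show "insert r F \<subseteq> L" using FL r by auto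
  \<comment> \<open>The relation \<open>r\<close> has to enter the left side through some image
    \<open>?q z\<close>, so \<open>Z\<close> must be nonempty; hence the separate cases for an empty
    \<open>Y\<close> and an empty \<open>Z\<close> below.\<close>
  have q_join: "cl (\<Union>(?q ` Z) \<union> u) = cl (\<Union>Z \<union> (r \<union> u))" if Z: "Z \<noteq> {}" for Z u
  proof
    show "cl (\<Union>(?q ` Z) \<union> u) \<subseteq> cl (\<Union>Z \<union> (r \<union> u))"
      unfolding cl_def by blast
    obtain z where "z \<in> Z" using Z by blast
    then have "r \<subseteq> \<Union>(?q ` Z)" using cl_extensive[of "z \<union> r"] by blast
    moreover have "\<Union>Z \<subseteq> \<Union>(?q ` Z)" using cl_extensive by fast
    ultimately have "cl (\<Union>Z \<union> (r \<union> u)) \<subseteq> cl (\<Union>(?q ` Z) \<union> u)"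
      by (intro cl_mono) blast
    then show "cl (\<Union>Z \<union> (r \<union> u)) \<subseteq> cl (\<Union>(?q ` Z) \<union> u)" .
  qed
  have q_meet: "mt (?q ` K) = cl (r \<union> mt K)" if "finite K" "K \<subseteq> F" for K
  proof
    have "mt K \<in> L" using that FL mt_in by auto
    then have "cl (r \<union> mt K) \<subseteq> \<Union>L" using cl_Un_in[OF r] by blast
    moreover have "cl (r \<union> mt K) \<subseteq> ?q a" if "a \<in> K" for a
      using that by (intro cl_mono) (auto simp: mt_def)
    ultimately show "cl (r \<union> mt K) \<subseteq> mt (?q ` K)" by (auto simp: mt_def)
  qed (rule h[OF that])
  fix S Z assume a: "finite S" "finite Z" "S \<subseteq> insert r F" "Z \<subseteq> insert r F" "S \<inter> Z = {}"
  show "mt (join Z ` S) \<subseteq> join Z (mt S)"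
  proof (cases "r \<in> Z")
    case True
    then have S: "S \<subseteq> F" using a by auto
    define Y where "Y = Z - {r}"
    have Y: "finite Y" "Y \<subseteq> F" "\<Union>Z = \<Union>Y \<union> r" using a True by (auto simp: Y_def)
    show ?thesis
    proof (cases "Y = {}")
      case True
      then have "\<Union>Z = r" using Y by simp
      then show ?thesis using h[OF a(1) S] by (simp add: Un_commute)
    next
      case False
      have "cl (\<Union>(?q ` Y) \<union> ?q s) = join Z s" for s
        using q_join[OF False, of "s \<union> r"] Y(3) by (simp only: cl_Un_cl) (simp add: Un_ac)
      then have "mt (join Z ` S) = mt ((\<lambda>s. cl (\<Union>(?q ` Y) \<union> s)) ` (?q ` S))"
        by (simp add: image_image)
      also have "\<dots> \<subseteq> cl (\<Union>(?q ` Y) \<union> mt (?q ` S))"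
        using S Y a by (intro distD[OF DQ]) auto
      also have "\<dots> = join Z (mt S)"
        using q_join[OF False, of "r \<union> mt S"] Y(3) q_meet[OF a(1) S]
        by (simp only: cl_Un_cl) (simp add: Un_ac)
      finally show ?thesis .
    qed
  next
    case rZ: False
    then have Z: "Z \<subseteq> F" using a by auto
    show ?thesis
    proof (cases "r \<in> S")
      case False
      then show ?thesis using a Z by (intro distD[OF D]) auto
    next
      case True
      define K where "K = S - {r}"
      have K: "finite K" "K \<subseteq> F" "S = insert r K" using a True by (auto simp: K_def)
      define c where "c = cl (\<Union>Z)"
      define t where "t = mt K"
      have cL: "c \<in> L" unfolding c_def using a Z FL by (intro cl_Union_in) auto
      have tL: "t \<in> L" unfolding t_def using K FL by (intro mt_in) auto
      \<comment> \<open>With \<open>r\<close> among the meetands, the law for the triple of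
        \<open>r\<close>, \<open>c\<close> and \<open>t\<close> is shown with \<open>r\<close> as
        the element that is joined to the others, where it is a statement about the quotient by
        \<open>r\<close>. Afterwards \<open>triple_join_rotate\<close> moves the distinguished place
        to \<open>c\<close>.\<close>
      have "cl (r \<union> c) \<inter> cl (r \<union> t) \<subseteq> cl (r \<union> (c \<inter> t))"
      proof (cases "Z = {}")
        case True
        have "c \<subseteq> r" using True r cl_least[of "{}" r] by (auto simp: c_def)
        then have "r \<union> c = r" by auto
        then have "cl (r \<union> c) = r" using cl_eq[OF r] by simp
        then show ?thesis using cl_extensive[of "r \<union> (c \<inter> t)"] by auto
      next
        case False
        have "cl (r \<union> c) \<inter> cl (r \<union> t) = mt (?q ` K) \<inter> cl (\<Union>(?q ` Z))"
          using q_join[OF False, of "{}"] q_meet[OF K(1,2)]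
          by (simp add: c_def t_def cl_Un_cl Un_commute Int_commute)
        also have "\<dots> \<subseteq> cl (\<Union>w\<in>?q ` Z. mt (?q ` K) \<inter> w)"
          using K Z a by (intro dist_meet_join[OF dist_mt[OF DQ, of "?q ` K"]]) auto
        also have "\<dots> = cl (\<Union>z\<in>Z. mt (?q ` insert z K))"
          by (intro arg_cong[where f = cl]) (auto simp: mt_insert)
        also have "(\<Union>z\<in>Z. mt (?q ` insert z K)) = (\<Union>z\<in>Z. cl (r \<union> mt (insert z K)))"
          using K Z by (intro SUP_cong q_meet) auto
        also have "cl \<dots> \<subseteq> cl (r \<union> (c \<inter> t))"
        proof (rule cl_least, rule UN_least, rule cl_mono)
          show "cl (r \<union> c \<inter> t) \<in> L" using cL tL r cl_Un_in Int_closed by simp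
          fix z assume "z \<in> Z"
          then show "r \<union> mt (insert z K) \<subseteq> r \<union> c \<inter> t"
            using cl_extensive[of "\<Union>Z"] by (auto simp: mt_insert t_def c_def)
        qed
        finally show ?thesis .
      qed
      then have "cl (c \<union> t) \<inter> cl (c \<union> r) \<subseteq> cl (c \<union> (t \<inter> r))"
        using triple_join_rotate[of t c r] cL tL r by (simp add: Int_commute)
      then have *: "join Z r \<inter> join Z (mt K) \<subseteq> cl (\<Union>Z \<union> (r \<inter> mt K))"
        by (simp add: c_def t_def cl_cl_Un Int_commute)
      have "mt (join Z ` S) = join Z r \<inter> mt (join Z ` K)"
        by (simp add: K(3) mt_insert)
      also have "\<dots> \<subseteq> join Z r \<inter> join Z (mt K)"
        using distD[OF D K(1) a(2) K(2) Z] by blast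
      also note *
      finally show ?thesis by (simp add: K(3) mt_insert)
    qed
  qed
qed

text \<open>Forming joins of images amounts to adding \<open>r\<close> to \<open>Z\<close>, which
  the condition on \<open>F\<close> permits since \<open>r\<close> is a member.\<close>

lemma dist_quotient:
  assumes D: "dist F" and r: "r \<in> F"
  shows "dist ((\<lambda>a. cl (a \<union> r)) ` F)"
proof (rule distI)
  let ?q = "\<lambda>a. cl (a \<union> r)"
  have FL: "F \<subseteq> L" using D by (rule dist_subset)
  then show "?q ` F \<subseteq> L" using r cl_Un_in by auto
  fix S' Z' assume a: "finite S'" "finite Z'" "S' \<subseteq> ?q ` F" "Z' \<subseteq> ?q ` F"
  obtain S where S: "finite S" "S \<subseteq> F" "S' = ?q ` S" using finite_subset_image[OF a(1,3)] by auto
  obtain Z where Z: "finite Z" "Z \<subseteq> F" "Z' = ?q ` Z" using finite_subset_image[OF a(2,4)] by auto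
  have "cl (\<Union>Z' \<union> ?q s) = cl (\<Union>(insert r Z) \<union> s)" for s
  proof
    have "cl (\<Union>Z' \<union> ?q s) \<subseteq> cl (cl (\<Union>(insert r Z) \<union> s))"
      unfolding Z by (rule cl_mono) (auto simp: cl_def)
    then show "cl (\<Union>Z' \<union> ?q s) \<subseteq> cl (\<Union>(insert r Z) \<union> s)"
      using cl_cl_Un[of _ "{}"] by simp
    have "\<Union>Z \<subseteq> \<Union>Z'" unfolding Z using cl_extensive by fast
    moreover have "s \<union> r \<subseteq> ?q s" by (rule cl_extensive)
    ultimately show "cl (\<Union>(insert r Z) \<union> s) \<subseteq> cl (\<Union>Z' \<union> ?q s)" by (intro cl_mono) auto
  qed
  then have "mt ((\<lambda>s. cl (\<Union>Z' \<union> s)) ` S') = mt ((\<lambda>s. cl (\<Union>(insert r Z) \<union> s)) ` S)"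
    by (simp add: S image_image)
  also have "\<dots> \<subseteq> cl (\<Union>(insert r Z) \<union> mt S)"
    using S Z r by (intro distD[OF D]) auto
  also have "\<dots> = cl (\<Union>Z \<union> (r \<union> mt S))" by (simp add: Un_ac)
  also have "\<dots> \<subseteq> cl (\<Union>Z' \<union> mt S')"
  proof (cases "S = {}")
    case True
    have "\<Union>Z \<union> (r \<union> mt S) \<subseteq> \<Union>L" using Z r FL by (auto simp: mt_def)
    then have "cl (\<Union>Z \<union> (r \<union> mt S)) \<subseteq> \<Union>L" by (rule cl_least[OF _ top_in])
    also have "\<Union>L \<subseteq> \<Union>Z' \<union> mt S'" using True S by (auto simp: mt_def)
    also have "\<dots> \<subseteq> cl (\<Union>Z' \<union> mt S')" by (rule cl_extensive)
    finally show ?thesis .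
  next
    case False
    have q: "a \<subseteq> ?q a" "r \<subseteq> ?q a" for a using cl_extensive[of "a \<union> r"] by auto
    have "r \<subseteq> mt S'" using r FL S q(2) by (auto simp: mt_def)
    moreover have "mt S \<subseteq> mt S'" using S q(1) by (auto simp: mt_def)
    moreover have "\<Union>Z \<subseteq> \<Union>Z'" using Z(3) q(1) by auto
    ultimately show ?thesis by (intro cl_mono) auto
  qed
  finally show "mt ((\<lambda>s. cl (\<Union>Z' \<union> s)) ` S') \<subseteq> cl (\<Union>Z' \<union> mt S')" .
qed

end

text \<open>There are two instances: inverse image along a regular epimorphism, and the lift of
  relations to one relation of the family. For the second, joins are preserved on account of
  distributivity, and so \<open>h_cl\<close> is restricted to the joins built from \<open>F\<close>
  that occur in \<open>dist\<close>.\<close>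

locale modular_set_lattice_hom = dom: modular_set_lattice L + cod: modular_set_lattice N
    for L :: "'a set set" and N :: "'b set set" +
  fixes h :: "'a set \<Rightarrow> 'b set" and F :: "'a set set"
  assumes FL: "F \<subseteq> L"
    and h_in: "a \<in> L \<Longrightarrow> h a \<in> N"
    and h_mono: "a \<in> L \<Longrightarrow> b \<in> L \<Longrightarrow> a \<subseteq> b \<Longrightarrow> h a \<subseteq> h b"
    and h_top: "h (\<Union>L) = \<Union>N"
    and h_Int: "a \<in> L \<Longrightarrow> b \<in> L \<Longrightarrow> h (a \<inter> b) = h a \<inter> h b"
    and h_cl: "finite Z \<Longrightarrow> finite S \<Longrightarrow> Z \<subseteq> F \<Longrightarrow> S \<subseteq> F \<Longrightarrow>
      h (dom.cl (\<Union>Z \<union> dom.mt S)) = cod.cl (\<Union>(h ` Z) \<union> h (dom.mt S))"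
begin

lemma h_mt: "finite S \<Longrightarrow> S \<subseteq> L \<Longrightarrow> h (dom.mt S) = cod.mt (h ` S)"
proof (induction S rule: finite_induct)
  case (insert a S)
  then show ?case using h_Int dom.mt_in by (simp add: dom.mt_insert cod.mt_insert)
qed (simp add: dom.mt_empty cod.mt_empty h_top)

lemma h_sides:
  assumes S: "finite S" "S \<subseteq> F" and Z: "finite Z" "Z \<subseteq> F"
  shows "dom.mt ((\<lambda>s. dom.cl (\<Union>Z \<union> s)) ` S) \<in> L" "dom.cl (\<Union>Z \<union> dom.mt S) \<in> L"
    and "h (dom.mt ((\<lambda>s. dom.cl (\<Union>Z \<union> s)) ` S)) = cod.mt ((\<lambda>s. cod.cl (\<Union>(h ` Z) \<union> s)) ` h ` S)"
    and "h (dom.cl (\<Union>Z \<union> dom.mt S)) = cod.cl (\<Union>(h ` Z) \<union> cod.mt (h ` S))"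
proof -
  have SL: "S \<subseteq> L" and ZL: "Z \<subseteq> L" using S Z FL by auto
  have cS: "dom.cl (\<Union>Z \<union> s) \<in> L" if "s \<in> L" for s
    using dom.cl_Un_in[OF dom.cl_Union_in[OF Z(1) ZL] that] by (simp add: dom.cl_cl_Un)
  show 1: "dom.mt ((\<lambda>s. dom.cl (\<Union>Z \<union> s)) ` S) \<in> L"
    using S SL cS by (intro dom.mt_in) auto
  show "dom.cl (\<Union>Z \<union> dom.mt S) \<in> L" using cS dom.mt_in[OF S(1) SL] .
  show "h (dom.cl (\<Union>Z \<union> dom.mt S)) = cod.cl (\<Union>(h ` Z) \<union> cod.mt (h ` S))"
    using h_cl[OF Z(1) S(1) Z(2) S(2)] h_mt[OF S(1) SL] by simp
  have "h (dom.cl (\<Union>Z \<union> s)) = cod.cl (\<Union>(h ` Z) \<union> h s)" if "s \<in> S" for s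
  proof -
    have "dom.mt {s} = s" using that SL dom.mt_singleton by auto
    then show ?thesis using h_cl[of Z "{s}"] that S Z by auto
  qed
  then have "(\<lambda>s. cod.cl (\<Union>(h ` Z) \<union> s)) ` h ` S = h ` (\<lambda>s. dom.cl (\<Union>Z \<union> s)) ` S"
    unfolding image_image by (intro image_cong) simp_all
  moreover have "h (dom.mt ((\<lambda>s. dom.cl (\<Union>Z \<union> s)) ` S)) = cod.mt (h ` (\<lambda>s. dom.cl (\<Union>Z \<union> s)) ` S)"
    using S SL cS by (intro h_mt) auto
  ultimately show "h (dom.mt ((\<lambda>s. dom.cl (\<Union>Z \<union> s)) ` S)) = cod.mt ((\<lambda>s. cod.cl (\<Union>(h ` Z) \<union> s)) ` h ` S)"
    by simp
qed

lemma dist_image: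
  assumes "dom.dist F"
  shows "cod.dist (h ` F)"
proof (rule cod.distI)
  show "h ` F \<subseteq> N" using FL h_in by auto
  fix S' Z' assume a: "finite S'" "finite Z'" "S' \<subseteq> h ` F" "Z' \<subseteq> h ` F"
  obtain S where S: "finite S" "S \<subseteq> F" "S' = h ` S" using finite_subset_image[OF a(1,3)] by auto
  obtain Z where Z: "finite Z" "Z \<subseteq> F" "Z' = h ` Z" using finite_subset_image[OF a(2,4)] by auto
  show "cod.mt ((\<lambda>s. cod.cl (\<Union>Z' \<union> s)) ` S') \<subseteq> cod.cl (\<Union>Z' \<union> cod.mt S')"
    using h_mono[OF h_sides(1,2)[OF S(1,2) Z(1,2)] dom.distD[OF assms S(1) Z(1) S(2) Z(2)]]
    by (simp only: h_sides[OF S(1,2) Z(1,2)] S(3) Z(3))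
qed

text \<open>Distributivity descends to quotients in this way: inverse image along a regular
  epimorphism reflects inclusions.\<close>

lemma dist_reflect:
  assumes "cod.dist (h ` F)" and h_reflect: "\<And>a b. a \<in> L \<Longrightarrow> b \<in> L \<Longrightarrow> h a \<subseteq> h b \<Longrightarrow> a \<subseteq> b"
  shows "dom.dist F"
proof (rule dom.distI[OF FL])
  fix S Z assume a: "finite S" "finite Z" "S \<subseteq> F" "Z \<subseteq> F"
  show "dom.mt ((\<lambda>s. dom.cl (\<Union>Z \<union> s)) ` S) \<subseteq> dom.cl (\<Union>Z \<union> dom.mt S)"
  proof (rule h_reflect[OF h_sides(1,2)[OF a(1,3,2,4)]])
    show "h (dom.mt ((\<lambda>s. dom.cl (\<Union>Z \<union> s)) ` S)) \<subseteq> h (dom.cl (\<Union>Z \<union> dom.mt S))"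
      unfolding h_sides(3,4)[OF a(1,3,2,4)]
      using a by (intro cod.distD[OF assms(1)]) auto
  qed
qed

end

section \<open>Categories and generalised elements\<close>

definition monic :: "('o, 'm) category \<Rightarrow> 'o \<Rightarrow> 'o \<Rightarrow> 'm \<Rightarrow> bool" where
  "monic C A B m \<longleftrightarrow> m \<in> Hom C A B \<and> jointly_monic C A m m"

section \<open>Isomorphisms, coequalisers, pullbacks and relations in a category\<close>

context category
begin

lemma comp_assoc': "f \<in> Hom C A B \<Longrightarrow> g \<in> Hom C B D \<Longrightarrow> h \<in> Hom C D E
      \<Longrightarrow> h \<cdot> (g \<cdot> f) = (h \<cdot> g) \<cdot> f"
  by (simp add: comp_assoc)

lemma comp_assoc4:
  assumes "f \<in> Hom C A B" "g \<in> Hom C B D" "h \<in> Hom C D E" "k \<in> Hom C E F"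
  shows "(k \<cdot> h) \<cdot> (g \<cdot> f) = k \<cdot> ((h \<cdot> g) \<cdot> f)"
  using comp_assoc[OF comp_hom[OF assms(1,2)] assms(3,4)] comp_assoc[OF assms(1-3)] by simp

lemma iso_hom: "iso C A B f \<Longrightarrow> f \<in> Hom C A B"
  by (simp add: iso_def)

lemma isoE:
  assumes "iso C A B f"
  obtains g where "g \<in> Hom C B A" "g \<cdot> f = Id C A" "f \<cdot> g = Id C B" "iso C B A g"
  using assms by (auto simp: iso_def)

lemma isoI: "f \<in> Hom C A B \<Longrightarrow> g \<in> Hom C B A \<Longrightarrow> g \<cdot> f = Id C A \<Longrightarrow> f \<cdot> g = Id C B \<Longrightarrow> iso C A B f"
  by (auto simp: iso_def)

lemma iso_id: "A \<in> Ob C \<Longrightarrow> iso C A A (Id C A)"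
  using id_hom comp_id_left unfolding iso_def by blast

lemma iso_comp:
  assumes "iso C A B f" "iso C B D g"
  shows "iso C A D (g \<cdot> f)"
proof -
  obtain f' where f: "f \<in> Hom C A B" "f' \<in> Hom C B A" "f' \<cdot> f = Id C A" "f \<cdot> f' = Id C B"
    using assms(1) by (auto simp: iso_def)
  obtain g' where g: "g \<in> Hom C B D" "g' \<in> Hom C D B" "g' \<cdot> g = Id C B" "g \<cdot> g' = Id C D"
    using assms(2) by (auto simp: iso_def)
  have "(f' \<cdot> g') \<cdot> (g \<cdot> f) = f' \<cdot> ((g' \<cdot> g) \<cdot> f)"
    by (rule comp_assoc4[OF f(1) g(1,2) f(2)])
  then have 1: "(f' \<cdot> g') \<cdot> (g \<cdot> f) = Id C A"
    using f g comp_id_left by auto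
  have "(g \<cdot> f) \<cdot> (f' \<cdot> g') = g \<cdot> ((f \<cdot> f') \<cdot> g')"
    by (rule comp_assoc4[OF g(2) f(2,1) g(1)])
  then have 2: "(g \<cdot> f) \<cdot> (f' \<cdot> g') = Id C D"
    using f g comp_id_left by auto
  show ?thesis
    using 1 2 f g comp_hom by (intro isoI) auto
qed

lemma iso_cancel_left: 
  assumes "iso C B D g" "x \<in> Hom C A B" "y \<in> Hom C A B" "g \<cdot> x = g \<cdot> y"
  shows "x = y"
proof -
  obtain h where h: "g \<in> Hom C B D" "h \<in> Hom C D B" "h \<cdot> g = Id C B"
    using assms(1) by (auto simp: iso_def)
  have "(h \<cdot> g) \<cdot> x = (h \<cdot> g) \<cdot> y"
    by (simp only: comp_assoc[OF assms(2) h(1,2)] comp_assoc[OF assms(3) h(1,2)] assms(4))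
  then show ?thesis using h(3) assms(2,3) comp_id_left by simp
qed

lemma monicD: "monic C A B m \<Longrightarrow> x \<in> Hom C T A \<Longrightarrow> y \<in> Hom C T A \<Longrightarrow> m \<cdot> x = m \<cdot> y \<Longrightarrow> x = y"
  by (simp add: monic_def jointly_monic_def)

lemma monicI: "m \<in> Hom C A B \<Longrightarrow> (\<And>T x y. x \<in> Hom C T A \<Longrightarrow> y \<in> Hom C T A \<Longrightarrow> m \<cdot> x = m \<cdot> y \<Longrightarrow> x = y)
   \<Longrightarrow> monic C A B m"
  by (auto simp add: monic_def jointly_monic_def)

lemma jointly_monicD: "jointly_monic C R d c \<Longrightarrow> x \<in> Hom C T R \<Longrightarrow> y \<in> Hom C T R
    \<Longrightarrow> d \<cdot> x = d \<cdot> y \<Longrightarrow> c \<cdot> x = c \<cdot> y \<Longrightarrow> x = y"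
  by (auto simp: jointly_monic_def)

lemma coequaliserD:
  assumes "is_coequaliser C A B x y Q q"
  shows "x \<in> Hom C A B" "y \<in> Hom C A B" "q \<in> Hom C B Q" "q \<cdot> x = q \<cdot> y"
  using assms by (auto simp: is_coequaliser_def)

lemma coequaliser_ex:
  assumes "is_coequaliser C A B x y Q q" "h \<in> Hom C B Z" "h \<cdot> x = h \<cdot> y"
  obtains k where "k \<in> Hom C Q Z" "k \<cdot> q = h"
  using assms unfolding is_coequaliser_def by blast

lemma coequaliser_epi:
  assumes "is_coequaliser C A B x y Q q" "h \<in> Hom C Q Z" "k \<in> Hom C Q Z" "h \<cdot> q = k \<cdot> q"
  shows "h = k"
proof -
  have "(k \<cdot> q) \<cdot> x = (k \<cdot> q) \<cdot> y"
    using assms coequaliserD[OF assms(1)] by (metis comp_assoc)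
  moreover have "k \<cdot> q \<in> Hom C B Z"
    using assms coequaliserD[OF assms(1)] comp_hom by blast
  ultimately show ?thesis
    using assms unfolding is_coequaliser_def by metis
qed

lemma coequaliserI:
  assumes "x \<in> Hom C A B" "y \<in> Hom C A B" "q \<in> Hom C B Q" "q \<cdot> x = q \<cdot> y"
    and "\<And>Z h. h \<in> Hom C B Z \<Longrightarrow> h \<cdot> x = h \<cdot> y \<Longrightarrow> \<exists>k \<in> Hom C Q Z. k \<cdot> q = h"
    and "\<And>Z h k. h \<in> Hom C Q Z \<Longrightarrow> k \<in> Hom C Q Z \<Longrightarrow> h \<cdot> q = k \<cdot> q \<Longrightarrow> h = k"
  shows "is_coequaliser C A B x y Q q"
  unfolding is_coequaliser_def using assms by (metis (no_types, lifting))

lemma coequaliser_unique: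
  assumes "is_coequaliser C A B x y Q q" "is_coequaliser C A B x y P p"
  obtains k where "iso C Q P k" "k \<cdot> q = p"
proof -
  obtain k where k: "k \<in> Hom C Q P" "k \<cdot> q = p"
    using coequaliser_ex[OF assms(1)] coequaliserD[OF assms(2)] by metis
  obtain l where l: "l \<in> Hom C P Q" "l \<cdot> p = q"
    using coequaliser_ex[OF assms(2)] coequaliserD[OF assms(1)] by metis
  have q: "q \<in> Hom C B Q" and p: "p \<in> Hom C B P"
    using coequaliserD assms by auto
  have "(l \<cdot> k) \<cdot> q = Id C Q \<cdot> q"
    using k l q comp_assoc comp_id_left by metis
  then have 1: "l \<cdot> k = Id C Q"
    using coequaliser_epi[OF assms(1)] k l comp_hom id_hom hom_ob by meson
  have "(k \<cdot> l) \<cdot> p = Id C P \<cdot> p"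
    using k l p comp_assoc comp_id_left by metis
  then have 2: "k \<cdot> l = Id C P"
    using coequaliser_epi[OF assms(2)] k l comp_hom id_hom hom_ob by meson
  show thesis
    using that isoI k l 1 2 by blast
qed

lemma coequaliser_iso:
  assumes "is_coequaliser C A B x y Q q" "iso C Q P k"
  shows "is_coequaliser C A B x y P (k \<cdot> q)"
proof -
  note a = coequaliserD[OF assms(1)]
  obtain l where l: "k \<in> Hom C Q P" "l \<in> Hom C P Q" "l \<cdot> k = Id C Q" "k \<cdot> l = Id C P"
    using assms(2) by (auto simp: iso_def)
  show ?thesis
  proof (rule coequaliserI)
    show "(k \<cdot> q) \<cdot> x = (k \<cdot> q) \<cdot> y"
      using a l by (metis comp_assoc)
    fix Z h assume h: "h \<in> Hom C B Z" "h \<cdot> x = h \<cdot> y"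
    obtain u where u: "u \<in> Hom C Q Z" "u \<cdot> q = h"
      using coequaliser_ex[OF assms(1) h] .
    have "(u \<cdot> l) \<cdot> (k \<cdot> q) = u \<cdot> ((l \<cdot> k) \<cdot> q)"
      by (rule comp_assoc4[OF a(3) l(1,2) u(1)])
    also have "\<dots> = h"
      using u l a by (metis comp_id_left)
    finally show "\<exists>k' \<in> Hom C P Z. k' \<cdot> (k \<cdot> q) = h"
      using u l comp_hom by blast
  next
    fix Z h h' assume h: "h \<in> Hom C P Z" "h' \<in> Hom C P Z" "h \<cdot> (k \<cdot> q) = h' \<cdot> (k \<cdot> q)"
    have "(h \<cdot> k) \<cdot> q = (h' \<cdot> k) \<cdot> q"
      using h(3) by (simp only: comp_assoc[OF a(3) l(1) h(1)] comp_assoc[OF a(3) l(1) h(2)])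
    then have "h \<cdot> k = h' \<cdot> k"
      using coequaliser_epi[OF assms(1) comp_hom[OF l(1) h(1)] comp_hom[OF l(1) h(2)]] by blast
    then have "h \<cdot> (k \<cdot> l) = h' \<cdot> (k \<cdot> l)"
      by (simp only: comp_assoc[OF l(2,1) h(1), symmetric] comp_assoc[OF l(2,1) h(2), symmetric])
    then show "h = h'" using l(4) h(1,2) comp_id_right by simp
  qed (use a(1,2) comp_hom[OF a(3) l(1)] in simp_all)
qed

lemma pullbackD:
  assumes "is_pullback C A B D f g P p q"
  shows "f \<in> Hom C A D" "g \<in> Hom C B D" "p \<in> Hom C P A" "q \<in> Hom C P B" "f \<cdot> p = g \<cdot> q"
  using assms by (auto simp: is_pullback_def)

lemma pullback_ex:
  assumes "is_pullback C A B D f g P p q" "x \<in> Hom C T A" "y \<in> Hom C T B" "f \<cdot> x = g \<cdot> y"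
  obtains h where "h \<in> Hom C T P" "p \<cdot> h = x" "q \<cdot> h = y"
  using assms unfolding is_pullback_def by meson

lemma pullback_mono:
  assumes "is_pullback C A B D f g P p q" "x \<in> Hom C T P" "y \<in> Hom C T P" "p \<cdot> x = p \<cdot> y" "q \<cdot> x = q \<cdot> y"
  shows "x = y"
proof -
  note a = pullbackD[OF assms(1)]
  have "f \<cdot> (p \<cdot> y) = g \<cdot> (q \<cdot> y)"
    using a(5) by (simp only: comp_assoc[OF assms(3) a(3,1), symmetric] comp_assoc[OF assms(3) a(4,2), symmetric])
  moreover have "p \<cdot> y \<in> Hom C T A" "q \<cdot> y \<in> Hom C T B"
    using a assms comp_hom by blast+
  ultimately show ?thesis
    using assms unfolding is_pullback_def by metis
qed

lemma pullbackI:
  assumes "f \<in> Hom C A D" "g \<in> Hom C B D" "p \<in> Hom C P A" "q \<in> Hom C P B" "f \<cdot> p = g \<cdot> q"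
    and "\<And>T x y. x \<in> Hom C T A \<Longrightarrow> y \<in> Hom C T B \<Longrightarrow> f \<cdot> x = g \<cdot> y \<Longrightarrow> \<exists>h \<in> Hom C T P. p \<cdot> h = x \<and> q \<cdot> h = y"
    and "\<And>T x y. x \<in> Hom C T P \<Longrightarrow> y \<in> Hom C T P \<Longrightarrow> p \<cdot> x = p \<cdot> y \<Longrightarrow> q \<cdot> x = q \<cdot> y \<Longrightarrow> x = y"
  shows "is_pullback C A B D f g P p q"
  unfolding is_pullback_def using assms(1-5)
proof (intro conjI allI ballI impI)
  fix T x y assume "x \<in> Hom C T A" "y \<in> Hom C T B" "f \<cdot> x = g \<cdot> y"
  then obtain h where "h \<in> Hom C T P" "p \<cdot> h = x" "q \<cdot> h = y"
    using assms(6) by blast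
  then show "\<exists>!h. h \<in> Hom C T P \<and> p \<cdot> h = x \<and> q \<cdot> h = y"
    using assms(7) by (intro ex1I[of _ h]) auto
qed

lemma kernel_pair_jointly_monic: "is_kernel_pair C A B f K d c \<Longrightarrow> is_relation C A K d c"
  unfolding is_kernel_pair_def is_relation_def jointly_monic_def
  by (meson pullbackD pullback_mono)

lemma regular_epi_hom: "regular_epi C A B f \<Longrightarrow> f \<in> Hom C A B"
  by (auto simp: regular_epi_def is_coequaliser_def)

lemma regular_epi_epi:
  assumes "regular_epi C A B f" "h \<in> Hom C B Z" "k \<in> Hom C B Z" "h \<cdot> f = k \<cdot> f"
  shows "h = k"
  using assms coequaliser_epi unfolding regular_epi_def by metis

lemma iso_regular_epi:
  assumes "iso C A B f"
  shows "regular_epi C A B f"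
proof -
  obtain g where g: "f \<in> Hom C A B" "g \<in> Hom C B A" "g \<cdot> f = Id C A" "f \<cdot> g = Id C B"
    using assms by (auto simp: iso_def)
  have A: "A \<in> Ob C" using g hom_ob by blast
  have "is_coequaliser C A A (Id C A) (Id C A) B f"
  proof (rule coequaliserI)
    fix Z h assume h: "h \<in> Hom C A Z"
    have "(h \<cdot> g) \<cdot> f = h" using h g by (metis comp_assoc comp_id_right)
    then show "\<exists>k \<in> Hom C B Z. k \<cdot> f = h" using comp_hom g h by blast
  next
    fix Z h k assume h: "h \<in> Hom C B Z" "k \<in> Hom C B Z" "h \<cdot> f = k \<cdot> f"
    then have "h \<cdot> (f \<cdot> g) = k \<cdot> (f \<cdot> g)"
      by (simp only: comp_assoc[OF g(2,1) h(1), symmetric] comp_assoc[OF g(2,1) h(2), symmetric])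
    then show "h = k" using g(4) h(1,2) comp_id_right by simp
  qed (use g(1) id_hom[OF A] in simp_all)
  then show ?thesis by (auto simp: regular_epi_def)
qed

text \<open>Regular epimorphisms are orthogonal to jointly monic pairs. The arrow \<open>a\<close>
  identifies the two arrows of which \<open>f\<close> is the coequaliser, because both of its
  components do, and so it factors through \<open>f\<close>.\<close>

lemma regular_epi_lift:
  assumes f: "regular_epi C A B f" and R: "jointly_monic C R d c" "d \<in> Hom C R X" "c \<in> Hom C R Y"
    and a: "a \<in> Hom C A R" and b: "b \<in> Hom C B X" "b' \<in> Hom C B Y"
    and eq: "d \<cdot> a = b \<cdot> f" "c \<cdot> a = b' \<cdot> f"
  obtains h where "h \<in> Hom C B R" "d \<cdot> h = b" "c \<cdot> h = b'"
proof -
  obtain K x y where K: "is_coequaliser C K A x y B f"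
    using f by (auto simp: regular_epi_def)
  note k = coequaliserD[OF K]
  have "d \<cdot> (a \<cdot> x) = d \<cdot> (a \<cdot> y)"
    by (simp only: comp_assoc'[OF k(1) a R(2)] comp_assoc'[OF k(2) a R(2)] eq
        comp_assoc[OF k(1,3) b(1)] comp_assoc[OF k(2,3) b(1)] k(4))
  moreover have "c \<cdot> (a \<cdot> x) = c \<cdot> (a \<cdot> y)"
    by (simp only: comp_assoc'[OF k(1) a R(3)] comp_assoc'[OF k(2) a R(3)] eq
        comp_assoc[OF k(1,3) b(2)] comp_assoc[OF k(2,3) b(2)] k(4))
  ultimately have "a \<cdot> x = a \<cdot> y"
    using jointly_monicD[OF R(1)] a k comp_hom by meson
  then obtain h where h: "h \<in> Hom C B R" "h \<cdot> f = a"
    using coequaliser_ex[OF K a] by blast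
  have "d \<cdot> h = b"
    using coequaliser_epi[OF K comp_hom[OF h(1) R(2)] b(1)] h eq k R comp_assoc by metis
  moreover have "c \<cdot> h = b'"
    using coequaliser_epi[OF K comp_hom[OF h(1) R(3)] b(2)] h eq k R comp_assoc by metis
  ultimately show thesis using that h by blast
qed

lemma split_monic_iso:
  assumes "monic C A B m" "k \<in> Hom C B A" "m \<cdot> k = Id C B"
  shows "iso C A B m"
proof -
  have m: "m \<in> Hom C A B" using assms by (simp add: monic_def)
  have "m \<cdot> (k \<cdot> m) = m \<cdot> Id C A"
    using assms m comp_assoc comp_id_left comp_id_right by metis
  then have "k \<cdot> m = Id C A"
    using monicD[OF assms(1)] m assms comp_hom id_hom hom_ob by meson
  then show ?thesis using isoI m assms by blast
qed

lemma kernel_pair_monic: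
  assumes "is_kernel_pair C A B f K d c" "monic C B D m"
  shows "is_kernel_pair C A D (m \<cdot> f) K d c"
proof -
  have m: "m \<in> Hom C B D" using assms by (simp add: monic_def)
  note k = pullbackD[OF assms(1)[unfolded is_kernel_pair_def]]
  show ?thesis
    unfolding is_kernel_pair_def
  proof (rule pullbackI)
    show "(m \<cdot> f) \<cdot> d = (m \<cdot> f) \<cdot> c" using k m by (metis comp_assoc)
    fix T x y assume h: "x \<in> Hom C T A" "y \<in> Hom C T A" "(m \<cdot> f) \<cdot> x = (m \<cdot> f) \<cdot> y"
    then have "m \<cdot> (f \<cdot> x) = m \<cdot> (f \<cdot> y)" using k m by (metis comp_assoc)
    then have "f \<cdot> x = f \<cdot> y" using monicD[OF assms(2)] h k comp_hom by meson
    then show "\<exists>h \<in> Hom C T K. d \<cdot> h = x \<and> c \<cdot> h = y"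
      using pullback_ex[OF assms(1)[unfolded is_kernel_pair_def]] h by metis
  qed (use k comp_hom[OF k(1) m] pullback_mono[OF assms(1)[unfolded is_kernel_pair_def]] in blast)+
qed

text \<open>Each pair carries its domain \<open>T\<close>, because hom-sets need not be disjoint.
  Isomorphic spans over \<open>A\<close> give the same set, and \<open>span_rel_iso\<close> is the
  converse for jointly monic ones.\<close>

definition span_rel :: "'o \<Rightarrow> 'm \<Rightarrow> 'm \<Rightarrow> ('o \<times> 'm \<times> 'm) set" where
  "span_rel R d c = {(T, x, y) |T x y. \<exists>z \<in> Hom C T R. x = d \<cdot> z \<and> y = c \<cdot> z}"

definition is_rel_on :: "'o \<Rightarrow> ('o \<times> 'm \<times> 'm) set \<Rightarrow> bool" where
  "is_rel_on A E \<longleftrightarrow> (\<exists>R d c. is_relation C A R d c \<and> E = span_rel R d c)"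

definition eq_rels :: "'o \<Rightarrow> ('o \<times> 'm \<times> 'm) set set" where
  "eq_rels A = {E. A \<in> Ob C \<and> is_rel_on A E \<and> (\<forall>T \<in> Ob C. equiv (Hom C T A) {(x, y). (T, x, y) \<in> E})}"

definition inv_rel :: "'o \<Rightarrow> 'm \<Rightarrow> ('o \<times> 'm \<times> 'm) set \<Rightarrow> ('o \<times> 'm \<times> 'm) set" where
  "inv_rel A f E = {(T, x, y) |T x y. x \<in> Hom C T A \<and> y \<in> Hom C T A \<and> (T, f \<cdot> x, f \<cdot> y) \<in> E}"

definition all_rel :: "'o \<Rightarrow> ('o \<times> 'm \<times> 'm) set" where
  "all_rel A = {(T, x, y) |T x y. x \<in> Hom C T A \<and> y \<in> Hom C T A}"

definition diag_rel :: "'o \<Rightarrow> ('o \<times> 'm \<times> 'm) set" where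
  "diag_rel A = {(T, x, y) |T x y. x \<in> Hom C T A \<and> x = y}"

definition ker :: "'o \<Rightarrow> 'm \<Rightarrow> ('o \<times> 'm \<times> 'm) set" where
  "ker A f = {(T, x, y) |T x y. x \<in> Hom C T A \<and> y \<in> Hom C T A \<and> f \<cdot> x = f \<cdot> y}"

section \<open>Reasoning with generalised elements of a relation\<close>

lemma is_rel_on_hom:
  assumes "is_rel_on A E" "(T, x, y) \<in> E"
  shows "x \<in> Hom C T A" "y \<in> Hom C T A" "T \<in> Ob C"
  using assms comp_hom hom_ob unfolding is_rel_on_def is_relation_def span_rel_def by blast+

lemma eq_rels_hom:
  assumes "E \<in> eq_rels A" "(T, x, y) \<in> E"
  shows "x \<in> Hom C T A" "y \<in> Hom C T A" "T \<in> Ob C"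
  using assms is_rel_on_hom unfolding eq_rels_def by blast+

lemma eq_rels_iff:
  "E \<in> eq_rels A \<longleftrightarrow> A \<in> Ob C \<and> (\<exists>R d c. is_equivalence_relation C A R d c \<and> E = span_rel R d c)"
proof -
  have "(\<lambda>x. (d \<cdot> x, c \<cdot> x)) ` Hom C T R = {(x, y). (T, x, y) \<in> span_rel R d c}" for T R d c
    by (auto simp: span_rel_def)
  then show ?thesis
    unfolding eq_rels_def is_rel_on_def is_equivalence_relation_def by auto
qed

lemma eq_relsI:
  assumes "A \<in> Ob C" "is_rel_on A E"
    "\<And>T x. x \<in> Hom C T A \<Longrightarrow> (T, x, x) \<in> E"
    "\<And>T x y. (T, x, y) \<in> E \<Longrightarrow> (T, y, x) \<in> E"
    "\<And>T x y z. (T, x, y) \<in> E \<Longrightarrow> (T, y, z) \<in> E \<Longrightarrow> (T, x, z) \<in> E"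
  shows "E \<in> eq_rels A"
  unfolding eq_rels_def
proof (intro CollectI conjI ballI equivI)
  fix T assume "T \<in> Ob C"
  show "refl_on (Hom C T A) {(x, y). (T, x, y) \<in> E}"
    using assms(3) is_rel_on_hom[OF assms(2)] by (auto simp: refl_on_def)
  show "sym {(x, y). (T, x, y) \<in> E}" using assms(4) by (auto simp: sym_def)
  show "trans {(x, y). (T, x, y) \<in> E}" unfolding trans_def using assms(5) by blast
  show "{(x, y). (T, x, y) \<in> E} \<subseteq> Hom C T A \<times> Hom C T A" using is_rel_on_hom[OF assms(2)] by auto
qed (use assms(1,2) in simp_all)

lemma eq_rels_refl: "E \<in> eq_rels A \<Longrightarrow> x \<in> Hom C T A \<Longrightarrow> (T, x, x) \<in> E"
  unfolding eq_rels_def equiv_def refl_on_def using hom_ob by blast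

lemma eq_rels_sym: "E \<in> eq_rels A \<Longrightarrow> (T, x, y) \<in> E \<Longrightarrow> (T, y, x) \<in> E"
  using eq_rels_hom(3)[of E A T x y] unfolding eq_rels_def equiv_def sym_def by blast

lemma eq_rels_trans: "E \<in> eq_rels A \<Longrightarrow> (T, x, y) \<in> E \<Longrightarrow> (T, y, z) \<in> E \<Longrightarrow> (T, x, z) \<in> E"
  using eq_rels_hom(3)[of E A T x y] unfolding eq_rels_def equiv_def trans_def by blast

lemma is_rel_on_stable:
  assumes "is_rel_on A E" "(T, x, y) \<in> E" "g \<in> Hom C U T"
  shows "(U, x \<cdot> g, y \<cdot> g) \<in> E"
proof -
  obtain R d c z where "d \<in> Hom C R A" "c \<in> Hom C R A" "E = span_rel R d c" "z \<in> Hom C T R" "x = d \<cdot> z" "y = c \<cdot> z"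
    using assms unfolding is_rel_on_def span_rel_def is_relation_def by blast
  moreover have "z \<cdot> g \<in> Hom C U R" "x \<cdot> g = d \<cdot> (z \<cdot> g)" "y \<cdot> g = c \<cdot> (z \<cdot> g)"
    using calculation assms(3) comp_assoc comp_hom by auto
  ultimately show ?thesis
    unfolding span_rel_def by blast
qed

lemma eq_rels_stable: "E \<in> eq_rels A \<Longrightarrow> (T, x, y) \<in> E \<Longrightarrow> g \<in> Hom C U T \<Longrightarrow> (U, x \<cdot> g, y \<cdot> g) \<in> E"
  unfolding eq_rels_def using is_rel_on_stable by blast

text \<open>Membership descends along a regular epimorphism, by orthogonality to the jointly monic
  legs. Together with stability under precomposition this justifies arguments that construct
  elements only after passing to a cover.\<close>

lemma is_rel_on_local:
  assumes E: "is_rel_on A E" and p: "regular_epi C U T p" and xy: "x \<in> Hom C T A" "y \<in> Hom C T A"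
    and m: "(U, x \<cdot> p, y \<cdot> p) \<in> E"
  shows "(T, x, y) \<in> E"
proof -
  obtain R d c z where R: "is_relation C A R d c" "E = span_rel R d c" "z \<in> Hom C U R" "x \<cdot> p = d \<cdot> z" "y \<cdot> p = c \<cdot> z"
    using assms unfolding is_rel_on_def span_rel_def by blast
  obtain h where "h \<in> Hom C T R" "d \<cdot> h = x" "c \<cdot> h = y"
    using regular_epi_lift[OF p, of R d c A A z x y] R xy unfolding is_relation_def by auto
  then show ?thesis using R(2) unfolding span_rel_def by blast
qed

lemma eq_rels_local: "E \<in> eq_rels A \<Longrightarrow> regular_epi C U T p \<Longrightarrow> x \<in> Hom C T A \<Longrightarrow> y \<in> Hom C T A
    \<Longrightarrow> (U, x \<cdot> p, y \<cdot> p) \<in> E \<Longrightarrow> (T, x, y) \<in> E"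
  unfolding eq_rels_def using is_rel_on_local by blast

lemma span_rel_span: "R \<in> Ob C \<Longrightarrow> d \<in> Hom C R A \<Longrightarrow> c \<in> Hom C R A \<Longrightarrow> (R, d, c) \<in> span_rel R d c"
  unfolding span_rel_def using id_hom[of R] comp_id_right[of d R A] comp_id_right[of c R A] by force

lemma span_rel_subset:
  assumes "is_rel_on A E" "(R, d, c) \<in> E"
  shows "span_rel R d c \<subseteq> E"
  using is_rel_on_stable[OF assms] unfolding span_rel_def by blast

lemma is_kernel_pair_span_rel:
  assumes K: "is_kernel_pair C A B f K d c"
  shows "span_rel K d c = ker A f"
proof (rule Set.set_eqI, rule iffI)
  note k = pullbackD[OF K[unfolded is_kernel_pair_def]]
  fix t
  { assume "t \<in> span_rel K d c"
    then obtain T z where "z \<in> Hom C T K" "t = (T, d \<cdot> z, c \<cdot> z)" by (auto simp: span_rel_def)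
    then show "t \<in> ker A f"
      using comp_hom[OF _ k(3)] comp_hom[OF _ k(4)] comp_assoc[OF _ k(3,1)] comp_assoc[OF _ k(4,2)] k(5)
      by (auto simp: ker_def simp flip: comp_assoc) }
  { assume "t \<in> ker A f"
    then show "t \<in> span_rel K d c" 
      unfolding ker_def span_rel_def using pullback_ex[OF K[unfolded is_kernel_pair_def]] 
      by (smt (verit, best) mem_Collect_eq) }
qed

lemma kernel_pairI:
  assumes "f \<in> Hom C A B" "is_relation C A K d c" "span_rel K d c = ker A f"
  shows "is_kernel_pair C A B f K d c"
proof -
  have dc: "d \<in> Hom C K A" "c \<in> Hom C K A" "jointly_monic C K d c"
    using assms by (auto simp: is_relation_def)
  then have "(K, d, c) \<in> ker A f"
    using span_rel_span[of K d A c] assms(3) hom_ob[OF dc(1)] by blast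
  then have "f \<cdot> d = f \<cdot> c" by (auto simp: ker_def)
  moreover have "\<exists>h \<in> Hom C T K. d \<cdot> h = x \<and> c \<cdot> h = y" 
    if "x \<in> Hom C T A" "y \<in> Hom C T A" "f \<cdot> x = f \<cdot> y" for T x y
  proof -
    have "(T, x, y) \<in> span_rel K d c" using that assms(3) by (auto simp: ker_def)
    then show ?thesis by (auto simp: span_rel_def)
  qed
  ultimately show ?thesis
    unfolding is_kernel_pair_def using assms(1) dc jointly_monicD[OF dc(3)] 
    by (intro pullbackI) auto
qed

text \<open>The Yoneda argument: the legs of either span form a pair that belongs to the other one,
  and joint monicity makes the two resulting arrows mutually inverse.\<close>

lemma span_rel_iso:
  assumes "is_relation C A R d c" "is_relation C A S d' c'" "span_rel R d c = span_rel S d' c'"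
  obtains k where "iso C R S k" "d' \<cdot> k = d" "c' \<cdot> k = c"
proof -
  have R: "d \<in> Hom C R A" "c \<in> Hom C R A" "jointly_monic C R d c"
    and S: "d' \<in> Hom C S A" "c' \<in> Hom C S A" "jointly_monic C S d' c'"
    using assms by (auto simp: is_relation_def)
  have "(R, d, c) \<in> span_rel S d' c'" "(S, d', c') \<in> span_rel R d c"
    using span_rel_span[of R d A c] span_rel_span[of S d' A c'] assms(3) hom_ob[OF R(1)] hom_ob[OF S(1)] R S by auto
  then obtain k l where k: "k \<in> Hom C R S" "d = d' \<cdot> k" "c = c' \<cdot> k" and l: "l \<in> Hom C S R" "d' = d \<cdot> l" "c' = c \<cdot> l"
    by (auto simp: span_rel_def)
  have kl: "k \<cdot> l \<in> Hom C S S" "l \<cdot> k \<in> Hom C R R" "Id C S \<in> Hom C S S" "Id C R \<in> Hom C R R"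
    using k l comp_hom id_hom hom_ob by blast+
  have "d \<cdot> (l \<cdot> k) = d \<cdot> Id C R" "c \<cdot> (l \<cdot> k) = c \<cdot> Id C R"
    using k l R S comp_assoc comp_id_right by metis+
  then have 1: "l \<cdot> k = Id C R" using jointly_monicD[OF R(3)] kl by blast
  have "d' \<cdot> (k \<cdot> l) = d' \<cdot> Id C S" "c' \<cdot> (k \<cdot> l) = c' \<cdot> Id C S"
    using k l R S comp_assoc comp_id_right by metis+
  then have 2: "k \<cdot> l = Id C S" using jointly_monicD[OF S(3)] kl by blast
  show thesis using that isoI k l 1 2 by metis
qed

end

section \<open>Finite limits: meets and inverse images of relations\<close>

context finitely_complete_category
begin

lemma ex_kernel_pair: "f \<in> Hom C A B \<Longrightarrow> \<exists>K d c. is_kernel_pair C A B f K d c"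
  unfolding is_kernel_pair_def by (rule ex_pullback)

lemma ex_product:
  assumes "A \<in> Ob C" "B \<in> Ob C"
  obtains p P q where "p \<in> Hom C P A" "q \<in> Hom C P B"
    "\<And>T x y. x \<in> Hom C T A \<Longrightarrow> y \<in> Hom C T B \<Longrightarrow> \<exists>h \<in> Hom C T P. p \<cdot> h = x \<and> q \<cdot> h = y"
    "\<And>T x y. x \<in> Hom C T P \<Longrightarrow> y \<in> Hom C T P \<Longrightarrow> p \<cdot> x = p \<cdot> y \<Longrightarrow> q \<cdot> x = q \<cdot> y \<Longrightarrow> x = y"
proof -
  obtain E where E: "terminal C E" using ex_terminal by blast
  then obtain a b where ab: "a \<in> Hom C A E" "b \<in> Hom C B E"
    using assms unfolding terminal_def by blast
  obtain P p q where P: "is_pullback C A B E a b P p q" using ex_pullback[OF ab] by blast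
  note p = pullbackD[OF P]
  show thesis
  proof (rule that[OF p(3,4)])
    fix T x y assume h: "x \<in> Hom C T A" "y \<in> Hom C T B"
    have "a \<cdot> x \<in> Hom C T E" "b \<cdot> y \<in> Hom C T E" using ab h comp_hom by blast+
    then have "a \<cdot> x = b \<cdot> y" using E hom_ob h unfolding terminal_def by blast
    then show "\<exists>h \<in> Hom C T P. p \<cdot> h = x \<and> q \<cdot> h = y"
      using pullback_ex[OF P h] by blast
  qed (rule pullback_mono[OF P])
qed

text \<open>The pullback of the monomorphism into \<open>B \<times> B\<close> along the pair
  \<open>(f, g)\<close>, viewed inside \<open>A \<times> A\<close> through the relation
  \<open>U\<close>. Intersections arise when \<open>f\<close>, \<open>g\<close> are the legs of
  \<open>U\<close> itself, inverse images when \<open>U\<close> is the largest relation.\<close>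

lemma is_rel_on_pullback:
  assumes E: "is_rel_on B E" and A: "A \<in> Ob C" and u: "is_relation C A U u v" 
    and fg: "f \<in> Hom C U B" "g \<in> Hom C U B"
  shows "is_rel_on A {(T, u \<cdot> w, v \<cdot> w) |T w. w \<in> Hom C T U \<and> (T, f \<cdot> w, g \<cdot> w) \<in> E}"
proof -
  have uv: "u \<in> Hom C U A" "v \<in> Hom C U A" "jointly_monic C U u v" using u by (auto simp: is_relation_def)
  obtain R d c where R: "is_relation C B R d c" and ER: "E = span_rel R d c"
    using E by (auto simp: is_rel_on_def)
  then have dc: "d \<in> Hom C R B" "c \<in> Hom C R B" "jointly_monic C R d c" by (auto simp: is_relation_def)
  have B: "B \<in> Ob C" using hom_ob fg by blast
  obtain P p q where pq: "p \<in> Hom C P B" "q \<in> Hom C P B"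
    and ex: "\<And>T x y. x \<in> Hom C T B \<Longrightarrow> y \<in> Hom C T B \<Longrightarrow> \<exists>h \<in> Hom C T P. p \<cdot> h = x \<and> q \<cdot> h = y"
    and un: "\<And>T x y. x \<in> Hom C T P \<Longrightarrow> y \<in> Hom C T P \<Longrightarrow> p \<cdot> x = p \<cdot> y \<Longrightarrow> q \<cdot> x = q \<cdot> y \<Longrightarrow> x = y"
    by (rule ex_product[OF B B]) (rule that, assumption+)
  obtain m where m: "m \<in> Hom C R P" "p \<cdot> m = d" "q \<cdot> m = c" using ex[OF dc(1,2)] by blast
  obtain n where n: "n \<in> Hom C U P" "p \<cdot> n = f" "q \<cdot> n = g" using ex[OF fg] by blast
  obtain Q r w where Q: "is_pullback C R U P m n Q r w" using ex_pullback[OF m(1) n(1)] by blast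
  note h = pullbackD[OF Q]
  have key: "(T, f \<cdot> x, g \<cdot> x) \<in> E \<longleftrightarrow> (\<exists>z \<in> Hom C T Q. w \<cdot> z = x)" if x: "x \<in> Hom C T U" for T x
  proof
    assume "(T, f \<cdot> x, g \<cdot> x) \<in> E"
    then obtain y where y: "y \<in> Hom C T R" "f \<cdot> x = d \<cdot> y" "g \<cdot> x = c \<cdot> y"
      by (auto simp: ER span_rel_def)
    have 1: "p \<cdot> (m \<cdot> y) = p \<cdot> (n \<cdot> x)"
      by (simp only: comp_assoc'[OF y(1) m(1) pq(1)] comp_assoc'[OF x n(1) pq(1)] m n y)
    have 2: "q \<cdot> (m \<cdot> y) = q \<cdot> (n \<cdot> x)"
      by (simp only: comp_assoc'[OF y(1) m(1) pq(2)] comp_assoc'[OF x n(1) pq(2)] m n y)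
    have "m \<cdot> y = n \<cdot> x"
      by (rule un[OF comp_hom[OF y(1) m(1)] comp_hom[OF x n(1)] 1 2])
    then show "\<exists>z \<in> Hom C T Q. w \<cdot> z = x" using pullback_ex[OF Q y(1) x] by blast
  next
    assume "\<exists>z \<in> Hom C T Q. w \<cdot> z = x"
    then obtain z where z: "z \<in> Hom C T Q" "w \<cdot> z = x" by blast
    have mr: "m \<cdot> (r \<cdot> z) = n \<cdot> x"
      by (simp only: comp_assoc'[OF z(1) h(3,1)] h(5) comp_assoc[OF z(1) h(4,2)] z(2))
    have rz: "r \<cdot> z \<in> Hom C T R" using z h comp_hom by blast
    have "f \<cdot> x = d \<cdot> (r \<cdot> z)"
      by (simp only: n(2)[symmetric] m(2)[symmetric] comp_assoc[OF x n(1) pq(1)] comp_assoc[OF rz m(1) pq(1)] mr)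
    moreover have "g \<cdot> x = c \<cdot> (r \<cdot> z)"
      by (simp only: n(3)[symmetric] m(3)[symmetric] comp_assoc[OF x n(1) pq(2)] comp_assoc[OF rz m(1) pq(2)] mr)
    ultimately show "(T, f \<cdot> x, g \<cdot> x) \<in> E" using rz by (auto simp: ER span_rel_def)
  qed
  have wm: "x = y" if x: "x \<in> Hom C T Q" and y: "y \<in> Hom C T Q" and eq: "w \<cdot> x = w \<cdot> y" for T x y
  proof (rule pullback_mono[OF Q x y _ eq], rule jointly_monicD[OF dc(3)])
    have "m \<cdot> (r \<cdot> x) = m \<cdot> (r \<cdot> y)"
      by (simp only: comp_assoc'[OF x h(3,1)] comp_assoc'[OF y h(3,1)] h(5)
          comp_assoc[OF x h(4,2)] comp_assoc[OF y h(4,2)] eq)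
    then have "p \<cdot> (m \<cdot> (r \<cdot> x)) = p \<cdot> (m \<cdot> (r \<cdot> y))" "q \<cdot> (m \<cdot> (r \<cdot> x)) = q \<cdot> (m \<cdot> (r \<cdot> y))" by simp_all
    moreover have rx: "r \<cdot> x \<in> Hom C T R" "r \<cdot> y \<in> Hom C T R" using x y h comp_hom by blast+
    ultimately show "d \<cdot> (r \<cdot> x) = d \<cdot> (r \<cdot> y)" "c \<cdot> (r \<cdot> x) = c \<cdot> (r \<cdot> y)"
      by (simp_all only: comp_assoc'[OF rx(1) m(1) pq(1)] comp_assoc'[OF rx(2) m(1) pq(1)] m
          comp_assoc'[OF rx(1) m(1) pq(2)] comp_assoc'[OF rx(2) m(1) pq(2)])
    show "r \<cdot> x \<in> Hom C T R" "r \<cdot> y \<in> Hom C T R" by fact+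
  qed
  have rel: "is_relation C A Q (u \<cdot> w) (v \<cdot> w)"
    unfolding is_relation_def jointly_monic_def
  proof (intro conjI allI ballI impI)
    show "u \<cdot> w \<in> Hom C Q A" "v \<cdot> w \<in> Hom C Q A" using uv h comp_hom by blast+
    fix T x y assume x: "x \<in> Hom C T Q" and y: "y \<in> Hom C T Q" 
      and eq: "(u \<cdot> w) \<cdot> x = (u \<cdot> w) \<cdot> y \<and> (v \<cdot> w) \<cdot> x = (v \<cdot> w) \<cdot> y"
    have "w \<cdot> x = w \<cdot> y"
    proof (rule jointly_monicD[OF uv(3) comp_hom[OF x h(4)] comp_hom[OF y h(4)]])
      show "u \<cdot> (w \<cdot> x) = u \<cdot> (w \<cdot> y)" "v \<cdot> (w \<cdot> x) = v \<cdot> (w \<cdot> y)"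
        using eq by (simp_all only: comp_assoc[OF x h(4) uv(1)] comp_assoc[OF y h(4) uv(1)]
           comp_assoc[OF x h(4) uv(2)] comp_assoc[OF y h(4) uv(2)])
    qed
    then show "x = y" by (rule wm[OF x y])
  qed
  have "{(T, u \<cdot> w, v \<cdot> w) |T w. w \<in> Hom C T U \<and> (T, f \<cdot> w, g \<cdot> w) \<in> E} = span_rel Q (u \<cdot> w) (v \<cdot> w)"
  proof (intro equalityI subsetI)
    fix t assume "t \<in> {(T, u \<cdot> w, v \<cdot> w) |T w. w \<in> Hom C T U \<and> (T, f \<cdot> w, g \<cdot> w) \<in> E}"
    then obtain T x where t: "t = (T, u \<cdot> x, v \<cdot> x)" "x \<in> Hom C T U" "(T, f \<cdot> x, g \<cdot> x) \<in> E" by blast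
    then obtain z where z: "z \<in> Hom C T Q" "w \<cdot> z = x" using key by blast
    have "u \<cdot> x = (u \<cdot> w) \<cdot> z" "v \<cdot> x = (v \<cdot> w) \<cdot> z"
      using comp_assoc[OF z(1) h(4) uv(1)] comp_assoc[OF z(1) h(4) uv(2)] z by simp_all
    then show "t \<in> span_rel Q (u \<cdot> w) (v \<cdot> w)" using z t unfolding span_rel_def by blast
  next
    fix t assume "t \<in> span_rel Q (u \<cdot> w) (v \<cdot> w)"
    then obtain T z where z: "z \<in> Hom C T Q" "t = (T, (u \<cdot> w) \<cdot> z, (v \<cdot> w) \<cdot> z)"
      unfolding span_rel_def by blast
    have "w \<cdot> z \<in> Hom C T U" using z h comp_hom by blast
    moreover have "(T, f \<cdot> (w \<cdot> z), g \<cdot> (w \<cdot> z)) \<in> E" using key calculation z by blast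
    ultimately show "t \<in> {(T, u \<cdot> w, v \<cdot> w) |T w. w \<in> Hom C T U \<and> (T, f \<cdot> w, g \<cdot> w) \<in> E}"
      using comp_assoc[OF z(1) h(4) uv(1)] comp_assoc[OF z(1) h(4) uv(2)] z(2) by auto
  qed
  then show ?thesis unfolding is_rel_on_def using rel by blast
qed

lemma is_rel_on_Int:
  assumes "A \<in> Ob C" "is_rel_on A E" "is_rel_on A F"
  shows "is_rel_on A (E \<inter> F)"
proof -
  obtain R d c where R: "is_relation C A R d c" "E = span_rel R d c" "d \<in> Hom C R A" "c \<in> Hom C R A"
    using assms(2) by (auto simp: is_rel_on_def is_relation_def)
  have "{(T, d \<cdot> w, c \<cdot> w) |T w. w \<in> Hom C T R \<and> (T, d \<cdot> w, c \<cdot> w) \<in> F} = E \<inter> F"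
    unfolding R(2) span_rel_def by blast
  then show ?thesis using is_rel_on_pullback[OF assms(3,1) R(1,3,4)] by simp
qed

lemma is_rel_on_all:
  assumes "A \<in> Ob C"
  shows "is_rel_on A (all_rel A)"
proof -
  obtain P p q where pq: "p \<in> Hom C P A" "q \<in> Hom C P A"
    and ex: "\<And>T x y. x \<in> Hom C T A \<Longrightarrow> y \<in> Hom C T A \<Longrightarrow> \<exists>h \<in> Hom C T P. p \<cdot> h = x \<and> q \<cdot> h = y"
    and un: "\<And>T x y. x \<in> Hom C T P \<Longrightarrow> y \<in> Hom C T P \<Longrightarrow> p \<cdot> x = p \<cdot> y \<Longrightarrow> q \<cdot> x = q \<cdot> y \<Longrightarrow> x = y"
    by (rule ex_product[OF assms assms]) (rule that, assumption+)
  have "is_relation C A P p q" unfolding is_relation_def jointly_monic_def using pq un by blast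
  moreover have "all_rel A = span_rel P p q"
  proof (intro equalityI subsetI)
    fix t assume "t \<in> all_rel A"
    then obtain T x y where t: "t = (T, x, y)" "x \<in> Hom C T A" "y \<in> Hom C T A" by (auto simp: all_rel_def)
    then show "t \<in> span_rel P p q" using ex[OF t(2,3)] by (auto simp: span_rel_def)
  next
    fix t assume "t \<in> span_rel P p q"
    then show "t \<in> all_rel A" using comp_hom[OF _ pq(1)] comp_hom[OF _ pq(2)] by (auto simp: span_rel_def all_rel_def)
  qed
  ultimately show ?thesis unfolding is_rel_on_def by blast
qed

lemma is_rel_on_diag:
  assumes "A \<in> Ob C"
  shows "is_rel_on A (diag_rel A)"
proof -
  have "is_relation C A A (Id C A) (Id C A)" 
    unfolding is_relation_def jointly_monic_def using id_hom[OF assms] comp_id_left by auto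
  moreover have "diag_rel A = span_rel A (Id C A) (Id C A)"
    unfolding diag_rel_def span_rel_def using comp_id_left by auto
  ultimately show ?thesis unfolding is_rel_on_def by blast
qed

lemma is_rel_on_inv:
  assumes f: "f \<in> Hom C A B" and E: "is_rel_on B E"
  shows "is_rel_on A (inv_rel A f E)"
proof -
  have A: "A \<in> Ob C" using f hom_ob by blast
  obtain P p q where R: "is_relation C A P p q" "all_rel A = span_rel P p q"
    using is_rel_on_all[OF A] by (auto simp: is_rel_on_def)
  then have pq: "p \<in> Hom C P A" "q \<in> Hom C P A" by (auto simp: is_relation_def)
  have "{(T, p \<cdot> w, q \<cdot> w) |T w. w \<in> Hom C T P \<and> (T, (f \<cdot> p) \<cdot> w, (f \<cdot> q) \<cdot> w) \<in> E} = inv_rel A f E"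
  proof (intro equalityI subsetI)
    fix t assume "t \<in> {(T, p \<cdot> w, q \<cdot> w) |T w. w \<in> Hom C T P \<and> (T, (f \<cdot> p) \<cdot> w, (f \<cdot> q) \<cdot> w) \<in> E}"
    then obtain T w where w: "t = (T, p \<cdot> w, q \<cdot> w)" "w \<in> Hom C T P" "(T, (f \<cdot> p) \<cdot> w, (f \<cdot> q) \<cdot> w) \<in> E" by blast
    then show "t \<in> inv_rel A f E"
      using comp_hom[OF w(2) pq(1)] comp_hom[OF w(2) pq(2)] comp_assoc[OF w(2) pq(1) f] comp_assoc[OF w(2) pq(2) f]
      by (auto simp: inv_rel_def)
  next
    fix t assume "t \<in> inv_rel A f E"
    then obtain T x y where t: "t = (T, x, y)" "x \<in> Hom C T A" "y \<in> Hom C T A" "(T, f \<cdot> x, f \<cdot> y) \<in> E"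
      by (auto simp: inv_rel_def)
    then have "(T, x, y) \<in> span_rel P p q" using R(2) by (auto simp: all_rel_def)
    then obtain w where w: "w \<in> Hom C T P" "x = p \<cdot> w" "y = q \<cdot> w" by (auto simp: span_rel_def)
    then show "t \<in> {(T, p \<cdot> w, q \<cdot> w) |T w. w \<in> Hom C T P \<and> (T, (f \<cdot> p) \<cdot> w, (f \<cdot> q) \<cdot> w) \<in> E}"
      using comp_assoc[OF w(1) pq(1) f] comp_assoc[OF w(1) pq(2) f] t by auto
  qed
  then show ?thesis
    using is_rel_on_pullback[OF E A R(1) comp_hom[OF pq(1) f] comp_hom[OF pq(2) f]] by simp
qed

lemma eq_rels_Int: "E \<in> eq_rels A \<Longrightarrow> F \<in> eq_rels A \<Longrightarrow> E \<inter> F \<in> eq_rels A"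
proof -
  assume a: "E \<in> eq_rels A" "F \<in> eq_rels A"
  then have "A \<in> Ob C" "is_rel_on A E" "is_rel_on A F" by (auto simp: eq_rels_def)
  then show ?thesis
    using a eq_rels_refl eq_rels_sym eq_rels_trans is_rel_on_Int by (intro eq_relsI) blast+
qed

lemma eq_rels_all: "A \<in> Ob C \<Longrightarrow> all_rel A \<in> eq_rels A"
  using is_rel_on_all by (intro eq_relsI) (auto simp: all_rel_def)

lemma eq_rels_diag: "A \<in> Ob C \<Longrightarrow> diag_rel A \<in> eq_rels A"
  using is_rel_on_diag by (intro eq_relsI) (auto simp: diag_rel_def)

lemma eq_rels_inv:
  assumes f: "f \<in> Hom C A B" and E: "E \<in> eq_rels B"
  shows "inv_rel A f E \<in> eq_rels A"
proof (rule eq_relsI)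
  show "A \<in> Ob C" using f hom_ob by blast
  show "is_rel_on A (inv_rel A f E)" using is_rel_on_inv[OF f] E by (auto simp: eq_rels_def)
  fix T x assume "x \<in> Hom C T A"
  then show "(T, x, x) \<in> inv_rel A f E" using eq_rels_refl[OF E comp_hom[OF _ f]] by (simp add: inv_rel_def)
next
  fix T x y assume "(T, x, y) \<in> inv_rel A f E"
  then show "(T, y, x) \<in> inv_rel A f E" using eq_rels_sym[OF E] by (auto simp: inv_rel_def)
next
  fix T x y z assume "(T, x, y) \<in> inv_rel A f E" "(T, y, z) \<in> inv_rel A f E"
  then show "(T, x, z) \<in> inv_rel A f E" using eq_rels_trans[OF E] by (auto simp: inv_rel_def)
qed

lemma ker_eq_inv: "f \<in> Hom C A B \<Longrightarrow> ker A f = inv_rel A f (diag_rel B)"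
  unfolding ker_def inv_rel_def diag_rel_def using comp_hom by auto

lemma ker_eq_rels: "f \<in> Hom C A B \<Longrightarrow> ker A f \<in> eq_rels A"
  using eq_rels_inv eq_rels_diag hom_ob ker_eq_inv by metis

end

section \<open>Regular categories: covers, images and composites\<close>

context regular_category
begin

lemma regular_epi_coequaliser:
  assumes "regular_epi C A B f" and K: "is_kernel_pair C A B f K d c"
  shows "is_coequaliser C K A d c B f"
proof -
  obtain L x y where L: "is_coequaliser C L A x y B f" using assms(1) by (auto simp: regular_epi_def)
  note l = coequaliserD[OF L]
  note k = pullbackD[OF K[unfolded is_kernel_pair_def]]
  obtain h where h: "h \<in> Hom C L K" "d \<cdot> h = x" "c \<cdot> h = y"
    using pullback_ex[OF K[unfolded is_kernel_pair_def] l(1,2,4)] .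
  show ?thesis
  proof (rule coequaliserI[OF k(3,4,1,5)])
    fix Z g assume g: "g \<in> Hom C A Z" "g \<cdot> d = g \<cdot> c"
    have "g \<cdot> x = g \<cdot> y"
      by (simp only: h(2,3)[symmetric] comp_assoc'[OF h(1) k(3) g(1)] comp_assoc'[OF h(1) k(4) g(1)] g(2))
    then show "\<exists>k \<in> Hom C B Z. k \<cdot> f = g" using coequaliser_ex[OF L g(1)] by blast
  qed (rule coequaliser_epi[OF L])
qed

text \<open>Regular epimorphisms play the role of covers: generalised elements lift along them locally.\<close>

lemma local_lift:
  assumes f: "regular_epi C A B f" and y: "y \<in> Hom C T B"
  obtains U p x where "regular_epi C U T p" "x \<in> Hom C U A" "f \<cdot> x = y \<cdot> p"
proof -
  obtain P p q where P: "is_pullback C A T B f y P p q"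
    using ex_pullback[OF regular_epi_hom[OF f] y] by blast
  show thesis
    using that regular_epi_pullback_stable[OF P f] pullbackD[OF P] by blast
qed

text \<open>The regular epimorphism is the coequaliser of the kernel pair. For \<open>m\<close> to
  be monic, two elements identified by it are lifted along \<open>q\<close> on a common cover; the
  lifts are then related by the kernel pair.\<close>

lemma ex_factorisation:
  assumes f: "f \<in> Hom C A B"
  obtains I q m where "regular_epi C A I q" "monic C I B m" "m \<cdot> q = f"
proof -
  obtain K d c where K: "is_kernel_pair C A B f K d c" using ex_kernel_pair[OF f] by blast
  note k = pullbackD[OF K[unfolded is_kernel_pair_def]]
  obtain I q where q: "is_coequaliser C K A d c I q" using ex_coequaliser_kernel_pair[OF K] by blast
  note qh = coequaliserD[OF q]
  have re: "regular_epi C A I q" using q by (auto simp: regular_epi_def)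
  obtain m where m: "m \<in> Hom C I B" "m \<cdot> q = f" using coequaliser_ex[OF q k(1,5)] .
  have "monic C I B m"
  proof (rule monicI[OF m(1)])
    fix T x y assume x: "x \<in> Hom C T I" and y: "y \<in> Hom C T I" and eq: "m \<cdot> x = m \<cdot> y"
    obtain U p u where p: "regular_epi C U T p" and u: "u \<in> Hom C U A" "q \<cdot> u = x \<cdot> p"
      using local_lift[OF re x] .
    note ph = regular_epi_hom[OF p]
    obtain V r v where r: "regular_epi C V U r" and v: "v \<in> Hom C V A" "q \<cdot> v = (y \<cdot> p) \<cdot> r"
      using local_lift[OF re comp_hom[OF ph y]] .
    note rh = regular_epi_hom[OF r]
    have ur: "u \<cdot> r \<in> Hom C V A" using u rh comp_hom by blast
    have "f \<cdot> (u \<cdot> r) = m \<cdot> ((q \<cdot> u) \<cdot> r)"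
      by (simp only: m(2)[symmetric] comp_assoc[OF ur qh(3) m(1)] comp_assoc[OF rh u(1) qh(3)])
    also have "\<dots> = (m \<cdot> x) \<cdot> (p \<cdot> r)"
      by (simp only: u(2) comp_assoc[OF rh ph x] comp_assoc[OF comp_hom[OF rh ph] x m(1)])
    also have "\<dots> = f \<cdot> v"
      by (simp only: eq m(2)[symmetric] comp_assoc[OF v(1) qh(3) m(1)] v(2) comp_assoc[OF rh ph y]
          comp_assoc[OF comp_hom[OF rh ph] y m(1)])
    finally obtain h where h: "h \<in> Hom C V K" "d \<cdot> h = u \<cdot> r" "c \<cdot> h = v"
      using pullback_ex[OF K[unfolded is_kernel_pair_def] ur v(1)] by blast
    have "q \<cdot> (u \<cdot> r) = q \<cdot> v"
      by (simp only: h(2,3)[symmetric] comp_assoc'[OF h(1) qh(1,3)] comp_assoc'[OF h(1) qh(2,3)] qh(4))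
    then have "(x \<cdot> p) \<cdot> r = (y \<cdot> p) \<cdot> r"
      by (simp only: v(2) comp_assoc'[OF rh u(1) qh(3)] u(2))
    then have "x \<cdot> p = y \<cdot> p"
      by (rule regular_epi_epi[OF r comp_hom[OF ph x] comp_hom[OF ph y]])
    then show "x = y" by (rule regular_epi_epi[OF p x y])
  qed
  then show thesis using that re m(2) by blast
qed

text \<open>The regular epimorphism \<open>p\<close> factors through the monic part of
  \<open>f\<close>. Lifting the identity of \<open>B\<close> along this factorisation splits the
  monic part, which is therefore invertible.\<close>

lemma regular_epi_cancel:
  assumes p: "regular_epi C T B p" and f: "f \<in> Hom C A B" and u: "u \<in> Hom C T A" "f \<cdot> u = p"
  shows "regular_epi C A B f"
proof -
  obtain I q m where q: "regular_epi C A I q" and m: "monic C I B m" and eq: "m \<cdot> q = f"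
    using ex_factorisation[OF f] .
  note qh = regular_epi_hom[OF q]
  have mh: "m \<in> Hom C I B" "jointly_monic C I m m" using m by (auto simp: monic_def)
  have B: "B \<in> Ob C" using f hom_ob by blast
  have 1: "m \<cdot> (q \<cdot> u) = Id C B \<cdot> p"
    by (simp only: comp_assoc'[OF u(1) qh mh(1)] eq u(2) comp_id_left[OF regular_epi_hom[OF p]])
  obtain k where "k \<in> Hom C B I" "m \<cdot> k = Id C B"
    using regular_epi_lift[OF p mh(2,1,1) comp_hom[OF u(1) qh] id_hom[OF B] id_hom[OF B] 1 1] .
  then have "iso C I B m" using split_monic_iso[OF m] by blast
  moreover obtain K x y where "is_coequaliser C K A x y I q" using q by (auto simp: regular_epi_def)
  ultimately have "is_coequaliser C K A x y B (m \<cdot> q)" using coequaliser_iso by blast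
  then show ?thesis using eq by (auto simp: regular_epi_def)
qed

text \<open>The monic part of the composite is split by lifting twice, once along \<open>f\<close>
  and once along \<open>g\<close>.\<close>

lemma regular_epi_comp:
  assumes f: "regular_epi C A B f" and g: "regular_epi C B D g"
  shows "regular_epi C A D (g \<cdot> f)"
proof -
  note fh = regular_epi_hom[OF f] note gh = regular_epi_hom[OF g]
  obtain I q m where q: "regular_epi C A I q" and m: "monic C I D m" and eq: "m \<cdot> q = g \<cdot> f"
    using ex_factorisation[OF comp_hom[OF fh gh]] .
  note qh = regular_epi_hom[OF q]
  have mh: "m \<in> Hom C I D" "jointly_monic C I m m" using m by (auto simp: monic_def)
  have D: "D \<in> Ob C" using gh hom_ob by blast
  obtain h where h: "h \<in> Hom C B I" "m \<cdot> h = g"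
    using regular_epi_lift[OF f mh(2,1,1) qh gh gh eq eq] .
  have 1: "m \<cdot> h = Id C D \<cdot> g" using h comp_id_left[OF gh] by simp
  obtain k where "k \<in> Hom C D I" "m \<cdot> k = Id C D"
    using regular_epi_lift[OF g mh(2,1,1) h(1) id_hom[OF D] id_hom[OF D] 1 1] .
  then have "iso C I D m" using split_monic_iso[OF m] by blast
  moreover obtain K x y where "is_coequaliser C K A x y I q" using q by (auto simp: regular_epi_def)
  ultimately have "is_coequaliser C K A x y D (m \<cdot> q)" using coequaliser_iso by blast
  then show ?thesis using eq by (auto simp: regular_epi_def)
qed

lemma regular_epi_id: "A \<in> Ob C \<Longrightarrow> regular_epi C A A (Id C A)"
  by (rule iso_regular_epi[OF iso_id])

lemma ex_image_relation:
  assumes u: "u \<in> Hom C P A" and v: "v \<in> Hom C P A"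
  obtains I d c q where "is_relation C A I d c" "regular_epi C P I q" "d \<cdot> q = u" "c \<cdot> q = v"
proof -
  have A: "A \<in> Ob C" using u hom_ob by blast
  obtain S p q where pq: "p \<in> Hom C S A" "q \<in> Hom C S A"
    and ex: "\<And>T x y. x \<in> Hom C T A \<Longrightarrow> y \<in> Hom C T A \<Longrightarrow> \<exists>h \<in> Hom C T S. p \<cdot> h = x \<and> q \<cdot> h = y"
    and un: "\<And>T x y. x \<in> Hom C T S \<Longrightarrow> y \<in> Hom C T S \<Longrightarrow> p \<cdot> x = p \<cdot> y \<Longrightarrow> q \<cdot> x = q \<cdot> y \<Longrightarrow> x = y"
    by (rule ex_product[OF A A]) (rule that, assumption+)
  obtain w where w: "w \<in> Hom C P S" "p \<cdot> w = u" "q \<cdot> w = v" using ex[OF u v] by blast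
  obtain I e m where e: "regular_epi C P I e" and m: "monic C I S m" and eq: "m \<cdot> e = w"
    using ex_factorisation[OF w(1)] .
  have mh: "m \<in> Hom C I S" using m by (auto simp: monic_def)
  note eh = regular_epi_hom[OF e]
  have "is_relation C A I (p \<cdot> m) (q \<cdot> m)"
    unfolding is_relation_def jointly_monic_def
  proof (intro conjI allI ballI impI)
    show "p \<cdot> m \<in> Hom C I A" "q \<cdot> m \<in> Hom C I A" using comp_hom[OF mh] pq by blast+
    fix T x y assume x: "x \<in> Hom C T I" and y: "y \<in> Hom C T I"
      and a: "(p \<cdot> m) \<cdot> x = (p \<cdot> m) \<cdot> y \<and> (q \<cdot> m) \<cdot> x = (q \<cdot> m) \<cdot> y"
    have "m \<cdot> x = m \<cdot> y"
      using un[OF comp_hom[OF x mh] comp_hom[OF y mh]] a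
      by (simp only: comp_assoc[OF x mh pq(1)] comp_assoc[OF y mh pq(1)] comp_assoc[OF x mh pq(2)] comp_assoc[OF y mh pq(2)])
    then show "x = y" by (rule monicD[OF m x y])
  qed
  moreover have "(p \<cdot> m) \<cdot> e = u" "(q \<cdot> m) \<cdot> e = v"
    by (simp_all only: comp_assoc[OF eh mh pq(1)] comp_assoc[OF eh mh pq(2)] eq w)
  ultimately show thesis using that e by blast
qed

text \<open>Membership in an image means having a preimage on some cover. This is how existential
  quantifiers are interpreted throughout.\<close>

lemma image_relation_iff:
  assumes R: "is_relation C A I d c" and q: "regular_epi C P I q" and x: "x \<in> Hom C T A" "y \<in> Hom C T A"
  shows "(T, x, y) \<in> span_rel I d c \<longleftrightarrow> (\<exists>U p z. regular_epi C U T p \<and> z \<in> Hom C U P \<and>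
    x \<cdot> p = (d \<cdot> q) \<cdot> z \<and> y \<cdot> p = (c \<cdot> q) \<cdot> z)"
proof
  have dc: "d \<in> Hom C I A" "c \<in> Hom C I A" using R by (auto simp: is_relation_def)
  note qh = regular_epi_hom[OF q]
  { assume "(T, x, y) \<in> span_rel I d c"
    then obtain w where w: "w \<in> Hom C T I" "x = d \<cdot> w" "y = c \<cdot> w" by (auto simp: span_rel_def)
    obtain U p z where z: "regular_epi C U T p" "z \<in> Hom C U P" "q \<cdot> z = w \<cdot> p"
      using local_lift[OF q w(1)] .
    note ph = regular_epi_hom[OF z(1)]
    have "x \<cdot> p = (d \<cdot> q) \<cdot> z" "y \<cdot> p = (c \<cdot> q) \<cdot> z"
      by (simp_all only: w(2,3) comp_assoc[OF ph w(1) dc(1)] comp_assoc[OF ph w(1) dc(2)]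
         comp_assoc[OF z(2) qh dc(1)] comp_assoc[OF z(2) qh dc(2)] z(3))
    then show "\<exists>U p z. regular_epi C U T p \<and> z \<in> Hom C U P \<and> x \<cdot> p = (d \<cdot> q) \<cdot> z \<and> y \<cdot> p = (c \<cdot> q) \<cdot> z"
      using z by blast }
  { assume "\<exists>U p z. regular_epi C U T p \<and> z \<in> Hom C U P \<and> x \<cdot> p = (d \<cdot> q) \<cdot> z \<and> y \<cdot> p = (c \<cdot> q) \<cdot> z"
    then obtain U p z where z: "regular_epi C U T p" "z \<in> Hom C U P" "x \<cdot> p = (d \<cdot> q) \<cdot> z" "y \<cdot> p = (c \<cdot> q) \<cdot> z"
      by blast
    have "x \<cdot> p = d \<cdot> (q \<cdot> z)" "y \<cdot> p = c \<cdot> (q \<cdot> z)"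
      using z comp_assoc[OF z(2) qh dc(1)] comp_assoc[OF z(2) qh dc(2)] by simp_all
    then have "(U, x \<cdot> p, y \<cdot> p) \<in> span_rel I d c"
      unfolding span_rel_def using comp_hom[OF z(2) qh] by blast
    then show "(T, x, y) \<in> span_rel I d c"
      using is_rel_on_local[OF _ z(1) x] R unfolding is_rel_on_def by blast }
qed

end

context exact_category
begin

text \<open>Exactness provides some arrow with the given kernel pair; only its regular epic part is
  kept, as composing with a monomorphism leaves the kernel unchanged.\<close>

lemma ex_quotient:
  assumes "E \<in> eq_rels A"
  obtains B f where "regular_epi C A B f" "ker A f = E"
proof -
  obtain R d c where R: "is_equivalence_relation C A R d c" "E = span_rel R d c"
    using assms by (auto simp: eq_rels_iff)
  obtain D g where g: "is_kernel_pair C A D g R d c"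
    using equivalence_relation_effective[OF R(1)] by blast
  have gh: "g \<in> Hom C A D" using g by (auto simp: is_kernel_pair_def is_pullback_def)
  obtain B f m where f: "regular_epi C A B f" and m: "monic C B D m" "m \<cdot> f = g"
    using ex_factorisation[OF gh] .
  note fh = regular_epi_hom[OF f]
  have mh: "m \<in> Hom C B D" using m by (simp add: monic_def)
  have "f \<cdot> x = f \<cdot> y \<longleftrightarrow> g \<cdot> x = g \<cdot> y" if "x \<in> Hom C T A" "y \<in> Hom C T A" for T x y
    using monicD[OF m(1) comp_hom[OF that(1) fh] comp_hom[OF that(2) fh]]
      comp_assoc[OF that(1) fh mh] comp_assoc[OF that(2) fh mh] m(2) by auto
  then have "ker A f = ker A g" unfolding ker_def by blast
  then show thesis using that f is_kernel_pair_span_rel[OF g] R(2) by simp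
qed

end

section \<open>The lattice of equivalence relations\<close>

context exact_maltsev_category
begin

text \<open>The image of the composite of \<open>E\<close> and \<open>F\<close>. That a single
  composition already yields the join is due to the Mal'tsev condition.\<close>

definition join_rel :: "'o \<Rightarrow> ('o \<times> 'm \<times> 'm) set \<Rightarrow> ('o \<times> 'm \<times> 'm) set \<Rightarrow> ('o \<times> 'm \<times> 'm) set" where
  "join_rel A E F = {(T, x, y) |T x y. x \<in> Hom C T A \<and> y \<in> Hom C T A \<and>
    (\<exists>U p w. regular_epi C U T p \<and> (U, x \<cdot> p, w) \<in> E \<and> (U, w, y \<cdot> p) \<in> F)}"

text \<open>Apart from the transfer to \<open>base X\<close>, the Mal'tsev axiom enters at this
  place alone: containing the diagonal makes a relation an equivalence relation.\<close>

lemma reflexive_image_eq_rel: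
  assumes I: "is_relation C A I d c" and r: "(A, Id C A, Id C A) \<in> span_rel I d c"
  shows "span_rel I d c \<in> eq_rels A"
proof -
  obtain e where "e \<in> Hom C A I" "d \<cdot> e = Id C A" "c \<cdot> e = Id C A"
    using r by (auto simp: span_rel_def)
  then have "is_reflexive_relation C A I d c" using I by (auto simp: is_reflexive_relation_def)
  then show ?thesis
    using reflexive_relation_equivalence I hom_ob unfolding eq_rels_iff is_relation_def by blast
qed

lemma join_rel_eq_rels:
  assumes E: "E \<in> eq_rels A" and F: "F \<in> eq_rels A"
  shows "join_rel A E F \<in> eq_rels A"
proof -
  have A: "A \<in> Ob C" using E by (simp add: eq_rels_def)
  obtain R d c where R: "is_relation C A R d c" "E = span_rel R d c"
    using E by (auto simp: eq_rels_def is_rel_on_def)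
  obtain S d' c' where S: "is_relation C A S d' c'" "F = span_rel S d' c'"
    using F by (auto simp: eq_rels_def is_rel_on_def)
  have h: "d \<in> Hom C R A" "c \<in> Hom C R A" "d' \<in> Hom C S A" "c' \<in> Hom C S A"
    using R S by (auto simp: is_relation_def)
  \<comment> \<open>\<open>P\<close> is the object of composable pairs, and its image
    \<open>I\<close> in the square of \<open>A\<close> represents
    \<open>join_rel A E F\<close>.\<close>
  obtain P r s where P: "is_pullback C R S A c d' P r s" using ex_pullback[OF h(2,3)] by blast
  note p = pullbackD[OF P]
  have ds: "d \<cdot> r \<in> Hom C P A" "c' \<cdot> s \<in> Hom C P A" using p h comp_hom by blast+
  obtain I i j q where I: "is_relation C A I i j" "regular_epi C P I q" "i \<cdot> q = d \<cdot> r" "j \<cdot> q = c' \<cdot> s"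
    using ex_image_relation[OF ds] .
  have ij: "i \<in> Hom C I A" "j \<in> Hom C I A" using I by (auto simp: is_relation_def)
  have mem: "(T, x, y) \<in> span_rel I i j \<longleftrightarrow> (T, x, y) \<in> join_rel A E F" 
    if x: "x \<in> Hom C T A" and y: "y \<in> Hom C T A" for T x y
  proof
    assume "(T, x, y) \<in> span_rel I i j"
    then obtain U p z where z: "regular_epi C U T p" "z \<in> Hom C U P" "x \<cdot> p = (d \<cdot> r) \<cdot> z" "y \<cdot> p = (c' \<cdot> s) \<cdot> z"
      using image_relation_iff[OF I(1,2) x y] I(3,4) by auto
    have rz: "r \<cdot> z \<in> Hom C U R" and sz: "s \<cdot> z \<in> Hom C U S" using z p comp_hom by blast+
    have "c \<cdot> (r \<cdot> z) = d' \<cdot> (s \<cdot> z)"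
      by (simp only: comp_assoc'[OF z(2) p(3) h(2)] comp_assoc'[OF z(2) p(4) h(3)] p(5))
    then have "(U, x \<cdot> p, c \<cdot> (r \<cdot> z)) \<in> E" "(U, c \<cdot> (r \<cdot> z), y \<cdot> p) \<in> F"
      using z rz sz comp_assoc[OF z(2) p(3) h(1)] comp_assoc[OF z(2) p(4) h(4)]
      unfolding R(2) S(2) span_rel_def by auto
    then show "(T, x, y) \<in> join_rel A E F" unfolding join_rel_def using z x y by blast
  next
    assume "(T, x, y) \<in> join_rel A E F"
    then obtain U p w where w: "regular_epi C U T p" "(U, x \<cdot> p, w) \<in> E" "(U, w, y \<cdot> p) \<in> F"
      unfolding join_rel_def by blast
    obtain a where a: "a \<in> Hom C U R" "x \<cdot> p = d \<cdot> a" "w = c \<cdot> a" using w(2) unfolding R(2) span_rel_def by blast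
    obtain b where b: "b \<in> Hom C U S" "w = d' \<cdot> b" "y \<cdot> p = c' \<cdot> b" using w(3) unfolding S(2) span_rel_def by blast
    obtain z where z: "z \<in> Hom C U P" "r \<cdot> z = a" "s \<cdot> z = b"
      using pullback_ex[OF P a(1) b(1)] a(3) b(2) by metis
    have "x \<cdot> p = (d \<cdot> r) \<cdot> z" "y \<cdot> p = (c' \<cdot> s) \<cdot> z"
      using a(2) b(3) comp_assoc[OF z(1) p(3) h(1)] comp_assoc[OF z(1) p(4) h(4)] z(2,3) by simp_all
    then show "(T, x, y) \<in> span_rel I i j"
      using image_relation_iff[OF I(1,2) x y] I(3,4) w(1) z(1) by auto
  qed
  have refl: "(T, x, x) \<in> join_rel A E F" if "x \<in> Hom C T A" for T x
  proof -
    have "T \<in> Ob C" using that hom_ob by blast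
    moreover have "(T, x \<cdot> Id C T, x) \<in> E" "(T, x, x \<cdot> Id C T) \<in> F"
      using comp_id_right[OF that] eq_rels_refl[OF E that] eq_rels_refl[OF F that] by simp_all
    ultimately show ?thesis unfolding join_rel_def using that regular_epi_id by blast
  qed
  have "span_rel I i j = join_rel A E F"
  proof (intro equalityI subsetI)
    fix t assume t: "t \<in> span_rel I i j"
    then obtain T z where z: "z \<in> Hom C T I" "t = (T, i \<cdot> z, j \<cdot> z)" unfolding span_rel_def by blast
    then show "t \<in> join_rel A E F" using mem[OF comp_hom[OF z(1) ij(1)] comp_hom[OF z(1) ij(2)]] t by simp
  next
    fix t assume t: "t \<in> join_rel A E F"
    then obtain T x y where "t = (T, x, y)" "x \<in> Hom C T A" "y \<in> Hom C T A" unfolding join_rel_def by blast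
    then show "t \<in> span_rel I i j" using mem t by simp
  qed
  then show ?thesis
    using reflexive_image_eq_rel[OF I(1)] refl[OF id_hom[OF A]] by simp
qed

lemma join_rel_upper:
  assumes E: "E \<in> eq_rels A" and F: "F \<in> eq_rels A"
  shows "E \<subseteq> join_rel A E F" "F \<subseteq> join_rel A E F"
proof -
  show "E \<subseteq> join_rel A E F"
  proof
    fix t assume "t \<in> E"
    then obtain T x y where t: "t = (T, x, y)" "(T, x, y) \<in> E" by (cases t) auto
    note h = eq_rels_hom[OF E t(2)]
    have "regular_epi C T T (Id C T)" "(T, x \<cdot> Id C T, y) \<in> E" "(T, y, y \<cdot> Id C T) \<in> F"
      using t h comp_id_right[OF h(1)] comp_id_right[OF h(2)] eq_rels_refl[OF F h(2)] regular_epi_id by simp_all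
    then show "t \<in> join_rel A E F" unfolding join_rel_def using t h by blast
  qed
  show "F \<subseteq> join_rel A E F"
  proof
    fix t assume "t \<in> F"
    then obtain T x y where t: "t = (T, x, y)" "(T, x, y) \<in> F" by (cases t) auto
    note h = eq_rels_hom[OF F t(2)]
    have "regular_epi C T T (Id C T)" "(T, x \<cdot> Id C T, x) \<in> E" "(T, x, y \<cdot> Id C T) \<in> F"
      using t h comp_id_right[OF h(1)] comp_id_right[OF h(2)] eq_rels_refl[OF E h(1)] regular_epi_id by simp_all
    then show "t \<in> join_rel A E F" unfolding join_rel_def using t h by blast
  qed
qed

lemma join_rel_least:
  assumes G: "G \<in> eq_rels A" and "E \<subseteq> G" "F \<subseteq> G"
  shows "join_rel A E F \<subseteq> G"
proof
  fix t assume "t \<in> join_rel A E F"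
  then obtain T x y U p w where t: "t = (T, x, y)" "x \<in> Hom C T A" "y \<in> Hom C T A" "regular_epi C U T p"
      "(U, x \<cdot> p, w) \<in> G" "(U, w, y \<cdot> p) \<in> G" unfolding join_rel_def using assms by blast
  then show "t \<in> G" using eq_rels_local[OF G t(4,2,3)] eq_rels_trans[OF G t(5,6)] by simp
qed

text \<open>Modularity follows from joins being composites. If a pair in \<open>c\<close> is
  connected through \<open>w\<close> by \<open>a\<close> and then by \<open>b\<close>, and
  \<open>a\<close> is contained in \<open>c\<close>, then the second half of the path is in
  \<open>b\<close> and in \<open>c\<close>.\<close>

lemma modular_eq_rels:
  assumes A: "A \<in> Ob C"
  shows "modular_set_lattice (eq_rels A)"
proof
  fix a b assume a: "a \<in> eq_rels A" and b: "b \<in> eq_rels A"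
  show "a \<inter> b \<in> eq_rels A" using eq_rels_Int[OF a b] .
  show "\<exists>j \<in> eq_rels A. a \<subseteq> j \<and> b \<subseteq> j \<and> (\<forall>u \<in> eq_rels A. a \<subseteq> u \<longrightarrow> b \<subseteq> u \<longrightarrow> j \<subseteq> u)"
    using join_rel_eq_rels[OF a b] join_rel_upper[OF a b] join_rel_least by (intro bexI[of _ "join_rel A a b"]) auto
  fix c u assume c: "c \<in> eq_rels A" "a \<subseteq> c" and u: "u \<in> eq_rels A" "a \<subseteq> u" "b \<inter> c \<subseteq> u"
  have "c \<inter> join_rel A a b \<subseteq> u"
  proof
    fix t assume t: "t \<in> c \<inter> join_rel A a b"
    then obtain T x y U p w where w: "t = (T, x, y)" "x \<in> Hom C T A" "y \<in> Hom C T A" "regular_epi C U T p"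
      "(U, x \<cdot> p, w) \<in> a" "(U, w, y \<cdot> p) \<in> b" unfolding join_rel_def by blast
    have "(U, x \<cdot> p, y \<cdot> p) \<in> c" using eq_rels_stable[OF c(1) _ regular_epi_hom[OF w(4)]] t w(1) by blast
    moreover have "(U, w, x \<cdot> p) \<in> c" using eq_rels_sym[OF c(1)] c(2) w(5) by blast
    ultimately have "(U, w, y \<cdot> p) \<in> u" using eq_rels_trans[OF c(1)] u(3) w(6) by blast
    then have "(U, x \<cdot> p, y \<cdot> p) \<in> u" using eq_rels_trans[OF u(1)] u(2) w(5) by blast
    then show "t \<in> u" using eq_rels_local[OF u(1) w(4,2,3)] w(1) by simp
  qed
  moreover have "join_rel A a b \<in> {v \<in> eq_rels A. a \<subseteq> v \<and> b \<subseteq> v}"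
    using join_rel_eq_rels[OF a b] join_rel_upper[OF a b] by simp
  ultimately show "c \<inter> \<Inter>{v \<in> eq_rels A. a \<subseteq> v \<and> b \<subseteq> v} \<subseteq> u" by blast
next
  show "\<exists>t \<in> eq_rels A. \<forall>a \<in> eq_rels A. a \<subseteq> t"
  proof (intro bexI[of _ "all_rel A"] ballI subsetI)
    fix a t assume "a \<in> eq_rels A" "t \<in> a"
    then show "t \<in> all_rel A" using eq_rels_hom[of a A] by (cases t) (auto simp: all_rel_def)
  qed (rule eq_rels_all[OF A])
  show "\<exists>t \<in> eq_rels A. \<forall>a \<in> eq_rels A. t \<subseteq> a"
  proof (intro bexI[of _ "diag_rel A"] ballI subsetI)
    fix a t assume "a \<in> eq_rels A" "t \<in> diag_rel A"
    then show "t \<in> a" using eq_rels_refl[of a A] by (auto simp: diag_rel_def)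
  qed (rule eq_rels_diag[OF A])
qed

section \<open>Computing with joins, permutation and simultaneous congruences\<close>

abbreviation cl where "cl A \<equiv> modular_set_lattice.cl (eq_rels A)"
abbreviation mt where "mt A \<equiv> modular_set_lattice.mt (eq_rels A)"
abbreviation dist where "dist A \<equiv> modular_set_lattice.dist (eq_rels A)"

lemma eq_rels_ob: "E \<in> eq_rels A \<Longrightarrow> A \<in> Ob C"
  by (simp add: eq_rels_def)

lemma Union_eq_rels: "A \<in> Ob C \<Longrightarrow> \<Union>(eq_rels A) = all_rel A"
proof (intro equalityI subsetI)
  assume A: "A \<in> Ob C"
  fix t assume "t \<in> \<Union>(eq_rels A)"
  then show "t \<in> all_rel A" using eq_rels_hom[of _ A] by (cases t) (auto simp: all_rel_def)
qed (use eq_rels_all in blast)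

lemma cl_empty: "A \<in> Ob C \<Longrightarrow> cl A {} = diag_rel A"
proof -
  assume A: "A \<in> Ob C"
  interpret A: modular_set_lattice "eq_rels A" by (rule modular_eq_rels[OF A])
  have "diag_rel A \<subseteq> u" if "u \<in> eq_rels A" for u
    using eq_rels_refl[OF that] by (auto simp: diag_rel_def)
  then show ?thesis using eq_rels_diag[OF A] by (intro antisym A.cl_least) (auto simp: A.cl_def)
qed

lemma cl_Un:
  assumes E: "E \<in> eq_rels A" and F: "F \<in> eq_rels A"
  shows "cl A (E \<union> F) = join_rel A E F"
proof -
  interpret A: modular_set_lattice "eq_rels A" by (rule modular_eq_rels[OF eq_rels_ob[OF E]])
  show ?thesis
  proof
    show "A.cl (E \<union> F) \<subseteq> join_rel A E F"
      using join_rel_upper[OF E F] join_rel_eq_rels[OF E F] by (intro A.cl_least) auto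
    show "join_rel A E F \<subseteq> A.cl (E \<union> F)"
      using A.cl_extensive[of "E \<union> F"] A.cl_Un_in[OF E F] by (intro join_rel_least) auto
  qed
qed

lemma cl_UnE:
  assumes E: "E \<in> eq_rels A" and F: "F \<in> eq_rels A" and m: "(T, x, y) \<in> cl A (E \<union> F)"
  obtains U p w where "regular_epi C U T p" "(U, x \<cdot> p, w) \<in> E" "(U, w, y \<cdot> p) \<in> F" "w \<in> Hom C U A"
proof -
  obtain U p w where "regular_epi C U T p" "(U, x \<cdot> p, w) \<in> E" "(U, w, y \<cdot> p) \<in> F"
    using m unfolding cl_Un[OF E F] join_rel_def by blast
  then show thesis using that eq_rels_hom(2)[OF E] by blast
qed

lemma cl_UnI:
  assumes E: "E \<in> eq_rels A" and F: "F \<in> eq_rels A" and "regular_epi C U T p" "x \<in> Hom C T A" "y \<in> Hom C T A"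
    "(U, x \<cdot> p, w) \<in> E" "(U, w, y \<cdot> p) \<in> F"
  shows "(T, x, y) \<in> cl A (E \<union> F)"
  unfolding cl_Un[OF E F] join_rel_def using assms by blast

text \<open>Both orders of composition represent the same join, so a path through \<open>E\<close>
  and \<open>F\<close> can be exchanged, on a cover, for one through \<open>F\<close> and
  \<open>E\<close>.\<close>

lemma permute:
  assumes E: "E \<in> eq_rels A" and F: "F \<in> eq_rels A" and "(T, x, w) \<in> E" "(T, w, y) \<in> F"
  obtains U p v where "regular_epi C U T p" "(U, x \<cdot> p, v) \<in> F" "(U, v, y \<cdot> p) \<in> E" "v \<in> Hom C U A"
proof -
  note h = eq_rels_hom[OF E assms(3)] eq_rels_hom[OF F assms(4)]
  have "(T, x, y) \<in> cl A (F \<union> E)"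
    using cl_UnI[OF E F regular_epi_id[OF h(3)] h(1,5), of w] assms(3,4) comp_id_right h by (simp add: Un_commute)
  then show thesis using cl_UnE[OF F E] that by blast
qed

text \<open>A common solution of \<open>w\<close> congruent to \<open>u\<close> modulo
  \<open>a\<close> and to \<open>v\<close> modulo \<open>b\<close> exists by \<open>uv\<close>. It
  is related to \<open>t\<close> both by \<open>c \<or> a\<close> and by \<open>c \<or> b\<close>,
  hence by \<open>c \<or> (a \<and> b)\<close>; a move inside \<open>a \<and> b\<close> then
  satisfies the third congruence without spoiling the others.\<close>

lemma chinese_remainder:
  assumes a: "a \<in> eq_rels A" and b: "b \<in> eq_rels A" and c: "c \<in> eq_rels A"
    and D: "cl A (c \<union> a) \<inter> cl A (c \<union> b) \<subseteq> cl A (c \<union> (a \<inter> b))"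
    and uv: "(T, u, v) \<in> cl A (a \<union> b)" and ut: "(T, u, t) \<in> cl A (c \<union> a)" and vt: "(T, v, t) \<in> cl A (c \<union> b)"
  obtains U p y where "regular_epi C U T p" "y \<in> Hom C U A" "(U, u \<cdot> p, y) \<in> a" "(U, v \<cdot> p, y) \<in> b" "(U, y, t \<cdot> p) \<in> c"
proof -
  interpret A: modular_set_lattice "eq_rels A" by (rule modular_eq_rels[OF eq_rels_ob[OF a]])
  have L: "A.cl (c \<union> a) \<in> eq_rels A" "A.cl (c \<union> b) \<in> eq_rels A" using A.cl_Un_in a b c by blast+
  obtain U p w where w: "regular_epi C U T p" "(U, u \<cdot> p, w) \<in> a" "(U, w, v \<cdot> p) \<in> b" "w \<in> Hom C U A"
    using cl_UnE[OF a b uv] .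
  note ph = regular_epi_hom[OF w(1)]
  have "(U, w, u \<cdot> p) \<in> A.cl (c \<union> a)" using eq_rels_sym[OF a w(2)] A.cl_extensive by blast
  then have 1: "(U, w, t \<cdot> p) \<in> A.cl (c \<union> a)"
    using eq_rels_trans[OF L(1)] eq_rels_stable[OF L(1) ut ph] by blast
  have "(U, w, v \<cdot> p) \<in> A.cl (c \<union> b)" using w(3) A.cl_extensive by blast
  then have 2: "(U, w, t \<cdot> p) \<in> A.cl (c \<union> b)"
    using eq_rels_trans[OF L(2)] eq_rels_stable[OF L(2) vt ph] by blast
  have 3: "(U, w, t \<cdot> p) \<in> A.cl ((a \<inter> b) \<union> c)" using 1 2 D by (auto simp: Un_commute)
  obtain V q y where y: "regular_epi C V U q" "(V, w \<cdot> q, y) \<in> a \<inter> b" "(V, y, (t \<cdot> p) \<cdot> q) \<in> c" "y \<in> Hom C V A"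
    using cl_UnE[OF eq_rels_Int[OF a b] c 3] .
  note qh = regular_epi_hom[OF y(1)]
  have h: "u \<in> Hom C T A" "v \<in> Hom C T A" "t \<in> Hom C T A" using eq_rels_hom[OF L(1) ut] eq_rels_hom[OF L(2) vt] by auto
  have "(V, (u \<cdot> p) \<cdot> q, y) \<in> a"
    using eq_rels_trans[OF a eq_rels_stable[OF a w(2) qh]] y(2) by blast
  moreover have "(V, (v \<cdot> p) \<cdot> q, y) \<in> b"
    using eq_rels_trans[OF b eq_rels_stable[OF b eq_rels_sym[OF b w(3)] qh]] y(2) by blast
  ultimately show thesis
    using that[OF regular_epi_comp[OF y(1) w(1)] y(4)] y(3)
      comp_assoc[OF qh ph h(1)] comp_assoc[OF qh ph h(2)] comp_assoc[OF qh ph h(3)] by simp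
qed

section \<open>Inverse and direct images\<close>

lemma inv_rel_mono: "E \<subseteq> F \<Longrightarrow> inv_rel A f E \<subseteq> inv_rel A f F"
  by (auto simp: inv_rel_def)

lemma inv_rel_Int: "inv_rel A f (E \<inter> F) = inv_rel A f E \<inter> inv_rel A f F"
  by (auto simp: inv_rel_def)

lemma inv_rel_all: "f \<in> Hom C A B \<Longrightarrow> inv_rel A f (all_rel B) = all_rel A"
  using comp_hom by (fastforce simp: inv_rel_def all_rel_def)

lemma ker_subset_inv: "f \<in> Hom C A B \<Longrightarrow> E \<in> eq_rels B \<Longrightarrow> ker A f \<subseteq> inv_rel A f E"
  using eq_rels_refl comp_hom by (fastforce simp: inv_rel_def ker_def)

text \<open>The intermediate element of a path in \<open>B\<close> lifts along \<open>f\<close> on a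
  cover, which yields a path in \<open>A\<close>.\<close>

lemma inv_rel_cl:
  assumes f: "regular_epi C A B f" and E: "E \<in> eq_rels B" and F: "F \<in> eq_rels B"
  shows "inv_rel A f (cl B (E \<union> F)) = cl A (inv_rel A f E \<union> inv_rel A f F)"
proof
  note fh = regular_epi_hom[OF f]
  note I = eq_rels_inv[OF fh E] eq_rels_inv[OF fh F]
  interpret B: modular_set_lattice "eq_rels B" by (rule modular_eq_rels[OF eq_rels_ob[OF E]])
  interpret A: modular_set_lattice "eq_rels A" by (rule modular_eq_rels[OF eq_rels_ob[OF I(1)]])
  show "A.cl (inv_rel A f E \<union> inv_rel A f F) \<subseteq> inv_rel A f (B.cl (E \<union> F))"
    using B.cl_extensive[of "E \<union> F"] eq_rels_inv[OF fh B.cl_Un_in[OF E F]]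
    by (intro A.cl_least Un_least inv_rel_mono) auto
  show "inv_rel A f (B.cl (E \<union> F)) \<subseteq> A.cl (inv_rel A f E \<union> inv_rel A f F)"
  proof
    fix t assume "t \<in> inv_rel A f (B.cl (E \<union> F))"
    then obtain T x y where t: "t = (T, x, y)" "x \<in> Hom C T A" "y \<in> Hom C T A" "(T, f \<cdot> x, f \<cdot> y) \<in> B.cl (E \<union> F)"
      by (auto simp: inv_rel_def)
    obtain U p w where w: "regular_epi C U T p" "(U, (f \<cdot> x) \<cdot> p, w) \<in> E" "(U, w, (f \<cdot> y) \<cdot> p) \<in> F" "w \<in> Hom C U B"
      using cl_UnE[OF E F t(4)] .
    obtain V q z where z: "regular_epi C V U q" "z \<in> Hom C V A" "f \<cdot> z = w \<cdot> q"
      using local_lift[OF f w(4)] .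
    note ph = regular_epi_hom[OF w(1)] note qh = regular_epi_hom[OF z(1)]
    have pq: "p \<cdot> q \<in> Hom C V T" using ph qh comp_hom by blast
    have "((f \<cdot> x) \<cdot> p) \<cdot> q = f \<cdot> (x \<cdot> (p \<cdot> q))" "((f \<cdot> y) \<cdot> p) \<cdot> q = f \<cdot> (y \<cdot> (p \<cdot> q))"
      by (simp_all only: comp_assoc[OF ph t(2) fh] comp_assoc[OF ph t(3) fh] comp_assoc[OF qh comp_hom[OF ph t(2)] fh]
          comp_assoc[OF qh comp_hom[OF ph t(3)] fh] comp_assoc[OF qh ph t(2)] comp_assoc[OF qh ph t(3)])
    then have "(V, f \<cdot> (x \<cdot> (p \<cdot> q)), f \<cdot> z) \<in> E" "(V, f \<cdot> z, f \<cdot> (y \<cdot> (p \<cdot> q))) \<in> F"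
      using eq_rels_stable[OF E w(2) qh] eq_rels_stable[OF F w(3) qh] z(3) by simp_all
    then have "(V, x \<cdot> (p \<cdot> q), z) \<in> inv_rel A f E" "(V, z, y \<cdot> (p \<cdot> q)) \<in> inv_rel A f F"
      unfolding inv_rel_def using z(2) comp_hom[OF pq t(2)] comp_hom[OF pq t(3)] by blast+
    then show "t \<in> A.cl (inv_rel A f E \<union> inv_rel A f F)"
      using cl_UnI[OF I regular_epi_comp[OF z(1) w(1)] t(2,3)] t(1) by blast
  qed
qed

lemma inv_rel_reflect:
  assumes f: "regular_epi C A B f" and E: "E \<in> eq_rels B" and F: "F \<in> eq_rels B"
    and sub: "inv_rel A f E \<subseteq> inv_rel A f F"
  shows "E \<subseteq> F"
proof
  note fh = regular_epi_hom[OF f]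
  fix t assume "t \<in> E"
  then obtain T x y where t: "t = (T, x, y)" "(T, x, y) \<in> E" by (cases t) auto
  note h = eq_rels_hom[OF E t(2)]
  obtain U p u where u: "regular_epi C U T p" "u \<in> Hom C U A" "f \<cdot> u = x \<cdot> p" using local_lift[OF f h(1)] .
  note ph = regular_epi_hom[OF u(1)]
  obtain V q v where v: "regular_epi C V U q" "v \<in> Hom C V A" "f \<cdot> v = (y \<cdot> p) \<cdot> q" using local_lift[OF f comp_hom[OF ph h(2)]] .
  note qh = regular_epi_hom[OF v(1)]
  have 1: "f \<cdot> (u \<cdot> q) = (x \<cdot> p) \<cdot> q" using comp_assoc[OF qh u(2) fh] u(3) by simp
  have uq: "u \<cdot> q \<in> Hom C V A" using u(2) qh comp_hom by blast
  have "(V, (x \<cdot> p) \<cdot> q, (y \<cdot> p) \<cdot> q) \<in> E"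
    using eq_rels_stable[OF E eq_rels_stable[OF E t(2) ph] qh] .
  then have "(V, u \<cdot> q, v) \<in> inv_rel A f E" unfolding inv_rel_def using uq v(2,3) 1 by simp
  then have "(V, u \<cdot> q, v) \<in> inv_rel A f F" using sub by blast
  then have "(V, (x \<cdot> p) \<cdot> q, (y \<cdot> p) \<cdot> q) \<in> F" unfolding inv_rel_def using v(3) 1 by simp
  then show "t \<in> F"
    using eq_rels_local[OF F v(1) comp_hom[OF ph h(1)] comp_hom[OF ph h(2)]] eq_rels_local[OF F u(1) h(1,2)] t(1) by blast
qed

text \<open>The image of the pairs of \<open>E\<close> in \<open>B\<close> is reflexive, since the
  identity of \<open>B\<close> lifts along \<open>f\<close> on a cover; it is thus an equivalence
  relation. Two elements of \<open>A\<close> with related images are linked through the kernel of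
  \<open>f\<close> to a pair of \<open>E\<close>.\<close>

lemma ex_direct_image:
  assumes f: "regular_epi C A B f" and E: "E \<in> eq_rels A"
  obtains F where "F \<in> eq_rels B" "inv_rel A f F = cl A (E \<union> ker A f)"
proof -
  note fh = regular_epi_hom[OF f]
  have B: "B \<in> Ob C" using fh hom_ob by blast
  interpret A: modular_set_lattice "eq_rels A" by (rule modular_eq_rels[OF eq_rels_ob[OF E]])
  note K = ker_eq_rels[OF fh]
  obtain R d c where R: "is_relation C A R d c" "E = span_rel R d c"
    using E by (auto simp: eq_rels_def is_rel_on_def)
  have dc: "d \<in> Hom C R A" "c \<in> Hom C R A" using R by (auto simp: is_relation_def)
  obtain I i j q where I: "is_relation C B I i j" "regular_epi C R I q" "i \<cdot> q = f \<cdot> d" "j \<cdot> q = f \<cdot> c"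
    using ex_image_relation[OF comp_hom[OF dc(1) fh] comp_hom[OF dc(2) fh]] .
  have mem: "(T, x, y) \<in> span_rel I i j \<longleftrightarrow> (\<exists>U p u v. regular_epi C U T p \<and> (U, u, v) \<in> E \<and> f \<cdot> u = x \<cdot> p \<and> f \<cdot> v = y \<cdot> p)"
    if x: "x \<in> Hom C T B" and y: "y \<in> Hom C T B" for T x y
  proof
    assume "(T, x, y) \<in> span_rel I i j"
    then obtain U p z where z: "regular_epi C U T p" "z \<in> Hom C U R" "x \<cdot> p = (f \<cdot> d) \<cdot> z" "y \<cdot> p = (f \<cdot> c) \<cdot> z"
      using image_relation_iff[OF I(1,2) x y] I(3,4) by auto
    then have "(U, d \<cdot> z, c \<cdot> z) \<in> E" "f \<cdot> (d \<cdot> z) = x \<cdot> p" "f \<cdot> (c \<cdot> z) = y \<cdot> p"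
      using comp_assoc[OF z(2) dc(1) fh] comp_assoc[OF z(2) dc(2) fh] by (auto simp: R(2) span_rel_def)
    then show "\<exists>U p u v. regular_epi C U T p \<and> (U, u, v) \<in> E \<and> f \<cdot> u = x \<cdot> p \<and> f \<cdot> v = y \<cdot> p" using z(1) by blast
  next
    assume "\<exists>U p u v. regular_epi C U T p \<and> (U, u, v) \<in> E \<and> f \<cdot> u = x \<cdot> p \<and> f \<cdot> v = y \<cdot> p"
    then obtain U p u v where u: "regular_epi C U T p" "(U, u, v) \<in> E" "f \<cdot> u = x \<cdot> p" "f \<cdot> v = y \<cdot> p" by blast
    then obtain z where z: "z \<in> Hom C U R" "u = d \<cdot> z" "v = c \<cdot> z" by (auto simp: R(2) span_rel_def)
    then have "x \<cdot> p = (f \<cdot> d) \<cdot> z" "y \<cdot> p = (f \<cdot> c) \<cdot> z"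
      using comp_assoc[OF z(1) dc(1) fh] comp_assoc[OF z(1) dc(2) fh] u by simp_all
    then show "(T, x, y) \<in> span_rel I i j" using image_relation_iff[OF I(1,2) x y] I(3,4) u(1) z(1) by auto
  qed
  have "(B, Id C B, Id C B) \<in> span_rel I i j"
  proof -
    obtain U p x where x: "regular_epi C U B p" "x \<in> Hom C U A" "f \<cdot> x = Id C B \<cdot> p"
      using local_lift[OF f id_hom[OF B]] .
    then show ?thesis using mem[OF id_hom[OF B] id_hom[OF B]] eq_rels_refl[OF E x(2)] by blast
  qed
  then have F: "span_rel I i j \<in> eq_rels B" by (rule reflexive_image_eq_rel[OF I(1)])
  have "inv_rel A f (span_rel I i j) = A.cl (E \<union> ker A f)"
  proof
    show "A.cl (E \<union> ker A f) \<subseteq> inv_rel A f (span_rel I i j)"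
    proof (rule A.cl_least[OF Un_least eq_rels_inv[OF fh F]])
      show "ker A f \<subseteq> inv_rel A f (span_rel I i j)" by (rule ker_subset_inv[OF fh F])
      show "E \<subseteq> inv_rel A f (span_rel I i j)"
      proof
        fix t assume "t \<in> E"
        then obtain T x y where t: "t = (T, x, y)" "(T, x, y) \<in> E" by (cases t) auto
        note h = eq_rels_hom[OF E t(2)]
        have "f \<cdot> x = (f \<cdot> x) \<cdot> Id C T" "f \<cdot> y = (f \<cdot> y) \<cdot> Id C T"
          using comp_id_right comp_hom[OF h(1) fh] comp_hom[OF h(2) fh] by metis+
        then have "(T, f \<cdot> x, f \<cdot> y) \<in> span_rel I i j"
          using mem[OF comp_hom[OF h(1) fh] comp_hom[OF h(2) fh]] t(2) regular_epi_id[OF h(3)] by blast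
        then show "t \<in> inv_rel A f (span_rel I i j)" using t h by (simp add: inv_rel_def)
      qed
    qed
    show "inv_rel A f (span_rel I i j) \<subseteq> A.cl (E \<union> ker A f)"
    proof
      fix t assume "t \<in> inv_rel A f (span_rel I i j)"
      then obtain T x y where t: "t = (T, x, y)" "x \<in> Hom C T A" "y \<in> Hom C T A" "(T, f \<cdot> x, f \<cdot> y) \<in> span_rel I i j"
        by (auto simp: inv_rel_def)
      obtain U p u v where u: "regular_epi C U T p" "(U, u, v) \<in> E" "f \<cdot> u = (f \<cdot> x) \<cdot> p" "f \<cdot> v = (f \<cdot> y) \<cdot> p"
        using t(4) mem[OF comp_hom[OF t(2) fh] comp_hom[OF t(3) fh]] by blast
      note ph = regular_epi_hom[OF u(1)] note h = eq_rels_hom[OF E u(2)]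
      have L: "A.cl (E \<union> ker A f) \<in> eq_rels A" using A.cl_Un_in[OF E K] .
      have "(U, x \<cdot> p, u) \<in> ker A f" "(U, v, y \<cdot> p) \<in> ker A f"
        using u h comp_hom[OF ph t(2)] comp_hom[OF ph t(3)] comp_assoc[OF ph t(2) fh] comp_assoc[OF ph t(3) fh]
        by (auto simp: ker_def)
      then have "(U, x \<cdot> p, u) \<in> A.cl (E \<union> ker A f)" "(U, v, y \<cdot> p) \<in> A.cl (E \<union> ker A f)" "(U, u, v) \<in> A.cl (E \<union> ker A f)"
        using A.cl_extensive[of "E \<union> ker A f"] u(2) by auto
      then have "(U, x \<cdot> p, y \<cdot> p) \<in> A.cl (E \<union> ker A f)" using eq_rels_trans[OF L] by blast
      then show "t \<in> A.cl (E \<union> ker A f)" using eq_rels_local[OF L u(1) t(2,3)] t(1) by simp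
    qed
  qed
  then show thesis using that F by blast
qed

lemma inv_rel_hom:
  assumes f: "regular_epi C A B f" and F: "F \<subseteq> eq_rels B"
  shows "modular_set_lattice_hom (eq_rels B) (eq_rels A) (inv_rel A f) F"
proof -
  note fh = regular_epi_hom[OF f]
  have A: "A \<in> Ob C" and B: "B \<in> Ob C" using fh hom_ob by blast+
  interpret B: modular_set_lattice "eq_rels B" by (rule modular_eq_rels[OF B])
  interpret A: modular_set_lattice "eq_rels A" by (rule modular_eq_rels[OF A])
  show ?thesis
  proof
    fix a b assume "a \<in> eq_rels B"
    then show "inv_rel A f a \<in> eq_rels A" using eq_rels_inv[OF fh] by blast
    show "a \<subseteq> b \<Longrightarrow> inv_rel A f a \<subseteq> inv_rel A f b" by (rule inv_rel_mono)
    show "inv_rel A f (a \<inter> b) = inv_rel A f a \<inter> inv_rel A f b" by (rule inv_rel_Int)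
  next
    show "inv_rel A f (\<Union>(eq_rels B)) = \<Union>(eq_rels A)"
      using inv_rel_all[OF fh] Union_eq_rels A B by simp
    fix Z S assume "finite Z" "finite S" "Z \<subseteq> F" "S \<subseteq> F"
    then show "inv_rel A f (B.cl (\<Union>Z \<union> B.mt S)) = A.cl (\<Union>(inv_rel A f ` Z) \<union> inv_rel A f (B.mt S))"
    proof (induction Z rule: finite_induct)
      case empty
      then have "B.mt S \<in> eq_rels B" using F by (intro B.mt_in) auto
      then show ?case using B.cl_eq A.cl_eq eq_rels_inv[OF fh] by simp
    next
      case (insert z Z)
      have L: "B.mt S \<in> eq_rels B" "B.cl (\<Union>Z) \<in> eq_rels B" "z \<in> eq_rels B"
        using insert F B.mt_in[of S] B.cl_Union_in[of Z] by auto
      then have M: "B.cl (\<Union>Z \<union> B.mt S) \<in> eq_rels B" using B.cl_Un_in B.cl_cl_Un by metis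
      have "inv_rel A f (B.cl (\<Union>(insert z Z) \<union> B.mt S)) = inv_rel A f (B.cl (z \<union> B.cl (\<Union>Z \<union> B.mt S)))"
        by (simp add: B.cl_Un_cl Un_ac)
      also have "\<dots> = A.cl (inv_rel A f z \<union> A.cl (\<Union>(inv_rel A f ` Z) \<union> inv_rel A f (B.mt S)))"
        using inv_rel_cl[OF f L(3) M] insert by simp
      also have "\<dots> = A.cl (\<Union>(inv_rel A f ` insert z Z) \<union> inv_rel A f (B.mt S))"
        by (simp add: A.cl_Un_cl Un_ac)
      finally show ?case .
    qed
  qed (use F in auto)
qed

end

section \<open>Lifted relations and exact sequences\<close>

context category
begin

lemma square_comp:
  assumes "g \<in> Hom C A B" "f \<in> Hom C B D" "k \<in> Hom C A B'" "h \<in> Hom C B' D" "f \<cdot> g = h \<cdot> k" "x \<in> Hom C T A"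
  shows "f \<cdot> (g \<cdot> x) = h \<cdot> (k \<cdot> x)"
  using comp_assoc[OF assms(6,1,2)] comp_assoc[OF assms(6,3,4)] assms(5) by simp

definition lift_rel :: "'o \<Rightarrow> 'm \<Rightarrow> 'm \<Rightarrow> ('o \<times> 'm \<times> 'm) set \<Rightarrow> ('o \<times> 'm \<times> 'm) set" where
  "lift_rel R d c E = inv_rel R d E \<inter> inv_rel R c E"

definition exact_seq :: "'o \<Rightarrow> 'o \<Rightarrow> 'o \<Rightarrow> 'm \<Rightarrow> 'm \<Rightarrow> 'm \<Rightarrow> bool" where
  "exact_seq K A B d c f \<longleftrightarrow> is_kernel_pair C A B f K d c \<and> is_coequaliser C K A d c B f"

lemma lift_rel_iff: "(T, x, y) \<in> lift_rel R d c E \<longleftrightarrow> x \<in> Hom C T R \<and> y \<in> Hom C T R \<and>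
    (T, d \<cdot> x, d \<cdot> y) \<in> E \<and> (T, c \<cdot> x, c \<cdot> y) \<in> E"
  by (auto simp: lift_rel_def inv_rel_def)

lemma lift_rel_mono: "E \<subseteq> F \<Longrightarrow> lift_rel R d c E \<subseteq> lift_rel R d c F"
  by (auto simp: lift_rel_def inv_rel_def)

lemma lift_rel_Int: "lift_rel R d c (E \<inter> F) = lift_rel R d c E \<inter> lift_rel R d c F"
  by (auto simp: lift_rel_def inv_rel_def)

lemma lift_rel_diag:
  assumes "is_relation C A R d c"
  shows "lift_rel R d c (diag_rel A) = diag_rel R"
proof -
  have dc: "d \<in> Hom C R A" "c \<in> Hom C R A" "jointly_monic C R d c" using assms by (auto simp: is_relation_def)
  show ?thesis
  proof (intro equalityI subsetI)
    fix t assume "t \<in> lift_rel R d c (diag_rel A)"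
    then obtain T x y where t: "t = (T, x, y)" "x \<in> Hom C T R" "y \<in> Hom C T R" "d \<cdot> x = d \<cdot> y" "c \<cdot> x = c \<cdot> y"
      by (cases t) (auto simp: lift_rel_iff diag_rel_def)
    then show "t \<in> diag_rel R" using jointly_monicD[OF dc(3)] by (simp add: diag_rel_def)
  next
    fix t assume "t \<in> diag_rel R"
    then obtain T x where t: "t = (T, x, x)" "x \<in> Hom C T R" by (auto simp: diag_rel_def)
    then show "t \<in> lift_rel R d c (diag_rel A)"
      using comp_hom[OF t(2) dc(1)] comp_hom[OF t(2) dc(2)] by (simp add: lift_rel_iff diag_rel_def)
  qed
qed

lemma ker_lift:
  assumes f: "f \<in> Hom C A B" and R: "d \<in> Hom C R A" "c \<in> Hom C R A"
    and S: "is_relation C B S d' c'" and g: "g \<in> Hom C R S" "d' \<cdot> g = f \<cdot> d" "c' \<cdot> g = f \<cdot> c"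
  shows "ker R g = lift_rel R d c (ker A f)"
proof -
  have S': "d' \<in> Hom C S B" "c' \<in> Hom C S B" "jointly_monic C S d' c'" using S by (auto simp: is_relation_def)
  have "(T, x, y) \<in> ker R g \<longleftrightarrow> (T, x, y) \<in> lift_rel R d c (ker A f)" for T x y
  proof (cases "x \<in> Hom C T R \<and> y \<in> Hom C T R")
    case True
    then have x: "x \<in> Hom C T R" and y: "y \<in> Hom C T R" by auto
    have eq: "d' \<cdot> (g \<cdot> x) = f \<cdot> (d \<cdot> x)" "c' \<cdot> (g \<cdot> x) = f \<cdot> (c \<cdot> x)" "d' \<cdot> (g \<cdot> y) = f \<cdot> (d \<cdot> y)" "c' \<cdot> (g \<cdot> y) = f \<cdot> (c \<cdot> y)"
      using square_comp[OF g(1) S'(1) R(1) f g(2) x] square_comp[OF g(1) S'(2) R(2) f g(3) x]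
        square_comp[OF g(1) S'(1) R(1) f g(2) y] square_comp[OF g(1) S'(2) R(2) f g(3) y] by auto
    have "g \<cdot> x = g \<cdot> y \<longleftrightarrow> f \<cdot> (d \<cdot> x) = f \<cdot> (d \<cdot> y) \<and> f \<cdot> (c \<cdot> x) = f \<cdot> (c \<cdot> y)"
      using jointly_monicD[OF S'(3) comp_hom[OF x g(1)] comp_hom[OF y g(1)]] eq by metis
    then show ?thesis
      using x y comp_hom[OF x R(1)] comp_hom[OF x R(2)] comp_hom[OF y R(1)] comp_hom[OF y R(2)]
      by (auto simp: ker_def lift_rel_iff)
  qed (auto simp: ker_def lift_rel_iff)
  then show ?thesis by auto
qed

lemma inv_lift:
  assumes f: "f \<in> Hom C A B" and R: "d \<in> Hom C R A" "c \<in> Hom C R A"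
    and S: "d' \<in> Hom C S B" "c' \<in> Hom C S B" and g: "g \<in> Hom C R S" "d' \<cdot> g = f \<cdot> d" "c' \<cdot> g = f \<cdot> c"
  shows "inv_rel R g (lift_rel S d' c' E) = lift_rel R d c (inv_rel A f E)"
proof -
  have "(T, x, y) \<in> inv_rel R g (lift_rel S d' c' E) \<longleftrightarrow> (T, x, y) \<in> lift_rel R d c (inv_rel A f E)" for T x y
  proof (cases "x \<in> Hom C T R \<and> y \<in> Hom C T R")
    case True
    then have x: "x \<in> Hom C T R" and y: "y \<in> Hom C T R" by auto
    have eq: "d' \<cdot> (g \<cdot> x) = f \<cdot> (d \<cdot> x)" "c' \<cdot> (g \<cdot> x) = f \<cdot> (c \<cdot> x)" "d' \<cdot> (g \<cdot> y) = f \<cdot> (d \<cdot> y)" "c' \<cdot> (g \<cdot> y) = f \<cdot> (c \<cdot> y)"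
      using square_comp[OF g(1) S(1) R(1) f g(2) x] square_comp[OF g(1) S(2) R(2) f g(3) x]
        square_comp[OF g(1) S(1) R(1) f g(2) y] square_comp[OF g(1) S(2) R(2) f g(3) y] by auto
    then show ?thesis
      using x y comp_hom[OF x R(1)] comp_hom[OF x R(2)] comp_hom[OF y R(1)] comp_hom[OF y R(2)]
        comp_hom[OF x g(1)] comp_hom[OF y g(1)]
      by (auto simp: inv_rel_def lift_rel_iff)
  qed (auto simp: inv_rel_def lift_rel_iff)
  then show ?thesis by auto
qed

end

context finitely_complete_category
begin

lemma lift_rel_in: "d \<in> Hom C R A \<Longrightarrow> c \<in> Hom C R A \<Longrightarrow> E \<in> eq_rels A \<Longrightarrow> lift_rel R d c E \<in> eq_rels R"
  unfolding lift_rel_def using eq_rels_Int eq_rels_inv by blast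

end

section \<open>Exact sequences and their transport along isomorphisms\<close>

context regular_category
begin

lemma exact_seqI:
  assumes "is_kernel_pair C A B f K d c" "regular_epi C A B f"
  shows "exact_seq K A B d c f"
  unfolding exact_seq_def using assms regular_epi_coequaliser by blast

lemma exact_seqD:
  assumes "exact_seq K A B d c f"
  shows "d \<in> Hom C K A" "c \<in> Hom C K A" "f \<in> Hom C A B" "f \<cdot> d = f \<cdot> c" "regular_epi C A B f"
    "is_kernel_pair C A B f K d c" "is_coequaliser C K A d c B f" "is_relation C A K d c"
    "\<And>T x y. x \<in> Hom C T A \<Longrightarrow> y \<in> Hom C T A \<Longrightarrow> f \<cdot> x = f \<cdot> y \<Longrightarrow> \<exists>h \<in> Hom C T K. d \<cdot> h = x \<and> c \<cdot> h = y"
    "\<And>T x y. x \<in> Hom C T K \<Longrightarrow> y \<in> Hom C T K \<Longrightarrow> d \<cdot> x = d \<cdot> y \<Longrightarrow> c \<cdot> x = c \<cdot> y \<Longrightarrow> x = y"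
proof -
  have K: "is_kernel_pair C A B f K d c" and Q: "is_coequaliser C K A d c B f" using assms by (auto simp: exact_seq_def)
  note P = K[unfolded is_kernel_pair_def]
  show "d \<in> Hom C K A" "c \<in> Hom C K A" "f \<in> Hom C A B" "f \<cdot> d = f \<cdot> c" using pullbackD[OF P] by auto
  show "regular_epi C A B f" using Q by (auto simp: regular_epi_def)
  show "is_kernel_pair C A B f K d c" "is_coequaliser C K A d c B f" by fact+
  show "is_relation C A K d c" by (rule kernel_pair_jointly_monic[OF K])
  show "\<exists>h \<in> Hom C T K. d \<cdot> h = x \<and> c \<cdot> h = y" if "x \<in> Hom C T A" "y \<in> Hom C T A" "f \<cdot> x = f \<cdot> y" for T x y
    using pullback_ex[OF P that] by blast
  show "x = y" if "x \<in> Hom C T K" "y \<in> Hom C T K" "d \<cdot> x = d \<cdot> y" "c \<cdot> x = c \<cdot> y" for T x y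
    using pullback_mono[OF P that] .
qed

lemma exact_seq_iso:
  assumes ex: "exact_seq K A B d c f" and k: "iso C K K' k" and a: "iso C A A' a" and b: "iso C B B' b"
    and d': "d' \<in> Hom C K' A'" "c' \<in> Hom C K' A'" "f' \<in> Hom C A' B'"
    and eq: "d' \<cdot> k = a \<cdot> d" "c' \<cdot> k = a \<cdot> c" "f' \<cdot> a = b \<cdot> f"
  shows "exact_seq K' A' B' d' c' f'"
proof -
  note e = exact_seqD[OF ex]
  obtain k' where k': "k \<in> Hom C K K'" "k' \<in> Hom C K' K" "k \<cdot> k' = Id C K'" "iso C K' K k'" using k iso_hom by (metis isoE)
  obtain a' where a': "a \<in> Hom C A A'" "a' \<in> Hom C A' A" "a' \<cdot> a = Id C A" "a \<cdot> a' = Id C A'" "iso C A' A a'" using a iso_hom by (metis isoE)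
  have bh: "b \<in> Hom C B B'" using b iso_hom by blast
  have re: "regular_epi C A' B' f'"
    using regular_epi_cancel[OF regular_epi_comp[OF e(5) iso_regular_epi[OF b]] d'(3) a'(1) eq(3)] .
  have aa: "a \<cdot> (a' \<cdot> x) = x" if "x \<in> Hom C T A'" for T x
    using comp_assoc[OF that a'(2,1)] a'(4) comp_id_left[OF that] by simp
  have kk: "k \<cdot> (k' \<cdot> x) = x" if "x \<in> Hom C T K'" for T x
    using comp_assoc[OF that k'(2,1)] k'(3) comp_id_left[OF that] by simp
  have "is_kernel_pair C A' B' f' K' d' c'"
    unfolding is_kernel_pair_def
  proof (rule pullbackI[OF d'(3,3,1,2)])
    have "f' \<cdot> (d' \<cdot> k) = f' \<cdot> (c' \<cdot> k)"
      using square_comp[OF a'(1) d'(3) e(3) bh eq(3) e(1)] square_comp[OF a'(1) d'(3) e(3) bh eq(3) e(2)] e(4) eq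
      by simp
    then have "(f' \<cdot> d') \<cdot> k = (f' \<cdot> c') \<cdot> k"
      using comp_assoc[OF k'(1) d'(1,3)] comp_assoc[OF k'(1) d'(2,3)] by simp
    then show "f' \<cdot> d' = f' \<cdot> c'"
      using regular_epi_epi[OF iso_regular_epi[OF k] comp_hom[OF d'(1,3)] comp_hom[OF d'(2,3)]] by blast
  next
    fix T x y assume x: "x \<in> Hom C T A'" and y: "y \<in> Hom C T A'" and xy: "f' \<cdot> x = f' \<cdot> y"
    have x': "a' \<cdot> x \<in> Hom C T A" and y': "a' \<cdot> y \<in> Hom C T A" using x y a' comp_hom by blast+
    have "b \<cdot> (f \<cdot> (a' \<cdot> x)) = b \<cdot> (f \<cdot> (a' \<cdot> y))"
      using square_comp[OF a'(1) d'(3) e(3) bh eq(3) x'] square_comp[OF a'(1) d'(3) e(3) bh eq(3) y'] aa[OF x] aa[OF y] xy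
      by simp
    then have "f \<cdot> (a' \<cdot> x) = f \<cdot> (a' \<cdot> y)" using iso_cancel_left[OF b comp_hom[OF x' e(3)] comp_hom[OF y' e(3)]] by blast
    then obtain h where h: "h \<in> Hom C T K" "d \<cdot> h = a' \<cdot> x" "c \<cdot> h = a' \<cdot> y" using e(9)[OF x' y'] by blast
    have "d' \<cdot> (k \<cdot> h) = x" "c' \<cdot> (k \<cdot> h) = y"
      using square_comp[OF k'(1) d'(1) e(1) a'(1) eq(1) h(1)] square_comp[OF k'(1) d'(2) e(2) a'(1) eq(2) h(1)]
        h(2,3) aa[OF x] aa[OF y] by simp_all
    then show "\<exists>h \<in> Hom C T K'. d' \<cdot> h = x \<and> c' \<cdot> h = y" using comp_hom[OF h(1) k'(1)] by blast
  next
    fix T x y assume x: "x \<in> Hom C T K'" and y: "y \<in> Hom C T K'" and xy: "d' \<cdot> x = d' \<cdot> y" "c' \<cdot> x = c' \<cdot> y"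
    have x': "k' \<cdot> x \<in> Hom C T K" and y': "k' \<cdot> y \<in> Hom C T K" using x y k' comp_hom by blast+
    have "a \<cdot> (d \<cdot> (k' \<cdot> x)) = a \<cdot> (d \<cdot> (k' \<cdot> y))" "a \<cdot> (c \<cdot> (k' \<cdot> x)) = a \<cdot> (c \<cdot> (k' \<cdot> y))"
      using square_comp[OF k'(1) d'(1) e(1) a'(1) eq(1) x'] square_comp[OF k'(1) d'(1) e(1) a'(1) eq(1) y']
        square_comp[OF k'(1) d'(2) e(2) a'(1) eq(2) x'] square_comp[OF k'(1) d'(2) e(2) a'(1) eq(2) y']
        kk[OF x] kk[OF y] xy by simp_all
    then have "d \<cdot> (k' \<cdot> x) = d \<cdot> (k' \<cdot> y)" "c \<cdot> (k' \<cdot> x) = c \<cdot> (k' \<cdot> y)"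
      using iso_cancel_left[OF a comp_hom[OF x' e(1)] comp_hom[OF y' e(1)]]
        iso_cancel_left[OF a comp_hom[OF x' e(2)] comp_hom[OF y' e(2)]] by blast+
    then have "k' \<cdot> x = k' \<cdot> y" using e(10)[OF x' y'] by blast
    then show "x = y" using iso_cancel_left[OF k'(4) x y] by blast
  qed
  then show ?thesis using re by (rule exact_seqI)
qed

end

section \<open>Joins of lifted relations and regular epimorphisms between relations\<close>

context exact_maltsev_category
begin

text \<open>Elements of \<open>R\<close> are pairs. A path in \<open>a\<close> and then
  \<open>b\<close> between the first endpoints has to be completed to a path of elements of
  \<open>R\<close> from \<open>x\<close> to \<open>y\<close>. This asks for a partner of the
  intermediate point that is at the same time the intermediate point of a path between the second
  endpoints, which is a system of three congruences.\<close>

lemma lift_rel_cl: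
  assumes R: "is_relation C A R d c" and r: "span_rel R d c \<in> eq_rels A" and a: "a \<in> eq_rels A" and b: "b \<in> eq_rels A"
    and D: "cl A (b \<union> span_rel R d c) \<inter> cl A (b \<union> a) \<subseteq> cl A (b \<union> (span_rel R d c \<inter> a))"
  shows "lift_rel R d c (cl A (a \<union> b)) = cl R (lift_rel R d c a \<union> lift_rel R d c b)"
proof
  let ?r = "span_rel R d c"
  have dc: "d \<in> Hom C R A" "c \<in> Hom C R A" using R by (auto simp: is_relation_def)
  note I = lift_rel_in[OF dc a] lift_rel_in[OF dc b]
  interpret A: modular_set_lattice "eq_rels A" by (rule modular_eq_rels[OF eq_rels_ob[OF a]])
  interpret R: modular_set_lattice "eq_rels R" by (rule modular_eq_rels[OF eq_rels_ob[OF I(1)]])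
  note ra = A.cl_Un_in[OF r a] and br = A.cl_Un_in[OF b r] and ba = A.cl_Un_in[OF b a]
  show "R.cl (lift_rel R d c a \<union> lift_rel R d c b) \<subseteq> lift_rel R d c (A.cl (a \<union> b))"
    using A.cl_extensive[of "a \<union> b"] lift_rel_in[OF dc A.cl_Un_in[OF a b]]
    by (intro R.cl_least Un_least lift_rel_mono) auto
  show "lift_rel R d c (A.cl (a \<union> b)) \<subseteq> R.cl (lift_rel R d c a \<union> lift_rel R d c b)"
  proof
    fix t assume "t \<in> lift_rel R d c (A.cl (a \<union> b))"
    then obtain T x y where t: "t = (T, x, y)" "x \<in> Hom C T R" "y \<in> Hom C T R" 
      "(T, d \<cdot> x, d \<cdot> y) \<in> A.cl (a \<union> b)" "(T, c \<cdot> x, c \<cdot> y) \<in> A.cl (a \<union> b)"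
      by (cases t) (auto simp: lift_rel_iff)
    obtain U p u where u: "regular_epi C U T p" "(U, (d \<cdot> x) \<cdot> p, u) \<in> a" "(U, u, (d \<cdot> y) \<cdot> p) \<in> b" "u \<in> Hom C U A"
      using cl_UnE[OF a b t(4)] .
    note ph = regular_epi_hom[OF u(1)]
    have rx: "(T, d \<cdot> x, c \<cdot> x) \<in> ?r" and ry: "(T, d \<cdot> y, c \<cdot> y) \<in> ?r" using t by (auto simp: span_rel_def)
    have rxp: "(U, (d \<cdot> x) \<cdot> p, (c \<cdot> x) \<cdot> p) \<in> ?r" and ryp: "(U, (d \<cdot> y) \<cdot> p, (c \<cdot> y) \<cdot> p) \<in> ?r"
      using eq_rels_stable[OF r rx ph] eq_rels_stable[OF r ry ph] by auto
    have 1: "(U, u, (c \<cdot> x) \<cdot> p) \<in> A.cl (?r \<union> a)"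
      using eq_rels_trans[OF ra, of U u "(d \<cdot> x) \<cdot> p"] eq_rels_sym[OF a u(2)] rxp A.cl_extensive[of "?r \<union> a"] by blast
    have 2: "(U, u, (c \<cdot> y) \<cdot> p) \<in> A.cl (b \<union> ?r)"
      using eq_rels_trans[OF br, of U u "(d \<cdot> y) \<cdot> p"] u(3) ryp A.cl_extensive[of "b \<union> ?r"] by blast
    have 3: "(U, (c \<cdot> x) \<cdot> p, (c \<cdot> y) \<cdot> p) \<in> A.cl (b \<union> a)"
      using eq_rels_stable[OF ba _ ph] t(5) by (simp add: Un_commute)
    \<comment> \<open>The moduli are \<open>R\<close>, \<open>a\<close> and \<open>b\<close>, the
      residues are \<open>u\<close>, the second endpoint of \<open>x\<close> and the second endpoint
      of \<open>y\<close>. The facts \<open>1\<close>, \<open>2\<close> and \<open>3\<close> are the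
      pairwise compatibility of the system.\<close>
    obtain V q w where w: "regular_epi C V U q" "w \<in> Hom C V A" "(V, u \<cdot> q, w) \<in> ?r" "(V, ((c \<cdot> x) \<cdot> p) \<cdot> q, w) \<in> a"
        "(V, w, ((c \<cdot> y) \<cdot> p) \<cdot> q) \<in> b"
      using chinese_remainder[OF r a b D 1 2 3] .
    note qh = regular_epi_hom[OF w(1)]
    have pq: "p \<cdot> q \<in> Hom C V T" using comp_hom[OF qh ph] .
    have as: "((e \<cdot> z) \<cdot> p) \<cdot> q = e \<cdot> (z \<cdot> (p \<cdot> q))" if "e \<in> Hom C R A" "z \<in> Hom C T R" for e z
      using comp_assoc[OF qh ph comp_hom[OF that(2,1)]] comp_assoc[OF pq that(2,1)] by simp
    obtain z where z: "z \<in> Hom C V R" "u \<cdot> q = d \<cdot> z" "w = c \<cdot> z" using w(3) by (auto simp: span_rel_def)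
    have "(V, x \<cdot> (p \<cdot> q), z) \<in> lift_rel R d c a"
      unfolding lift_rel_iff using z comp_hom[OF pq t(2)] eq_rels_stable[OF a u(2) qh] w(4) as[OF dc(1) t(2)] as[OF dc(2) t(2)]
      by simp
    moreover have "(V, z, y \<cdot> (p \<cdot> q)) \<in> lift_rel R d c b"
      unfolding lift_rel_iff using z comp_hom[OF pq t(3)] eq_rels_stable[OF b u(3) qh] w(5) as[OF dc(1) t(3)] as[OF dc(2) t(3)]
      by simp
    ultimately show "t \<in> R.cl (lift_rel R d c a \<union> lift_rel R d c b)"
      using cl_UnI[OF I regular_epi_comp[OF w(1) u(1)] t(2,3)] t(1) by blast
  qed
qed

text \<open>The condition required by \<open>lift_rel_cl\<close> is an instance of
  \<open>dist_triple\<close> in which the relation of \<open>R\<close> is one of the members; here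
  its membership in \<open>F\<close> enters.\<close>

lemma lift_rel_hom:
  assumes R: "is_relation C A R d c" and r: "span_rel R d c \<in> F" and D: "dist A F" and A: "A \<in> Ob C"
  shows "modular_set_lattice_hom (eq_rels A) (eq_rels R) (lift_rel R d c) F"
proof -
  let ?r = "span_rel R d c"
  have dc: "d \<in> Hom C R A" "c \<in> Hom C R A" using R by (auto simp: is_relation_def)
  have RO: "R \<in> Ob C" using dc hom_ob by blast
  interpret A: modular_set_lattice "eq_rels A" by (rule modular_eq_rels[OF A])
  interpret R: modular_set_lattice "eq_rels R" by (rule modular_eq_rels[OF RO])
  have FL: "F \<subseteq> eq_rels A" using A.dist_subset[OF D] .
  have rL: "?r \<in> eq_rels A" using r FL by blast
  have *: "lift_rel R d c (A.cl (\<Union>Z)) = R.cl (\<Union>(lift_rel R d c ` Z))" if "finite Z" "Z \<subseteq> F" for Z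
    using that
  proof (induction Z rule: finite_induct)
    case empty
    show ?case using lift_rel_diag[OF R] cl_empty[OF A] cl_empty[OF RO] by simp
  next
    case (insert z Z)
    have L: "z \<in> eq_rels A" "A.cl (\<Union>Z) \<in> eq_rels A" using insert FL A.cl_Union_in[of Z] by auto
    have "A.cl (\<Union>Z \<union> ?r) \<inter> A.cl (\<Union>Z \<union> A.mt {z}) \<subseteq> A.cl (\<Union>Z \<union> (?r \<inter> A.mt {z}))"
      using insert r by (intro A.dist_triple[OF D]) auto
    then have "lift_rel R d c (A.cl (z \<union> A.cl (\<Union>Z))) = R.cl (lift_rel R d c z \<union> lift_rel R d c (A.cl (\<Union>Z)))"
      using A.mt_singleton[OF L(1)] by (intro lift_rel_cl[OF R rL L]) (simp add: A.cl_cl_Un)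
    then show ?case using insert by (simp add: A.cl_Un_cl R.cl_Un_cl)
  qed
  show ?thesis
  proof
    fix a b assume "a \<in> eq_rels A"
    then show "lift_rel R d c a \<in> eq_rels R" using lift_rel_in[OF dc] by blast
    show "a \<subseteq> b \<Longrightarrow> lift_rel R d c a \<subseteq> lift_rel R d c b" by (rule lift_rel_mono)
    show "lift_rel R d c (a \<inter> b) = lift_rel R d c a \<inter> lift_rel R d c b" by (rule lift_rel_Int)
  next
    show "lift_rel R d c (\<Union>(eq_rels A)) = \<Union>(eq_rels R)"
      using inv_rel_all[OF dc(1)] inv_rel_all[OF dc(2)] Union_eq_rels A RO by (simp add: lift_rel_def)
    fix Z S assume h: "finite Z" "finite S" "Z \<subseteq> F" "S \<subseteq> F"
    have L: "A.mt S \<in> eq_rels A" "A.cl (\<Union>Z) \<in> eq_rels A" using h FL A.mt_in[of S] A.cl_Union_in[of Z] by auto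
    have "A.cl (\<Union>Z \<union> ?r) \<inter> A.cl (\<Union>Z \<union> A.mt S) \<subseteq> A.cl (\<Union>Z \<union> (?r \<inter> A.mt S))"
      using h r by (intro A.dist_triple[OF D]) auto
    then have "lift_rel R d c (A.cl (A.mt S \<union> A.cl (\<Union>Z))) = R.cl (lift_rel R d c (A.mt S) \<union> lift_rel R d c (A.cl (\<Union>Z)))"
      by (intro lift_rel_cl[OF R rL L]) (simp add: A.cl_cl_Un)
    then show "lift_rel R d c (A.cl (\<Union>Z \<union> A.mt S)) = R.cl (\<Union>(lift_rel R d c ` Z) \<union> lift_rel R d c (A.mt S))"
      using *[OF h(1,3)] by (simp add: A.cl_Un_cl R.cl_Un_cl Un_commute)
  qed (use FL in auto)
qed

lemma dist_lift:
  assumes R: "is_relation C A R d c" and r: "span_rel R d c \<in> F" and D: "dist A F" and A: "A \<in> Ob C"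
  shows "dist R (lift_rel R d c ` F)"
  using modular_set_lattice_hom.dist_image[OF lift_rel_hom[OF assms] D] .

text \<open>The endpoints of a pair of \<open>S\<close> lift to \<open>A\<close> on a cover. By
  \<open>sub\<close> the lifted pair is a pair of \<open>R\<close> followed by one of the kernel of
  \<open>f\<close>, and the latter disappears in \<open>B\<close>.\<close>

lemma regular_epi_relI:
  assumes f: "regular_epi C A B f" and R: "is_relation C A R d c" and S: "is_relation C B S d' c'"
    and r: "span_rel R d c \<in> eq_rels A" and g: "g \<in> Hom C R S" "d' \<cdot> g = f \<cdot> d" "c' \<cdot> g = f \<cdot> c"
    and sub: "inv_rel A f (span_rel S d' c') \<subseteq> cl A (span_rel R d c \<union> ker A f)"
  shows "regular_epi C R S g"
proof -
  note fh = regular_epi_hom[OF f]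
  have dc: "d \<in> Hom C R A" "c \<in> Hom C R A" using R by (auto simp: is_relation_def)
  have dc': "d' \<in> Hom C S B" "c' \<in> Hom C S B" "jointly_monic C S d' c'" using S by (auto simp: is_relation_def)
  obtain U p x where x: "regular_epi C U S p" "x \<in> Hom C U A" "f \<cdot> x = d' \<cdot> p" using local_lift[OF f dc'(1)] .
  note ph = regular_epi_hom[OF x(1)]
  obtain V q y where y: "regular_epi C V U q" "y \<in> Hom C V A" "f \<cdot> y = (c' \<cdot> p) \<cdot> q" using local_lift[OF f comp_hom[OF ph dc'(2)]] .
  note qh = regular_epi_hom[OF y(1)]
  have pq: "p \<cdot> q \<in> Hom C V S" using comp_hom[OF qh ph] .
  have xq: "x \<cdot> q \<in> Hom C V A" using comp_hom[OF qh x(2)] .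
  have fx: "f \<cdot> (x \<cdot> q) = d' \<cdot> (p \<cdot> q)"
    using square_comp[OF x(2) fh ph dc'(1) x(3) qh] .
  have fy: "f \<cdot> y = c' \<cdot> (p \<cdot> q)" using y(3) comp_assoc[OF qh ph dc'(2)] by simp
  have "(V, x \<cdot> q, y) \<in> inv_rel A f (span_rel S d' c')"
    unfolding inv_rel_def span_rel_def using fx fy xq y(2) pq by blast
  then have xy: "(V, x \<cdot> q, y) \<in> cl A (span_rel R d c \<union> ker A f)" using sub by blast
  obtain W s w where w: "regular_epi C W V s" "(W, (x \<cdot> q) \<cdot> s, w) \<in> span_rel R d c" "(W, w, y \<cdot> s) \<in> ker A f"
    using cl_UnE[OF r ker_eq_rels[OF fh] xy] by blast
  note sh = regular_epi_hom[OF w(1)]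
  obtain z where z: "z \<in> Hom C W R" "(x \<cdot> q) \<cdot> s = d \<cdot> z" "w = c \<cdot> z" using w(2) by (auto simp: span_rel_def)
  have gz: "g \<cdot> z \<in> Hom C W S" and pqs: "(p \<cdot> q) \<cdot> s \<in> Hom C W S" using comp_hom z g sh pq by blast+
  have "d' \<cdot> (g \<cdot> z) = f \<cdot> ((x \<cdot> q) \<cdot> s)" using square_comp[OF g(1) dc'(1) dc(1) fh g(2) z(1)] z(2) by simp
  also have "\<dots> = d' \<cdot> ((p \<cdot> q) \<cdot> s)" using square_comp[OF xq fh pq dc'(1) fx sh] .
  finally have 1: "d' \<cdot> (g \<cdot> z) = d' \<cdot> ((p \<cdot> q) \<cdot> s)" .
  have "c' \<cdot> (g \<cdot> z) = f \<cdot> (y \<cdot> s)" using square_comp[OF g(1) dc'(2) dc(2) fh g(3) z(1)] z(3) w(3) by (auto simp: ker_def)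
  also have "\<dots> = c' \<cdot> ((p \<cdot> q) \<cdot> s)" using square_comp[OF y(2) fh pq dc'(2) fy sh] .
  finally have "g \<cdot> z = (p \<cdot> q) \<cdot> s" using jointly_monicD[OF dc'(3) gz pqs 1] by blast
  then show ?thesis
    using regular_epi_cancel[OF regular_epi_comp[OF w(1) regular_epi_comp[OF y(1) x(1)]] g(1) z(1)] by blast
qed

text \<open>Converse of \<open>regular_epi_relI\<close>: a pair of \<open>S\<close> lifts through
  \<open>g\<close> to a pair of \<open>R\<close>, whose endpoints agree with any given lifts up to
  the kernel of \<open>f\<close>.\<close>

lemma regular_epi_relD:
  assumes f: "f \<in> Hom C A B" and R: "is_relation C A R d c" and S: "is_relation C B S d' c'"
    and r: "span_rel R d c \<in> eq_rels A" and s: "span_rel S d' c' \<in> eq_rels B"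
    and g: "g \<in> Hom C R S" "d' \<cdot> g = f \<cdot> d" "c' \<cdot> g = f \<cdot> c" and ge: "regular_epi C R S g"
  shows "inv_rel A f (span_rel S d' c') = cl A (span_rel R d c \<union> ker A f)"
proof
  have dc: "d \<in> Hom C R A" "c \<in> Hom C R A" using R by (auto simp: is_relation_def)
  have dc': "d' \<in> Hom C S B" "c' \<in> Hom C S B" using S by (auto simp: is_relation_def)
  have A: "A \<in> Ob C" using hom_ob dc by blast
  interpret A: modular_set_lattice "eq_rels A" by (rule modular_eq_rels[OF A])
  note I = eq_rels_inv[OF f s] note K = ker_eq_rels[OF f]
  note L = A.cl_Un_in[OF r K]
  have "span_rel R d c \<subseteq> inv_rel A f (span_rel S d' c')"
  proof
    fix t assume "t \<in> span_rel R d c"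
    then obtain T z where z: "t = (T, d \<cdot> z, c \<cdot> z)" "z \<in> Hom C T R" by (auto simp: span_rel_def)
    then have "f \<cdot> (d \<cdot> z) = d' \<cdot> (g \<cdot> z)" "f \<cdot> (c \<cdot> z) = c' \<cdot> (g \<cdot> z)"
      using square_comp[OF g(1) dc'(1) dc(1) f g(2) z(2)] square_comp[OF g(1) dc'(2) dc(2) f g(3) z(2)] by auto
    then show "t \<in> inv_rel A f (span_rel S d' c')"
      using z comp_hom[OF z(2) dc(1)] comp_hom[OF z(2) dc(2)] comp_hom[OF z(2) g(1)] by (auto simp: inv_rel_def span_rel_def)
  qed
  then show "A.cl (span_rel R d c \<union> ker A f) \<subseteq> inv_rel A f (span_rel S d' c')"
    using I ker_subset_inv[OF f s] by (intro A.cl_least) auto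
  show "inv_rel A f (span_rel S d' c') \<subseteq> A.cl (span_rel R d c \<union> ker A f)"
  proof
    fix t assume "t \<in> inv_rel A f (span_rel S d' c')"
    then obtain T x y z where t: "t = (T, x, y)" "x \<in> Hom C T A" "y \<in> Hom C T A" and z: "z \<in> Hom C T S" "f \<cdot> x = d' \<cdot> z" "f \<cdot> y = c' \<cdot> z"
      by (auto simp: inv_rel_def span_rel_def)
    obtain U p w where w: "regular_epi C U T p" "w \<in> Hom C U R" "g \<cdot> w = z \<cdot> p" using local_lift[OF ge z(1)] .
    note ph = regular_epi_hom[OF w(1)]
    have "f \<cdot> (x \<cdot> p) = f \<cdot> (d \<cdot> w)" "f \<cdot> (c \<cdot> w) = f \<cdot> (y \<cdot> p)"
      using square_comp[OF t(2) f z(1) dc'(1) z(2) ph] square_comp[OF t(3) f z(1) dc'(2) z(3) ph]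
        square_comp[OF g(1) dc'(1) dc(1) f g(2) w(2)] square_comp[OF g(1) dc'(2) dc(2) f g(3) w(2)] w(3) by simp_all
    then have "(U, x \<cdot> p, d \<cdot> w) \<in> ker A f" "(U, c \<cdot> w, y \<cdot> p) \<in> ker A f" "(U, d \<cdot> w, c \<cdot> w) \<in> span_rel R d c"
      using comp_hom[OF ph t(2)] comp_hom[OF ph t(3)] comp_hom[OF w(2) dc(1)] comp_hom[OF w(2) dc(2)] w(2)
      by (auto simp: ker_def span_rel_def)
    then have "(U, x \<cdot> p, y \<cdot> p) \<in> A.cl (span_rel R d c \<union> ker A f)"
      using A.cl_extensive[of "span_rel R d c \<union> ker A f"] eq_rels_trans[OF L] by blast
    then show "t \<in> A.cl (span_rel R d c \<union> ker A f)" using eq_rels_local[OF L w(1) t(2,3)] t(1) by simp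
  qed
qed

text \<open>The image of a reflexive graph in the square of \<open>A\<close> is an equivalence
  relation. As the graph covers its image, the quotient by the image is also the coequaliser of the
  graph.\<close>

lemma ex_coequaliser_reflexive:
  assumes d: "d \<in> Hom C G A" and c: "c \<in> Hom C G A" and e: "e \<in> Hom C A G" "d \<cdot> e = Id C A" "c \<cdot> e = Id C A"
  shows "\<exists>Q q. is_coequaliser C G A d c Q q"
proof -
  obtain I i j p where I: "is_relation C A I i j" "regular_epi C G I p" "i \<cdot> p = d" "j \<cdot> p = c"
    using ex_image_relation[OF d c] .
  note ph = regular_epi_hom[OF I(2)]
  have ij: "i \<in> Hom C I A" "j \<in> Hom C I A" using I by (auto simp: is_relation_def)
  have "Id C A = i \<cdot> (p \<cdot> e)" "Id C A = j \<cdot> (p \<cdot> e)"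
    using comp_assoc[OF e(1) ph ij(1)] comp_assoc[OF e(1) ph ij(2)] e I by simp_all
  then have "(A, Id C A, Id C A) \<in> span_rel I i j"
    unfolding span_rel_def using comp_hom[OF e(1) ph] by blast
  then have E: "span_rel I i j \<in> eq_rels A" by (rule reflexive_image_eq_rel[OF I(1)])
  obtain Q q where q: "regular_epi C A Q q" "ker A q = span_rel I i j" using ex_quotient[OF E] .
  note qh = regular_epi_hom[OF q(1)]
  have Q: "is_coequaliser C I A i j Q q"
    using regular_epi_coequaliser[OF q(1) kernel_pairI[OF qh I(1) q(2)[symmetric]]] .
  have "is_coequaliser C G A d c Q q"
  proof (rule coequaliserI[OF d c qh])
    show "q \<cdot> d = q \<cdot> c"
      using square_comp[OF ij(1) qh ij(2) qh coequaliserD(4)[OF Q] ph] I by simp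
    fix Z h assume h: "h \<in> Hom C A Z" "h \<cdot> d = h \<cdot> c"
    then have "(h \<cdot> i) \<cdot> p = (h \<cdot> j) \<cdot> p"
      using comp_assoc[OF ph ij(1) h(1)] comp_assoc[OF ph ij(2) h(1)] I by simp
    then have "h \<cdot> i = h \<cdot> j" using regular_epi_epi[OF I(2) comp_hom[OF ij(1) h(1)] comp_hom[OF ij(2) h(1)]] by blast
    then show "\<exists>k \<in> Hom C Q Z. k \<cdot> q = h" using coequaliser_ex[OF Q h(1)] by blast
  qed (rule coequaliser_epi[OF Q])
  then show ?thesis by blast
qed

text \<open>The row indices are the second coordinates.\<close>

lemma three_by_three:
  assumes row1: "exact_seq F21 F11 F01 d1 c1 f1" and row2: "exact_seq F22 F12 F02 d2 c2 f2"
    and col0: "exact_seq F02 F01 F00 u0 v0 w0" and col1: "exact_seq F12 F11 F10 u1 v1 w1" and col2: "exact_seq F22 F21 F20 u2 v2 w2"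
    and row0: "d0 \<in> Hom C F20 F10" "c0 \<in> Hom C F20 F10" "e0 \<in> Hom C F10 F20" "f0 \<in> Hom C F10 F00"
      "d0 \<cdot> e0 = Id C F10" "c0 \<cdot> e0 = Id C F10" "f0 \<cdot> d0 = f0 \<cdot> c0"
    and sq: "d1 \<cdot> u2 = u1 \<cdot> d2" "d1 \<cdot> v2 = v1 \<cdot> d2" "c1 \<cdot> u2 = u1 \<cdot> c2" "c1 \<cdot> v2 = v1 \<cdot> c2"
      "d0 \<cdot> w2 = w1 \<cdot> d1" "c0 \<cdot> w2 = w1 \<cdot> c1" "f1 \<cdot> u1 = u0 \<cdot> f2" "f1 \<cdot> v1 = v0 \<cdot> f2" "f0 \<cdot> w1 = w0 \<cdot> f1"
  shows "exact_seq F20 F10 F00 d0 c0 f0"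
proof -
  note r1 = exact_seqD[OF row1] note r2 = exact_seqD[OF row2]
  note k0 = exact_seqD[OF col0] note k1 = exact_seqD[OF col1] note k2 = exact_seqD[OF col2]
  \<comment> \<open>An arrow out of \<open>F10\<close> factors through \<open>F01\<close> by row 1,
    and then through \<open>F00\<close> by column 0. The equations involved are tested after
    precomposition with the regular epimorphisms \<open>f2\<close>, \<open>w1\<close>,
    \<open>f1\<close> and \<open>w0\<close>.\<close>
  have Q: "is_coequaliser C F20 F10 d0 c0 F00 f0"
  proof (rule coequaliserI[OF row0(1,2,4,7)])
    fix Z h assume h: "h \<in> Hom C F10 Z" "h \<cdot> d0 = h \<cdot> c0"
    have hw: "h \<cdot> w1 \<in> Hom C F11 Z" using comp_hom[OF k1(3) h(1)] .
    have "(h \<cdot> w1) \<cdot> d1 = h \<cdot> (d0 \<cdot> w2)" using comp_assoc[OF r1(1) k1(3) h(1)] sq by simp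
    also have "\<dots> = h \<cdot> (c0 \<cdot> w2)" using square_comp[OF row0(1) h(1) row0(2) h(1) h(2) k2(3)] .
    also have "\<dots> = (h \<cdot> w1) \<cdot> c1" using comp_assoc[OF r1(2) k1(3) h(1)] sq by simp
    finally obtain k where k: "k \<in> Hom C F01 Z" "k \<cdot> f1 = h \<cdot> w1" using coequaliser_ex[OF r1(7) hw] by blast
    have "(k \<cdot> u0) \<cdot> f2 = (h \<cdot> w1) \<cdot> u1"
      using comp_assoc[OF r2(3) k0(1) k(1)] square_comp[OF r1(3) k(1) k1(3) h(1) k(2) k1(1)] comp_assoc[OF k1(1,3) h(1)] sq(7) by simp
    also have "\<dots> = (h \<cdot> w1) \<cdot> v1" using comp_assoc[OF k1(1,3) h(1)] comp_assoc[OF k1(2,3) h(1)] k1(4) by simp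
    also have "\<dots> = (k \<cdot> v0) \<cdot> f2"
      using comp_assoc[OF r2(3) k0(2) k(1)] square_comp[OF r1(3) k(1) k1(3) h(1) k(2) k1(2)] comp_assoc[OF k1(2,3) h(1)] sq(8) by simp
    finally have "k \<cdot> u0 = k \<cdot> v0"
      using regular_epi_epi[OF r2(5) comp_hom[OF k0(1) k(1)] comp_hom[OF k0(2) k(1)]] by blast
    then obtain l where l: "l \<in> Hom C F00 Z" "l \<cdot> w0 = k" using coequaliser_ex[OF k0(7) k(1)] by blast
    have "(l \<cdot> f0) \<cdot> w1 = h \<cdot> w1"
      using comp_assoc[OF k1(3) row0(4) l(1)] comp_assoc[OF r1(3) k0(3) l(1)] sq(9) l(2) k(2) by simp
    then have "l \<cdot> f0 = h" using regular_epi_epi[OF k1(5) comp_hom[OF row0(4) l(1)] h(1)] by blast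
    then show "\<exists>k \<in> Hom C F00 Z. k \<cdot> f0 = h" using l(1) by blast
  next
    fix Z h k assume h: "h \<in> Hom C F00 Z" and k: "k \<in> Hom C F00 Z" and eq: "h \<cdot> f0 = k \<cdot> f0"
    have "(h \<cdot> w0) \<cdot> f1 = (k \<cdot> w0) \<cdot> f1"
      using comp_assoc[OF r1(3) k0(3) h] comp_assoc[OF r1(3) k0(3) k] square_comp[OF row0(4) h row0(4) k eq k1(3)] sq(9) by simp
    then have "h \<cdot> w0 = k \<cdot> w0" using regular_epi_epi[OF r1(5) comp_hom[OF k0(3) h] comp_hom[OF k0(3) k]] by blast
    then show "h = k" by (rule regular_epi_epi[OF k0(5) h k])
  qed
  \<comment> \<open>Two elements of \<open>F20\<close> with equal images are lifted to
    \<open>t\<close> and \<open>s\<close> in \<open>F21\<close>. Their images under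
    \<open>d1\<close> agree in \<open>F10\<close> and so form an element \<open>a\<close> of
    \<open>F12\<close>; likewise \<open>c1\<close> yields \<open>b\<close>. Both become equal in
    \<open>F02\<close>, hence \<open>a\<close> and \<open>b\<close> are the two images of an element
    \<open>w\<close> of \<open>F22\<close>, and \<open>w\<close> witnesses that \<open>t\<close> and
    \<open>s\<close> agree in \<open>F20\<close>.\<close>
  have rel: "is_relation C F10 F20 d0 c0"
    unfolding is_relation_def jointly_monic_def
  proof (intro conjI allI ballI impI row0)
    fix T x y assume x: "x \<in> Hom C T F20" and y: "y \<in> Hom C T F20" and "d0 \<cdot> x = d0 \<cdot> y \<and> c0 \<cdot> x = c0 \<cdot> y"
    then have xy: "d0 \<cdot> x = d0 \<cdot> y" "c0 \<cdot> x = c0 \<cdot> y" by auto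
    obtain U p r where r: "regular_epi C U T p" "r \<in> Hom C U F21" "w2 \<cdot> r = x \<cdot> p" using local_lift[OF k2(5) x] .
    note ph = regular_epi_hom[OF r(1)]
    obtain V q s where s: "regular_epi C V U q" "s \<in> Hom C V F21" "w2 \<cdot> s = (y \<cdot> p) \<cdot> q" using local_lift[OF k2(5) comp_hom[OF ph y]] .
    note qh = regular_epi_hom[OF s(1)]
    have pq: "p \<cdot> q \<in> Hom C V T" using comp_hom[OF qh ph] .
    define t where "t = r \<cdot> q"
    have t: "t \<in> Hom C V F21" unfolding t_def using comp_hom[OF qh r(2)] .
    have wt: "w2 \<cdot> t = x \<cdot> (p \<cdot> q)" unfolding t_def using square_comp[OF r(2) k2(3) ph x r(3) qh] .
    have ws: "w2 \<cdot> s = y \<cdot> (p \<cdot> q)" using s(3) comp_assoc[OF qh ph y] by simp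
    have "w1 \<cdot> (d1 \<cdot> t) = w1 \<cdot> (d1 \<cdot> s)"
      using square_comp[OF k2(3) row0(1) r1(1) k1(3) sq(5) t] square_comp[OF k2(3) row0(1) r1(1) k1(3) sq(5) s(2)]
        wt ws square_comp[OF x row0(1) y row0(1) xy(1) pq] by simp
    then obtain a where a: "a \<in> Hom C V F12" "u1 \<cdot> a = d1 \<cdot> t" "v1 \<cdot> a = d1 \<cdot> s"
      using k1(9)[OF comp_hom[OF t r1(1)] comp_hom[OF s(2) r1(1)]] by blast
    have "w1 \<cdot> (c1 \<cdot> t) = w1 \<cdot> (c1 \<cdot> s)"
      using square_comp[OF k2(3) row0(2) r1(2) k1(3) sq(6) t] square_comp[OF k2(3) row0(2) r1(2) k1(3) sq(6) s(2)]
        wt ws square_comp[OF x row0(2) y row0(2) xy(2) pq] by simp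
    then obtain b where b: "b \<in> Hom C V F12" "u1 \<cdot> b = c1 \<cdot> t" "v1 \<cdot> b = c1 \<cdot> s"
      using k1(9)[OF comp_hom[OF t r1(2)] comp_hom[OF s(2) r1(2)]] by blast
    have "u0 \<cdot> (f2 \<cdot> a) = u0 \<cdot> (f2 \<cdot> b)"
      using square_comp[OF k1(1) r1(3) r2(3) k0(1) sq(7) a(1)] square_comp[OF k1(1) r1(3) r2(3) k0(1) sq(7) b(1)]
        a(2) b(2) square_comp[OF r1(1,3,2,3,4) t] by simp
    moreover have "v0 \<cdot> (f2 \<cdot> a) = v0 \<cdot> (f2 \<cdot> b)"
      using square_comp[OF k1(2) r1(3) r2(3) k0(2) sq(8) a(1)] square_comp[OF k1(2) r1(3) r2(3) k0(2) sq(8) b(1)]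
        a(3) b(3) square_comp[OF r1(1,3,2,3,4) s(2)] by simp
    ultimately have "f2 \<cdot> a = f2 \<cdot> b" using k0(10)[OF comp_hom[OF a(1) r2(3)] comp_hom[OF b(1) r2(3)]] by blast
    then obtain w where w: "w \<in> Hom C V F22" "d2 \<cdot> w = a" "c2 \<cdot> w = b" using r2(9)[OF a(1) b(1)] by blast
    have "d1 \<cdot> (u2 \<cdot> w) = d1 \<cdot> t" "c1 \<cdot> (u2 \<cdot> w) = c1 \<cdot> t"
      using square_comp[OF k2(1) r1(1) r2(1) k1(1) sq(1) w(1)] square_comp[OF k2(1) r1(2) r2(2) k1(1) sq(3) w(1)] w a b by simp_all
    then have 1: "u2 \<cdot> w = t" using r1(10)[OF comp_hom[OF w(1) k2(1)] t] by blast
    have "d1 \<cdot> (v2 \<cdot> w) = d1 \<cdot> s" "c1 \<cdot> (v2 \<cdot> w) = c1 \<cdot> s"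
      using square_comp[OF k2(2) r1(1) r2(1) k1(2) sq(2) w(1)] square_comp[OF k2(2) r1(2) r2(2) k1(2) sq(4) w(1)] w a b by simp_all
    then have 2: "v2 \<cdot> w = s" using r1(10)[OF comp_hom[OF w(1) k2(2)] s(2)] by blast
    have "x \<cdot> (p \<cdot> q) = y \<cdot> (p \<cdot> q)"
      using square_comp[OF k2(1,3,2,3,4) w(1)] 1 2 wt ws by simp
    then show "x = y" by (rule regular_epi_epi[OF regular_epi_comp[OF s(1) r(1)] x y])
  qed
  \<comment> \<open>The section \<open>e0\<close> makes the relation reflexive, so that it is an
    equivalence relation and the kernel pair of its quotient \<open>q\<close>. Comparing
    coequalisers identifies \<open>q\<close> with \<open>f0\<close>.\<close>
  have "(F10, Id C F10, Id C F10) \<in> span_rel F20 d0 c0"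
    unfolding span_rel_def using row0(3,5,6) by force
  then have E: "span_rel F20 d0 c0 \<in> eq_rels F10" by (rule reflexive_image_eq_rel[OF rel])
  obtain P q where q: "regular_epi C F10 P q" "ker F10 q = span_rel F20 d0 c0" using ex_quotient[OF E] .
  note qh = regular_epi_hom[OF q(1)]
  have K: "is_kernel_pair C F10 P q F20 d0 c0" using kernel_pairI[OF qh rel q(2)[symmetric]] .
  obtain k where k: "iso C P F00 k" "k \<cdot> q = f0"
    using coequaliser_unique[OF regular_epi_coequaliser[OF q(1) K] Q] .
  have "monic C P F00 k" using k(1) iso_cancel_left[OF k(1)] by (intro monicI) (auto simp: iso_def)
  then have "is_kernel_pair C F10 F00 f0 F20 d0 c0" using kernel_pair_monic[OF K] k(2) by auto
  then show ?thesis unfolding exact_seq_def using Q by blast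
qed

end

section \<open>The categories of the tower\<close>

lemma base_simps [simp]:
  "Ob (base X) = Base ` Ob X"
  "BaseA f \<in> Hom (base X) (Base a) (Base b) \<longleftrightarrow> f \<in> Hom X a b"
  "Id (base X) (Base a) = BaseA (Id X a)"
  "BaseA g \<cdot>\<^bsub>base X\<^esub> BaseA f = BaseA (g \<cdot>\<^bsub>X\<^esub> f)"
  by (auto simp: base_def)

lemma base_homE:
  assumes "f \<in> Hom (base X) A B"
  obtains g a b where "f = BaseA g" "A = Base a" "B = Base b" "g \<in> Hom X a b"
  using assms by (auto simp: base_def)

lemma RGrph_simps [simp]:
  fixes C (structure)
  shows "Ob (RGrph C) = rgrph_ob C"
  "Hom (RGrph C) = rgrph_hom C"
  "Id (RGrph C) (RG G1 G2 d c e) = RGA (Id C G1) (Id C G2)"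
  "RGA n1 n2 \<cdot>\<^bsub>RGrph C\<^esub> RGA m1 m2 = RGA (n1 \<cdot> m1) (n2 \<cdot> m2)"
  by (auto simp: RGrph_def)

lemma RG_ob_iff:
  fixes C (structure)
  shows "RG G1 G2 d c e \<in> rgrph_ob C \<longleftrightarrow>
    G1 \<in> Ob C \<and> G2 \<in> Ob C \<and> d \<in> Hom C G2 G1 \<and> c \<in> Hom C G2 G1 \<and> e \<in> Hom C G1 G2 \<and>
    d \<cdot> e = Id C G1 \<and> c \<cdot> e = Id C G1"
  by (auto simp: rgrph_ob_def)

lemma rgrph_obE:
  fixes C (structure)
  assumes "G \<in> rgrph_ob C"
  obtains G1 G2 d c e where "G = RG G1 G2 d c e" "G1 \<in> Ob C" "G2 \<in> Ob C" "d \<in> Hom C G2 G1" "c \<in> Hom C G2 G1"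
    "e \<in> Hom C G1 G2" "d \<cdot> e = Id C G1" "c \<cdot> e = Id C G1"
  using assms by (auto simp: rgrph_ob_def)

lemma RGA_hom_iff:
  fixes C (structure)
  shows "RGA m1 m2 \<in> rgrph_hom C (RG G1 G2 d c e) (RG H1 H2 d' c' e') \<longleftrightarrow>
    RG G1 G2 d c e \<in> rgrph_ob C \<and> RG H1 H2 d' c' e' \<in> rgrph_ob C \<and> m1 \<in> Hom C G1 H1 \<and> m2 \<in> Hom C G2 H2 \<and>
    d' \<cdot> m2 = m1 \<cdot> d \<and> c' \<cdot> m2 = m1 \<cdot> c \<and> e' \<cdot> m1 = m2 \<cdot> e"
  by (auto simp: rgrph_hom_def)

lemma rgrph_homE:
  fixes C (structure)
  assumes "m \<in> rgrph_hom C G H"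
  obtains m1 m2 G1 G2 d c e H1 H2 d' c' e' where "m = RGA m1 m2" "G = RG G1 G2 d c e" "H = RG H1 H2 d' c' e'"
    "RG G1 G2 d c e \<in> rgrph_ob C" "RG H1 H2 d' c' e' \<in> rgrph_ob C" "m1 \<in> Hom C G1 H1" "m2 \<in> Hom C G2 H2"
    "d' \<cdot> m2 = m1 \<cdot> d" "c' \<cdot> m2 = m1 \<cdot> c" "e' \<cdot> m1 = m2 \<cdot> e"
  using assms by (auto simp: rgrph_hom_def)

lemma Fork_simps [simp]:
  fixes C (structure)
  shows "Ob (Fork C) = fork_ob C"
  "Hom (Fork C) = fork_hom C"
  "Id (Fork C) (Fk F0 F1 F2 d c e f) = FkA (Id C F0) (Id C F1) (Id C F2)"
  "FkA n0 n1 n2 \<cdot>\<^bsub>Fork C\<^esub> FkA m0 m1 m2 = FkA (n0 \<cdot> m0) (n1 \<cdot> m1) (n2 \<cdot> m2)"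
  by (auto simp: Fork_def)

lemma Fk_ob_iff:
  fixes C (structure)
  shows "Fk F0 F1 F2 d c e f \<in> fork_ob C \<longleftrightarrow>
    F0 \<in> Ob C \<and> F1 \<in> Ob C \<and> F2 \<in> Ob C \<and>
    d \<in> Hom C F2 F1 \<and> c \<in> Hom C F2 F1 \<and> e \<in> Hom C F1 F2 \<and> f \<in> Hom C F1 F0 \<and>
    f \<cdot> d = f \<cdot> c \<and> d \<cdot> e = Id C F1 \<and> c \<cdot> e = Id C F1"
  by (auto simp: fork_ob_def)

lemma fork_obE:
  fixes C (structure)
  assumes "F \<in> fork_ob C"
  obtains F0 F1 F2 d c e f where "F = Fk F0 F1 F2 d c e f" "F0 \<in> Ob C" "F1 \<in> Ob C" "F2 \<in> Ob C"
    "d \<in> Hom C F2 F1" "c \<in> Hom C F2 F1" "e \<in> Hom C F1 F2" "f \<in> Hom C F1 F0"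
    "f \<cdot> d = f \<cdot> c" "d \<cdot> e = Id C F1" "c \<cdot> e = Id C F1"
  using assms by (auto simp: fork_ob_def)

lemma FkA_hom_iff:
  fixes C (structure)
  shows "FkA m0 m1 m2 \<in> fork_hom C (Fk F0 F1 F2 d c e f) (Fk H0 H1 H2 d' c' e' f') \<longleftrightarrow>
    Fk F0 F1 F2 d c e f \<in> fork_ob C \<and> Fk H0 H1 H2 d' c' e' f' \<in> fork_ob C \<and>
    m0 \<in> Hom C F0 H0 \<and> m1 \<in> Hom C F1 H1 \<and> m2 \<in> Hom C F2 H2 \<and>
    d' \<cdot> m2 = m1 \<cdot> d \<and> c' \<cdot> m2 = m1 \<cdot> c \<and> e' \<cdot> m1 = m2 \<cdot> e \<and>
    f' \<cdot> m1 = m0 \<cdot> f"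
  by (auto simp: fork_hom_def)

lemma fork_homE:
  fixes C (structure)
  assumes "m \<in> fork_hom C F H"
  obtains m0 m1 m2 F0 F1 F2 d c e f H0 H1 H2 d' c' e' f' where "m = FkA m0 m1 m2"
    "F = Fk F0 F1 F2 d c e f" "H = Fk H0 H1 H2 d' c' e' f'"
    "Fk F0 F1 F2 d c e f \<in> fork_ob C" "Fk H0 H1 H2 d' c' e' f' \<in> fork_ob C"
    "m0 \<in> Hom C F0 H0" "m1 \<in> Hom C F1 H1" "m2 \<in> Hom C F2 H2"
    "d' \<cdot> m2 = m1 \<cdot> d" "c' \<cdot> m2 = m1 \<cdot> c" "e' \<cdot> m1 = m2 \<cdot> e" "f' \<cdot> m1 = m0 \<cdot> f"
  using assms by (auto simp: fork_hom_def)

lemma category_base: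
  assumes "category X"
  shows "category (base X)"
proof -
  interpret X: category X by fact
  show ?thesis
  proof
    fix f A B assume f: "f \<in> Hom (base X) A B"
    show "A \<in> Ob (base X) \<and> B \<in> Ob (base X)" using f by (elim base_homE) (use X.hom_ob in auto)
    show "f \<cdot>\<^bsub>base X\<^esub> Id (base X) A = f" using f by (elim base_homE) (auto simp: X.comp_id_right)
    show "Id (base X) B \<cdot>\<^bsub>base X\<^esub> f = f" using f by (elim base_homE) (auto simp: X.comp_id_left)
    fix g D assume g: "g \<in> Hom (base X) B D"
    show "g \<cdot>\<^bsub>base X\<^esub> f \<in> Hom (base X) A D" using f g by (elim base_homE) (auto simp: X.comp_hom)
    fix h E assume h: "h \<in> Hom (base X) D E"
    show "(h \<cdot>\<^bsub>base X\<^esub> g) \<cdot>\<^bsub>base X\<^esub> f = h \<cdot>\<^bsub>base X\<^esub> (g \<cdot>\<^bsub>base X\<^esub> f)" using f g h by (elim base_homE) (auto simp: X.comp_assoc)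
  qed (auto simp: X.id_hom)
qed

context category
begin

lemma square_paste:
  assumes "d \<in> Hom C G2 G1" "m1 \<in> Hom C G1 H1" "m2 \<in> Hom C G2 H2" "d' \<in> Hom C H2 H1" "n1 \<in> Hom C H1 K1" "n2 \<in> Hom C H2 K2"
    "d'' \<in> Hom C K2 K1" "d' \<cdot> m2 = m1 \<cdot> d" "d'' \<cdot> n2 = n1 \<cdot> d'"
  shows "d'' \<cdot> (n2 \<cdot> m2) = (n1 \<cdot> m1) \<cdot> d"
proof -
  have "d'' \<cdot> (n2 \<cdot> m2) = n1 \<cdot> (d' \<cdot> m2)" by (rule square_comp[OF assms(6,7,4,5,9,3)])
  then show ?thesis using assms(8) comp_assoc[OF assms(1,2,5)] by simp
qed

end

lemma category_RGrph:
  fixes C (structure)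
  assumes "category C"
  shows "category (RGrph C)"
proof -
  interpret C: category C by fact
  show ?thesis
  proof
    fix f A B assume f: "f \<in> Hom (RGrph C) A B"
    show "A \<in> Ob (RGrph C) \<and> B \<in> Ob (RGrph C)" using f by (auto elim: rgrph_homE)
    show "f \<cdot>\<^bsub>RGrph C\<^esub> Id (RGrph C) A = f" using f by (auto elim!: rgrph_homE simp: C.comp_id_right)
    show "Id (RGrph C) B \<cdot>\<^bsub>RGrph C\<^esub> f = f" using f by (auto elim!: rgrph_homE simp: C.comp_id_left)
    fix g D assume g: "g \<in> Hom (RGrph C) B D"
    obtain m1 m2 G1 G2 d c e H1 H2 d' c' e' where m: "f = RGA m1 m2" "A = RG G1 G2 d c e" "B = RG H1 H2 d' c' e'"
      "RG G1 G2 d c e \<in> rgrph_ob C" "RG H1 H2 d' c' e' \<in> rgrph_ob C" "m1 \<in> Hom C G1 H1" "m2 \<in> Hom C G2 H2"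
      "d' \<cdot> m2 = m1 \<cdot> d" "c' \<cdot> m2 = m1 \<cdot> c" "e' \<cdot> m1 = m2 \<cdot> e"
      using f by (auto elim: rgrph_homE)
    obtain n1 n2 K1 K2 d'' c'' e'' where n: "g = RGA n1 n2" "D = RG K1 K2 d'' c'' e''"
      "RG K1 K2 d'' c'' e'' \<in> rgrph_ob C" "n1 \<in> Hom C H1 K1" "n2 \<in> Hom C H2 K2"
      "d'' \<cdot> n2 = n1 \<cdot> d'" "c'' \<cdot> n2 = n1 \<cdot> c'" "e'' \<cdot> n1 = n2 \<cdot> e'"
      using g m(3) by (auto elim: rgrph_homE)
    note o = m(4)[unfolded RG_ob_iff] m(5)[unfolded RG_ob_iff] n(3)[unfolded RG_ob_iff]
    have "d'' \<cdot> (n2 \<cdot> m2) = (n1 \<cdot> m1) \<cdot> d" 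
      using C.square_paste[of d G2 G1 m1 H1 m2 H2 d' n1 K1 n2 K2 d''] o m n by blast
    moreover have "c'' \<cdot> (n2 \<cdot> m2) = (n1 \<cdot> m1) \<cdot> c" 
      using C.square_paste[of c G2 G1 m1 H1 m2 H2 c' n1 K1 n2 K2 c''] o m n by blast
    moreover have "e'' \<cdot> (n1 \<cdot> m1) = (n2 \<cdot> m2) \<cdot> e" 
      using C.square_paste[of e G1 G2 m2 H2 m1 H1 e' n2 K2 n1 K1 e''] o m n by blast
    ultimately show "g \<cdot>\<^bsub>RGrph C\<^esub> f \<in> Hom (RGrph C) A D"
      using m n C.comp_hom[OF m(6) n(4)] C.comp_hom[OF m(7) n(5)] by (simp add: RGA_hom_iff)
    fix h E assume h: "h \<in> Hom (RGrph C) D E"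
    then obtain l1 l2 J1 J2 where l: "h = RGA l1 l2" "l1 \<in> Hom C K1 J1" "l2 \<in> Hom C K2 J2" using n(2) by (auto elim: rgrph_homE)
    show "(h \<cdot>\<^bsub>RGrph C\<^esub> g) \<cdot>\<^bsub>RGrph C\<^esub> f = h \<cdot>\<^bsub>RGrph C\<^esub> (g \<cdot>\<^bsub>RGrph C\<^esub> f)"
      using m(1) n(1) l C.comp_assoc[OF m(6) n(4) l(2)] C.comp_assoc[OF m(7) n(5) l(3)] by simp
  next
    fix A assume "A \<in> Ob (RGrph C)"
    then obtain G1 G2 d c e where G: "A = RG G1 G2 d c e" "RG G1 G2 d c e \<in> rgrph_ob C" by (auto simp: rgrph_ob_def)
    then have o: "G1 \<in> Ob C" "G2 \<in> Ob C" "d \<in> Hom C G2 G1" "c \<in> Hom C G2 G1" "e \<in> Hom C G1 G2" by (auto simp: RG_ob_iff)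
    show "Id (RGrph C) A \<in> Hom (RGrph C) A A"
      using G C.id_hom[OF o(1)] C.id_hom[OF o(2)] C.comp_id_left[OF o(3)] C.comp_id_right[OF o(3)]
        C.comp_id_left[OF o(4)] C.comp_id_right[OF o(4)] C.comp_id_left[OF o(5)] C.comp_id_right[OF o(5)]
      by (simp add: RGA_hom_iff)
  qed
qed

lemma category_Fork:
  fixes C (structure)
  assumes "category C"
  shows "category (Fork C)"
proof -
  interpret C: category C by fact
  show ?thesis
  proof
    fix f A B assume f: "f \<in> Hom (Fork C) A B"
    show "A \<in> Ob (Fork C) \<and> B \<in> Ob (Fork C)" using f by (auto elim: fork_homE)
    show "f \<cdot>\<^bsub>Fork C\<^esub> Id (Fork C) A = f" using f by (auto elim!: fork_homE simp: C.comp_id_right)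
    show "Id (Fork C) B \<cdot>\<^bsub>Fork C\<^esub> f = f" using f by (auto elim!: fork_homE simp: C.comp_id_left)
    fix g D assume g: "g \<in> Hom (Fork C) B D"
    obtain m0 m1 m2 G0 G1 G2 d c e q H0 H1 H2 d' c' e' q' where m: "f = FkA m0 m1 m2" "A = Fk G0 G1 G2 d c e q" "B = Fk H0 H1 H2 d' c' e' q'"
      "Fk G0 G1 G2 d c e q \<in> fork_ob C" "Fk H0 H1 H2 d' c' e' q' \<in> fork_ob C" "m0 \<in> Hom C G0 H0" "m1 \<in> Hom C G1 H1" "m2 \<in> Hom C G2 H2"
      "d' \<cdot> m2 = m1 \<cdot> d" "c' \<cdot> m2 = m1 \<cdot> c" "e' \<cdot> m1 = m2 \<cdot> e" "q' \<cdot> m1 = m0 \<cdot> q"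
      using f by (auto elim: fork_homE)
    obtain n0 n1 n2 K0 K1 K2 d'' c'' e'' q'' where n: "g = FkA n0 n1 n2" "D = Fk K0 K1 K2 d'' c'' e'' q''"
      "Fk K0 K1 K2 d'' c'' e'' q'' \<in> fork_ob C" "n0 \<in> Hom C H0 K0" "n1 \<in> Hom C H1 K1" "n2 \<in> Hom C H2 K2"
      "d'' \<cdot> n2 = n1 \<cdot> d'" "c'' \<cdot> n2 = n1 \<cdot> c'" "e'' \<cdot> n1 = n2 \<cdot> e'" "q'' \<cdot> n1 = n0 \<cdot> q'"
      using g m(3) by (auto elim: fork_homE)
    note o = m(4)[unfolded Fk_ob_iff] m(5)[unfolded Fk_ob_iff] n(3)[unfolded Fk_ob_iff]
    have "d'' \<cdot> (n2 \<cdot> m2) = (n1 \<cdot> m1) \<cdot> d" 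
      using C.square_paste[of d G2 G1 m1 H1 m2 H2 d' n1 K1 n2 K2 d''] o m n by blast
    moreover have "c'' \<cdot> (n2 \<cdot> m2) = (n1 \<cdot> m1) \<cdot> c" 
      using C.square_paste[of c G2 G1 m1 H1 m2 H2 c' n1 K1 n2 K2 c''] o m n by blast
    moreover have "e'' \<cdot> (n1 \<cdot> m1) = (n2 \<cdot> m2) \<cdot> e" 
      using C.square_paste[of e G1 G2 m2 H2 m1 H1 e' n2 K2 n1 K1 e''] o m n by blast
    moreover have "q'' \<cdot> (n1 \<cdot> m1) = (n0 \<cdot> m0) \<cdot> q" 
      using C.square_paste[of q G1 G0 m0 H0 m1 H1 q' n0 K0 n1 K1 q''] o m n by blast
    ultimately show "g \<cdot>\<^bsub>Fork C\<^esub> f \<in> Hom (Fork C) A D"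
      using m n C.comp_hom[OF m(6) n(4)] C.comp_hom[OF m(7) n(5)] C.comp_hom[OF m(8) n(6)] by (simp add: FkA_hom_iff)
    fix h E assume h: "h \<in> Hom (Fork C) D E"
    then obtain l0 l1 l2 J0 J1 J2 where l: "h = FkA l0 l1 l2" "l0 \<in> Hom C K0 J0" "l1 \<in> Hom C K1 J1" "l2 \<in> Hom C K2 J2" using n(2) by (auto elim: fork_homE)
    show "(h \<cdot>\<^bsub>Fork C\<^esub> g) \<cdot>\<^bsub>Fork C\<^esub> f = h \<cdot>\<^bsub>Fork C\<^esub> (g \<cdot>\<^bsub>Fork C\<^esub> f)"
      using m(1) n(1) l C.comp_assoc[OF m(6) n(4) l(2)] C.comp_assoc[OF m(7) n(5) l(3)] C.comp_assoc[OF m(8) n(6) l(4)] by simp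
  next
    fix A assume "A \<in> Ob (Fork C)"
    then obtain G0 G1 G2 d c e q where G: "A = Fk G0 G1 G2 d c e q" "Fk G0 G1 G2 d c e q \<in> fork_ob C" by (auto simp: fork_ob_def)
    then have o: "G0 \<in> Ob C" "G1 \<in> Ob C" "G2 \<in> Ob C" "d \<in> Hom C G2 G1" "c \<in> Hom C G2 G1" "e \<in> Hom C G1 G2" "q \<in> Hom C G1 G0" by (auto simp: Fk_ob_iff)
    show "Id (Fork C) A \<in> Hom (Fork C) A A"
      using G C.id_hom[OF o(1)] C.id_hom[OF o(2)] C.id_hom[OF o(3)] C.comp_id_left[OF o(4)] C.comp_id_right[OF o(4)]
        C.comp_id_left[OF o(5)] C.comp_id_right[OF o(5)] C.comp_id_left[OF o(6)] C.comp_id_right[OF o(6)]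
        C.comp_id_left[OF o(7)] C.comp_id_right[OF o(7)]
      by (simp add: FkA_hom_iff)
  qed
qed

lemma RGrphN_simps: "RGrphN 0 X = base X" "RGrphN (Suc n) X = RGrph (RGrphN n X)"
  by (simp_all add: RGrphN_def)

lemma ForkN_simps: "ForkN 0 X = base X" "ForkN (Suc n) X = Fork (ForkN n X)"
  by (simp_all add: ForkN_def)

lemma category_RGrphN: "category X \<Longrightarrow> category (RGrphN n X)"
  by (induction n) (simp_all add: RGrphN_simps category_base category_RGrph)

lemma category_ForkN: "category X \<Longrightarrow> category (ForkN n X)"
  by (induction n) (simp_all add: ForkN_simps category_base category_Fork)

section \<open>Functors\<close>

lemma functorD:
  assumes "is_functor C D F"
  shows "A \<in> Ob C \<Longrightarrow> FOb F A \<in> Ob D"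
    "f \<in> Hom C A B \<Longrightarrow> FAr F A B f \<in> Hom D (FOb F A) (FOb F B)"
    "A \<in> Ob C \<Longrightarrow> FAr F A A (Id C A) = Id D (FOb F A)"
    "f \<in> Hom C A B \<Longrightarrow> g \<in> Hom C B E \<Longrightarrow> FAr F A E (g \<cdot>\<^bsub>C\<^esub> f) = FAr F B E g \<cdot>\<^bsub>D\<^esub> FAr F A B f"
  using assms unfolding is_functor_def by blast+

lemma functor_iso:
  fixes C (structure)
  assumes "is_functor C D F" "category C" "iso C A B f"
  shows "iso D (FOb F A) (FOb F B) (FAr F A B f)"
proof -
  interpret C: category C by fact
  obtain g where g: "f \<in> Hom C A B" "g \<in> Hom C B A" "g \<cdot> f = Id C A" "f \<cdot> g = Id C B"
    using assms(3) by (auto simp: iso_def)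
  note F = functorD[OF assms(1)]
  have "A \<in> Ob C" "B \<in> Ob C" using C.hom_ob g by auto
  then show ?thesis
    unfolding iso_def using F(2)[OF g(1)] F(2)[OF g(2)] F(4)[OF g(1,2)] F(4)[OF g(2,1)] F(3) g by auto
qed

lemma functor_square:
  fixes C (structure)
  assumes "is_functor C D F" "f \<in> Hom C A B" "g \<in> Hom C B E" "h \<in> Hom C A B'" "k \<in> Hom C B' E" "g \<cdot> f = k \<cdot> h"
  shows "FAr F B E g \<cdot>\<^bsub>D\<^esub> FAr F A B f = FAr F B' E k \<cdot>\<^bsub>D\<^esub> FAr F A B' h"
  using functorD(4)[OF assms(1,2,3)] functorD(4)[OF assms(1,4,5)] assms(6) by simp

lemma functor_comp:
  assumes "is_functor C D F" "is_functor D E G"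
  shows "is_functor C E (comp_functor G F)"
  using assms by (simp add: is_functor_def comp_functor_def)

lemma functor_id: "is_functor C C id_functor"
  by (simp add: is_functor_def id_functor_def)

lemma Fork_functor_simps [simp]:
  "FOb (Fork_functor G) (Fk F0 F1 F2 d c e f) = Fk (FOb G F0) (FOb G F1) (FOb G F2)
        (FAr G F2 F1 d) (FAr G F2 F1 c) (FAr G F1 F2 e) (FAr G F1 F0 f)"
  "FAr (Fork_functor G) (Fk F0 F1 F2 d c e f) (Fk H0 H1 H2 d' c' e' f') (FkA m0 m1 m2) =
     FkA (FAr G F0 H0 m0) (FAr G F1 H1 m1) (FAr G F2 H2 m2)"
  by (simp_all add: Fork_functor_def)

lemma grph_simps [simp]:
  "FOb grph (Fk F0 F1 F2 d c e f) = RG F1 F2 d c e"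
  "FAr grph F H (FkA m0 m1 m2) = RGA m1 m2"
  by (simp_all add: grph_def)

lemma functor_Fork_ob:
  fixes C (structure)
  assumes G: "is_functor C D G" and F: "Fk F0 F1 F2 d c e f \<in> fork_ob C"
  shows "FOb (Fork_functor G) (Fk F0 F1 F2 d c e f) \<in> fork_ob D"
proof -
  note g = functorD[OF G]
  have F': "F0 \<in> Ob C" "F1 \<in> Ob C" "F2 \<in> Ob C" "d \<in> Hom C F2 F1" "c \<in> Hom C F2 F1" "e \<in> Hom C F1 F2" "f \<in> Hom C F1 F0"
    "f \<cdot> d = f \<cdot> c" "d \<cdot> e = Id C F1" "c \<cdot> e = Id C F1"
    using F by (auto simp: Fk_ob_iff)
  show ?thesis
    using g(1)[OF F'(1)] g(1)[OF F'(2)] g(1)[OF F'(3)] g(2)[OF F'(4)] g(2)[OF F'(5)] g(2)[OF F'(6)] g(2)[OF F'(7)]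
      functor_square[OF G F'(4,7,5,7,8)] g(4)[OF F'(6,4)] g(4)[OF F'(6,5)] g(3)[OF F'(2)] F'(9,10)
    by (simp add: Fk_ob_iff)
qed

lemma functor_Fork:
  fixes C (structure)
  assumes G: "is_functor C D G"
  shows "is_functor (Fork C) (Fork D) (Fork_functor G)"
  unfolding is_functor_def
proof (intro conjI allI ballI)
  note g = functorD[OF G]
  fix F assume F: "F \<in> Ob (Fork C)"
  then obtain F0 F1 F2 d c e f where "F = Fk F0 F1 F2 d c e f" "Fk F0 F1 F2 d c e f \<in> fork_ob C" by (auto simp: fork_ob_def)
  then show "FOb (Fork_functor G) F \<in> Ob (Fork D)" using functor_Fork_ob[OF G] by simp
  show "FAr (Fork_functor G) F F (Id (Fork C) F) = Id (Fork D) (FOb (Fork_functor G) F)"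
    using F g(3) by (auto elim!: fork_obE)
next
  note g = functorD[OF G]
  fix A B f assume "f \<in> Hom (Fork C) A B"
  then obtain m0 m1 m2 G0 G1 G2 d c e q H0 H1 H2 d' c' e' q' where m: "f = FkA m0 m1 m2" "A = Fk G0 G1 G2 d c e q" "B = Fk H0 H1 H2 d' c' e' q'"
      "Fk G0 G1 G2 d c e q \<in> fork_ob C" "Fk H0 H1 H2 d' c' e' q' \<in> fork_ob C" "m0 \<in> Hom C G0 H0" "m1 \<in> Hom C G1 H1" "m2 \<in> Hom C G2 H2"
      "d' \<cdot> m2 = m1 \<cdot> d" "c' \<cdot> m2 = m1 \<cdot> c" "e' \<cdot> m1 = m2 \<cdot> e" "q' \<cdot> m1 = m0 \<cdot> q"
    by (auto elim: fork_homE)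
  have o: "d \<in> Hom C G2 G1" "c \<in> Hom C G2 G1" "e \<in> Hom C G1 G2" "q \<in> Hom C G1 G0"
    "d' \<in> Hom C H2 H1" "c' \<in> Hom C H2 H1" "e' \<in> Hom C H1 H2" "q' \<in> Hom C H1 H0"
    using m(4,5) by (auto simp: Fk_ob_iff)
  show "FAr (Fork_functor G) A B f \<in> Hom (Fork D) (FOb (Fork_functor G) A) (FOb (Fork_functor G) B)"
    using functor_Fork_ob[OF G m(4)] functor_Fork_ob[OF G m(5)] g(2)[OF m(6)] g(2)[OF m(7)] g(2)[OF m(8)]
      functor_square[OF G m(8) o(5) o(1) m(7) m(9)] functor_square[OF G m(8) o(6) o(2) m(7) m(10)]
      functor_square[OF G m(7) o(7) o(3) m(8) m(11)] functor_square[OF G m(7) o(8) o(4) m(6) m(12)] m(1-3)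
    by (simp add: FkA_hom_iff)
  fix E h assume "h \<in> Hom (Fork C) B E"
  then obtain n0 n1 n2 K0 K1 K2 d'' c'' e'' q'' where n: "h = FkA n0 n1 n2" "E = Fk K0 K1 K2 d'' c'' e'' q''"
      "n0 \<in> Hom C H0 K0" "n1 \<in> Hom C H1 K1" "n2 \<in> Hom C H2 K2"
    using m(3) by (auto elim: fork_homE)
  show "FAr (Fork_functor G) A E (h \<cdot>\<^bsub>Fork C\<^esub> f) = FAr (Fork_functor G) B E h \<cdot>\<^bsub>Fork D\<^esub> FAr (Fork_functor G) A B f"
    using m(1-3) n(1,2) g(4)[OF m(6) n(3)] g(4)[OF m(7) n(4)] g(4)[OF m(8) n(5)] by simp
qed

lemma functor_grph: "is_functor (Fork C) (RGrph C) grph"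
  unfolding is_functor_def
proof (intro conjI allI ballI)
  fix F assume F: "F \<in> Ob (Fork C)"
  then show "FOb grph F \<in> Ob (RGrph C)" by (auto elim!: fork_obE simp: RG_ob_iff)
  show "FAr grph F F (Id (Fork C) F) = Id (RGrph C) (FOb grph F)"
    using F by (auto elim!: fork_obE)
next
  fix A B f assume f: "f \<in> Hom (Fork C) A B"
  then show "FAr grph A B f \<in> Hom (RGrph C) (FOb grph A) (FOb grph B)"
    by (auto elim!: fork_homE simp: RGA_hom_iff Fk_ob_iff RG_ob_iff)
  fix E h assume h: "h \<in> Hom (Fork C) B E"
  show "FAr grph A E (h \<cdot>\<^bsub>Fork C\<^esub> f) = FAr grph B E h \<cdot>\<^bsub>RGrph C\<^esub> FAr grph A B f"
    using f h by (auto elim!: fork_homE)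
qed

lemma functor_grphN: "is_functor (ForkN n X) (RGrphN n X) (grphN n)"
proof (induction n)
  case (Suc n)
  then show ?case
    using functor_comp[OF functor_Fork[OF Suc] functor_grph] by (simp add: ForkN_simps RGrphN_simps)
qed (simp add: ForkN_simps RGrphN_simps functor_id)

section \<open>Coequalisers of reflexive graphs\<close>

text \<open>This is the property that climbs the tower: \<open>CoeqFork\<close> is applied in
  \<open>RGrphN n X\<close>, and so the property has to pass from \<open>C\<close> to
  \<open>RGrph C\<close>.\<close>

definition reflexive_coequalisers :: "('o, 'm) category \<Rightarrow> bool" where
  "reflexive_coequalisers C \<longleftrightarrow> (\<forall>G A d c e. d \<in> Hom C G A \<longrightarrow> c \<in> Hom C G A \<longrightarrow> e \<in> Hom C A G \<longrightarrow>
    d \<cdot>\<^bsub>C\<^esub> e = Id C A \<longrightarrow> c \<cdot>\<^bsub>C\<^esub> e = Id C A \<longrightarrow> (\<exists>Q q. is_coequaliser C G A d c Q q))"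

text \<open>Coequalisers of graphs are computed levelwise. The induced arrows form a morphism of
  graphs because the required equations hold after precomposition with the epimorphisms
  \<open>q1\<close> and \<open>q2\<close>.\<close>

lemma coequaliser_RGrph:
  fixes C (structure)
  assumes C: "category C"
    and d: "RGA d1 d2 \<in> rgrph_hom C (RG G1 G2 x y z) (RG A1 A2 x' y' z')"
    and c: "RGA c1 c2 \<in> rgrph_hom C (RG G1 G2 x y z) (RG A1 A2 x' y' z')"
    and q: "RGA q1 q2 \<in> rgrph_hom C (RG A1 A2 x' y' z') (RG Q1 Q2 u v w)"
    and 1: "is_coequaliser C G1 A1 d1 c1 Q1 q1" and 2: "is_coequaliser C G2 A2 d2 c2 Q2 q2"
  shows "is_coequaliser (RGrph C) (RG G1 G2 x y z) (RG A1 A2 x' y' z') (RGA d1 d2) (RGA c1 c2) (RG Q1 Q2 u v w) (RGA q1 q2)"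
proof -
  interpret C: category C by fact
  interpret R: category "RGrph C" by (rule category_RGrph[OF C])
  note q1 = C.coequaliserD[OF 1] note q2 = C.coequaliserD[OF 2]
  show ?thesis
  proof (rule R.coequaliserI)
    fix Z h assume h: "h \<in> Hom (RGrph C) (RG A1 A2 x' y' z') Z" 
      "h \<cdot>\<^bsub>RGrph C\<^esub> RGA d1 d2 = h \<cdot>\<^bsub>RGrph C\<^esub> RGA c1 c2"
    obtain h1 h2 Z1 Z2 a b e where Z: "h = RGA h1 h2" "Z = RG Z1 Z2 a b e" "RG Z1 Z2 a b e \<in> rgrph_ob C"
      "h1 \<in> Hom C A1 Z1" "h2 \<in> Hom C A2 Z2" "a \<cdot> h2 = h1 \<cdot> x'" "b \<cdot> h2 = h1 \<cdot> y'" "e \<cdot> h1 = h2 \<cdot> z'"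
      using h(1) by (auto elim: rgrph_homE)
    have ob: "a \<in> Hom C Z2 Z1" "b \<in> Hom C Z2 Z1" "e \<in> Hom C Z1 Z2" using Z(3) by (auto simp: RG_ob_iff)
    have Q: "u \<in> Hom C Q2 Q1" "v \<in> Hom C Q2 Q1" "w \<in> Hom C Q1 Q2" "x' \<in> Hom C A2 A1" "y' \<in> Hom C A2 A1" "z' \<in> Hom C A1 A2"
      "u \<cdot> q2 = q1 \<cdot> x'" "v \<cdot> q2 = q1 \<cdot> y'" "w \<cdot> q1 = q2 \<cdot> z'"
      using q by (auto simp: RG_ob_iff RGA_hom_iff)
    obtain k1 where k1: "k1 \<in> Hom C Q1 Z1" "k1 \<cdot> q1 = h1" using C.coequaliser_ex[OF 1 Z(4)] h(2) Z(1) by auto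
    obtain k2 where k2: "k2 \<in> Hom C Q2 Z2" "k2 \<cdot> q2 = h2" using C.coequaliser_ex[OF 2 Z(5)] h(2) Z(1) by auto
    have e: "s \<cdot> l = l' \<cdot> t" if "is_coequaliser C G A g g' Q r" "s \<in> Hom C Y Y'" "l \<in> Hom C Q Y" "l' \<in> Hom C Q' Y'" "t \<in> Hom C Q Q'"
        "s \<cdot> (l \<cdot> r) = (l' \<cdot> r') \<cdot> p" "t \<cdot> r = r' \<cdot> p" "p \<in> Hom C A A'" "r' \<in> Hom C A' Q'" 
      for G A g g' Q r s l l' t Y Y' Q' p r' A'
    proof (rule C.coequaliser_epi[OF that(1) C.comp_hom[OF that(3,2)] C.comp_hom[OF that(5,4)]])
      have r: "r \<in> Hom C A Q" using C.coequaliserD[OF that(1)] by blast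
      show "(s \<cdot> l) \<cdot> r = (l' \<cdot> t) \<cdot> r"
        using C.comp_assoc[OF r that(3,2)] C.comp_assoc[OF r that(5,4)] C.comp_assoc[OF that(8,9,4)] that(6,7) by simp
    qed
    have "a \<cdot> k2 = k1 \<cdot> u" using e[OF 2 ob(1) k2(1) k1(1) Q(1) _ Q(7) Q(4) q1(3)] k1 k2 Z(6) by simp
    moreover have "b \<cdot> k2 = k1 \<cdot> v" using e[OF 2 ob(2) k2(1) k1(1) Q(2) _ Q(8) Q(5) q1(3)] k1 k2 Z(7) by simp
    moreover have "e \<cdot> k1 = k2 \<cdot> w" using e[OF 1 ob(3) k1(1) k2(1) Q(3) _ Q(9) Q(6) q2(3)] k1 k2 Z(8) by simp
    ultimately have "RGA k1 k2 \<in> Hom (RGrph C) (RG Q1 Q2 u v w) Z"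
      using k1(1) k2(1) Z(2,3) q by (simp add: RGA_hom_iff)
    then show "\<exists>k \<in> Hom (RGrph C) (RG Q1 Q2 u v w) Z. k \<cdot>\<^bsub>RGrph C\<^esub> RGA q1 q2 = h"
      using k1(2) k2(2) Z(1) by (intro bexI[of _ "RGA k1 k2"]) auto
  next
    fix Z h k assume h: "h \<in> Hom (RGrph C) (RG Q1 Q2 u v w) Z" "k \<in> Hom (RGrph C) (RG Q1 Q2 u v w) Z"
      "h \<cdot>\<^bsub>RGrph C\<^esub> RGA q1 q2 = k \<cdot>\<^bsub>RGrph C\<^esub> RGA q1 q2"
    then obtain h1 h2 k1 k2 Z1 Z2 where "h = RGA h1 h2" "k = RGA k1 k2" "h1 \<in> Hom C Q1 Z1" "k1 \<in> Hom C Q1 Z1" "h2 \<in> Hom C Q2 Z2" "k2 \<in> Hom C Q2 Z2"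
      by (auto elim!: rgrph_homE)
    then show "h = k" using h(3) C.coequaliser_epi[OF 1] C.coequaliser_epi[OF 2] by auto
  qed (use d c q q1(4) q2(4) in simp_all)
qed

lemma reflexive_coequalisers_RGrph:
  fixes C (structure)
  assumes C: "category C" and RC: "reflexive_coequalisers C"
  shows "reflexive_coequalisers (RGrph C)"
  unfolding reflexive_coequalisers_def
proof (intro allI impI)
  interpret C: category C by fact
  fix G A d c e assume d: "d \<in> Hom (RGrph C) G A" and c: "c \<in> Hom (RGrph C) G A" and e: "e \<in> Hom (RGrph C) A G"
    and de: "d \<cdot>\<^bsub>RGrph C\<^esub> e = Id (RGrph C) A" and ce: "c \<cdot>\<^bsub>RGrph C\<^esub> e = Id (RGrph C) A"
  obtain d1 d2 G1 G2 x y z A1 A2 x' y' z' where D: "d = RGA d1 d2" "G = RG G1 G2 x y z" "A = RG A1 A2 x' y' z'"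
      "RG G1 G2 x y z \<in> rgrph_ob C" "RG A1 A2 x' y' z' \<in> rgrph_ob C" "d1 \<in> Hom C G1 A1" "d2 \<in> Hom C G2 A2"
      "x' \<cdot> d2 = d1 \<cdot> x" "y' \<cdot> d2 = d1 \<cdot> y" "z' \<cdot> d1 = d2 \<cdot> z"
    using d by (auto elim: rgrph_homE)
  obtain c1 c2 where E: "c = RGA c1 c2" "c1 \<in> Hom C G1 A1" "c2 \<in> Hom C G2 A2"
      "x' \<cdot> c2 = c1 \<cdot> x" "y' \<cdot> c2 = c1 \<cdot> y" "z' \<cdot> c1 = c2 \<cdot> z"
    using c D(2,3) by (auto elim: rgrph_homE)
  obtain e1 e2 where F: "e = RGA e1 e2" "e1 \<in> Hom C A1 G1" "e2 \<in> Hom C A2 G2"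
    using e D(2,3) by (auto elim: rgrph_homE)
  have xyz: "x \<in> Hom C G2 G1" "y \<in> Hom C G2 G1" "z \<in> Hom C G1 G2" "x' \<in> Hom C A2 A1" "y' \<in> Hom C A2 A1" "z' \<in> Hom C A1 A2"
    "x' \<cdot> z' = Id C A1" "y' \<cdot> z' = Id C A1"
    using D(4,5) by (auto simp: RG_ob_iff)
  have "\<exists>Q q. is_coequaliser C G1 A1 d1 c1 Q q" "\<exists>Q q. is_coequaliser C G2 A2 d2 c2 Q q"
    using RC D E F de ce unfolding reflexive_coequalisers_def by auto
  then obtain Q1 q1 Q2 q2 where 1: "is_coequaliser C G1 A1 d1 c1 Q1 q1" and 2: "is_coequaliser C G2 A2 d2 c2 Q2 q2" by blast
  note q1 = C.coequaliserD[OF 1] note q2 = C.coequaliserD[OF 2]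
  have ind: "\<exists>u \<in> Hom C Q Q'. u \<cdot> q = q' \<cdot> a"
    if "is_coequaliser C K B k l Q q" "is_coequaliser C K' B' k' l' Q' q'" "a \<in> Hom C B B'" "b \<in> Hom C K K'" "a \<cdot> k = k' \<cdot> b" "a \<cdot> l = l' \<cdot> b"
    for K B k l Q q K' B' k' l' Q' q' a b
  proof -
    note p = C.coequaliserD[OF that(1)] note p' = C.coequaliserD[OF that(2)]
    have "(q' \<cdot> a) \<cdot> k = (q' \<cdot> a) \<cdot> l"
      using C.comp_assoc[OF p(1) that(3) p'(3)] C.comp_assoc[OF p(2) that(3) p'(3)] that(5,6)
        C.square_comp[OF p'(1) p'(3) p'(2) p'(3) p'(4) that(4)] by simp
    then show ?thesis using C.coequaliser_ex[OF that(1) C.comp_hom[OF that(3) p'(3)]] by blast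
  qed
  obtain u where u: "u \<in> Hom C Q2 Q1" "u \<cdot> q2 = q1 \<cdot> x'" using ind[OF 2 1 xyz(4,1)] D E by auto
  obtain v where v: "v \<in> Hom C Q2 Q1" "v \<cdot> q2 = q1 \<cdot> y'" using ind[OF 2 1 xyz(5,2)] D E by auto
  obtain w where w: "w \<in> Hom C Q1 Q2" "w \<cdot> q1 = q2 \<cdot> z'" using ind[OF 1 2 xyz(6,3)] D E by auto
  have Q: "Q1 \<in> Ob C" "Q2 \<in> Ob C" using C.hom_ob q1 q2 by auto
  have id: "u' \<cdot> w = Id C Q1" if "u' \<in> Hom C Q2 Q1" "u' \<cdot> q2 = q1 \<cdot> x''" "x'' \<in> Hom C A2 A1" "x'' \<cdot> z' = Id C A1" for u' x''
  proof (rule C.coequaliser_epi[OF 1 C.comp_hom[OF w(1) that(1)] C.id_hom[OF Q(1)]])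
    show "(u' \<cdot> w) \<cdot> q1 = Id C Q1 \<cdot> q1"
      using C.comp_assoc[OF q1(3) w(1) that(1)] w(2) C.square_comp[OF q2(3) that(1) that(3) q1(3) that(2) xyz(6)] that(4)
        C.comp_id_left[OF q1(3)] C.comp_id_right[OF q1(3)] by simp
  qed
  have "RG Q1 Q2 u v w \<in> rgrph_ob C"
    using Q u v w id[OF u xyz(4,7)] id[OF v xyz(5,8)] by (simp add: RG_ob_iff)
  then have q: "RGA q1 q2 \<in> rgrph_hom C (RG A1 A2 x' y' z') (RG Q1 Q2 u v w)"
    using D(5) q1 q2 u v w by (simp add: RGA_hom_iff)
  show "\<exists>Q q. is_coequaliser (RGrph C) G A d c Q q"
    using coequaliser_RGrph[OF C _ _ q 1 2, of x y z] d c D(1-3) E(1) by auto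
qed

lemma coeq_is_coequaliser:
  fixes C (structure)
  assumes "reflexive_coequalisers C" "d \<in> Hom C G A" "c \<in> Hom C G A" "e \<in> Hom C A G"
    "d \<cdot> e = Id C A" "c \<cdot> e = Id C A"
  shows "is_coequaliser C G A d c (fst (coeq C G A d c)) (snd (coeq C G A d c))"
proof -
  obtain Q q where "is_coequaliser C G A d c Q q" using assms unfolding reflexive_coequalisers_def by blast
  then show ?thesis
    unfolding coeq_def by (intro someI[of "\<lambda>z. is_coequaliser C G A d c (fst z) (snd z)" "(Q, q)"]) simp
qed

lemma CoeqFork_ob:
  "FOb (CoeqFork C) (RG G1 G2 d c e) = Fk (fst (coeq C G2 G1 d c)) G1 G2 d c e (snd (coeq C G2 G1 d c))"
  by (simp add: CoeqFork_def)

text \<open>Resolves the definite description in \<open>CoeqFork\<close>: the component at the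
  quotient exists and is unique by the universal property of the coequaliser.\<close>

lemma CoeqFork_ar:
  fixes C (structure)
  assumes C: "category C" and RC: "reflexive_coequalisers C" and m: "RGA m1 m2 \<in> rgrph_hom C (RG G1 G2 d c e) (RG H1 H2 d' c' e')"
  obtains m0 where "FAr (CoeqFork C) (RG G1 G2 d c e) (RG H1 H2 d' c' e') (RGA m1 m2) = FkA m0 m1 m2"
    "m0 \<in> Hom C (fst (coeq C G2 G1 d c)) (fst (coeq C H2 H1 d' c'))"
    "m0 \<cdot> snd (coeq C G2 G1 d c) = snd (coeq C H2 H1 d' c') \<cdot> m1"
proof -
  interpret C: category C by fact
  have ob: "RG G1 G2 d c e \<in> rgrph_ob C" "RG H1 H2 d' c' e' \<in> rgrph_ob C" "m1 \<in> Hom C G1 H1" "m2 \<in> Hom C G2 H2"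
     "d' \<cdot> m2 = m1 \<cdot> d" "c' \<cdot> m2 = m1 \<cdot> c"
    using m by (auto simp: RGA_hom_iff)
  let ?Q = "fst (coeq C G2 G1 d c)" and ?q = "snd (coeq C G2 G1 d c)"
  let ?P = "fst (coeq C H2 H1 d' c')" and ?p = "snd (coeq C H2 H1 d' c')"
  have Q: "is_coequaliser C G2 G1 d c ?Q ?q" and P: "is_coequaliser C H2 H1 d' c' ?P ?p"
    using ob(1,2) coeq_is_coequaliser[OF RC] by (auto simp: RG_ob_iff)
  note q = C.coequaliserD[OF Q] note p = C.coequaliserD[OF P]
  have "(?p \<cdot> m1) \<cdot> d = (?p \<cdot> m1) \<cdot> c"
    using C.comp_assoc[OF q(1) ob(3) p(3)] C.comp_assoc[OF q(2) ob(3) p(3)] ob(5,6) C.square_comp[OF p(1,3,2,3,4) ob(4)] by simp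
  then obtain m0 where m0: "m0 \<in> Hom C ?Q ?P" "m0 \<cdot> ?q = ?p \<cdot> m1"
    using C.coequaliser_ex[OF Q C.comp_hom[OF ob(3) p(3)]] by blast
  have "(THE m0. m0 \<in> Hom C ?Q ?P \<and> m0 \<cdot> ?q = ?p \<cdot> m1) = m0"
    using m0 C.coequaliser_epi[OF Q] by (intro the_equality) auto
  then show thesis using that m0 by (simp add: CoeqFork_def)
qed

lemma functor_CoeqFork:
  fixes C (structure)
  assumes C: "category C" and RC: "reflexive_coequalisers C"
  shows "is_functor (RGrph C) (Fork C) (CoeqFork C)"
  unfolding is_functor_def
proof (intro conjI allI ballI)
  interpret C: category C by fact
  interpret R: category "RGrph C" by (rule category_RGrph[OF C])
  interpret F: category "Fork C" by (rule category_Fork[OF C])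
  have fob: "FOb (CoeqFork C) (RG G1 G2 d c e) \<in> fork_ob C" 
    and Q: "is_coequaliser C G2 G1 d c (fst (coeq C G2 G1 d c)) (snd (coeq C G2 G1 d c))" 
    if G: "RG G1 G2 d c e \<in> rgrph_ob C" for G1 G2 d c e
  proof -
    show Q: "is_coequaliser C G2 G1 d c (fst (coeq C G2 G1 d c)) (snd (coeq C G2 G1 d c))"
      using G coeq_is_coequaliser[OF RC] by (auto simp: RG_ob_iff)
    note q = C.coequaliserD[OF Q]
    show "FOb (CoeqFork C) (RG G1 G2 d c e) \<in> fork_ob C"
      using G q C.hom_ob[OF q(3)] by (simp add: CoeqFork_ob RG_ob_iff Fk_ob_iff)
  qed
  fix G assume "G \<in> Ob (RGrph C)"
  then obtain G1 G2 d c e where G: "G = RG G1 G2 d c e" "RG G1 G2 d c e \<in> rgrph_ob C"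
    by (auto simp: rgrph_ob_def)
  then show "FOb (CoeqFork C) G \<in> Ob (Fork C)" using fob by simp
  note q = C.coequaliserD[OF Q[OF G(2)]]
  have "RGA (Id C G1) (Id C G2) \<in> rgrph_hom C (RG G1 G2 d c e) (RG G1 G2 d c e)"
    using R.id_hom[of G] G by simp
  then obtain m0 where m0: "FAr (CoeqFork C) (RG G1 G2 d c e) (RG G1 G2 d c e) (RGA (Id C G1) (Id C G2)) = FkA m0 (Id C G1) (Id C G2)"
    "m0 \<in> Hom C (fst (coeq C G2 G1 d c)) (fst (coeq C G2 G1 d c))"
    "m0 \<cdot> snd (coeq C G2 G1 d c) = snd (coeq C G2 G1 d c) \<cdot> Id C G1" by (rule CoeqFork_ar[OF C RC])
  have "Id C (fst (coeq C G2 G1 d c)) \<in> Hom C (fst (coeq C G2 G1 d c)) (fst (coeq C G2 G1 d c))"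
    using C.id_hom C.hom_ob[OF q(3)] by blast
  then have "m0 = Id C (fst (coeq C G2 G1 d c))"
    using C.coequaliser_epi[OF Q[OF G(2)] m0(2)] m0(3) C.comp_id_right[OF q(3)] C.comp_id_left[OF q(3)] by simp
  then show "FAr (CoeqFork C) G G (Id (RGrph C) G) = Id (Fork C) (FOb (CoeqFork C) G)"
    using m0(1) G by (simp add: CoeqFork_ob)
next
  interpret C: category C by fact
  interpret R: category "RGrph C" by (rule category_RGrph[OF C])
  fix A B f assume f: "f \<in> Hom (RGrph C) A B"
  obtain m1 m2 G1 G2 d c e H1 H2 d' c' e' where m: "f = RGA m1 m2" "A = RG G1 G2 d c e" "B = RG H1 H2 d' c' e'"
      "RG G1 G2 d c e \<in> rgrph_ob C" "RG H1 H2 d' c' e' \<in> rgrph_ob C" "m1 \<in> Hom C G1 H1" "m2 \<in> Hom C G2 H2"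
      "d' \<cdot> m2 = m1 \<cdot> d" "c' \<cdot> m2 = m1 \<cdot> c" "e' \<cdot> m1 = m2 \<cdot> e"
      using f by (auto elim: rgrph_homE)
  have Q: "is_coequaliser C G2 G1 d c (fst (coeq C G2 G1 d c)) (snd (coeq C G2 G1 d c))" if "RG G1 G2 d c e \<in> rgrph_ob C" for G1 G2 d c e
    using that coeq_is_coequaliser[OF RC] by (auto simp: RG_ob_iff)
  note q = C.coequaliserD[OF Q[OF m(4)]] note p = C.coequaliserD[OF Q[OF m(5)]]
  obtain m0 where m0: "FAr (CoeqFork C) A B f = FkA m0 m1 m2"
    "m0 \<in> Hom C (fst (coeq C G2 G1 d c)) (fst (coeq C H2 H1 d' c'))"
    "m0 \<cdot> snd (coeq C G2 G1 d c) = snd (coeq C H2 H1 d' c') \<cdot> m1"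
    using CoeqFork_ar[OF C RC, of m1 m2 G1 G2 d c e H1 H2 d' c' e'] f m(1-3) by auto
  show "FAr (CoeqFork C) A B f \<in> Hom (Fork C) (FOb (CoeqFork C) A) (FOb (CoeqFork C) B)"
    using m0 m q p C.hom_ob[OF q(3)] C.hom_ob[OF p(3)] by (simp add: CoeqFork_ob FkA_hom_iff Fk_ob_iff RG_ob_iff)
  fix E h assume h: "h \<in> Hom (RGrph C) B E"
  obtain n1 n2 K1 K2 d'' c'' e'' where n: "h = RGA n1 n2" "E = RG K1 K2 d'' c'' e''" "n1 \<in> Hom C H1 K1"
     "RG K1 K2 d'' c'' e'' \<in> rgrph_ob C"
    using h m(3) by (auto elim: rgrph_homE)
  note r = C.coequaliserD[OF Q[OF n(4)]]
  obtain n0 where n0: "FAr (CoeqFork C) B E h = FkA n0 n1 n2"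
    "n0 \<in> Hom C (fst (coeq C H2 H1 d' c')) (fst (coeq C K2 K1 d'' c''))"
    "n0 \<cdot> snd (coeq C H2 H1 d' c') = snd (coeq C K2 K1 d'' c'') \<cdot> n1"
    using CoeqFork_ar[OF C RC, of n1 n2 H1 H2 d' c' e' K1 K2 d'' c'' e''] h n m(3) by auto
  have "RGA (n1 \<cdot> m1) (n2 \<cdot> m2) \<in> rgrph_hom C A E"
    using R.comp_hom[OF f h] m(1) n(1) by simp
  then obtain l0 where l0: "FAr (CoeqFork C) A E (RGA (n1 \<cdot> m1) (n2 \<cdot> m2)) = FkA l0 (n1 \<cdot> m1) (n2 \<cdot> m2)"
    "l0 \<in> Hom C (fst (coeq C G2 G1 d c)) (fst (coeq C K2 K1 d'' c''))"
    "l0 \<cdot> snd (coeq C G2 G1 d c) = snd (coeq C K2 K1 d'' c'') \<cdot> (n1 \<cdot> m1)"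
    using CoeqFork_ar[OF C RC] m(2) n(2) by blast
  have "l0 \<cdot> snd (coeq C G2 G1 d c) = (n0 \<cdot> m0) \<cdot> snd (coeq C G2 G1 d c)"
    using C.comp_assoc[OF q(3) m0(2) n0(2)] C.square_comp[OF p(3) n0(2) n(3) r(3) n0(3) m(6)] m0(3) l0(3) by simp
  then have "l0 = n0 \<cdot> m0"
    by (rule C.coequaliser_epi[OF Q[OF m(4)] l0(2) C.comp_hom[OF m0(2) n0(2)]])
  then show "FAr (CoeqFork C) A E (h \<cdot>\<^bsub>RGrph C\<^esub> f) = FAr (CoeqFork C) B E h \<cdot>\<^bsub>Fork C\<^esub> FAr (CoeqFork C) A B f"
    using l0(1) m0(1) n0(1) m(1) n(1) by simp
qed

section \<open>The adjunction\<close>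

text \<open>\<open>L\<close> is a left adjoint of \<open>R\<close> whose unit is the identity.\<close>

definition strict_reflection ::
    "('o, 'm) category \<Rightarrow> ('p, 'k) category \<Rightarrow> ('o, 'm, 'p, 'k) functr \<Rightarrow> ('p, 'k, 'o, 'm) functr \<Rightarrow> bool" where
  "strict_reflection C D L R \<longleftrightarrow> category C \<and> category D \<and> is_functor C D L \<and> is_functor D C R \<and>
    (\<forall>A \<in> Ob C. FOb R (FOb L A) = A) \<and>
    (\<forall>A B. \<forall>f \<in> Hom C A B. FAr R (FOb L A) (FOb L B) (FAr L A B f) = f) \<and>
    (\<forall>A \<in> Ob C. \<forall>F \<in> Ob D. \<forall>m \<in> Hom C A (FOb R F). \<exists>!g. g \<in> Hom D (FOb L A) F \<and> FAr R (FOb L A) F g = m)"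

lemma strict_reflectionD:
  assumes "strict_reflection C D L R"
  shows "category C" "category D" "is_functor C D L" "is_functor D C R"
    "A \<in> Ob C \<Longrightarrow> FOb R (FOb L A) = A"
    "f \<in> Hom C A B \<Longrightarrow> FAr R (FOb L A) (FOb L B) (FAr L A B f) = f"
    "A \<in> Ob C \<Longrightarrow> F \<in> Ob D \<Longrightarrow> m \<in> Hom C A (FOb R F) \<Longrightarrow> \<exists>g. g \<in> Hom D (FOb L A) F \<and> FAr R (FOb L A) F g = m"
  using assms unfolding strict_reflection_def by blast+

lemma strict_reflection_unique:
  assumes S: "strict_reflection C D L R" and A: "A \<in> Ob C" and g: "g \<in> Hom D (FOb L A) F" "h \<in> Hom D (FOb L A) F"
    and eq: "FAr R (FOb L A) F g = FAr R (FOb L A) F h"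
  shows "g = h"
proof -
  interpret D: category D using strict_reflectionD(2)[OF S] .
  have F: "F \<in> Ob D" using D.hom_ob g by blast
  have "FAr R (FOb L A) F g \<in> Hom C (FOb R (FOb L A)) (FOb R F)" using functorD(2)[OF strict_reflectionD(4)[OF S] g(1)] .
  then have "FAr R (FOb L A) F g \<in> Hom C A (FOb R F)" using strict_reflectionD(5)[OF S A] by simp
  then show ?thesis using S A F g eq unfolding strict_reflection_def by metis
qed

text \<open>The unit is the identity, and the counit at \<open>F\<close> is the arrow that
  \<open>R\<close> sends to the identity of \<open>R F\<close>. Its naturality and the triangle
  identities follow since \<open>R\<close> is faithful on arrows out of objects
  \<open>L A\<close>.\<close>

lemma strict_reflection_adjunction:
  fixes C (structure)
  assumes S: "strict_reflection C D L R"
  shows "\<exists>\<eta> \<epsilon>. adjunction C D L R \<eta> \<epsilon>"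
proof -
  note s = strict_reflectionD[OF S]
  interpret C: category C by (rule s(1))
  interpret D: category D by (rule s(2))
  note l = functorD[OF s(3)] note r = functorD[OF s(4)]
  define \<epsilon> where "\<epsilon> = (\<lambda>F. SOME g. g \<in> Hom D (FOb L (FOb R F)) F \<and> FAr R (FOb L (FOb R F)) F g = Id C (FOb R F))"
  have e: "\<epsilon> F \<in> Hom D (FOb L (FOb R F)) F" "FAr R (FOb L (FOb R F)) F (\<epsilon> F) = Id C (FOb R F)" if "F \<in> Ob D" for F
  proof -
    have "\<exists>g. g \<in> Hom D (FOb L (FOb R F)) F \<and> FAr R (FOb L (FOb R F)) F g = Id C (FOb R F)"
      using s(7)[OF r(1)[OF that] that C.id_hom[OF r(1)[OF that]]] .
    then have "\<epsilon> F \<in> Hom D (FOb L (FOb R F)) F \<and> FAr R (FOb L (FOb R F)) F (\<epsilon> F) = Id C (FOb R F)"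
      unfolding \<epsilon>_def by (rule someI_ex)
    then show "\<epsilon> F \<in> Hom D (FOb L (FOb R F)) F" "FAr R (FOb L (FOb R F)) F (\<epsilon> F) = Id C (FOb R F)" by auto
  qed
  have "adjunction C D L R (Id C) \<epsilon>"
    unfolding adjunction_def
  proof (intro conjI s(1-4) ballI)
    show "natural_transformation C C id_functor (comp_functor R L) (Id C)"
      unfolding natural_transformation_def
    proof (intro conjI ballI allI)
      fix A assume A: "A \<in> Ob C"
      show "Id C A \<in> Hom C (FOb id_functor A) (FOb (comp_functor R L) A)"
        using s(5)[OF A] C.id_hom[OF A] by (simp add: id_functor_def comp_functor_def)
    next
      fix A B f assume f: "f \<in> Hom C A B"
      show "Id C B \<cdot> FAr id_functor A B f = FAr (comp_functor R L) A B f \<cdot> Id C A"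
        using s(6)[OF f] C.comp_id_left[OF f] C.comp_id_right[OF f] by (simp add: id_functor_def comp_functor_def)
    qed
    show "natural_transformation D D (comp_functor L R) id_functor \<epsilon>"
      unfolding natural_transformation_def
    proof (intro conjI ballI allI)
      fix F assume "F \<in> Ob D"
      then show "\<epsilon> F \<in> Hom D (FOb (comp_functor L R) F) (FOb id_functor F)"
        using e by (simp add: id_functor_def comp_functor_def)
    next
      fix F G f assume f: "f \<in> Hom D F G"
      have F: "F \<in> Ob D" and G: "G \<in> Ob D" using D.hom_ob[OF f] by auto
      have rf: "FAr R F G f \<in> Hom C (FOb R F) (FOb R G)" using r(2)[OF f] .
      have lrf: "FAr L (FOb R F) (FOb R G) (FAr R F G f) \<in> Hom D (FOb L (FOb R F)) (FOb L (FOb R G))" using l(2)[OF rf] .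
      have "\<epsilon> G \<cdot>\<^bsub>D\<^esub> FAr L (FOb R F) (FOb R G) (FAr R F G f) = f \<cdot>\<^bsub>D\<^esub> \<epsilon> F"
      proof (rule strict_reflection_unique[OF S r(1)[OF F] D.comp_hom[OF lrf e(1)[OF G]] D.comp_hom[OF e(1)[OF F] f]])
        show "FAr R (FOb L (FOb R F)) G (\<epsilon> G \<cdot>\<^bsub>D\<^esub> FAr L (FOb R F) (FOb R G) (FAr R F G f)) =
          FAr R (FOb L (FOb R F)) G (f \<cdot>\<^bsub>D\<^esub> \<epsilon> F)"
          using r(4)[OF lrf e(1)[OF G]] r(4)[OF e(1)[OF F] f] e(2)[OF F] e(2)[OF G] s(6)[OF rf]
            C.comp_id_left[OF rf] C.comp_id_right[OF rf] by simp
      qed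
      then show "\<epsilon> G \<cdot>\<^bsub>D\<^esub> FAr (comp_functor L R) F G f = FAr id_functor F G f \<cdot>\<^bsub>D\<^esub> \<epsilon> F"
        by (simp add: id_functor_def comp_functor_def)
    qed
  next
    fix A assume A: "A \<in> Ob C"
    note LA = l(1)[OF A]
    have "\<epsilon> (FOb L A) = Id D (FOb L A)"
      using e[OF LA] s(5)[OF A] D.id_hom[OF LA] r(3)[OF LA] by (intro strict_reflection_unique[OF S A]) auto
    then show "\<epsilon> (FOb L A) \<cdot>\<^bsub>D\<^esub> FAr L A (FOb R (FOb L A)) (Id C A) = Id D (FOb L A)"
      using s(5)[OF A] l(3)[OF A] D.comp_id_left[OF D.id_hom[OF LA]] by simp
  next
    fix F assume F: "F \<in> Ob D"
    then show "FAr R (FOb L (FOb R F)) F (\<epsilon> F) \<cdot> Id C (FOb R F) = Id C (FOb R F)"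
      using e(2)[OF F] C.comp_id_left[OF C.id_hom[OF r(1)[OF F]]] by simp
  qed
  then show ?thesis by blast
qed

lemma adjunctionD:
  assumes "adjunction C D L R \<eta> \<epsilon>"
  shows "A \<in> Ob C \<Longrightarrow> \<eta> A \<in> Hom C A (FOb R (FOb L A))"
    "F \<in> Ob D \<Longrightarrow> \<epsilon> F \<in> Hom D (FOb L (FOb R F)) F"
    "f \<in> Hom D F G \<Longrightarrow> \<epsilon> G \<cdot>\<^bsub>D\<^esub> FAr L (FOb R F) (FOb R G) (FAr R F G f) = f \<cdot>\<^bsub>D\<^esub> \<epsilon> F"
    "A \<in> Ob C \<Longrightarrow> \<epsilon> (FOb L A) \<cdot>\<^bsub>D\<^esub> FAr L A (FOb R (FOb L A)) (\<eta> A) = Id D (FOb L A)"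
    "F \<in> Ob D \<Longrightarrow> FAr R (FOb L (FOb R F)) F (\<epsilon> F) \<cdot>\<^bsub>C\<^esub> \<eta> (FOb R F) = Id C (FOb R F)"
  using assms unfolding adjunction_def natural_transformation_def
  by (simp_all add: id_functor_def comp_functor_def)

text \<open>The unit \<open>\<eta>\<close> of a given adjunction need not be the identity. As
  \<open>R\<close> is full on arrows out of \<open>L A\<close>, \<open>\<eta> A\<close> is the image
  of some \<open>g\<close>. The endomorphism \<open>?x\<close>, which is \<open>g\<close> after the
  counit, satisfies \<open>R ?x \<cdot> \<eta> A = \<eta> A\<close>, and naturality of the counit
  turns this into \<open>?x\<close> being the identity. So the image of the counit under
  \<open>R\<close> is a two-sided inverse of \<open>\<eta> A\<close>.\<close>

lemma strict_reflection_unit_iso: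
  fixes C (structure)
  assumes S: "strict_reflection C D L R" and adj: "adjunction C D L R \<eta> \<epsilon>" and A: "A \<in> Ob C"
  shows "iso C A (FOb R (FOb L A)) (\<eta> A)"
proof -
  note s = strict_reflectionD[OF S]
  interpret C: category C by (rule s(1))
  interpret D: category D by (rule s(2))
  note l = functorD[OF s(3)] note r = functorD[OF s(4)]
  note LA = l(1)[OF A] note RLA = s(5)[OF A]
  note a = adjunctionD[OF adj]
  have eta: "\<eta> A \<in> Hom C A A" using a(1)[OF A] RLA by simp
  have eps: "\<epsilon> (FOb L A) \<in> Hom D (FOb L A) (FOb L A)" using a(2)[OF LA] RLA by simp
  have nat: "\<epsilon> (FOb L A) \<cdot>\<^bsub>D\<^esub> FAr L A A (FAr R (FOb L A) (FOb L A) x) = x \<cdot>\<^bsub>D\<^esub> \<epsilon> (FOb L A)"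
    if "x \<in> Hom D (FOb L A) (FOb L A)" for x
    using a(3)[OF that] RLA by simp
  have t1: "\<epsilon> (FOb L A) \<cdot>\<^bsub>D\<^esub> FAr L A A (\<eta> A) = Id D (FOb L A)" using a(4)[OF A] RLA by simp
  have t2: "FAr R (FOb L A) (FOb L A) (\<epsilon> (FOb L A)) \<cdot> \<eta> A = Id C A" using a(5)[OF LA] RLA by simp
  have "\<exists>g. g \<in> Hom D (FOb L A) (FOb L A) \<and> FAr R (FOb L A) (FOb L A) g = \<eta> A"
    using s(7)[OF A LA] eta RLA by simp
  then obtain g where g: "g \<in> Hom D (FOb L A) (FOb L A)" "FAr R (FOb L A) (FOb L A) g = \<eta> A" by blast
  let ?e = "\<epsilon> (FOb L A)"
  have re: "FAr R (FOb L A) (FOb L A) ?e \<in> Hom C A A" using r(2)[OF eps] RLA by simp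
  let ?x = "g \<cdot>\<^bsub>D\<^esub> ?e"
  have x: "?x \<in> Hom D (FOb L A) (FOb L A)" using D.comp_hom[OF eps g(1)] .
  have Rx: "FAr R (FOb L A) (FOb L A) ?x = \<eta> A \<cdot> FAr R (FOb L A) (FOb L A) ?e" using r(4)[OF eps g(1)] g(2) by simp
  have Rxeta: "FAr R (FOb L A) (FOb L A) ?x \<cdot> \<eta> A = \<eta> A"
    using Rx C.comp_assoc[OF eta re eta] t2 C.comp_id_right[OF eta] by simp
  have Le: "FAr L A A (\<eta> A) \<in> Hom D (FOb L A) (FOb L A)" using l(2)[OF eta] .
  have Rx': "FAr R (FOb L A) (FOb L A) ?x \<in> Hom C A A" using r(2)[OF x] RLA by simp
  have "?x = ?x \<cdot>\<^bsub>D\<^esub> (?e \<cdot>\<^bsub>D\<^esub> FAr L A A (\<eta> A))" using t1 D.comp_id_right[OF x] by simp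
  also have "\<dots> = (?x \<cdot>\<^bsub>D\<^esub> ?e) \<cdot>\<^bsub>D\<^esub> FAr L A A (\<eta> A)" using D.comp_assoc[OF Le eps x] by simp
  also have "\<dots> = ?e \<cdot>\<^bsub>D\<^esub> (FAr L A A (FAr R (FOb L A) (FOb L A) ?x) \<cdot>\<^bsub>D\<^esub> FAr L A A (\<eta> A))"
    using nat[OF x] D.comp_assoc[OF Le l(2)[OF Rx'] eps] by simp
  also have "\<dots> = ?e \<cdot>\<^bsub>D\<^esub> FAr L A A (\<eta> A)" using l(4)[OF eta Rx'] Rxeta by simp
  finally have "?x = Id D (FOb L A)" using t1 by simp
  then have "\<eta> A \<cdot> FAr R (FOb L A) (FOb L A) ?e = Id C A" using Rx r(3)[OF LA] RLA by simp
  then show ?thesis using C.isoI[OF eta re t2] RLA by simp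
qed

text \<open>By a triangle identity the image of the counit under \<open>R\<close> is a retraction of
  the unit, which is already known to be invertible.\<close>

lemma strict_reflection_counit_iso:
  fixes C (structure)
  assumes S: "strict_reflection C D L R" and adj: "adjunction C D L R \<eta> \<epsilon>" and F: "F \<in> Ob D"
  shows "\<epsilon> F \<in> Hom D (FOb L (FOb R F)) F" "iso C (FOb R (FOb L (FOb R F))) (FOb R F) (FAr R (FOb L (FOb R F)) F (\<epsilon> F))"
proof -
  note s = strict_reflectionD[OF S]
  interpret C: category C by (rule s(1))
  note r = functorD[OF s(4)]
  show e: "\<epsilon> F \<in> Hom D (FOb L (FOb R F)) F"
    using adjunctionD(2)[OF adj F] .
  have t: "FAr R (FOb L (FOb R F)) F (\<epsilon> F) \<cdot> \<eta> (FOb R F) = Id C (FOb R F)"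
    using adjunctionD(5)[OF adj F] .
  obtain k where k: "\<eta> (FOb R F) \<in> Hom C (FOb R F) (FOb R (FOb L (FOb R F)))" "k \<in> Hom C (FOb R (FOb L (FOb R F))) (FOb R F)"
    "\<eta> (FOb R F) \<cdot> k = Id C (FOb R (FOb L (FOb R F)))" "iso C (FOb R (FOb L (FOb R F))) (FOb R F) k"
    using strict_reflection_unit_iso[OF S adj r(1)[OF F]] by (metis C.isoE C.iso_hom)
  have "FAr R (FOb L (FOb R F)) F (\<epsilon> F) = FAr R (FOb L (FOb R F)) F (\<epsilon> F) \<cdot> (\<eta> (FOb R F) \<cdot> k)"
    using k(3) C.comp_id_right[OF r(2)[OF e]] by simp
  also have "\<dots> = k" using C.comp_assoc[OF k(2,1) r(2)[OF e]] t C.comp_id_left[OF k(2)] by simp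
  finally show "iso C (FOb R (FOb L (FOb R F))) (FOb R F) (FAr R (FOb L (FOb R F)) F (\<epsilon> F))" using k(4) by simp
qed

text \<open>A morphism from a graph to the underlying graph of a fork is transposed vertex by vertex
  with the given reflection. At coordinate 0 the arrow \<open>k\<close> is produced in
  \<open>C\<close> by the coequaliser and then transposed to \<open>g0\<close>. All squares may be
  checked under \<open>R\<close>, where transposition disappears.\<close>

lemma strict_reflection_step:
  fixes C (structure)
  assumes S: "strict_reflection C D L R" and RC: "reflexive_coequalisers C"
  shows "strict_reflection (RGrph C) (Fork D) (comp_functor (Fork_functor L) (CoeqFork C)) (comp_functor grph (Fork_functor R))"
    (is "strict_reflection _ _ ?L ?R")
proof -
  note s = strict_reflectionD[OF S]
  interpret C: category C by (rule s(1))
  interpret D: category D by (rule s(2))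
  interpret RG: category "RGrph C" by (rule category_RGrph[OF s(1)])
  note l = functorD[OF s(3)] note r = functorD[OF s(4)]
  have FL: "is_functor (RGrph C) (Fork D) ?L"
    using functor_comp[OF functor_CoeqFork[OF s(1) RC] functor_Fork[OF s(3)]] .
  have FR: "is_functor (Fork D) (RGrph C) ?R"
    using functor_comp[OF functor_Fork[OF s(4)] functor_grph] .
  have Lob: "FOb ?L (RG G1 G2 d c e) = Fk (FOb L (fst (coeq C G2 G1 d c))) (FOb L G1) (FOb L G2)
      (FAr L G2 G1 d) (FAr L G2 G1 c) (FAr L G1 G2 e) (FAr L G1 (fst (coeq C G2 G1 d c)) (snd (coeq C G2 G1 d c)))" for G1 G2 d c e
    by (simp add: comp_functor_def CoeqFork_ob)
  have Rob: "FOb ?R (Fk F0 F1 F2 d c e f) = RG (FOb R F1) (FOb R F2) (FAr R F2 F1 d) (FAr R F2 F1 c) (FAr R F1 F2 e)" for F0 F1 F2 d c e f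
    by (simp add: comp_functor_def)
  have Rar: "FAr ?R (Fk F0 F1 F2 d c e f) (Fk H0 H1 H2 d' c' e' f') (FkA m0 m1 m2) = RGA (FAr R F1 H1 m1) (FAr R F2 H2 m2)"
    for F0 F1 F2 d c e f H0 H1 H2 d' c' e' f' m0 m1 m2 by (simp add: comp_functor_def)
  show ?thesis
    unfolding strict_reflection_def
  proof (intro conjI ballI allI RG.category_axioms category_Fork s FL FR)
    fix A assume "A \<in> Ob (RGrph C)"
    then obtain G1 G2 d c e where G: "A = RG G1 G2 d c e" "RG G1 G2 d c e \<in> rgrph_ob C" by (auto simp: rgrph_ob_def)
    then have o: "G1 \<in> Ob C" "G2 \<in> Ob C" "d \<in> Hom C G2 G1" "c \<in> Hom C G2 G1" "e \<in> Hom C G1 G2" "d \<cdot> e = Id C G1" "c \<cdot> e = Id C G1"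
      by (auto simp: RG_ob_iff)
    show "FOb ?R (FOb ?L A) = A"
      using G(1) s(5)[OF o(1)] s(5)[OF o(2)] s(6)[OF o(3)] s(6)[OF o(4)] s(6)[OF o(5)] by (simp add: Lob Rob)
    fix F m assume F: "F \<in> Ob (Fork D)" and m: "m \<in> Hom (RGrph C) A (FOb ?R F)"
    obtain F0 F1 F2 d' c' e' f' where F': "F = Fk F0 F1 F2 d' c' e' f'" "Fk F0 F1 F2 d' c' e' f' \<in> fork_ob D" using F by (auto simp: fork_ob_def)
    then have p: "F0 \<in> Ob D" "F1 \<in> Ob D" "F2 \<in> Ob D" "d' \<in> Hom D F2 F1" "c' \<in> Hom D F2 F1" "e' \<in> Hom D F1 F2" "f' \<in> Hom D F1 F0"
      "f' \<cdot>\<^bsub>D\<^esub> d' = f' \<cdot>\<^bsub>D\<^esub> c'" by (auto simp: Fk_ob_iff)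
    note rd = r(2)[OF p(4)] and rc = r(2)[OF p(5)] and re = r(2)[OF p(6)] and rf = r(2)[OF p(7)]
    obtain m1 m2 where m': "m = RGA m1 m2" "m1 \<in> Hom C G1 (FOb R F1)" "m2 \<in> Hom C G2 (FOb R F2)"
      "FAr R F2 F1 d' \<cdot> m2 = m1 \<cdot> d" "FAr R F2 F1 c' \<cdot> m2 = m1 \<cdot> c" "FAr R F1 F2 e' \<cdot> m1 = m2 \<cdot> e"
      using m G(1) F'(1) by (auto elim!: rgrph_homE simp: Rob)
    define Q q where "Q = fst (coeq C G2 G1 d c)" and "q = snd (coeq C G2 G1 d c)"
    have Q: "is_coequaliser C G2 G1 d c Q q" unfolding Q_def q_def using coeq_is_coequaliser[OF RC o(3-7)] .
    note qh = C.coequaliserD[OF Q]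
    have QO: "Q \<in> Ob C" using C.hom_ob qh by blast
    have LA: "FOb ?L A = Fk (FOb L Q) (FOb L G1) (FOb L G2) (FAr L G2 G1 d) (FAr L G2 G1 c) (FAr L G1 G2 e) (FAr L G1 Q q)"
      using G(1) by (simp add: Lob Q_def q_def)
    have LAo: "FOb ?L A \<in> fork_ob D" using functorD(1)[OF FL, of A] G by simp
    obtain g1 where g1: "g1 \<in> Hom D (FOb L G1) F1" "FAr R (FOb L G1) F1 g1 = m1" using s(7)[OF o(1) p(2) m'(2)] by blast
    obtain g2 where g2: "g2 \<in> Hom D (FOb L G2) F2" "FAr R (FOb L G2) F2 g2 = m2" using s(7)[OF o(2) p(3) m'(3)] by blast
    have "(FAr R F1 F0 f' \<cdot> m1) \<cdot> d = (FAr R F1 F0 f' \<cdot> m1) \<cdot> c"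
      using C.comp_assoc[OF o(3) m'(2) rf] C.comp_assoc[OF o(4) m'(2) rf] m'(4,5)
        C.square_comp[OF rd rf rc rf functor_square[OF s(4) p(4,7,5,7,8)] m'(3)] by simp
    then obtain k where k: "k \<in> Hom C Q (FOb R F0)" "k \<cdot> q = FAr R F1 F0 f' \<cdot> m1"
      using C.coequaliser_ex[OF Q C.comp_hom[OF m'(2) rf]] by blast
    obtain g0 where g0: "g0 \<in> Hom D (FOb L Q) F0" "FAr R (FOb L Q) F0 g0 = k" using s(7)[OF QO p(1) k(1)] by blast
    have sq: "x' \<cdot>\<^bsub>D\<^esub> a = b \<cdot>\<^bsub>D\<^esub> FAr L X Y x" if "a \<in> Hom D (FOb L X) H" "b \<in> Hom D (FOb L Y) K" "x \<in> Hom C X Y" "x' \<in> Hom D H K"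
       "FAr R H K x' \<cdot> FAr R (FOb L X) H a = FAr R (FOb L Y) K b \<cdot> x" for a b x x' X Y H K
    proof (rule strict_reflection_unique[OF S _ D.comp_hom[OF that(1,4)] D.comp_hom[OF l(2)[OF that(3)] that(2)]])
      show "X \<in> Ob C" using C.hom_ob that(3) by blast
      show "FAr R (FOb L X) K (x' \<cdot>\<^bsub>D\<^esub> a) = FAr R (FOb L X) K (b \<cdot>\<^bsub>D\<^esub> FAr L X Y x)"
        using r(4)[OF that(1,4)] r(4)[OF l(2)[OF that(3)] that(2)] s(6)[OF that(3)] that(5) by simp
    qed
    have "FkA g0 g1 g2 \<in> fork_hom D (FOb ?L A) F"
      using LAo F' g0 g1 g2 sq[OF g2(1) g1(1) o(3) p(4)] sq[OF g2(1) g1(1) o(4) p(5)] sq[OF g1(1) g2(1) o(5) p(6)]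
        sq[OF g1(1) g0(1) qh(3) p(7)] m' k(2) unfolding LA by (simp add: FkA_hom_iff)
    moreover have "FAr ?R (FOb ?L A) F (FkA g0 g1 g2) = m" using g1 g2 F'(1) m'(1) unfolding LA by (simp add: Rar)
    moreover have "h = FkA g0 g1 g2" if h: "h \<in> fork_hom D (FOb ?L A) F" "FAr ?R (FOb ?L A) F h = m" for h
    proof -
      obtain h0 h1 h2 where h': "h = FkA h0 h1 h2" "h0 \<in> Hom D (FOb L Q) F0" "h1 \<in> Hom D (FOb L G1) F1" "h2 \<in> Hom D (FOb L G2) F2"
         "f' \<cdot>\<^bsub>D\<^esub> h1 = h0 \<cdot>\<^bsub>D\<^esub> FAr L G1 Q q"
        using h(1) F'(1) unfolding LA by (auto elim!: fork_homE)
      have Rh: "FAr R (FOb L G1) F1 h1 = m1" "FAr R (FOb L G2) F2 h2 = m2" using h(2) h'(1) F'(1) m'(1) unfolding LA by (simp_all add: Rar)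
      have 1: "h1 = g1" using strict_reflection_unique[OF S o(1) h'(3) g1(1)] Rh g1(2) by simp
      have 2: "h2 = g2" using strict_reflection_unique[OF S o(2) h'(4) g2(1)] Rh g2(2) by simp
      have rh0: "FAr R (FOb L Q) F0 h0 \<in> Hom C Q (FOb R F0)" using r(2)[OF h'(2)] s(5)[OF QO] by simp
      have "FAr R (FOb L Q) F0 h0 \<cdot> q = k \<cdot> q"
        using functor_square[OF s(4) h'(3) p(7) l(2)[OF qh(3)] h'(2,5)] s(6)[OF qh(3)] Rh(1) k(2) by simp
      then have "FAr R (FOb L Q) F0 h0 = k" using C.coequaliser_epi[OF Q rh0 k(1)] by blast
      then have "h0 = g0" using strict_reflection_unique[OF S QO h'(2) g0(1)] g0(2) by simp
      then show ?thesis using h'(1) 1 2 by simp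
    qed
    ultimately have "\<exists>!g. g \<in> fork_hom D (FOb ?L A) F \<and> FAr ?R (FOb ?L A) F g = m" by blast
    then show "\<exists>!g. g \<in> Hom (Fork D) (FOb ?L A) F \<and> FAr ?R (FOb ?L A) F g = m" by (simp only: Fork_simps)
  next
    fix A B f assume f: "f \<in> Hom (RGrph C) A B"
    then obtain m1 m2 G1 G2 d c e H1 H2 d' c' e' where m: "f = RGA m1 m2" "A = RG G1 G2 d c e" "B = RG H1 H2 d' c' e'"
      "m1 \<in> Hom C G1 H1" "m2 \<in> Hom C G2 H2" by (auto elim: rgrph_homE)
    obtain m0 where "FAr (CoeqFork C) A B f = FkA m0 m1 m2"
      using CoeqFork_ar[OF s(1) RC, of m1 m2 G1 G2 d c e H1 H2 d' c' e'] f m by auto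
    then have "FAr ?L A B f = FAr (Fork_functor L) (FOb (CoeqFork C) A) (FOb (CoeqFork C) B) (FkA m0 m1 m2)"
      by (simp add: comp_functor_def)
    then show "FAr ?R (FOb ?L A) (FOb ?L B) (FAr ?L A B f) = f"
      using m(1-3) s(6)[OF m(4)] s(6)[OF m(5)] by (simp add: Lob Rar CoeqFork_ob)
  qed
qed

lemma reflexive_coequalisers_RGrphN:
  assumes "category X" "reflexive_coequalisers (base X)"
  shows "reflexive_coequalisers (RGrphN n X)"
proof (induction n)
  case (Suc n)
  then show ?case using reflexive_coequalisers_RGrph[OF category_RGrphN[OF assms(1)]] by (simp add: RGrphN_simps)
qed (simp add: RGrphN_simps assms)

lemma strict_reflection_N:
  assumes "category X" "reflexive_coequalisers (base X)"
  shows "strict_reflection (RGrphN n X) (ForkN n X) (CoeqForkN n X) (grphN n)"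
proof (induction n)
  case 0
  show ?case
    unfolding strict_reflection_def RGrphN_simps ForkN_simps CoeqForkN.simps grphN.simps
  proof (intro conjI ballI allI category_base[OF assms(1)] functor_id)
    fix A F :: "('a, 'b) obj" and m assume "m \<in> Hom (base X) A (FOb id_functor F)"
    then show "\<exists>!g. g \<in> Hom (base X) (FOb id_functor A) F \<and> FAr id_functor (FOb id_functor A) F g = m"
      unfolding id_functor_def by (intro ex1I[of _ m]) simp_all
  qed (simp_all add: id_functor_def)
next
  case (Suc n)
  then show ?case
    using strict_reflection_step[OF Suc reflexive_coequalisers_RGrphN[OF assms]] by (simp add: RGrphN_simps ForkN_simps)
qed

section \<open>Transfer of the hypotheses to \<open>base X\<close>\<close>

lemma Hom_base: "Hom (base X) (Base a) (Base b) = BaseA ` Hom X a b"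
  by (auto simp: base_def)

text \<open>Quantifiers over arrows of \<open>base X\<close> become quantifiers over arrows of
  \<open>X\<close>, so that the universal properties below transfer by rewriting.\<close>

lemma ball_base_dom: "(\<forall>T. \<forall>x \<in> Hom (base X) T (Base a). P T x) \<longleftrightarrow> (\<forall>t. \<forall>x \<in> Hom X t a. P (Base t) (BaseA x))"
  by (auto simp: base_def)

lemma ball_base_cod: "(\<forall>T. \<forall>x \<in> Hom (base X) (Base a) T. P T x) \<longleftrightarrow> (\<forall>t. \<forall>x \<in> Hom X a t. P (Base t) (BaseA x))"
  by (auto simp: base_def)

lemma ball_base: "(\<forall>x \<in> Hom (base X) (Base a) (Base b). P x) \<longleftrightarrow> (\<forall>x \<in> Hom X a b. P (BaseA x))"
  by (auto simp: base_def)

lemma bex_base: "(\<exists>x \<in> Hom (base X) (Base a) (Base b). P x) \<longleftrightarrow> (\<exists>x \<in> Hom X a b. P (BaseA x))"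
  by (auto simp: base_def)

lemma ex1_base: "(\<exists>!h. h \<in> Hom (base X) (Base a) (Base b) \<and> P h) \<longleftrightarrow> (\<exists>!h. h \<in> Hom X a b \<and> P (BaseA h))"
  unfolding Hom_base Ex1_def by auto

lemma is_pullback_base_iff [simp]:
  "is_pullback (base X) (Base a) (Base b) (Base d) (BaseA f) (BaseA g) (Base t) (BaseA p) (BaseA q) \<longleftrightarrow>
    is_pullback X a b d f g t p q"
  unfolding is_pullback_def by (simp add: ball_base_dom ball_base ex1_base)

lemma is_pullback_baseE:
  assumes "is_pullback (base X) A B D f g P p q"
  obtains a b d f' g' t p' q' where "A = Base a" "B = Base b" "D = Base d" "f = BaseA f'" "g = BaseA g'" "P = Base t" "p = BaseA p'" "q = BaseA q'"
    "is_pullback X a b d f' g' t p' q'"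
proof -
  have h: "f \<in> Hom (base X) A D" "g \<in> Hom (base X) B D" "p \<in> Hom (base X) P A" "q \<in> Hom (base X) P B"
    using assms by (auto simp: is_pullback_def)
  obtain a d f' where 1: "f = BaseA f'" "A = Base a" "D = Base d" using h(1) by (rule base_homE)
  obtain b g' where 2: "g = BaseA g'" "B = Base b" using h(2) by (rule base_homE)
  obtain t p' where 3: "p = BaseA p'" "P = Base t" using h(3) by (rule base_homE)
  obtain q' where 4: "q = BaseA q'" using h(4) by (rule base_homE)
  show thesis using that 1 2 3 4 assms by simp
qed

lemma is_coequaliser_base_iff [simp]:
  "is_coequaliser (base X) (Base a) (Base b) (BaseA x) (BaseA y) (Base q) (BaseA f) \<longleftrightarrow> is_coequaliser X a b x y q f"
  unfolding is_coequaliser_def by (simp add: ball_base_cod ball_base ex1_base)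

lemma regular_epi_base_iff [simp]: "regular_epi (base X) (Base a) (Base b) (BaseA f) \<longleftrightarrow> regular_epi X a b f"
proof
  assume "regular_epi (base X) (Base a) (Base b) (BaseA f)"
  then obtain K x y where K: "is_coequaliser (base X) K (Base a) x y (Base b) (BaseA f)" by (auto simp: regular_epi_def)
  then have h: "x \<in> Hom (base X) K (Base a)" "y \<in> Hom (base X) K (Base a)" by (auto simp: is_coequaliser_def)
  obtain k x' where 1: "x = BaseA x'" "K = Base k" using h(1) by (rule base_homE)
  obtain y' where 2: "y = BaseA y'" using h(2) by (rule base_homE)
  show "regular_epi X a b f" using K unfolding 1 2 by (auto simp: regular_epi_def)
next
  assume "regular_epi X a b f"
  then obtain k x y where "is_coequaliser X k a x y b f" by (auto simp: regular_epi_def)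
  then have "is_coequaliser (base X) (Base k) (Base a) (BaseA x) (BaseA y) (Base b) (BaseA f)" by simp
  then show "regular_epi (base X) (Base a) (Base b) (BaseA f)" unfolding regular_epi_def by blast
qed

lemma is_relation_base_iff [simp]: "is_relation (base X) (Base a) (Base r) (BaseA d) (BaseA c) \<longleftrightarrow> is_relation X a r d c"
  unfolding is_relation_def jointly_monic_def by (simp add: ball_base_dom ball_base)

lemma is_relation_baseE:
  assumes "is_relation (base X) A R d c"
  obtains a r d' c' where "A = Base a" "R = Base r" "d = BaseA d'" "c = BaseA c'" "is_relation X a r d' c'"
proof -
  have h: "d \<in> Hom (base X) R A" "c \<in> Hom (base X) R A" using assms by (auto simp: is_relation_def)
  obtain r a d' where 1: "d = BaseA d'" "R = Base r" "A = Base a" using h(1) by (rule base_homE)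
  obtain c' where 2: "c = BaseA c'" using h(2) by (rule base_homE)
  show thesis using that 1 2 assms by simp
qed

lemma equiv_image_iff:
  assumes f: "inj f"
  shows "equiv (f ` A) (map_prod f f ` r) \<longleftrightarrow> equiv A r"
proof -
  have mem: "(f x, f y) \<in> map_prod f f ` r \<longleftrightarrow> (x, y) \<in> r" for x y
    using f by (auto simp: inj_eq map_prod_def)
  have im: "\<exists>x y. z = (f x, f y) \<and> (x, y) \<in> r" if "z \<in> map_prod f f ` r" for z
    using that by (auto simp: map_prod_def)
  have "refl_on (f ` A) (map_prod f f ` r) \<longleftrightarrow> refl_on A r"
    using mem by (auto simp: refl_on_def)
  moreover have "sym (map_prod f f ` r) \<longleftrightarrow> sym r"
  proof
    assume "sym (map_prod f f ` r)" then show "sym r" by (metis mem symD symI)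
  next
    assume r: "sym r"
    show "sym (map_prod f f ` r)"
      unfolding sym_def
    proof (intro allI impI)
      fix x y assume "(x, y) \<in> map_prod f f ` r"
      then obtain a b where "(x, y) = (f a, f b)" "(a, b) \<in> r" using im by blast
      then show "(y, x) \<in> map_prod f f ` r" using r mem unfolding sym_def by auto
    qed
  qed
  moreover have "trans (map_prod f f ` r) \<longleftrightarrow> trans r"
  proof
    assume "trans (map_prod f f ` r)" then show "trans r" unfolding trans_def using mem by metis
  next
    assume t: "trans r"
    show "trans (map_prod f f ` r)"
      unfolding trans_def
    proof (intro allI impI)
      fix x y z assume "(x, y) \<in> map_prod f f ` r" "(y, z) \<in> map_prod f f ` r"
      then obtain a b b' c where "x = f a" "y = f b" "(a, b) \<in> r" "y = f b'" "z = f c" "(b', c) \<in> r" using im by (metis prod.inject)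
      then show "(x, z) \<in> map_prod f f ` r" using t mem f unfolding trans_def inj_def by metis
    qed
  qed
  moreover have "map_prod f f ` r \<subseteq> f ` A \<times> f ` A \<longleftrightarrow> r \<subseteq> A \<times> A"
  proof
    assume h: "map_prod f f ` r \<subseteq> f ` A \<times> f ` A"
    show "r \<subseteq> A \<times> A"
    proof
      fix z assume "z \<in> r"
      then obtain x y where z: "z = (x, y)" "(x, y) \<in> r" by (cases z) auto
      then have "(f x, f y) \<in> f ` A \<times> f ` A" using h mem by blast
      then show "z \<in> A \<times> A" using f z by (auto simp: inj_def)
    qed
  qed (use im in fastforce)
  ultimately show ?thesis unfolding equiv_def by blast
qed

lemma is_equivalence_relation_base_iff [simp]:
  fixes X :: "('o, 'm) category"
  shows "is_equivalence_relation (base X) (Base a) (Base r) (BaseA d) (BaseA c) \<longleftrightarrow> is_equivalence_relation X a r d c"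
proof -
  have "(\<lambda>x. (BaseA d \<cdot>\<^bsub>base X\<^esub> x, BaseA c \<cdot>\<^bsub>base X\<^esub> x)) ` Hom (base X) (Base t) (Base r)
      = map_prod BaseA BaseA ` (\<lambda>x. (d \<cdot>\<^bsub>X\<^esub> x, c \<cdot>\<^bsub>X\<^esub> x)) ` Hom X t r" for t
    unfolding Hom_base image_image by (intro image_cong) auto
  moreover have "equiv (BaseA ` H) (map_prod BaseA BaseA ` r) \<longleftrightarrow> equiv H r" for H :: "'m set" and r
    by (rule equiv_image_iff) (simp add: inj_def)
  ultimately show ?thesis
    unfolding is_equivalence_relation_def by (simp add: Hom_base)
qed

lemma exact_maltsev_base:
  assumes "exact_maltsev_category X"
  shows "exact_maltsev_category (base X)"
proof -
  interpret X: exact_maltsev_category X by fact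
  interpret C: category "base X" by (rule category_base[OF X.category_axioms])
  show ?thesis
  proof
    obtain t where t: "terminal X t" using X.ex_terminal by blast
    have "terminal (base X) (Base t)"
      unfolding terminal_def
    proof (intro conjI ballI)
      show "Base t \<in> Ob (base X)" using t by (auto simp: terminal_def)
      fix A assume "A \<in> Ob (base X)"
      then obtain a where a: "A = Base a" "a \<in> Ob X" by auto
      then have "\<exists>!f. f \<in> Hom X a t \<and> True" using t by (auto simp: terminal_def)
      then show "\<exists>!f. f \<in> Hom (base X) A (Base t)" using ex1_base[of X a t "\<lambda>_. True"] a(1) by simp
    qed
    then show "\<exists>T. terminal (base X) T" by blast
  next
    fix f A D g B assume f: "f \<in> Hom (base X) A D" and g: "g \<in> Hom (base X) B D"
    obtain a d f' where 1: "f = BaseA f'" "A = Base a" "D = Base d" "f' \<in> Hom X a d" using f by (rule base_homE)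
    obtain b g' where 2: "g = BaseA g'" "B = Base b" "g' \<in> Hom X b d" using g 1(3) by (auto elim: base_homE)
    obtain t p q where "is_pullback X a b d f' g' t p q" using X.ex_pullback[OF 1(4) 2(3)] by blast
    then have "is_pullback (base X) A B D f g (Base t) (BaseA p) (BaseA q)" using 1 2 by simp
    then show "\<exists>P p q. is_pullback (base X) A B D f g P p q" by blast
  next
    fix A B f K d c assume "is_kernel_pair (base X) A B f K d c"
    then obtain a b f' t p' q' where h: "A = Base a" "B = Base b" "f = BaseA f'" "K = Base t" "d = BaseA p'" "c = BaseA q'"
      "is_kernel_pair X a b f' t p' q'" unfolding is_kernel_pair_def by (elim is_pullback_baseE) auto
    obtain Q q where "is_coequaliser X t a p' q' Q q" using X.ex_coequaliser_kernel_pair[OF h(7)] by blast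
    then have "is_coequaliser (base X) K A d c (Base Q) (BaseA q)" using h by simp
    then show "\<exists>Q q. is_coequaliser (base X) K A d c Q q" by blast
  next
    fix A B D f g P p q assume "is_pullback (base X) A B D f g P p q" and re: "regular_epi (base X) A D f"
    then show "regular_epi (base X) P B q" 
      by (elim is_pullback_baseE) (use X.regular_epi_pullback_stable in auto)
  next
    fix A R d c assume e: "is_equivalence_relation (base X) A R d c"
    then have "is_relation (base X) A R d c" by (simp add: is_equivalence_relation_def)
    then obtain a r d' c' where h: "A = Base a" "R = Base r" "d = BaseA d'" "c = BaseA c'" by (rule is_relation_baseE)
    then have "is_equivalence_relation X a r d' c'" using e by simp
    then obtain b f where "is_kernel_pair X a b f r d' c'" using X.equivalence_relation_effective by blast
    then have "is_kernel_pair (base X) A (Base b) (BaseA f) R d c" using h by (simp add: is_kernel_pair_def)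
    then show "\<exists>B f. is_kernel_pair (base X) A B f R d c" by blast
  next
    fix A R d c assume e: "is_reflexive_relation (base X) A R d c"
    then have "is_relation (base X) A R d c" by (simp add: is_reflexive_relation_def)
    then obtain a r d' c' where h: "A = Base a" "R = Base r" "d = BaseA d'" "c = BaseA c'" "is_relation X a r d' c'" by (rule is_relation_baseE)
    have "\<exists>e' \<in> Hom X a r. d' \<cdot>\<^bsub>X\<^esub> e' = Id X a \<and> c' \<cdot>\<^bsub>X\<^esub> e' = Id X a"
      using e h unfolding is_reflexive_relation_def by (simp add: bex_base)
    then have "is_reflexive_relation X a r d' c'" using h(5) by (auto simp: is_reflexive_relation_def)
    then show "is_equivalence_relation (base X) A R d c" using X.reflexive_relation_equivalence h by simp
  qed
qed

section \<open>Vertices\<close>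

text \<open>\<open>True\<close> stands for the coordinate 2 and \<open>False\<close> for the
  coordinate 1; a graph has nothing at 0.\<close>

fun gvertex :: "bool list \<Rightarrow> ('o, 'm) obj \<Rightarrow> ('o, 'm) obj" where
  "gvertex [] G = G"
| "gvertex (b # a) (RG G1 G2 d c e) = gvertex a (if b then G2 else G1)"

fun gcomponent :: "bool list \<Rightarrow> 'm arr \<Rightarrow> 'm arr" where
  "gcomponent [] m = m"
| "gcomponent (b # a) (RGA m1 m2) = gcomponent a (if b then m2 else m1)"

definition gvertex_functor :: "bool list \<Rightarrow> ('o, 'm) tfun" where
  "gvertex_functor a = \<lparr>FOb = gvertex a, FAr = (\<lambda>G H. gcomponent a)\<rparr>"

definition vertex_functor :: "nat list \<Rightarrow> ('o, 'm) tfun" where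
  "vertex_functor a = \<lparr>FOb = vertex a, FAr = (\<lambda>G H. component a)\<rparr>"

definition corner_functor :: "('o, 'm) tfun" where
  "corner_functor = \<lparr>FOb = corner, FAr = (\<lambda>G H. corner_arr)\<rparr>"

lemma functor_gvertex: "length a = n \<Longrightarrow> is_functor (RGrphN n X) (base X) (gvertex_functor a)"
proof (induction a arbitrary: n)
  case Nil
  then show ?case by (simp add: RGrphN_simps gvertex_functor_def is_functor_def)
next
  case (Cons b a)
  then obtain k where k: "n = Suc k" "length a = k" by (cases n) auto
  note f = functorD[OF Cons.IH[OF k(2)]]
  show ?case
    unfolding is_functor_def k(1) RGrphN_simps
  proof (intro conjI ballI allI)
    fix A assume "A \<in> Ob (RGrph (RGrphN k X))"
    then show "FOb (gvertex_functor (b # a)) A \<in> Ob (base X)"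
      "FAr (gvertex_functor (b # a)) A A (Id (RGrph (RGrphN k X)) A) = Id (base X) (FOb (gvertex_functor (b # a)) A)"
      using f(1,3) by (auto elim!: rgrph_obE simp: gvertex_functor_def simp del: base_simps)
  next
    fix A B m assume m: "m \<in> Hom (RGrph (RGrphN k X)) A B"
    then show "FAr (gvertex_functor (b # a)) A B m \<in> Hom (base X) (FOb (gvertex_functor (b # a)) A) (FOb (gvertex_functor (b # a)) B)"
      using f(2) by (auto elim!: rgrph_homE simp: gvertex_functor_def)
    fix E n assume n: "n \<in> Hom (RGrph (RGrphN k X)) B E"
    show "FAr (gvertex_functor (b # a)) A E (n \<cdot>\<^bsub>RGrph (RGrphN k X)\<^esub> m) =
      FAr (gvertex_functor (b # a)) B E n \<cdot>\<^bsub>base X\<^esub> FAr (gvertex_functor (b # a)) A B m"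
      using m n f(4) by (auto elim!: rgrph_homE simp: gvertex_functor_def)
  qed
qed

lemma functor_corner: "is_functor (RGrphN n X) (base X) corner_functor"
proof (induction n)
  case 0
  then show ?case
    by (auto simp: RGrphN_simps corner_functor_def is_functor_def elim!: base_homE)
next
  case (Suc k)
  note f = functorD[OF Suc]
  show ?case
    unfolding is_functor_def RGrphN_simps
  proof (intro conjI ballI allI)
    fix A assume "A \<in> Ob (RGrph (RGrphN k X))"
    then show "FOb corner_functor A \<in> Ob (base X)"
      "FAr corner_functor A A (Id (RGrph (RGrphN k X)) A) = Id (base X) (FOb corner_functor A)"
      using f(1,3) by (auto elim!: rgrph_obE simp: corner_functor_def simp del: base_simps)
  next
    fix A B m assume m: "m \<in> Hom (RGrph (RGrphN k X)) A B"
    then show "FAr corner_functor A B m \<in> Hom (base X) (FOb corner_functor A) (FOb corner_functor B)"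
      using f(2) by (auto elim!: rgrph_homE simp: corner_functor_def)
    fix E n assume n: "n \<in> Hom (RGrph (RGrphN k X)) B E"
    show "FAr corner_functor A E (n \<cdot>\<^bsub>RGrph (RGrphN k X)\<^esub> m) =
      FAr corner_functor B E n \<cdot>\<^bsub>base X\<^esub> FAr corner_functor A B m"
      using m n f(4) by (auto elim!: rgrph_homE simp: corner_functor_def)
  qed
qed

lemma functor_vertex: "length a = n \<Longrightarrow> set a \<subseteq> {0, 1, 2} \<Longrightarrow> is_functor (ForkN n X) (base X) (vertex_functor a)"
proof (induction a arbitrary: n)
  case Nil
  then show ?case by (simp add: ForkN_simps vertex_functor_def is_functor_def)
next
  case (Cons b a)
  then obtain k where k: "n = Suc k" "length a = k" by (cases n) auto
  note f = functorD[OF Cons.IH[OF k(2)]]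
  have b: "b = 0 \<or> b = 1 \<or> b = 2" and a: "set a \<subseteq> {0, 1, 2}" using Cons.prems by auto
  show ?case
    unfolding is_functor_def k(1) ForkN_simps
  proof (intro conjI ballI allI)
    fix A assume "A \<in> Ob (Fork (ForkN k X))"
    then show "FOb (vertex_functor (b # a)) A \<in> Ob (base X)"
      "FAr (vertex_functor (b # a)) A A (Id (Fork (ForkN k X)) A) = Id (base X) (FOb (vertex_functor (b # a)) A)"
      using f(1,3)[OF a] b by (auto elim!: fork_obE simp: vertex_functor_def simp del: base_simps)
  next
    fix A B m assume m: "m \<in> Hom (Fork (ForkN k X)) A B"
    then show "FAr (vertex_functor (b # a)) A B m \<in> Hom (base X) (FOb (vertex_functor (b # a)) A) (FOb (vertex_functor (b # a)) B)"
      using f(2)[OF a] b by (auto elim!: fork_homE simp: vertex_functor_def)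
    fix E n assume n: "n \<in> Hom (Fork (ForkN k X)) B E"
    show "FAr (vertex_functor (b # a)) A E (n \<cdot>\<^bsub>Fork (ForkN k X)\<^esub> m) =
      FAr (vertex_functor (b # a)) B E n \<cdot>\<^bsub>base X\<^esub> FAr (vertex_functor (b # a)) A B m"
      using m n f(4)[OF a] b by (auto elim!: fork_homE simp: vertex_functor_def)
  qed
qed

lemma gvertex_Id:
  assumes "G \<in> Ob (RGrphN n X)" "length a = n"
  shows "gvertex a G \<in> Ob (base X)" "gcomponent a (Id (RGrphN n X) G) = Id (base X) (gvertex a G)"
  using functorD(1,3)[OF functor_gvertex[OF assms(2)] assms(1)] by (simp_all add: gvertex_functor_def)

lemma gcomponent_hom: "m \<in> Hom (RGrphN n X) G H \<Longrightarrow> length a = n \<Longrightarrow> gcomponent a m \<in> Hom (base X) (gvertex a G) (gvertex a H)"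
  using functorD(2)[OF functor_gvertex] by (simp add: gvertex_functor_def)

lemma gcomponent_comp: "m \<in> Hom (RGrphN n X) G H \<Longrightarrow> k \<in> Hom (RGrphN n X) H K \<Longrightarrow> length a = n \<Longrightarrow>
    gcomponent a (k \<cdot>\<^bsub>RGrphN n X\<^esub> m) = gcomponent a k \<cdot>\<^bsub>base X\<^esub> gcomponent a m"
  using functorD(4)[OF functor_gvertex] by (simp add: gvertex_functor_def)

lemma corner_Id:
  assumes "G \<in> Ob (RGrphN n X)"
  shows "corner G \<in> Ob (base X)" "corner_arr (Id (RGrphN n X) G) = Id (base X) (corner G)"
  using functorD(1,3)[OF functor_corner assms] by (simp_all add: corner_functor_def)

lemma corner_hom: "m \<in> Hom (RGrphN n X) G H \<Longrightarrow> corner_arr m \<in> Hom (base X) (corner G) (corner H)"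
  using functorD(2)[OF functor_corner] by (simp add: corner_functor_def)

lemma corner_comp: "m \<in> Hom (RGrphN n X) G H \<Longrightarrow> k \<in> Hom (RGrphN n X) H K \<Longrightarrow>
    corner_arr (k \<cdot>\<^bsub>RGrphN n X\<^esub> m) = corner_arr k \<cdot>\<^bsub>base X\<^esub> corner_arr m"
  using functorD(4)[OF functor_corner] by (simp add: corner_functor_def)

lemma component_hom: "m \<in> Hom (ForkN n X) G H \<Longrightarrow> length a = n \<Longrightarrow> set a \<subseteq> {0, 1, 2} \<Longrightarrow>
    component a m \<in> Hom (base X) (vertex a G) (vertex a H)"
  using functorD(2)[OF functor_vertex] by (simp add: vertex_functor_def)

lemma component_comp: "m \<in> Hom (ForkN n X) G H \<Longrightarrow> k \<in> Hom (ForkN n X) H K \<Longrightarrow> length a = n \<Longrightarrow> set a \<subseteq> {0, 1, 2} \<Longrightarrow>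
    component a (k \<cdot>\<^bsub>ForkN n X\<^esub> m) = component a k \<cdot>\<^bsub>base X\<^esub> component a m"
  using functorD(4)[OF functor_vertex] by (simp add: vertex_functor_def)

lemma component_Id: "G \<in> Ob (ForkN n X) \<Longrightarrow> length a = n \<Longrightarrow> set a \<subseteq> {0, 1, 2} \<Longrightarrow>
    component a (Id (ForkN n X) G) = Id (base X) (vertex a G)"
  using functorD(3)[OF functor_vertex] by (simp add: vertex_functor_def)

section \<open>Isomorphisms are detected levelwise\<close>

lemma iso_RGrphI:
  fixes C (structure)
  assumes C: "category C" and m: "RGA m1 m2 \<in> rgrph_hom C (RG G1 G2 d c e) (RG H1 H2 d' c' e')"
    and 1: "iso C G1 H1 m1" and 2: "iso C G2 H2 m2"
  shows "iso (RGrph C) (RG G1 G2 d c e) (RG H1 H2 d' c' e') (RGA m1 m2)"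
proof -
  interpret C: category C by fact
  obtain k1 where k1: "m1 \<in> Hom C G1 H1" "k1 \<in> Hom C H1 G1" "k1 \<cdot> m1 = Id C G1" "m1 \<cdot> k1 = Id C H1" using 1 by (auto simp: iso_def)
  obtain k2 where k2: "m2 \<in> Hom C G2 H2" "k2 \<in> Hom C H2 G2" "k2 \<cdot> m2 = Id C G2" "m2 \<cdot> k2 = Id C H2" using 2 by (auto simp: iso_def)
  have o: "RG G1 G2 d c e \<in> rgrph_ob C" "RG H1 H2 d' c' e' \<in> rgrph_ob C" 
    "d' \<cdot> m2 = m1 \<cdot> d" "c' \<cdot> m2 = m1 \<cdot> c" "e' \<cdot> m1 = m2 \<cdot> e"
    using m by (auto simp: RGA_hom_iff)
  have p: "d \<in> Hom C G2 G1" "c \<in> Hom C G2 G1" "e \<in> Hom C G1 G2" "d' \<in> Hom C H2 H1" "c' \<in> Hom C H2 H1" "e' \<in> Hom C H1 H2"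
    using o(1,2) by (auto simp: RG_ob_iff)
  \<comment> \<open>Inverting both vertical sides of a commutative square gives a commutative
    square; hence the inverse components form a morphism of graphs.\<close>
  have inv: "x \<cdot> k = l \<cdot> x'" if "m \<in> Hom C G H" "k \<in> Hom C H G" "m \<cdot> k = Id C H" "n \<in> Hom C G' H'" "l \<in> Hom C H' G'" "l \<cdot> n = Id C G'"
      "x \<in> Hom C G G'" "x' \<in> Hom C H H'" "x' \<cdot> m = n \<cdot> x" for m k n l x x' G H G' H'
  proof -
    have "l \<cdot> x' = l \<cdot> (x' \<cdot> (m \<cdot> k))" using that(3) C.comp_id_right[OF that(8)] by simp
    also have "\<dots> = l \<cdot> (n \<cdot> (x \<cdot> k))" using C.square_comp[OF that(1,8,7,4,9,2)] by simp
    also have "\<dots> = x \<cdot> k"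
      using C.comp_assoc[OF C.comp_hom[OF that(2,7)] that(4,5)] that(6) C.comp_id_left[OF C.comp_hom[OF that(2,7)]] by simp
    finally show ?thesis by simp
  qed
  have "RGA k1 k2 \<in> rgrph_hom C (RG H1 H2 d' c' e') (RG G1 G2 d c e)"
    using o(1,2) k1(2) k2(2) inv[OF k2(1,2,4) k1(1,2,3) p(1) p(4) o(3)] inv[OF k2(1,2,4) k1(1,2,3) p(2) p(5) o(4)]
      inv[OF k1(1,2,4) k2(1,2,3) p(3) p(6) o(5)] by (simp add: RGA_hom_iff)
  then show ?thesis unfolding iso_def using m k1 k2 by (intro conjI bexI[of _ "RGA k1 k2"]) auto
qed

lemma iso_RGrphD:
  assumes "iso (RGrph C) (RG G1 G2 d c e) (RG H1 H2 d' c' e') (RGA m1 m2)"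
  shows "iso C G1 H1 m1" "iso C G2 H2 m2"
proof -
  obtain k where k: "k \<in> rgrph_hom C (RG H1 H2 d' c' e') (RG G1 G2 d c e)" "RGA m1 m2 \<in> rgrph_hom C (RG G1 G2 d c e) (RG H1 H2 d' c' e')"
     "k \<cdot>\<^bsub>RGrph C\<^esub> RGA m1 m2 = RGA (Id C G1) (Id C G2)" "RGA m1 m2 \<cdot>\<^bsub>RGrph C\<^esub> k = RGA (Id C H1) (Id C H2)"
    using assms by (auto simp: iso_def)
  then show "iso C G1 H1 m1" "iso C G2 H2 m2" by (auto elim!: rgrph_homE simp: iso_def)
qed

lemma iso_ForkI:
  fixes C (structure)
  assumes C: "category C" and m: "FkA m0 m1 m2 \<in> fork_hom C (Fk G0 G1 G2 d c e q) (Fk H0 H1 H2 d' c' e' q')"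
    and 0: "iso C G0 H0 m0" and 1: "iso C G1 H1 m1" and 2: "iso C G2 H2 m2"
  shows "iso (Fork C) (Fk G0 G1 G2 d c e q) (Fk H0 H1 H2 d' c' e' q') (FkA m0 m1 m2)"
proof -
  interpret C: category C by fact
  obtain k0 where k0: "m0 \<in> Hom C G0 H0" "k0 \<in> Hom C H0 G0" "k0 \<cdot> m0 = Id C G0" "m0 \<cdot> k0 = Id C H0" using 0 by (auto simp: iso_def)
  obtain k1 where k1: "m1 \<in> Hom C G1 H1" "k1 \<in> Hom C H1 G1" "k1 \<cdot> m1 = Id C G1" "m1 \<cdot> k1 = Id C H1" using 1 by (auto simp: iso_def)
  obtain k2 where k2: "m2 \<in> Hom C G2 H2" "k2 \<in> Hom C H2 G2" "k2 \<cdot> m2 = Id C G2" "m2 \<cdot> k2 = Id C H2" using 2 by (auto simp: iso_def)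
  have o: "Fk G0 G1 G2 d c e q \<in> fork_ob C" "Fk H0 H1 H2 d' c' e' q' \<in> fork_ob C" 
    "d' \<cdot> m2 = m1 \<cdot> d" "c' \<cdot> m2 = m1 \<cdot> c" "e' \<cdot> m1 = m2 \<cdot> e" "q' \<cdot> m1 = m0 \<cdot> q"
    using m by (auto simp: FkA_hom_iff)
  have p: "d \<in> Hom C G2 G1" "c \<in> Hom C G2 G1" "e \<in> Hom C G1 G2" "q \<in> Hom C G1 G0" "d' \<in> Hom C H2 H1" "c' \<in> Hom C H2 H1" "e' \<in> Hom C H1 H2" "q' \<in> Hom C H1 H0"
    using o(1,2) by (auto simp: Fk_ob_iff)
  have inv: "x \<cdot> k = l \<cdot> x'" if "m \<in> Hom C G H" "k \<in> Hom C H G" "m \<cdot> k = Id C H" "n \<in> Hom C G' H'" "l \<in> Hom C H' G'" "l \<cdot> n = Id C G'"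
      "x \<in> Hom C G G'" "x' \<in> Hom C H H'" "x' \<cdot> m = n \<cdot> x" for m k n l x x' G H G' H'
  proof -
    have "l \<cdot> x' = l \<cdot> (x' \<cdot> (m \<cdot> k))" using that(3) C.comp_id_right[OF that(8)] by simp
    also have "\<dots> = l \<cdot> (n \<cdot> (x \<cdot> k))" using C.square_comp[OF that(1,8,7,4,9,2)] by simp
    also have "\<dots> = x \<cdot> k"
      using C.comp_assoc[OF C.comp_hom[OF that(2,7)] that(4,5)] that(6) C.comp_id_left[OF C.comp_hom[OF that(2,7)]] by simp
    finally show ?thesis by simp
  qed
  have "FkA k0 k1 k2 \<in> fork_hom C (Fk H0 H1 H2 d' c' e' q') (Fk G0 G1 G2 d c e q)"
    using o(1,2) k0(2) k1(2) k2(2) inv[OF k2(1,2,4) k1(1,2,3) p(1) p(5) o(3)] inv[OF k2(1,2,4) k1(1,2,3) p(2) p(6) o(4)]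
      inv[OF k1(1,2,4) k2(1,2,3) p(3) p(7) o(5)] inv[OF k1(1,2,4) k0(1,2,3) p(4) p(8) o(6)] by (simp add: FkA_hom_iff)
  then show ?thesis unfolding iso_def using m k0 k1 k2 by (intro conjI bexI[of _ "FkA k0 k1 k2"]) auto
qed

lemma iso_RGrphN_levelwise:
  assumes X: "category X" and "m \<in> Hom (RGrphN n X) G H"
    "\<And>a. length a = n \<Longrightarrow> iso (base X) (gvertex a G) (gvertex a H) (gcomponent a m)"
  shows "iso (RGrphN n X) G H m"
  using assms(2,3)
proof (induction n arbitrary: G H m)
  case 0
  then show ?case using 0(2)[of "[]"] by (simp add: RGrphN_simps)
next
  case (Suc n)
  obtain m1 m2 G1 G2 d c e H1 H2 d' c' e' where m: "m = RGA m1 m2" "G = RG G1 G2 d c e" "H = RG H1 H2 d' c' e'"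
    "m1 \<in> Hom (RGrphN n X) G1 H1" "m2 \<in> Hom (RGrphN n X) G2 H2"
    using Suc.prems(1) by (auto simp: RGrphN_simps elim: rgrph_homE)
  have "iso (base X) (gvertex a G1) (gvertex a H1) (gcomponent a m1)" "iso (base X) (gvertex a G2) (gvertex a H2) (gcomponent a m2)"
    if "length a = n" for a
    using Suc.prems(2)[of "False # a"] Suc.prems(2)[of "True # a"] that m(1-3) by simp_all
  then have "iso (RGrphN n X) G1 H1 m1" "iso (RGrphN n X) G2 H2 m2" using Suc.IH m(4,5) by auto
  then show ?case
    using iso_RGrphI[OF category_RGrphN[OF X]] Suc.prems(1) m(1-3) by (simp add: RGrphN_simps)
qed

lemma iso_ForkN_levelwise:
  assumes X: "category X" and "m \<in> Hom (ForkN n X) G H"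
    "\<And>a. length a = n \<Longrightarrow> set a \<subseteq> {0, 1, 2} \<Longrightarrow> iso (base X) (vertex a G) (vertex a H) (component a m)"
  shows "iso (ForkN n X) G H m"
  using assms(2,3)
proof (induction n arbitrary: G H m)
  case 0
  then show ?case using 0(2)[of "[]"] by (simp add: ForkN_simps)
next
  case (Suc n)
  obtain m0 m1 m2 G0 G1 G2 d c e q H0 H1 H2 d' c' e' q' where m: "m = FkA m0 m1 m2" "G = Fk G0 G1 G2 d c e q" "H = Fk H0 H1 H2 d' c' e' q'"
    "m0 \<in> Hom (ForkN n X) G0 H0" "m1 \<in> Hom (ForkN n X) G1 H1" "m2 \<in> Hom (ForkN n X) G2 H2"
    using Suc.prems(1) by (auto simp: ForkN_simps elim: fork_homE)
  have "iso (base X) (vertex a G0) (vertex a H0) (component a m0)" "iso (base X) (vertex a G1) (vertex a H1) (component a m1)"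
    "iso (base X) (vertex a G2) (vertex a H2) (component a m2)"
    if "length a = n" "set a \<subseteq> {0, 1, 2}" for a
    using Suc.prems(2)[of "0 # a"] Suc.prems(2)[of "1 # a"] Suc.prems(2)[of "2 # a"] that m(1-3) by simp_all
  then have "iso (ForkN n X) G0 H0 m0" "iso (ForkN n X) G1 H1 m1" "iso (ForkN n X) G2 H2 m2" using Suc.IH m(4-6) by auto
  then show ?case
    using iso_ForkI[OF category_ForkN[OF X]] Suc.prems(1) m(1-3) by (simp add: ForkN_simps)
qed

section \<open>Parallelistic equivalence relations\<close>

fun rtop :: "('o, 'm) obj \<Rightarrow> ('o, 'm) obj" where "rtop (RG A R d c e) = R"
fun rd :: "('o, 'm) obj \<Rightarrow> 'm arr" where "rd (RG A R d c e) = d"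
fun rc :: "('o, 'm) obj \<Rightarrow> 'm arr" where "rc (RG A R d c e) = c"
fun re :: "('o, 'm) obj \<Rightarrow> 'm arr" where "re (RG A R d c e) = e"

locale tower = X: exact_maltsev_category X for X :: "('o, 'm) category"

sublocale tower \<subseteq> C: exact_maltsev_category "base X"
  by (rule exact_maltsev_base[OF X.exact_maltsev_category_axioms])

context tower
begin

abbreviation HomR where "HomR n \<equiv> Hom (RGrphN n X)"
abbreviation HomB where "HomB \<equiv> Hom (base X)"
abbreviation comp_base (infixl \<open>\<bullet>\<close> 70) where "g \<bullet> f \<equiv> g \<cdot>\<^bsub>base X\<^esub> f"
abbreviation IdB where "IdB \<equiv> Id (base X)"

definition rels :: "('o, 'm) obj \<Rightarrow> ('o, 'm) obj set" where
  "rels A = carrier (erel_order (base X) A)"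

definition rho :: "('o, 'm) obj \<Rightarrow> (('o, 'm) obj \<times> 'm arr \<times> 'm arr) set" where
  "rho r = C.span_rel (rtop r) (rd r) (rc r)"

lemma rels_iff: "r \<in> rels A \<longleftrightarrow> (\<exists>R d c e. r = RG A R d c e \<and> e \<in> HomB A R \<and> d \<bullet> e = IdB A \<and> c \<bullet> e = IdB A \<and>
    is_equivalence_relation (base X) A R d c)"
proof
  assume "r \<in> rels A"
  then show "\<exists>R d c e. r = RG A R d c e \<and> e \<in> HomB A R \<and> d \<bullet> e = IdB A \<and> c \<bullet> e = IdB A \<and> is_equivalence_relation (base X) A R d c"
    by (auto simp: rels_def erel_order_def ERel_def full_subcategory_def RG_ob_iff)
next
  assume "\<exists>R d c e. r = RG A R d c e \<and> e \<in> HomB A R \<and> d \<bullet> e = IdB A \<and> c \<bullet> e = IdB A \<and> is_equivalence_relation (base X) A R d c"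
  then obtain R d c e where r: "r = RG A R d c e" "e \<in> HomB A R" "d \<bullet> e = IdB A" "c \<bullet> e = IdB A" "is_equivalence_relation (base X) A R d c"
    by blast
  have "d \<in> HomB R A" "c \<in> HomB R A" "A \<in> Ob (base X)" "R \<in> Ob (base X)"
    using r(5) C.hom_ob[OF r(2)] by (auto simp: is_equivalence_relation_def is_relation_def)
  then have "r \<in> rgrph_ob (base X)" using r by (simp add: RG_ob_iff del: base_simps)
  then show "r \<in> rels A" using r by (auto simp: rels_def erel_order_def ERel_def full_subcategory_def)
qed

lemma relsD:
  assumes "r \<in> rels A"
  shows "r = RG A (rtop r) (rd r) (rc r) (re r)" "rd r \<in> HomB (rtop r) A" "rc r \<in> HomB (rtop r) A" "re r \<in> HomB A (rtop r)"
    "rd r \<bullet> re r = IdB A" "rc r \<bullet> re r = IdB A" "is_relation (base X) A (rtop r) (rd r) (rc r)"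
    "jointly_monic (base X) (rtop r) (rd r) (rc r)" "rho r \<in> C.eq_rels A" "A \<in> Ob (base X)" "rtop r \<in> Ob (base X)"
    "is_equivalence_relation (base X) A (rtop r) (rd r) (rc r)"
proof -
  obtain R d c e where r: "r = RG A R d c e" "e \<in> HomB A R" "d \<bullet> e = IdB A" "c \<bullet> e = IdB A" "is_equivalence_relation (base X) A R d c"
    using assms unfolding rels_iff by blast
  have R: "is_relation (base X) A R d c" using r(5) by (simp add: is_equivalence_relation_def)
  show "r = RG A (rtop r) (rd r) (rc r) (re r)" "re r \<in> HomB A (rtop r)" "rd r \<bullet> re r = IdB A" "rc r \<bullet> re r = IdB A"
    "is_equivalence_relation (base X) A (rtop r) (rd r) (rc r)"
    using r by simp_all
  show "rd r \<in> HomB (rtop r) A" "rc r \<in> HomB (rtop r) A" "is_relation (base X) A (rtop r) (rd r) (rc r)"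
    "jointly_monic (base X) (rtop r) (rd r) (rc r)" using R r(1) by (simp_all add: is_relation_def)
  show "A \<in> Ob (base X)" "rtop r \<in> Ob (base X)" using C.hom_ob[OF r(2)] r(1) by simp_all
  then show "rho r \<in> C.eq_rels A" unfolding C.eq_rels_iff rho_def using r by auto
qed

text \<open>The reflexivity arrow that turns a representing span into a reflexive graph is the
  factorisation of the diagonal.\<close>

lemma ex_rels:
  assumes "E \<in> C.eq_rels A"
  obtains r where "r \<in> rels A" "rho r = E"
proof -
  obtain R d c where R: "is_equivalence_relation (base X) A R d c" "E = C.span_rel R d c" and A: "A \<in> Ob (base X)"
    using assms unfolding C.eq_rels_iff by blast
  have "(A, IdB A, IdB A) \<in> E" using C.eq_rels_refl[OF assms C.id_hom[OF A]] .
  then obtain e where e: "e \<in> HomB A R" "d \<bullet> e = IdB A" "c \<bullet> e = IdB A" using R(2) by (auto simp: C.span_rel_def)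
  have "RG A R d c e \<in> rels A" unfolding rels_iff using R(1) e by blast
  then show thesis using that R(2) by (simp add: rho_def)
qed

text \<open>A representing object is chosen; only its set of pairs is ever used. As a consequence, a
  box depends on choices and is meaningful up to isomorphism only.\<close>

definition lift :: "('o, 'm) obj \<Rightarrow> ('o, 'm) obj \<Rightarrow> ('o, 'm) obj" where
  "lift r s = (SOME t. t \<in> rels (rtop r) \<and> rho t = C.lift_rel (rtop r) (rd r) (rc r) (rho s))"

lemma lift:
  assumes "r \<in> rels A" "s \<in> rels A"
  shows "lift r s \<in> rels (rtop r)" "rho (lift r s) = C.lift_rel (rtop r) (rd r) (rc r) (rho s)"
proof -
  have "C.lift_rel (rtop r) (rd r) (rc r) (rho s) \<in> C.eq_rels (rtop r)"
    using C.lift_rel_in relsD[OF assms(1)] relsD[OF assms(2)] by blast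
  then obtain t where "t \<in> rels (rtop r)" "rho t = C.lift_rel (rtop r) (rd r) (rc r) (rho s)" by (rule ex_rels)
  then have "lift r s \<in> rels (rtop r) \<and> rho (lift r s) = C.lift_rel (rtop r) (rd r) (rc r) (rho s)"
    unfolding lift_def by (intro someI[of "\<lambda>t. t \<in> rels (rtop r) \<and> rho t = C.lift_rel (rtop r) (rd r) (rc r) (rho s)"]) simp
  then show "lift r s \<in> rels (rtop r)" "rho (lift r s) = C.lift_rel (rtop r) (rd r) (rc r) (rho s)" by auto
qed

lemma lift_rels: "r \<in> rels A \<Longrightarrow> set rs \<subseteq> rels A \<Longrightarrow> set (map (lift r) rs) \<subseteq> rels (rtop r)"
  using lift by auto

text \<open>A definite description, because \<open>Box\<close> has to be defined before the
  universal property that yields existence and uniqueness of these arrows can be stated.\<close>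

definition bar :: "nat \<Rightarrow> ('o, 'm) obj \<Rightarrow> ('o, 'm) obj \<Rightarrow> 'm arr \<Rightarrow> 'm arr" where
  "bar n T B f = (THE m. m \<in> HomR n T B \<and> corner_arr m = f)"

text \<open>
  \<open>Box A [R\<^sub>0, \<dots>, R\<^sub>k]\<close> is the largest \<open>(k + 1)\<close>-fold equivalence relation on the \<open>R\<^sub>i\<close>: in the outermost
  direction it is the equivalence relation \<open>R\<^sub>0\<close> on \<open>A\<close>, where \<open>R\<^sub>0\<close> carries the relations that hold
  between both pairs of endpoints.
\<close>

fun Box :: "('o, 'm) obj \<Rightarrow> ('o, 'm) obj list \<Rightarrow> ('o, 'm) obj" where
  "Box A [] = A"
| "Box A (r # rs) = RG (Box A rs) (Box (rtop r) (map (lift r) rs))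
    (bar (length rs) (Box (rtop r) (map (lift r) rs)) (Box A rs) (rd r))
    (bar (length rs) (Box (rtop r) (map (lift r) rs)) (Box A rs) (rc r))
    (bar (length rs) (Box A rs) (Box (rtop r) (map (lift r) rs)) (re r))"

text \<open>The arrow \<open>f\<close> out of the corner of \<open>T\<close> sends the underlying
  graph of \<open>T\<close> in direction \<open>i\<close> into the \<open>i\<close>-th relation. By
  \<open>box_universal_Box\<close> this is the condition for \<open>f\<close> to extend to a
  morphism into the box.\<close>

fun compat :: "('o, 'm) obj \<Rightarrow> ('o, 'm) obj list \<Rightarrow> 'm arr \<Rightarrow> bool" where
  "compat T [] f \<longleftrightarrow> True"
| "compat (RG T1 T2 d c e) (r # rs) f \<longleftrightarrow>
    (corner T2, f \<bullet> corner_arr d, f \<bullet> corner_arr c) \<in> rho r \<and> compat T1 rs f"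

section \<open>The universal property of the box\<close>

lemma RGrphN_SucE:
  assumes "T \<in> Ob (RGrphN (Suc n) X)"
  obtains T1 T2 d c e where "T = RG T1 T2 d c e" "T1 \<in> Ob (RGrphN n X)" "T2 \<in> Ob (RGrphN n X)"
    "d \<in> HomR n T2 T1" "c \<in> HomR n T2 T1" "e \<in> HomR n T1 T2"
    "d \<cdot>\<^bsub>RGrphN n X\<^esub> e = Id (RGrphN n X) T1" "c \<cdot>\<^bsub>RGrphN n X\<^esub> e = Id (RGrphN n X) T1"
  using assms by (auto simp: RGrphN_simps elim: rgrph_obE)

lemma RGrphN_Suc_homE:
  assumes "m \<in> HomR (Suc n) T S"
  obtains m1 m2 T1 T2 d c e S1 S2 d' c' e' where "m = RGA m1 m2" "T = RG T1 T2 d c e" "S = RG S1 S2 d' c' e'"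
    "m1 \<in> HomR n T1 S1" "m2 \<in> HomR n T2 S2"
    "d \<in> HomR n T2 T1" "c \<in> HomR n T2 T1" "e \<in> HomR n T1 T2"
    "d' \<in> HomR n S2 S1" "c' \<in> HomR n S2 S1" "e' \<in> HomR n S1 S2"
    "d' \<cdot>\<^bsub>RGrphN n X\<^esub> m2 = m1 \<cdot>\<^bsub>RGrphN n X\<^esub> d" "c' \<cdot>\<^bsub>RGrphN n X\<^esub> m2 = m1 \<cdot>\<^bsub>RGrphN n X\<^esub> c" "e' \<cdot>\<^bsub>RGrphN n X\<^esub> m1 = m2 \<cdot>\<^bsub>RGrphN n X\<^esub> e"
  using assms unfolding RGrphN_simps RGrph_simps by (elim rgrph_homE) (simp add: RG_ob_iff)

lemma corner_square:
  assumes "m \<in> HomR n A B" "k \<in> HomR n B D" "m' \<in> HomR n A B'" "k' \<in> HomR n B' D"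
    "k \<cdot>\<^bsub>RGrphN n X\<^esub> m = k' \<cdot>\<^bsub>RGrphN n X\<^esub> m'"
  shows "corner_arr k \<bullet> corner_arr m = corner_arr k' \<bullet> corner_arr m'"
  using corner_comp[OF assms(1,2)] corner_comp[OF assms(3,4)] assms(5) by simp

lemma compat_precomp:
  assumes "m \<in> HomR (length rs) T' T" "set rs \<subseteq> rels A" "f \<in> HomB (corner T) A" "compat T rs f"
  shows "compat T' rs (f \<bullet> corner_arr m)"
  using assms
proof (induction rs arbitrary: T T' m)
  case (Cons r rs)
  from Cons.prems(1) have "m \<in> Hom (RGrphN (Suc (length rs)) X) T' T" by simp
  then obtain m1 m2 T1 T2 d c e S1 S2 d' c' e' where m: "m = RGA m1 m2" "T' = RG T1 T2 d c e" "T = RG S1 S2 d' c' e'"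
    "m1 \<in> HomR (length rs) T1 S1" "m2 \<in> HomR (length rs) T2 S2"
    "d \<in> HomR (length rs) T2 T1" "c \<in> HomR (length rs) T2 T1" "e \<in> HomR (length rs) T1 T2"
    "d' \<in> HomR (length rs) S2 S1" "c' \<in> HomR (length rs) S2 S1" "e' \<in> HomR (length rs) S1 S2"
    "d' \<cdot>\<^bsub>RGrphN (length rs) X\<^esub> m2 = m1 \<cdot>\<^bsub>RGrphN (length rs) X\<^esub> d" "c' \<cdot>\<^bsub>RGrphN (length rs) X\<^esub> m2 = m1 \<cdot>\<^bsub>RGrphN (length rs) X\<^esub> c"
    by (rule RGrphN_Suc_homE)
  have f: "f \<in> HomB (corner S1) A" using Cons.prems(3) m(3) by simp
  note h = corner_hom[OF m(4)] corner_hom[OF m(5)] corner_hom[OF m(6)] corner_hom[OF m(7)] corner_hom[OF m(9)] corner_hom[OF m(10)]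
  have r: "rho r \<in> C.eq_rels A" using relsD(9) Cons.prems(2) by auto
  have "(corner S2, f \<bullet> corner_arr d', f \<bullet> corner_arr c') \<in> rho r" using Cons.prems(4) m(3) by simp
  then have "(corner T2, (f \<bullet> corner_arr d') \<bullet> corner_arr m2, (f \<bullet> corner_arr c') \<bullet> corner_arr m2) \<in> rho r"
    using C.eq_rels_stable[OF r _ h(2)] by blast
  moreover have "(f \<bullet> corner_arr d') \<bullet> corner_arr m2 = (f \<bullet> corner_arr m1) \<bullet> corner_arr d"
    using C.comp_assoc[OF h(2,5) f] C.comp_assoc[OF h(3,1) f] corner_square[OF m(5,9,6,4,12)] by simp
  moreover have "(f \<bullet> corner_arr c') \<bullet> corner_arr m2 = (f \<bullet> corner_arr m1) \<bullet> corner_arr c"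
    using C.comp_assoc[OF h(2,6) f] C.comp_assoc[OF h(4,1) f] corner_square[OF m(5,10,7,4,13)] by simp
  moreover have "compat T1 rs (f \<bullet> corner_arr m1)"
    using Cons.IH[OF m(4)] Cons.prems f m(3) by simp
  ultimately show ?case using m(1,2) by simp
qed simp

text \<open>A map into the top level of a box amounts to two maps into its bottom level whose
  corners are related by \<open>r\<close>; this is the part concerning the remaining
  relations.\<close>

lemma compat_lift:
  assumes "T \<in> Ob (RGrphN (length rs) X)" "r \<in> rels A" "set rs \<subseteq> rels A" "g \<in> HomB (corner T) (rtop r)"
  shows "compat T (map (lift r) rs) g \<longleftrightarrow> compat T rs (rd r \<bullet> g) \<and> compat T rs (rc r \<bullet> g)"
  using assms(1,3,4)
proof (induction rs arbitrary: T)
  case (Cons s rs)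
  from Cons.prems(1) have "T \<in> Ob (RGrphN (Suc (length rs)) X)" by simp
  then obtain T1 T2 d c e where T: "T = RG T1 T2 d c e" "T1 \<in> Ob (RGrphN (length rs) X)"
    "d \<in> HomR (length rs) T2 T1" "c \<in> HomR (length rs) T2 T1" by (rule RGrphN_SucE)
  have g: "g \<in> HomB (corner T1) (rtop r)" using Cons.prems(3) T(1) by simp
  note h = corner_hom[OF T(3)] corner_hom[OF T(4)]
  note r = relsD[OF assms(2)]
  have s: "s \<in> rels A" using Cons.prems(2) by simp
  have "(corner T2, g \<bullet> corner_arr d, g \<bullet> corner_arr c) \<in> rho (lift r s) \<longleftrightarrow>
    (corner T2, (rd r \<bullet> g) \<bullet> corner_arr d, (rd r \<bullet> g) \<bullet> corner_arr c) \<in> rho s \<and>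
    (corner T2, (rc r \<bullet> g) \<bullet> corner_arr d, (rc r \<bullet> g) \<bullet> corner_arr c) \<in> rho s"
    unfolding lift(2)[OF assms(2) s] C.lift_rel_iff
    using C.comp_assoc[OF h(1) g r(2)] C.comp_assoc[OF h(2) g r(2)] C.comp_assoc[OF h(1) g r(3)] C.comp_assoc[OF h(2) g r(3)]
      C.comp_hom[OF h(1) g] C.comp_hom[OF h(2) g] by simp
  then show ?case using Cons.IH[OF T(2) _ g] Cons.prems(2) T(1) by auto
qed simp

text \<open>Morphisms into the box are the compatible arrows out of the corner. The test objects are
  all \<open>n\<close>-fold reflexive graphs, so the property is available for the box itself before
  it is known to be an \<open>n\<close>-fold equivalence relation.\<close>

definition box_universal :: "('o, 'm) obj \<Rightarrow> ('o, 'm) obj list \<Rightarrow> ('o, 'm) obj \<Rightarrow> bool" where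
  "box_universal A rs B \<longleftrightarrow> B \<in> Ob (RGrphN (length rs) X) \<and> corner B = A \<and>
    (\<forall>T. \<forall>m \<in> HomR (length rs) T B. compat T rs (corner_arr m)) \<and>
    (\<forall>T \<in> Ob (RGrphN (length rs) X). \<forall>f \<in> HomB (corner T) A. compat T rs f \<longrightarrow>
      (\<exists>m \<in> HomR (length rs) T B. corner_arr m = f)) \<and>
    (\<forall>T. \<forall>m \<in> HomR (length rs) T B. \<forall>m' \<in> HomR (length rs) T B.
      corner_arr m = corner_arr m' \<longrightarrow> m = m')"

lemma box_universalD:
  assumes "box_universal A rs B"
  shows "B \<in> Ob (RGrphN (length rs) X)" "corner B = A"
    "m \<in> HomR (length rs) T B \<Longrightarrow> compat T rs (corner_arr m)"
    "T \<in> Ob (RGrphN (length rs) X) \<Longrightarrow> f \<in> HomB (corner T) A \<Longrightarrow> compat T rs f \<Longrightarrow>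
      \<exists>m \<in> HomR (length rs) T B. corner_arr m = f"
    "m \<in> HomR (length rs) T B \<Longrightarrow> m' \<in> HomR (length rs) T B \<Longrightarrow> corner_arr m = corner_arr m' \<Longrightarrow> m = m'"
  using assms unfolding box_universal_def by blast+

lemma box_universal_compat_Id:
  assumes "box_universal A rs B"
  shows "compat B rs (IdB A)"
proof -
  interpret R: category "RGrphN (length rs) X" by (rule category_RGrphN[OF X.category_axioms])
  note b = box_universalD[OF assms]
  show ?thesis using b(3)[OF R.id_hom[OF b(1)]] corner_Id(2)[OF b(1)] b(2) by simp
qed

lemma bar:
  assumes B: "box_universal A rs B" and f: "T \<in> Ob (RGrphN (length rs) X)" "f \<in> HomB (corner T) A" "compat T rs f"
  shows "bar (length rs) T B f \<in> HomR (length rs) T B" "corner_arr (bar (length rs) T B f) = f"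
proof -
  note b = box_universalD[OF B]
  obtain m where m: "m \<in> HomR (length rs) T B" "corner_arr m = f" using b(4)[OF f] by blast
  have "bar (length rs) T B f = m"
    unfolding bar_def using m b(5) by (intro the_equality) auto
  then show "bar (length rs) T B f \<in> HomR (length rs) T B" "corner_arr (bar (length rs) T B f) = f" using m by auto
qed

lemma Box_arrows:
  assumes r: "r \<in> rels A" and rs: "set rs \<subseteq> rels A"
    and 1: "box_universal A rs B1" and 2: "box_universal (rtop r) (map (lift r) rs) B2"
  shows "bar (length rs) B2 B1 (rd r) \<in> HomR (length rs) B2 B1" "corner_arr (bar (length rs) B2 B1 (rd r)) = rd r"
    "bar (length rs) B2 B1 (rc r) \<in> HomR (length rs) B2 B1" "corner_arr (bar (length rs) B2 B1 (rc r)) = rc r"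
    "bar (length rs) B1 B2 (re r) \<in> HomR (length rs) B1 B2" "corner_arr (bar (length rs) B1 B2 (re r)) = re r"
proof -
  note r' = relsD[OF r] note b1 = box_universalD[OF 1]
  have b2: "B2 \<in> Ob (RGrphN (length rs) X)" "corner B2 = rtop r" using box_universalD(1,2)[OF 2] by simp_all
  have "compat B2 rs (rd r)" "compat B2 rs (rc r)"
    using box_universal_compat_Id[OF 2] compat_lift[OF b2(1) r rs] b2(2) C.id_hom[OF r'(11)] C.comp_id_right r'(2,3) by metis+
  then show "bar (length rs) B2 B1 (rd r) \<in> HomR (length rs) B2 B1" "corner_arr (bar (length rs) B2 B1 (rd r)) = rd r"
    "bar (length rs) B2 B1 (rc r) \<in> HomR (length rs) B2 B1" "corner_arr (bar (length rs) B2 B1 (rc r)) = rc r"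
    using bar[OF 1 b2(1)] b2(2) r' by auto
  have "compat B1 (map (lift r) rs) (re r)"
    using compat_lift[OF b1(1) r rs] b1(2) r'(4,5,6) box_universal_compat_Id[OF 1] by simp
  then show "bar (length rs) B1 B2 (re r) \<in> HomR (length rs) B1 B2" "corner_arr (bar (length rs) B1 B2 (re r)) = re r"
    using bar[OF 2, of B1 "re r"] b1(1,2) r'(4) by simp_all
qed

text \<open>The recursion of \<open>Box\<close> matches that of \<open>compat\<close>: the bottom
  component of a morphism is governed by the box of the remaining relations, the top component by
  the box of their lifts. Structure arrows and their equations come from these two universal
  properties.\<close>

lemma box_universal_Box: "A \<in> Ob (base X) \<Longrightarrow> set rs \<subseteq> rels A \<Longrightarrow> box_universal A rs (Box A rs)"
proof (induction A rs rule: Box.induct)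
  case (1 A)
  have "corner_arr m = m" if "m \<in> HomB T T'" for m T T' using that by (auto elim: base_homE)
  moreover have "corner T = T" if "T \<in> Ob (base X)" for T using that by auto
  ultimately show ?case unfolding box_universal_def using 1 by (auto simp: RGrphN_simps simp del: base_simps)
next
  case (2 A r rs)
  let ?n = "length rs"
  define B1 B2 where "B1 = Box A rs" and "B2 = Box (rtop r) (map (lift r) rs)"
  have r: "r \<in> rels A" and rs: "set rs \<subseteq> rels A" using 2 by auto
  note r' = relsD[OF r]
  have U1: "box_universal A rs B1" unfolding B1_def using 2 by simp
  have U2: "box_universal (rtop r) (map (lift r) rs) B2" unfolding B2_def using 2 r'(11) lift_rels[OF r rs] by simp
  note b1 = box_universalD[OF U1] note b2 = box_universalD[OF U2, simplified length_map]
  interpret R: category "RGrphN ?n X" by (rule category_RGrphN[OF X.category_axioms])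
  define \<delta> \<gamma> \<epsilon> where "\<delta> = bar ?n B2 B1 (rd r)" and "\<gamma> = bar ?n B2 B1 (rc r)" and "\<epsilon> = bar ?n B1 B2 (re r)"
  note a = Box_arrows[OF r rs U1 U2, folded \<delta>_def \<gamma>_def \<epsilon>_def]
  have Box: "Box A (r # rs) = RG B1 B2 \<delta> \<gamma> \<epsilon>" by (simp add: B1_def B2_def \<delta>_def \<gamma>_def \<epsilon>_def)
  have "\<delta> \<cdot>\<^bsub>RGrphN ?n X\<^esub> \<epsilon> = Id (RGrphN ?n X) B1"
    using corner_comp[OF a(5,1)] a r' corner_Id(2)[OF b1(1)] b1(2) by (intro b1(5)[OF R.comp_hom[OF a(5,1)] R.id_hom[OF b1(1)]]) simp
  moreover have "\<gamma> \<cdot>\<^bsub>RGrphN ?n X\<^esub> \<epsilon> = Id (RGrphN ?n X) B1"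
    using corner_comp[OF a(5,3)] a r' corner_Id(2)[OF b1(1)] b1(2) by (intro b1(5)[OF R.comp_hom[OF a(5,3)] R.id_hom[OF b1(1)]]) simp
  ultimately have ob: "RG B1 B2 \<delta> \<gamma> \<epsilon> \<in> rgrph_ob (RGrphN ?n X)" using b1(1) b2(1) a by (simp add: RG_ob_iff)
  have homE: "\<exists>m1 m2 T1 T2 x y z. m = RGA m1 m2 \<and> T = RG T1 T2 x y z \<and> m1 \<in> Hom (RGrphN ?n X) T1 B1 \<and> m2 \<in> Hom (RGrphN ?n X) T2 B2 \<and>
      x \<in> Hom (RGrphN ?n X) T2 T1 \<and> y \<in> Hom (RGrphN ?n X) T2 T1 \<and>
      rd r \<bullet> corner_arr m2 = corner_arr m1 \<bullet> corner_arr x \<and> rc r \<bullet> corner_arr m2 = corner_arr m1 \<bullet> corner_arr y"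
    if m: "m \<in> HomR (Suc ?n) T (RG B1 B2 \<delta> \<gamma> \<epsilon>)" for m T
  proof -
    obtain m1 m2 T1 T2 x y z where m': "m = RGA m1 m2" "T = RG T1 T2 x y z"
      "m1 \<in> Hom (RGrphN ?n X) T1 B1" "m2 \<in> Hom (RGrphN ?n X) T2 B2" "x \<in> Hom (RGrphN ?n X) T2 T1" "y \<in> Hom (RGrphN ?n X) T2 T1"
      "\<delta> \<cdot>\<^bsub>RGrphN ?n X\<^esub> m2 = m1 \<cdot>\<^bsub>RGrphN ?n X\<^esub> x" "\<gamma> \<cdot>\<^bsub>RGrphN ?n X\<^esub> m2 = m1 \<cdot>\<^bsub>RGrphN ?n X\<^esub> y"
      using m by (elim RGrphN_Suc_homE) simp
    show ?thesis using m' corner_square[OF m'(4) a(1) m'(5,3,7)] corner_square[OF m'(4) a(3) m'(6,3,8)] a(2,4) by auto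
  qed
  have jm: "g = g'" if "g \<in> HomB T (rtop r)" "g' \<in> HomB T (rtop r)" "rd r \<bullet> g = rd r \<bullet> g'" "rc r \<bullet> g = rc r \<bullet> g'" for g g' T
    using C.jointly_monicD[OF r'(8) that] .
  show ?case
    unfolding box_universal_def Box list.size(4) add_Suc_right add_0_right
  proof (intro conjI allI ballI impI)
    show "RG B1 B2 \<delta> \<gamma> \<epsilon> \<in> Ob (RGrphN (Suc ?n) X)" using ob by (simp add: RGrphN_simps)
    show "corner (RG B1 B2 \<delta> \<gamma> \<epsilon>) = A" using b1(2) by simp
  next
    fix T m assume "m \<in> HomR (Suc ?n) T (RG B1 B2 \<delta> \<gamma> \<epsilon>)"
    then obtain m1 m2 T1 T2 x y z where m: "m = RGA m1 m2" "T = RG T1 T2 x y z" "m1 \<in> Hom (RGrphN ?n X) T1 B1" "m2 \<in> Hom (RGrphN ?n X) T2 B2"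
      "rd r \<bullet> corner_arr m2 = corner_arr m1 \<bullet> corner_arr x" "rc r \<bullet> corner_arr m2 = corner_arr m1 \<bullet> corner_arr y"
      using homE by blast
    have "corner_arr m2 \<in> HomB (corner T2) (rtop r)" using corner_hom[OF m(4)] b2(2) by simp
    then have "(corner T2, corner_arr m1 \<bullet> corner_arr x, corner_arr m1 \<bullet> corner_arr y) \<in> rho r"
      unfolding rho_def C.span_rel_def using m(5,6)[symmetric] by blast
    then show "compat T (r # rs) (corner_arr m)" using m(1,2) b1(3)[OF m(3)] by simp
  next
    fix T m m' assume h: "m \<in> HomR (Suc ?n) T (RG B1 B2 \<delta> \<gamma> \<epsilon>)" and h': "m' \<in> HomR (Suc ?n) T (RG B1 B2 \<delta> \<gamma> \<epsilon>)"
      and eq: "corner_arr m = corner_arr m'"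
    obtain m1 m2 T1 T2 x y z where m: "m = RGA m1 m2" "T = RG T1 T2 x y z" "m1 \<in> Hom (RGrphN ?n X) T1 B1" "m2 \<in> Hom (RGrphN ?n X) T2 B2"
      "rd r \<bullet> corner_arr m2 = corner_arr m1 \<bullet> corner_arr x" "rc r \<bullet> corner_arr m2 = corner_arr m1 \<bullet> corner_arr y"
      using homE[OF h] by blast
    obtain m1' m2' where m': "m' = RGA m1' m2'" "m1' \<in> Hom (RGrphN ?n X) T1 B1" "m2' \<in> Hom (RGrphN ?n X) T2 B2"
      "rd r \<bullet> corner_arr m2' = corner_arr m1' \<bullet> corner_arr x" "rc r \<bullet> corner_arr m2' = corner_arr m1' \<bullet> corner_arr y"
      using homE[OF h'] m(2) by auto
    have e: "corner_arr m1 = corner_arr m1'" using eq m(1) m'(1) by simp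
    then have 1: "m1 = m1'" using b1(5)[OF m(3) m'(2)] by blast
    have "corner_arr m2 = corner_arr m2'"
      using jm[of "corner_arr m2" "corner T2" "corner_arr m2'"] corner_hom[OF m(4)] corner_hom[OF m'(3)] b2(2) m(5,6) m'(4,5) e by simp
    then show "m = m'" using 1 b2(5)[OF m(4) m'(3)] m(1) m'(1) by simp
  next
    fix T f assume T: "T \<in> Ob (RGrphN (Suc ?n) X)" and f: "f \<in> HomB (corner T) A" and c: "compat T (r # rs) f"
    obtain T1 T2 x y z where T': "T = RG T1 T2 x y z" "T1 \<in> Ob (RGrphN ?n X)" "T2 \<in> Ob (RGrphN ?n X)"
      "x \<in> Hom (RGrphN ?n X) T2 T1" "y \<in> Hom (RGrphN ?n X) T2 T1" "z \<in> Hom (RGrphN ?n X) T1 T2"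
      "x \<cdot>\<^bsub>RGrphN ?n X\<^esub> z = Id (RGrphN ?n X) T1" "y \<cdot>\<^bsub>RGrphN ?n X\<^esub> z = Id (RGrphN ?n X) T1"
      using T by (rule RGrphN_SucE)
    have f': "f \<in> HomB (corner T1) A" and c1: "(corner T2, f \<bullet> corner_arr x, f \<bullet> corner_arr y) \<in> rho r" and c2: "compat T1 rs f"
      using f c T'(1) by simp_all
    \<comment> \<open>The top component has to lie over the pair of \<open>f\<close> composed with
      the two structure arrows; \<open>g\<close> is the factorisation of this pair through
      \<open>r\<close>, and it becomes the corner of \<open>m2\<close>.\<close>
    obtain g where g: "g \<in> HomB (corner T2) (rtop r)" "rd r \<bullet> g = f \<bullet> corner_arr x" "rc r \<bullet> g = f \<bullet> corner_arr y"
      using c1 by (auto simp: rho_def C.span_rel_def)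
    obtain m1 where m1: "m1 \<in> Hom (RGrphN ?n X) T1 B1" "corner_arr m1 = f" using b1(4)[OF T'(2) f' c2] by blast
    have "compat T2 (map (lift r) rs) g"
      using compat_lift[OF T'(3) r rs g(1)] compat_precomp[OF T'(4) rs f' c2] compat_precomp[OF T'(5) rs f' c2] g(2,3) by simp
    then obtain m2 where m2: "m2 \<in> Hom (RGrphN ?n X) T2 B2" "corner_arr m2 = g" using b2(4)[OF T'(3) g(1)] by blast
    have 1: "\<delta> \<cdot>\<^bsub>RGrphN ?n X\<^esub> m2 = m1 \<cdot>\<^bsub>RGrphN ?n X\<^esub> x"
      using corner_comp[OF m2(1) a(1)] corner_comp[OF T'(4) m1(1)] a(2) m1(2) m2(2) g(2)
      by (intro b1(5)[OF R.comp_hom[OF m2(1) a(1)] R.comp_hom[OF T'(4) m1(1)]]) simp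
    have 2: "\<gamma> \<cdot>\<^bsub>RGrphN ?n X\<^esub> m2 = m1 \<cdot>\<^bsub>RGrphN ?n X\<^esub> y"
      using corner_comp[OF m2(1) a(3)] corner_comp[OF T'(5) m1(1)] a(4) m1(2) m2(2) g(3)
      by (intro b1(5)[OF R.comp_hom[OF m2(1) a(3)] R.comp_hom[OF T'(5) m1(1)]]) simp
    have zh: "corner_arr z \<in> HomB (corner T1) (corner T2)" "corner_arr x \<in> HomB (corner T2) (corner T1)" "corner_arr y \<in> HomB (corner T2) (corner T1)"
      using corner_hom T' by blast+
    have xz: "corner_arr x \<bullet> corner_arr z = IdB (corner T1)" "corner_arr y \<bullet> corner_arr z = IdB (corner T1)"
      using corner_comp[OF T'(6,4)] corner_comp[OF T'(6,5)] T'(7,8) corner_Id(2)[OF T'(2)] by simp_all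
    \<comment> \<open>Compatibility with the reflexivity arrows is automatic, since an arrow into
      \<open>r\<close> is determined by its two endpoints.\<close>
    have "re r \<bullet> f = g \<bullet> corner_arr z"
    proof (rule jm[OF C.comp_hom[OF f' r'(4)] C.comp_hom[OF zh(1) g(1)]])
      show "rd r \<bullet> (re r \<bullet> f) = rd r \<bullet> (g \<bullet> corner_arr z)"
        using C.comp_assoc[OF f' r'(4,2)] r'(5) C.comp_id_left[OF f'] C.comp_assoc[OF zh(1) g(1) r'(2)] g(2) C.comp_assoc[OF zh(1,2) f'] xz(1) C.comp_id_right[OF f'] by simp
      show "rc r \<bullet> (re r \<bullet> f) = rc r \<bullet> (g \<bullet> corner_arr z)"
        using C.comp_assoc[OF f' r'(4,3)] r'(6) C.comp_id_left[OF f'] C.comp_assoc[OF zh(1) g(1) r'(3)] g(3) C.comp_assoc[OF zh(1,3) f'] xz(2) C.comp_id_right[OF f'] by simp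
    qed
    then have 3: "\<epsilon> \<cdot>\<^bsub>RGrphN ?n X\<^esub> m1 = m2 \<cdot>\<^bsub>RGrphN ?n X\<^esub> z"
      using corner_comp[OF m1(1) a(5)] corner_comp[OF T'(6) m2(1)] a(6) m1(2) m2(2)
      by (intro b2(5)[OF R.comp_hom[OF m1(1) a(5)] R.comp_hom[OF T'(6) m2(1)]]) simp
    have "RGA m1 m2 \<in> HomR (Suc ?n) T (RG B1 B2 \<delta> \<gamma> \<epsilon>)"
      using T T'(1) ob m1(1) m2(1) 1 2 3 by (simp add: RGrphN_simps RGA_hom_iff)
    then show "\<exists>m \<in> HomR (Suc ?n) T (RG B1 B2 \<delta> \<gamma> \<epsilon>). corner_arr m = f"
      using m1(2) by (intro bexI[of _ "RGA m1 m2"]) auto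
  qed
qed

end

section \<open>The box is an \<open>n\<close>-fold equivalence relation\<close>

lemma ERelN_simps: "ERelN 0 X = base X" "ERelN (Suc n) X = ERel (ERelN n X)"
  by (simp_all add: ERelN_def)

lemma ERelN_full:
  "Ob (ERelN n X) \<subseteq> Ob (RGrphN n X) \<and>
   (\<forall>A B. Hom (ERelN n X) A B = {f \<in> Hom (RGrphN n X) A B. A \<in> Ob (ERelN n X) \<and> B \<in> Ob (ERelN n X)}) \<and>
   Id (ERelN n X) = Id (RGrphN n X) \<and> Comp (ERelN n X) = Comp (RGrphN n X)" if "category X"
proof (induction n)
  case 0
  interpret C: category "base X" by (rule category_base[OF that])
  show ?case using C.hom_ob by (auto simp: ERelN_simps RGrphN_simps simp del: base_simps)
next
  case (Suc n)
  let ?E = "ERelN n X" and ?C = "RGrphN n X"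
  have ob: "G \<in> rgrph_ob ?E \<longleftrightarrow> (\<exists>G1 G2 d c e. G = RG G1 G2 d c e \<and> G \<in> rgrph_ob ?C \<and> G1 \<in> Ob ?E \<and> G2 \<in> Ob ?E)" for G
    using Suc by (auto simp: rgrph_ob_def)
  have hom: "f \<in> rgrph_hom ?E G H \<longleftrightarrow> f \<in> rgrph_hom ?C G H \<and> G \<in> rgrph_ob ?E \<and> H \<in> rgrph_ob ?E" for f G H
    using Suc ob unfolding rgrph_hom_def by auto
  have Id: "Id (RGrph ?E) = Id (RGrph ?C)"
    using Suc by (intro ext) (simp add: RGrph_def split: obj.split)
  have Comp: "Comp (RGrph ?E) = Comp (RGrph ?C)"
    using Suc by (intro ext) (simp add: RGrph_def split: arr.split)
  show ?case
    unfolding ERelN_simps RGrphN_simps ERel_def full_subcategory_def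
    using ob hom Id Comp by auto
qed

lemma ERelN_Suc_iff:
  assumes "category X"
  shows "RG G1 G2 d c e \<in> Ob (ERelN (Suc n) X) \<longleftrightarrow> RG G1 G2 d c e \<in> Ob (RGrphN (Suc n) X) \<and>
    G1 \<in> Ob (ERelN n X) \<and> G2 \<in> Ob (ERelN n X) \<and> is_equivalence_relation (ERelN n X) G1 G2 d c"
  using ERelN_full[OF assms, of n]
  by (auto simp: ERelN_simps RGrphN_simps ERel_def full_subcategory_def RG_ob_iff)

text \<open>At each level the top component is determined by the bottom one, because the structure
  arrows of an equivalence relation are jointly monic.\<close>

lemma ERelN_corner_faithful:
  assumes X: "category X"
    and "m \<in> Hom (ERelN n X) T E" "m' \<in> Hom (ERelN n X) T E" "corner_arr m = corner_arr m'"
  shows "m = m'"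
  using assms(2-4)
proof (induction n arbitrary: T E m m')
  case 0
  have "corner_arr m = m" if "m \<in> Hom (base X) T E" for m using that by (auto elim: base_homE)
  then show ?case using 0 by (simp add: ERelN_simps)
next
  case (Suc n)
  note full = ERelN_full[OF X]
  have E: "E \<in> Ob (ERelN (Suc n) X)" "T \<in> Ob (ERelN (Suc n) X)" using Suc.prems(1) full[of "Suc n"] by auto
  have h: "m \<in> rgrph_hom (RGrphN n X) T E" "m' \<in> rgrph_hom (RGrphN n X) T E"
    using Suc.prems(1,2) full[of "Suc n"] by (auto simp: RGrphN_simps)
  obtain m1 m2 T1 T2 x y z E1 E2 d c e where m: "m = RGA m1 m2" "T = RG T1 T2 x y z" "E = RG E1 E2 d c e"
    "m1 \<in> Hom (RGrphN n X) T1 E1" "m2 \<in> Hom (RGrphN n X) T2 E2"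
    "d \<cdot>\<^bsub>RGrphN n X\<^esub> m2 = m1 \<cdot>\<^bsub>RGrphN n X\<^esub> x" "c \<cdot>\<^bsub>RGrphN n X\<^esub> m2 = m1 \<cdot>\<^bsub>RGrphN n X\<^esub> y"
    using h(1) by (elim rgrph_homE) simp
  obtain m1' m2' where m': "m' = RGA m1' m2'" "m1' \<in> Hom (RGrphN n X) T1 E1" "m2' \<in> Hom (RGrphN n X) T2 E2"
    "d \<cdot>\<^bsub>RGrphN n X\<^esub> m2' = m1' \<cdot>\<^bsub>RGrphN n X\<^esub> x" "c \<cdot>\<^bsub>RGrphN n X\<^esub> m2' = m1' \<cdot>\<^bsub>RGrphN n X\<^esub> y"
    using h(2) m(2,3) by (elim rgrph_homE) simp
  have ob: "T1 \<in> Ob (ERelN n X)" "T2 \<in> Ob (ERelN n X)" "E1 \<in> Ob (ERelN n X)" "E2 \<in> Ob (ERelN n X)"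
    and eq: "is_equivalence_relation (ERelN n X) E1 E2 d c"
    using E unfolding m(2) m(3) ERelN_Suc_iff[OF X] by auto
  have hom: "k \<in> Hom (ERelN n X) G H" if "k \<in> Hom (RGrphN n X) G H" "G \<in> Ob (ERelN n X)" "H \<in> Ob (ERelN n X)" for k G H
    using that full[of n] by auto
  have 1: "m1 = m1'" using Suc.IH[OF hom[OF m(4) ob(1,3)] hom[OF m'(2) ob(1,3)]] Suc.prems(3) m(1) m'(1) by simp
  have "jointly_monic (ERelN n X) E2 d c" using eq by (auto simp: is_equivalence_relation_def is_relation_def)
  moreover have "d \<cdot>\<^bsub>ERelN n X\<^esub> m2 = d \<cdot>\<^bsub>ERelN n X\<^esub> m2'" "c \<cdot>\<^bsub>ERelN n X\<^esub> m2 = c \<cdot>\<^bsub>ERelN n X\<^esub> m2'"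
    using full[of n] m m' 1 by simp_all
  ultimately have "m2 = m2'"
    using hom[OF m(5) ob(2,4)] hom[OF m'(3) ob(2,4)] unfolding jointly_monic_def by blast
  then show ?case using 1 m(1) m'(1) by simp
qed

context tower
begin

lemmas box_U = box_universalD[OF box_universal_Box]

lemma Box_Cons:
  assumes "A \<in> Ob (base X)" and r: "r \<in> rels A" and rs: "set rs \<subseteq> rels A"
  obtains \<delta> \<gamma> \<epsilon> where "Box A (r # rs) = RG (Box A rs) (Box (rtop r) (map (lift r) rs)) \<delta> \<gamma> \<epsilon>"
    "\<delta> \<in> HomR (length rs) (Box (rtop r) (map (lift r) rs)) (Box A rs)" "corner_arr \<delta> = rd r"
    "\<gamma> \<in> HomR (length rs) (Box (rtop r) (map (lift r) rs)) (Box A rs)" "corner_arr \<gamma> = rc r"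
    "\<epsilon> \<in> HomR (length rs) (Box A rs) (Box (rtop r) (map (lift r) rs))" "corner_arr \<epsilon> = re r"
  using that Box_arrows[OF r rs box_universal_Box[OF assms(1) rs] box_universal_Box[OF relsD(11)[OF r] lift_rels[OF r rs]]]
  by simp

lemma Box_hom_Cons:
  assumes A: "A \<in> Ob (base X)" and r: "r \<in> rels A" and rs: "set rs \<subseteq> rels A" and B: "B \<in> Ob (base X)" and s: "s \<in> rels B" and ss: "set ss \<subseteq> rels B"
    and n: "length rs = n" "length ss = n"
    and m: "m \<in> HomR (Suc n) (Box A (r # rs)) (Box B (s # ss))"
  obtains m1 m2 where "m = RGA m1 m2" "m1 \<in> HomR n (Box A rs) (Box B ss)" "corner_arr m1 = corner_arr m"
    "m2 \<in> HomR n (Box (rtop r) (map (lift r) rs)) (Box (rtop s) (map (lift s) ss))"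
    "corner_arr m2 \<in> HomB (rtop r) (rtop s)"
    "rd s \<bullet> corner_arr m2 = corner_arr m \<bullet> rd r" "rc s \<bullet> corner_arr m2 = corner_arr m \<bullet> rc r"
proof -
  obtain \<delta> \<gamma> \<epsilon> where 1: "Box A (r # rs) = RG (Box A rs) (Box (rtop r) (map (lift r) rs)) \<delta> \<gamma> \<epsilon>"
    "\<delta> \<in> HomR n (Box (rtop r) (map (lift r) rs)) (Box A rs)" "corner_arr \<delta> = rd r"
    "\<gamma> \<in> HomR n (Box (rtop r) (map (lift r) rs)) (Box A rs)" "corner_arr \<gamma> = rc r"
    using Box_Cons[OF A r rs] n by metis
  obtain \<delta>' \<gamma>' \<epsilon>' where 2: "Box B (s # ss) = RG (Box B ss) (Box (rtop s) (map (lift s) ss)) \<delta>' \<gamma>' \<epsilon>'"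
    "\<delta>' \<in> HomR n (Box (rtop s) (map (lift s) ss)) (Box B ss)" "corner_arr \<delta>' = rd s"
    "\<gamma>' \<in> HomR n (Box (rtop s) (map (lift s) ss)) (Box B ss)" "corner_arr \<gamma>' = rc s"
    using Box_Cons[OF B s ss] n by metis
  obtain m1 m2 where m': "m = RGA m1 m2" "m1 \<in> HomR n (Box A rs) (Box B ss)"
    "m2 \<in> HomR n (Box (rtop r) (map (lift r) rs)) (Box (rtop s) (map (lift s) ss))"
    "\<delta>' \<cdot>\<^bsub>RGrphN n X\<^esub> m2 = m1 \<cdot>\<^bsub>RGrphN n X\<^esub> \<delta>" "\<gamma>' \<cdot>\<^bsub>RGrphN n X\<^esub> m2 = m1 \<cdot>\<^bsub>RGrphN n X\<^esub> \<gamma>"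
    using m unfolding 1(1) 2(1) by (elim RGrphN_Suc_homE) simp
  have "corner (Box (rtop r) (map (lift r) rs)) = rtop r" "corner (Box (rtop s) (map (lift s) ss)) = rtop s"
    using box_U(2)[OF relsD(11)[OF r] lift_rels[OF r rs]] box_U(2)[OF relsD(11)[OF s] lift_rels[OF s ss]] by auto
  then show thesis
    using that[of m1 m2] m' corner_hom[OF m'(3)] corner_square[OF m'(3) 2(2) 1(2) m'(2,4)] corner_square[OF m'(3) 2(4) 1(4) m'(2,5)] 1 2 by simp
qed

lemma Box_ERelN: "A \<in> Ob (base X) \<Longrightarrow> set rs \<subseteq> rels A \<Longrightarrow> Box A rs \<in> Ob (ERelN (length rs) X)"
proof (induction A rs rule: Box.induct)
  case (2 A r rs)
  let ?n = "length rs"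
  define B1 B2 where "B1 = Box A rs" and "B2 = Box (rtop r) (map (lift r) rs)"
  have r: "r \<in> rels A" and rs: "set rs \<subseteq> rels A" using 2 by auto
  note r' = relsD[OF r]
  note full = ERelN_full[OF X.category_axioms]
  have U1: "box_universal A rs B1" unfolding B1_def by (rule box_universal_Box[OF "2.prems"(1) rs])
  have U2: "box_universal (rtop r) (map (lift r) rs) B2" unfolding B2_def by (rule box_universal_Box[OF r'(11) lift_rels[OF r rs]])
  note b1 = box_universalD[OF U1] note b2 = box_universalD[OF U2, simplified length_map]
  have E1: "B1 \<in> Ob (ERelN ?n X)" and E2: "B2 \<in> Ob (ERelN ?n X)"
    unfolding B1_def B2_def using 2 r'(11) lift_rels[OF r rs] by auto
  obtain \<delta> \<gamma> \<epsilon> where B: "Box A (r # rs) = RG B1 B2 \<delta> \<gamma> \<epsilon>"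
    "\<delta> \<in> Hom (RGrphN ?n X) B2 B1" "corner_arr \<delta> = rd r" "\<gamma> \<in> Hom (RGrphN ?n X) B2 B1" "corner_arr \<gamma> = rc r"
    using Box_Cons[OF "2.prems"(1) r rs] unfolding B1_def B2_def by metis
  interpret R: category "RGrphN ?n X" by (rule category_RGrphN[OF X.category_axioms])
  \<comment> \<open>By the universal property, two arrows into the lower box come from the upper one
    exactly if their corners are related by \<open>r\<close>. So the three laws are inherited from
    \<open>rho r\<close>.\<close>
  have mem: "(x, y) \<in> (\<lambda>z. (\<delta> \<cdot>\<^bsub>RGrphN ?n X\<^esub> z, \<gamma> \<cdot>\<^bsub>RGrphN ?n X\<^esub> z)) ` Hom (RGrphN ?n X) T B2 \<longleftrightarrow>
     x \<in> Hom (RGrphN ?n X) T B1 \<and> y \<in> Hom (RGrphN ?n X) T B1 \<and> (corner T, corner_arr x, corner_arr y) \<in> rho r" for x y T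
  proof
    assume "(x, y) \<in> (\<lambda>z. (\<delta> \<cdot>\<^bsub>RGrphN ?n X\<^esub> z, \<gamma> \<cdot>\<^bsub>RGrphN ?n X\<^esub> z)) ` Hom (RGrphN ?n X) T B2"
    then obtain z where z: "z \<in> Hom (RGrphN ?n X) T B2" "x = \<delta> \<cdot>\<^bsub>RGrphN ?n X\<^esub> z" "y = \<gamma> \<cdot>\<^bsub>RGrphN ?n X\<^esub> z" by auto
    then show "x \<in> Hom (RGrphN ?n X) T B1 \<and> y \<in> Hom (RGrphN ?n X) T B1 \<and> (corner T, corner_arr x, corner_arr y) \<in> rho r"
      using R.comp_hom[OF z(1) B(2)] R.comp_hom[OF z(1) B(4)] corner_comp[OF z(1) B(2)] corner_comp[OF z(1) B(4)] B(3,5)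
        corner_hom[OF z(1)] b2(2) by (auto simp: rho_def C.span_rel_def)
  next
    assume "x \<in> Hom (RGrphN ?n X) T B1 \<and> y \<in> Hom (RGrphN ?n X) T B1 \<and> (corner T, corner_arr x, corner_arr y) \<in> rho r"
    then have x: "x \<in> Hom (RGrphN ?n X) T B1" and y: "y \<in> Hom (RGrphN ?n X) T B1" and xy: "(corner T, corner_arr x, corner_arr y) \<in> rho r" by auto
    obtain g where g: "g \<in> HomB (corner T) (rtop r)" "rd r \<bullet> g = corner_arr x" "rc r \<bullet> g = corner_arr y"
      using xy by (auto simp: rho_def C.span_rel_def)
    have T: "T \<in> Ob (RGrphN ?n X)" using R.hom_ob x by blast
    have "compat T (map (lift r) rs) g" using compat_lift[OF T r rs g(1)] b1(3)[OF x] b1(3)[OF y] g(2,3) by simp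
    then obtain z where z: "z \<in> Hom (RGrphN ?n X) T B2" "corner_arr z = g" using b2(4)[OF T g(1)] by blast
    have "x = \<delta> \<cdot>\<^bsub>RGrphN ?n X\<^esub> z" using b1(5)[OF x R.comp_hom[OF z(1) B(2)]] corner_comp[OF z(1) B(2)] B(3) g(2) z(2) by simp
    moreover have "y = \<gamma> \<cdot>\<^bsub>RGrphN ?n X\<^esub> z" using b1(5)[OF y R.comp_hom[OF z(1) B(4)]] corner_comp[OF z(1) B(4)] B(5) g(3) z(2) by simp
    ultimately show "(x, y) \<in> (\<lambda>z. (\<delta> \<cdot>\<^bsub>RGrphN ?n X\<^esub> z, \<gamma> \<cdot>\<^bsub>RGrphN ?n X\<^esub> z)) ` Hom (RGrphN ?n X) T B2" using z(1) by blast
  qed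
  have jm: "x = y" if "x \<in> Hom (RGrphN ?n X) T B2" "y \<in> Hom (RGrphN ?n X) T B2" "\<delta> \<cdot>\<^bsub>RGrphN ?n X\<^esub> x = \<delta> \<cdot>\<^bsub>RGrphN ?n X\<^esub> y"
      "\<gamma> \<cdot>\<^bsub>RGrphN ?n X\<^esub> x = \<gamma> \<cdot>\<^bsub>RGrphN ?n X\<^esub> y" for x y T
  proof -
    have "corner_arr x = corner_arr y"
    proof (rule C.jointly_monicD[OF r'(8)])
      show "corner_arr x \<in> HomB (corner T) (rtop r)" "corner_arr y \<in> HomB (corner T) (rtop r)"
        using corner_hom[OF that(1)] corner_hom[OF that(2)] b2(2) by simp_all
      show "rd r \<bullet> corner_arr x = rd r \<bullet> corner_arr y" using corner_square[OF that(1) B(2) that(2) B(2) that(3)] B(3) by simp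
      show "rc r \<bullet> corner_arr x = rc r \<bullet> corner_arr y" using corner_square[OF that(1) B(4) that(2) B(4) that(4)] B(5) by simp
    qed
    then show ?thesis using b2(5) that by blast
  qed
  have rr: "rho r \<in> C.eq_rels A" by (rule r'(9))
  have "is_equivalence_relation (ERelN ?n X) B1 B2 \<delta> \<gamma>"
    unfolding is_equivalence_relation_def is_relation_def jointly_monic_def
  proof (intro conjI allI ballI impI)
    show "\<delta> \<in> Hom (ERelN ?n X) B2 B1" "\<gamma> \<in> Hom (ERelN ?n X) B2 B1" using full[of ?n] B E1 E2 by auto
    fix T x y assume "x \<in> Hom (ERelN ?n X) T B2" "y \<in> Hom (ERelN ?n X) T B2"
      "\<delta> \<cdot>\<^bsub>ERelN ?n X\<^esub> x = \<delta> \<cdot>\<^bsub>ERelN ?n X\<^esub> y \<and> \<gamma> \<cdot>\<^bsub>ERelN ?n X\<^esub> x = \<gamma> \<cdot>\<^bsub>ERelN ?n X\<^esub> y"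
    then show "x = y" using jm full[of ?n] by auto
  next
    fix T assume T: "T \<in> Ob (ERelN ?n X)"
    have H: "Hom (ERelN ?n X) T B1 = Hom (RGrphN ?n X) T B1" "Hom (ERelN ?n X) T B2 = Hom (RGrphN ?n X) T B2"
      and c: "Comp (ERelN ?n X) = Comp (RGrphN ?n X)"
      using full[of ?n] T E1 E2 by auto
    have ch: "corner_arr x \<in> HomB (corner T) A" if "x \<in> Hom (RGrphN ?n X) T B1" for x using corner_hom[OF that] b1(2) by simp
    show "equiv (Hom (ERelN ?n X) T B1) ((\<lambda>x. (\<delta> \<cdot>\<^bsub>ERelN ?n X\<^esub> x, \<gamma> \<cdot>\<^bsub>ERelN ?n X\<^esub> x)) ` Hom (ERelN ?n X) T B2)"
      unfolding H c
    proof (rule equivI)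
      show "refl_on (Hom (RGrphN ?n X) T B1) ((\<lambda>x. (\<delta> \<cdot>\<^bsub>RGrphN ?n X\<^esub> x, \<gamma> \<cdot>\<^bsub>RGrphN ?n X\<^esub> x)) ` Hom (RGrphN ?n X) T B2)"
        unfolding refl_on_def mem using C.eq_rels_refl[OF rr ch] by blast
      show "sym ((\<lambda>x. (\<delta> \<cdot>\<^bsub>RGrphN ?n X\<^esub> x, \<gamma> \<cdot>\<^bsub>RGrphN ?n X\<^esub> x)) ` Hom (RGrphN ?n X) T B2)"
        unfolding sym_def mem using C.eq_rels_sym[OF rr] by blast
      show "trans ((\<lambda>x. (\<delta> \<cdot>\<^bsub>RGrphN ?n X\<^esub> x, \<gamma> \<cdot>\<^bsub>RGrphN ?n X\<^esub> x)) ` Hom (RGrphN ?n X) T B2)"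
        unfolding trans_def mem using C.eq_rels_trans[OF rr] by blast
      show "(\<lambda>x. (\<delta> \<cdot>\<^bsub>RGrphN ?n X\<^esub> x, \<gamma> \<cdot>\<^bsub>RGrphN ?n X\<^esub> x)) ` Hom (RGrphN ?n X) T B2 \<subseteq> Hom (RGrphN ?n X) T B1 \<times> Hom (RGrphN ?n X) T B1"
        using mem by auto
    qed
  qed
  then show ?case
    using box_U(1)[OF "2.prems"] E1 E2 unfolding B(1) by (simp add: ERelN_Suc_iff[OF X.category_axioms])
qed (simp add: ERelN_simps)

lemma underlying_rel_Box:
  assumes "A \<in> Ob (base X)"
  shows "set rs \<subseteq> rels A \<Longrightarrow> i < length rs \<Longrightarrow> underlying_rel i (Box A rs) = rs ! i"
proof (induction rs arbitrary: i)
  case (Cons r rs)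
  have r: "r \<in> rels A" and rs: "set rs \<subseteq> rels A" using Cons.prems by auto
  obtain \<delta> \<gamma> \<epsilon> where B: "Box A (r # rs) = RG (Box A rs) (Box (rtop r) (map (lift r) rs)) \<delta> \<gamma> \<epsilon>"
    "corner_arr \<delta> = rd r" "corner_arr \<gamma> = rc r" "corner_arr \<epsilon> = re r" by (rule Box_Cons[OF assms r rs])
  show ?case
  proof (cases i)
    case 0
    then show ?thesis
      using B relsD(1)[OF r] box_U(2)[OF assms rs] box_U(2)[OF relsD(11)[OF r] lift_rels[OF r rs]] by (simp del: Box.simps)
  next
    case (Suc j)
    then show ?thesis using B(1) Cons.IH[OF rs, of j] Cons.prems by (simp del: Box.simps)
  qed
qed simp

text \<open>The source of maximality: for every \<open>T\<close> over the relations
  \<open>rs\<close> the identity of \<open>A\<close> is compatible, and so \<open>T\<close> maps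
  into the box over \<open>A\<close>.\<close>

lemma compat_underlying:
  "T \<in> Ob (RGrphN (length rs) X) \<Longrightarrow> corner T = A \<Longrightarrow> set rs \<subseteq> rels A \<Longrightarrow>
    \<forall>i<length rs. underlying_rel i T = rs ! i \<Longrightarrow> compat T rs (IdB A)"
proof (induction rs arbitrary: T)
  case (Cons r rs)
  from Cons.prems(1) have "T \<in> Ob (RGrphN (Suc (length rs)) X)" by simp
  then obtain T1 T2 d c e where T: "T = RG T1 T2 d c e" "T1 \<in> Ob (RGrphN (length rs) X)" "T2 \<in> Ob (RGrphN (length rs) X)" by (rule RGrphN_SucE)
  have r: "r \<in> rels A" using Cons.prems by simp
  note r' = relsD[OF r]
  have "underlying_rel 0 T = r" using Cons.prems(4) by auto
  then have "corner T2 = rtop r" "corner_arr d = rd r" "corner_arr c = rc r" using T(1) by (auto simp flip: rd.simps)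
  moreover have "(rtop r, rd r, rc r) \<in> rho r" unfolding rho_def using C.span_rel_span[OF r'(11,2,3)] .
  moreover have "\<forall>i<length rs. underlying_rel i T1 = rs ! i" using Cons.prems(4) T(1) by auto
  then have "compat T1 rs (IdB A)" using Cons.IH[OF T(2)] Cons.prems T(1) by simp
  ultimately show ?case using T(1) C.comp_id_left[OF r'(2)] C.comp_id_left[OF r'(3)] by simp
qed simp

text \<open>With \<open>n = 0\<close> there would be no relation to tie the object of
  \<open>E\<close> to \<open>A\<close>; for \<open>0 < n\<close> the relation in direction 0 does
  so.\<close>

lemma nfold_erel_corner:
  assumes "0 < n" "\<And>i. i < n \<Longrightarrow> R i \<in> rels A" "is_nfold_erel_on n X R E"
  shows "corner E = A" "E \<in> Ob (RGrphN n X)" "E \<in> Ob (ERelN n X)" "A \<in> Ob (base X)"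
proof -
  show E: "E \<in> Ob (ERelN n X)" using assms(3) by (simp add: is_nfold_erel_on_def)
  then show E': "E \<in> Ob (RGrphN n X)" using ERelN_full[OF X.category_axioms, of n] by auto
  obtain k where k: "n = Suc k" using assms(1) gr0_implies_Suc by blast
  obtain G1 G2 d c e where G: "E = RG G1 G2 d c e" using E' unfolding k by (rule RGrphN_SucE)
  have "underlying_rel 0 E = R 0" using assms(1,3) by (simp add: is_nfold_erel_on_def)
  moreover obtain R' d' c' e' where "R 0 = RG A R' d' c' e'" using relsD(1)[OF assms(2)[OF assms(1)]] by metis
  ultimately show "corner E = A" using G by simp
  show "A \<in> Ob (base X)" using relsD(10)[OF assms(2)[OF assms(1)]] .
qed

lemma is_box_Box:
  assumes "0 < n" "\<And>i. i < n \<Longrightarrow> R i \<in> rels A"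
  shows "is_box n X R (Box A (map R [0..<n]))"
proof -
  let ?rs = "map R [0..<n]"
  have rs: "set ?rs \<subseteq> rels A" "length ?rs = n" using assms(2) by auto
  have A: "A \<in> Ob (base X)" using relsD(10)[OF assms(2)[OF assms(1)]] .
  note full = ERelN_full[OF X.category_axioms, of n]
  note b = box_U[OF A rs(1), unfolded rs(2)]
  have B: "Box A ?rs \<in> Ob (ERelN n X)" using Box_ERelN[OF A rs(1)] by simp
  have "is_nfold_erel_on n X R (Box A ?rs)"
    unfolding is_nfold_erel_on_def using B underlying_rel_Box[OF A rs(1)] by simp
  moreover have "\<exists>m \<in> Hom (ERelN n X) E' (Box A ?rs). corner_arr m = IdB (corner (Box A ?rs))"
    if E': "is_nfold_erel_on n X R E'" for E'
  proof -
    note c = nfold_erel_corner[OF assms E']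
    have "compat E' ?rs (IdB A)" using compat_underlying[of E' ?rs A] c rs E' by (simp add: is_nfold_erel_on_def)
    then obtain m where "m \<in> HomR n E' (Box A ?rs)" "corner_arr m = IdB A"
      using b(4)[OF c(2)] c(1) C.id_hom[OF A] by auto
    then show ?thesis using b(2) full c(3) B by auto
  qed
  ultimately show ?thesis unfolding is_box_def by blast
qed

text \<open>Two largest \<open>n\<close>-fold equivalence relations map to each other over the
  identity of \<open>A\<close>, and both composites are identities because morphisms are determined
  by their corner.\<close>

lemma is_box_iso:
  assumes n: "0 < n" and R: "\<And>i. i < n \<Longrightarrow> R i \<in> rels A" and E: "is_box n X R E"
  shows "isomorphic (RGrphN n X) E (Box A (map R [0..<n]))"
proof -
  let ?B = "Box A (map R [0..<n])"
  interpret Rn: category "RGrphN n X" by (rule category_RGrphN[OF X.category_axioms])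
  have B: "is_box n X R ?B" by (rule is_box_Box[OF n R])
  have nE: "is_nfold_erel_on n X R E" and nB: "is_nfold_erel_on n X R ?B" using E B by (auto simp: is_box_def)
  note cE = nfold_erel_corner[OF n R nE] note cB = nfold_erel_corner[OF n R nB]
  note full = ERelN_full[OF X.category_axioms, of n]
  obtain m where m: "m \<in> Hom (ERelN n X) E ?B" "corner_arr m = IdB A" using B nE cB(1) unfolding is_box_def by auto
  obtain k where k: "k \<in> Hom (ERelN n X) ?B E" "corner_arr k = IdB A" using E nB cE(1) unfolding is_box_def by auto
  have m': "m \<in> HomR n E ?B" and k': "k \<in> HomR n ?B E" using m k full by auto
  have II: "IdB A \<bullet> IdB A = IdB A" using C.comp_id_left[OF C.id_hom[OF cE(4)]] .
  have hom: "k \<in> Hom (ERelN n X) G H" if "k \<in> HomR n G H" "G \<in> Ob (ERelN n X)" "H \<in> Ob (ERelN n X)" for k G H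
    using that full by auto
  have "k \<cdot>\<^bsub>RGrphN n X\<^esub> m = Id (RGrphN n X) E"
    using ERelN_corner_faithful[OF X.category_axioms hom[OF Rn.comp_hom[OF m' k'] cE(3,3)] hom[OF Rn.id_hom[OF cE(2)] cE(3,3)]]
      corner_comp[OF m' k'] m(2) k(2) II corner_Id(2)[OF cE(2)] cE(1) by simp
  moreover have "m \<cdot>\<^bsub>RGrphN n X\<^esub> k = Id (RGrphN n X) ?B"
    using ERelN_corner_faithful[OF X.category_axioms hom[OF Rn.comp_hom[OF k' m'] cB(3,3)] hom[OF Rn.id_hom[OF cB(2)] cB(3,3)]]
      corner_comp[OF k' m'] m(2) k(2) II corner_Id(2)[OF cB(2)] cB(1) by simp
  ultimately show ?thesis unfolding isomorphic_def using Rn.isoI[OF m' k'] by blast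
qed

section \<open>Exactness of boxes\<close>

text \<open>An interchange of limits: two elements of \<open>r\<close> that agree in
  \<open>s\<close> amount to four elements of \<open>A\<close>, which can be read as two elements of
  \<open>K\<close> that are related by \<open>r\<close> in both components.\<close>

lemma kernel_pair_rels:
  assumes K: "is_kernel_pair (base X) A B f K \<delta> \<gamma>" and r: "r \<in> rels A" and s: "s \<in> rels B" and k: "k \<in> rels K"
    and rk: "rho k = C.lift_rel K \<delta> \<gamma> (rho r)"
    and g: "g \<in> HomB (rtop r) (rtop s)" "rd s \<bullet> g = f \<bullet> rd r" "rc s \<bullet> g = f \<bullet> rc r"
    and d: "d \<in> HomB (rtop k) (rtop r)" "rd r \<bullet> d = \<delta> \<bullet> rd k" "rc r \<bullet> d = \<delta> \<bullet> rc k"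
    and c: "c \<in> HomB (rtop k) (rtop r)" "rd r \<bullet> c = \<gamma> \<bullet> rd k" "rc r \<bullet> c = \<gamma> \<bullet> rc k"
  shows "is_kernel_pair (base X) (rtop r) (rtop s) g (rtop k) d c"
proof -
  note P = K[unfolded is_kernel_pair_def]
  note p = C.pullbackD[OF P]
  note r' = relsD[OF r] note s' = relsD[OF s] note k' = relsD[OF k]
  have g\<delta>: "rd s \<bullet> (g \<bullet> x) = f \<bullet> (rd r \<bullet> x)" "rc s \<bullet> (g \<bullet> x) = f \<bullet> (rc r \<bullet> x)" if "x \<in> HomB T (rtop r)" for x T
    using C.square_comp[OF g(1) s'(2) r'(2) p(1) g(2) that] C.square_comp[OF g(1) s'(3) r'(3) p(1) g(3) that] by auto
  have dd: "rd r \<bullet> (d \<bullet> x) = \<delta> \<bullet> (rd k \<bullet> x)" "rc r \<bullet> (d \<bullet> x) = \<delta> \<bullet> (rc k \<bullet> x)" 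
    "rd r \<bullet> (c \<bullet> x) = \<gamma> \<bullet> (rd k \<bullet> x)" "rc r \<bullet> (c \<bullet> x) = \<gamma> \<bullet> (rc k \<bullet> x)" if "x \<in> HomB T (rtop k)" for x T
    using C.square_comp[OF d(1) r'(2) k'(2) p(3) d(2) that] C.square_comp[OF d(1) r'(3) k'(3) p(3) d(3) that]
      C.square_comp[OF c(1) r'(2) k'(2) p(4) c(2) that] C.square_comp[OF c(1) r'(3) k'(3) p(4) c(3) that] by auto
  show ?thesis
    unfolding is_kernel_pair_def
  proof (rule C.pullbackI[OF g(1) g(1) d(1) c(1)])
    show "g \<bullet> d = g \<bullet> c"
    proof (rule C.jointly_monicD[OF s'(8) C.comp_hom[OF d(1) g(1)] C.comp_hom[OF c(1) g(1)]])
      show "rd s \<bullet> (g \<bullet> d) = rd s \<bullet> (g \<bullet> c)"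
        using g\<delta>(1)[OF d(1)] g\<delta>(1)[OF c(1)] d(2) c(2) C.square_comp[OF p(3,1,4,1,5) k'(2)] by simp
      show "rc s \<bullet> (g \<bullet> d) = rc s \<bullet> (g \<bullet> c)"
        using g\<delta>(2)[OF d(1)] g\<delta>(2)[OF c(1)] d(3) c(3) C.square_comp[OF p(3,1,4,1,5) k'(3)] by simp
    qed
    fix T x y assume x: "x \<in> HomB T (rtop r)" and y: "y \<in> HomB T (rtop r)" and xy: "g \<bullet> x = g \<bullet> y"
    have "f \<bullet> (rd r \<bullet> x) = f \<bullet> (rd r \<bullet> y)" "f \<bullet> (rc r \<bullet> x) = f \<bullet> (rc r \<bullet> y)" using g\<delta>[OF x] g\<delta>[OF y] xy by simp_all
    note e = this
    obtain u where u: "u \<in> HomB T K" "\<delta> \<bullet> u = rd r \<bullet> x" "\<gamma> \<bullet> u = rd r \<bullet> y"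
      using C.pullback_ex[OF P C.comp_hom[OF x r'(2)] C.comp_hom[OF y r'(2)] e(1)] .
    obtain v where v: "v \<in> HomB T K" "\<delta> \<bullet> v = rc r \<bullet> x" "\<gamma> \<bullet> v = rc r \<bullet> y"
      using C.pullback_ex[OF P C.comp_hom[OF x r'(3)] C.comp_hom[OF y r'(3)] e(2)] .
    have "(T, u, v) \<in> rho k"
      unfolding rk C.lift_rel_iff u(2,3) v(2,3) using u(1) v(1) x y by (auto simp: rho_def C.span_rel_def)
    then obtain w where w: "w \<in> HomB T (rtop k)" "u = rd k \<bullet> w" "v = rc k \<bullet> w" by (auto simp: rho_def C.span_rel_def)
    have "d \<bullet> w = x" using dd[OF w(1)] u v w by (intro C.jointly_monicD[OF r'(8) C.comp_hom[OF w(1) d(1)] x]) simp_all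
    moreover have "c \<bullet> w = y" using dd[OF w(1)] u v w by (intro C.jointly_monicD[OF r'(8) C.comp_hom[OF w(1) c(1)] y]) simp_all
    ultimately show "\<exists>h \<in> HomB T (rtop k). d \<bullet> h = x \<and> c \<bullet> h = y" using w(1) by blast
  next
    fix T x y assume x: "x \<in> HomB T (rtop k)" and y: "y \<in> HomB T (rtop k)" and xy: "d \<bullet> x = d \<bullet> y" "c \<bullet> x = c \<bullet> y"
    have "rd k \<bullet> x = rd k \<bullet> y"
      using dd[OF x] dd[OF y] xy by (intro C.pullback_mono[OF P C.comp_hom[OF x k'(2)] C.comp_hom[OF y k'(2)]]) simp_all
    moreover have "rc k \<bullet> x = rc k \<bullet> y"
      using dd[OF x] dd[OF y] xy by (intro C.pullback_mono[OF P C.comp_hom[OF x k'(3)] C.comp_hom[OF y k'(3)]]) simp_all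
    ultimately show "x = y" using C.jointly_monicD[OF k'(8) x y] by blast
  qed
qed

lemma corner_arr_base: "m \<in> HomB A B \<Longrightarrow> corner_arr m = m"
  by (auto elim: base_homE)

text \<open>Induction along the coordinates of the vertex. A coordinate 2 replaces the kernel pair
  of the corner by that of the induced map between relations, and the remaining relations by their
  lifts.\<close>

lemma Box_kernel_pair:
  assumes "length a = n" "length ks = n" "length rs = n" "length ss = n"
    and "set ks \<subseteq> rels K" "set rs \<subseteq> rels A" "set ss \<subseteq> rels B"
    and "is_kernel_pair (base X) A B (corner_arr mf) K (corner_arr md) (corner_arr mc)"
    and "map rho ks = map (\<lambda>r. C.lift_rel K (corner_arr md) (corner_arr mc) (rho r)) rs"
    and "mf \<in> HomR n (Box A rs) (Box B ss)"
    and "md \<in> HomR n (Box K ks) (Box A rs)" "mc \<in> HomR n (Box K ks) (Box A rs)"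
  shows "is_kernel_pair (base X) (gvertex a (Box A rs)) (gvertex a (Box B ss)) (gcomponent a mf)
    (gvertex a (Box K ks)) (gcomponent a md) (gcomponent a mc)"
  using assms
proof (induction a arbitrary: n K A B ks rs ss mf md mc)
  case Nil
  then show ?case using corner_arr_base by (auto simp: RGrphN_simps)
next
  case (Cons b a)
  obtain l where l: "n = Suc l" "length a = l" using Cons.prems(1) by (cases n) auto
  obtain k ks' where ks: "ks = k # ks'" "length ks' = l" using Cons.prems(2) l by (cases ks) auto
  obtain r rs' where rs: "rs = r # rs'" "length rs' = l" using Cons.prems(3) l by (cases rs) auto
  obtain s ss' where ss: "ss = s # ss'" "length ss' = l" using Cons.prems(4) l by (cases ss) auto
  have k: "k \<in> rels K" "set ks' \<subseteq> rels K" and r: "r \<in> rels A" "set rs' \<subseteq> rels A" and s: "s \<in> rels B" "set ss' \<subseteq> rels B"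
    using Cons.prems(5-7) ks rs ss by auto
  note k' = relsD[OF k(1)] note r' = relsD[OF r(1)] note s' = relsD[OF s(1)]
  have rk: "rho k = C.lift_rel K (corner_arr md) (corner_arr mc) (rho r)"
    and rks: "map rho ks' = map (\<lambda>r. C.lift_rel K (corner_arr md) (corner_arr mc) (rho r)) rs'"
    using Cons.prems(9) ks rs by auto
  obtain f1 f2 where f: "mf = RGA f1 f2" "f1 \<in> HomR l (Box A rs') (Box B ss')" "corner_arr f1 = corner_arr mf"
    "f2 \<in> HomR l (Box (rtop r) (map (lift r) rs')) (Box (rtop s) (map (lift s) ss'))"
    "corner_arr f2 \<in> HomB (rtop r) (rtop s)"
    "rd s \<bullet> corner_arr f2 = corner_arr mf \<bullet> rd r" "rc s \<bullet> corner_arr f2 = corner_arr mf \<bullet> rc r"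
    by (rule Box_hom_Cons[OF r'(10) r s'(10) s rs(2) ss(2) Cons.prems(10)[unfolded l(1) rs(1) ss(1)]])
  obtain d1 d2 where d: "md = RGA d1 d2" "d1 \<in> HomR l (Box K ks') (Box A rs')" "corner_arr d1 = corner_arr md"
    "d2 \<in> HomR l (Box (rtop k) (map (lift k) ks')) (Box (rtop r) (map (lift r) rs'))"
    "corner_arr d2 \<in> HomB (rtop k) (rtop r)"
    "rd r \<bullet> corner_arr d2 = corner_arr md \<bullet> rd k" "rc r \<bullet> corner_arr d2 = corner_arr md \<bullet> rc k"
    by (rule Box_hom_Cons[OF k'(10) k r'(10) r ks(2) rs(2) Cons.prems(11)[unfolded l(1) rs(1) ks(1)]])
  obtain c1 c2 where c: "mc = RGA c1 c2" "c1 \<in> HomR l (Box K ks') (Box A rs')" "corner_arr c1 = corner_arr mc"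
    "c2 \<in> HomR l (Box (rtop k) (map (lift k) ks')) (Box (rtop r) (map (lift r) rs'))"
    "corner_arr c2 \<in> HomB (rtop k) (rtop r)"
    "rd r \<bullet> corner_arr c2 = corner_arr mc \<bullet> rd k" "rc r \<bullet> corner_arr c2 = corner_arr mc \<bullet> rc k"
    by (rule Box_hom_Cons[OF k'(10) k r'(10) r ks(2) rs(2) Cons.prems(12)[unfolded l(1) rs(1) ks(1)]])
  show ?case
  proof (cases b)
    case False
    have 1: "is_kernel_pair (base X) A B (corner_arr f1) K (corner_arr d1) (corner_arr c1)"
      unfolding f(3) d(3) c(3) by (rule Cons.prems(8))
    have 2: "map rho ks' = map (\<lambda>r. C.lift_rel K (corner_arr d1) (corner_arr c1) (rho r)) rs'"
      unfolding d(3) c(3) by (rule rks)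
    show ?thesis
      using Cons.IH[OF l(2) ks(2) rs(2) ss(2) k(2) r(2) s(2) 1 2 f(2) d(2) c(2)] unfolding f(1) d(1) c(1) ks(1) rs(1) ss(1)
      by (simp add: False)
  next
    case True
    have KP: "is_kernel_pair (base X) (rtop r) (rtop s) (corner_arr f2) (rtop k) (corner_arr d2) (corner_arr c2)"
      by (rule kernel_pair_rels[OF Cons.prems(8) r(1) s(1) k(1) rk f(5-7) d(5-7) c(5-7)])
    note p = C.pullbackD[OF Cons.prems(8)[unfolded is_kernel_pair_def]]
    \<comment> \<open>Restricting \<open>E\<close> to \<open>K\<close> and then to \<open>k\<close>,
      or to \<open>r\<close> and then to the kernel pair over \<open>r\<close>, imposes the same
      condition on the four underlying elements.\<close>
    have lift_eq: "C.lift_rel (rtop k) (rd k) (rc k) (C.lift_rel K (corner_arr md) (corner_arr mc) E) =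
      C.lift_rel (rtop k) (corner_arr d2) (corner_arr c2) (C.lift_rel (rtop r) (rd r) (rc r) E)" for E
    proof -
      have "(T, x, y) \<in> C.lift_rel (rtop k) (rd k) (rc k) (C.lift_rel K (corner_arr md) (corner_arr mc) E) \<longleftrightarrow>
        (T, x, y) \<in> C.lift_rel (rtop k) (corner_arr d2) (corner_arr c2) (C.lift_rel (rtop r) (rd r) (rc r) E)" for T x y
      proof (cases "x \<in> HomB T (rtop k) \<and> y \<in> HomB T (rtop k)")
        case True
        have sq: "rd r \<bullet> (corner_arr d2 \<bullet> z) = corner_arr md \<bullet> (rd k \<bullet> z)" "rc r \<bullet> (corner_arr d2 \<bullet> z) = corner_arr md \<bullet> (rc k \<bullet> z)"
          "rd r \<bullet> (corner_arr c2 \<bullet> z) = corner_arr mc \<bullet> (rd k \<bullet> z)" "rc r \<bullet> (corner_arr c2 \<bullet> z) = corner_arr mc \<bullet> (rc k \<bullet> z)"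
          "rd k \<bullet> z \<in> HomB T K" "rc k \<bullet> z \<in> HomB T K" "corner_arr d2 \<bullet> z \<in> HomB T (rtop r)" "corner_arr c2 \<bullet> z \<in> HomB T (rtop r)"
          if "z \<in> HomB T (rtop k)" for z
          using C.square_comp[OF d(5) r'(2) k'(2) p(3) d(6) that] C.square_comp[OF d(5) r'(3) k'(3) p(3) d(7) that]
            C.square_comp[OF c(5) r'(2) k'(2) p(4) c(6) that] C.square_comp[OF c(5) r'(3) k'(3) p(4) c(7) that]
            C.comp_hom[OF that k'(2)] C.comp_hom[OF that k'(3)] C.comp_hom[OF that d(5)] C.comp_hom[OF that c(5)] by auto
        have x: "x \<in> HomB T (rtop k)" and y: "y \<in> HomB T (rtop k)" using True by auto
        show ?thesis unfolding C.lift_rel_iff using x y sq[OF x] sq[OF y] by auto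
      qed (auto simp: C.lift_rel_iff)
      then show ?thesis by auto
    qed
    have a1: "rho (lift k x) = C.lift_rel (rtop k) (corner_arr d2) (corner_arr c2) (rho (lift r y))"
      if "x \<in> rels K" "y \<in> rels A" "rho x = C.lift_rel K (corner_arr md) (corner_arr mc) (rho y)" for x y
      using lift(2)[OF k(1) that(1)] lift(2)[OF r(1) that(2)] that(3) lift_eq by simp
    have a2: "rho (ks' ! i) = C.lift_rel K (corner_arr md) (corner_arr mc) (rho (rs' ! i))" if "i < l" for i
      using arg_cong[OF rks, of "\<lambda>z. z ! i"] that ks(2) rs(2) by simp
    have "rho (lift k (ks' ! i)) = C.lift_rel (rtop k) (corner_arr d2) (corner_arr c2) (rho (lift r (rs' ! i)))" if "i < l" for i
    proof -
      have "ks' ! i \<in> rels K" "rs' ! i \<in> rels A" using that k(2) r(2) ks(2) rs(2) nth_mem[of i ks'] nth_mem[of i rs'] by auto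
      then show ?thesis using a1 a2[OF that] by blast
    qed
    then have map_eq: "map rho (map (lift k) ks') = map (\<lambda>r. C.lift_rel (rtop k) (corner_arr d2) (corner_arr c2) (rho r)) (map (lift r) rs')"
      using ks(2) rs(2) by (intro nth_equalityI) auto
    show ?thesis
      using Cons.IH[OF l(2) _ _ _ lift_rels[OF k] lift_rels[OF r] lift_rels[OF s] KP map_eq f(4) d(4) c(4)] ks(2) rs(2) ss(2)
      unfolding f(1) d(1) c(1) ks(1) rs(1) ss(1) by (simp add: True)
  qed
qed

text \<open>The kernel of the map belongs to the distributive family, so the hypotheses reproduce
  themselves on the relation \<open>r\<close>: the lifts form a distributive family together with
  the kernel of the induced map, and direct images commute with lifting.\<close>

lemma Box_regular_epi:
  assumes "length a = n" "length rs = n" "length ss = n" "set rs \<subseteq> rels A" "set ss \<subseteq> rels B"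
    and "regular_epi (base X) A B (corner_arr m)"
    and "C.dist A (insert (C.ker A (corner_arr m)) (rho ` set rs))"
    and "map (\<lambda>s. C.inv_rel A (corner_arr m) (rho s)) ss = map (\<lambda>r. C.cl A (rho r \<union> C.ker A (corner_arr m))) rs"
    and "m \<in> HomR n (Box A rs) (Box B ss)"
  shows "regular_epi (base X) (gvertex a (Box A rs)) (gvertex a (Box B ss)) (gcomponent a m)"
  using assms
proof (induction a arbitrary: n A B rs ss m)
  case Nil
  then show ?case using corner_arr_base by (auto simp: RGrphN_simps)
next
  case (Cons b a)
  obtain l where l: "n = Suc l" "length a = l" using Cons.prems(1) by (cases n) auto
  obtain r rs' where rs: "rs = r # rs'" "length rs' = l" using Cons.prems(2) l by (cases rs) auto
  obtain s ss' where ss: "ss = s # ss'" "length ss' = l" using Cons.prems(3) l by (cases ss) auto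
  have r: "r \<in> rels A" "set rs' \<subseteq> rels A" and s: "s \<in> rels B" "set ss' \<subseteq> rels B"
    using Cons.prems(4,5) rs ss by auto
  note r' = relsD[OF r(1)] note s' = relsD[OF s(1)]
  let ?f = "corner_arr m"
  note f = Cons.prems(6) note fh = C.regular_epi_hom[OF f]
  interpret A: modular_set_lattice "C.eq_rels A" by (rule C.modular_eq_rels[OF r'(10)])
  have inv_r: "C.inv_rel A ?f (rho s) = A.cl (rho r \<union> C.ker A ?f)"
    and inv_rs: "map (\<lambda>s. C.inv_rel A ?f (rho s)) ss' = map (\<lambda>r. A.cl (rho r \<union> C.ker A ?f)) rs'"
    using Cons.prems(8) rs ss by auto
  obtain m1 m2 where m: "m = RGA m1 m2" "m1 \<in> HomR l (Box A rs') (Box B ss')" "corner_arr m1 = ?f"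
    "m2 \<in> HomR l (Box (rtop r) (map (lift r) rs')) (Box (rtop s) (map (lift s) ss'))"
    "corner_arr m2 \<in> HomB (rtop r) (rtop s)" "rd s \<bullet> corner_arr m2 = ?f \<bullet> rd r" "rc s \<bullet> corner_arr m2 = ?f \<bullet> rc r"
    by (rule Box_hom_Cons[OF r'(10) r s'(10) s rs(2) ss(2) Cons.prems(9)[unfolded l(1) rs(1) ss(1)]])
  let ?F = "insert (C.ker A ?f) (rho ` set rs)"
  note D = Cons.prems(7)
  show ?case
  proof (cases b)
    case False
    have "A.dist (insert (C.ker A ?f) (rho ` set rs'))" by (rule A.dist_mono[OF D]) (auto simp: rs)
    then show ?thesis
      using Cons.IH[OF l(2) rs(2) ss(2) r(2) s(2) _ _ _ m(2), unfolded m(3)] f inv_rs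
      unfolding m(1) rs(1) ss(1) by (simp add: False)
  next
    case True
    let ?L = "C.lift_rel (rtop r) (rd r) (rc r)"
    have g: "regular_epi (base X) (rtop r) (rtop s) (corner_arr m2)"
      using C.regular_epi_relI[OF f r'(7) s'(7) _ m(5-7)] r'(9) inv_r unfolding rho_def by blast
    have rF: "C.span_rel (rtop r) (rd r) (rc r) \<in> ?F" unfolding rho_def[symmetric] by (simp add: rs)
    interpret H: modular_set_lattice_hom "C.eq_rels A" "C.eq_rels (rtop r)" ?L ?F
      by (rule C.lift_rel_hom[OF r'(7) rF D r'(10)])
    have ker: "C.ker (rtop r) (corner_arr m2) = ?L (C.ker A ?f)" by (rule C.ker_lift[OF fh r'(2,3) s'(7) m(5-7)])
    have "insert (C.ker (rtop r) (corner_arr m2)) (rho ` set (map (lift r) rs')) \<subseteq> ?L ` ?F"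
      using ker lift(2)[OF r(1)] r(2) rs(1) by auto
    then have D': "C.dist (rtop r) (insert (C.ker (rtop r) (corner_arr m2)) (rho ` set (map (lift r) rs')))"
      using H.cod.dist_mono[OF H.dist_image[OF D]] by blast
    \<comment> \<open>The inverse image of a lift is the lift of the inverse image, which is a join
      with the kernel of \<open>?f\<close>. Distributivity lets the lift distribute over this
      join.\<close>
    have step: "C.inv_rel (rtop r) (corner_arr m2) (rho (lift s y)) = C.cl (rtop r) (rho (lift r x) \<union> C.ker (rtop r) (corner_arr m2))"
      if "x \<in> set rs'" "y \<in> set ss'" "C.inv_rel A ?f (rho y) = A.cl (rho x \<union> C.ker A ?f)" for x y
    proof -
      have x: "x \<in> rels A" and y: "y \<in> rels B" using that r s by auto
      have "C.inv_rel (rtop r) (corner_arr m2) (rho (lift s y)) = ?L (C.inv_rel A ?f (rho y))"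
        unfolding lift(2)[OF s(1) y] by (rule C.inv_lift[OF fh r'(2,3) s'(2,3) m(5-7)])
      also have "\<dots> = ?L (A.cl (\<Union>{C.ker A ?f} \<union> A.mt {rho x}))"
        using that(3) A.mt_singleton[OF relsD(9)[OF x]] by (simp add: Un_commute)
      also have "\<dots> = C.cl (rtop r) (\<Union>(?L ` {C.ker A ?f}) \<union> ?L (A.mt {rho x}))"
        using that(1) rs(1) by (intro H.h_cl) auto
      also have "\<dots> = C.cl (rtop r) (rho (lift r x) \<union> C.ker (rtop r) (corner_arr m2))"
        using ker lift(2)[OF r(1) x] A.mt_singleton[OF relsD(9)[OF x]] by (simp add: Un_commute)
      finally show ?thesis .
    qed
    have "C.inv_rel A ?f (rho (ss' ! i)) = A.cl (rho (rs' ! i) \<union> C.ker A ?f)" if "i < l" for i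
      using arg_cong[OF inv_rs, of "\<lambda>z. z ! i"] that rs(2) ss(2) by simp
    then have map_eq: "map (\<lambda>s. C.inv_rel (rtop r) (corner_arr m2) (rho s)) (map (lift s) ss') =
       map (\<lambda>x. C.cl (rtop r) (rho x \<union> C.ker (rtop r) (corner_arr m2))) (map (lift r) rs')"
      using step rs(2) ss(2) by (intro nth_equalityI) auto
    show ?thesis
      using Cons.IH[OF l(2) _ _ lift_rels[OF r] lift_rels[OF s] g D' map_eq m(4)] rs(2) ss(2)
      unfolding m(1) rs(1) ss(1) by (simp add: True)
  qed
qed

end

lemma corner_gvertex: "G \<in> Ob (RGrphN n X) \<Longrightarrow> gvertex (replicate n False) G = corner G"
  by (induction n arbitrary: G) (auto simp: RGrphN_simps elim!: rgrph_obE)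

lemma corner_gcomponent: "m \<in> Hom (RGrphN n X) G H \<Longrightarrow> gcomponent (replicate n False) m = corner_arr m"
  by (induction n arbitrary: G H m) (auto simp: RGrphN_simps elim!: rgrph_homE base_homE)

section \<open>Levelwise regular epimorphisms between boxes\<close>

context tower
begin

lemma regular_epi_corner:
  assumes "m \<in> HomR n (Box A rs) (Box B ss)" "A \<in> Ob (base X)" "set rs \<subseteq> rels A" "B \<in> Ob (base X)" "set ss \<subseteq> rels B"
    "length rs = n" "length ss = n"
    "\<And>a. length a = n \<Longrightarrow> regular_epi (base X) (gvertex a (Box A rs)) (gvertex a (Box B ss)) (gcomponent a m)"
  shows "regular_epi (base X) A B (corner_arr m)"
  using assms(8)[of "replicate n False"] corner_gcomponent[OF assms(1)] corner_gvertex[of "Box A rs" n X] corner_gvertex[of "Box B ss" n X]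
    box_U(1,2)[OF assms(2,3)] box_U(1,2)[OF assms(4,5)] assms(6,7) by simp

text \<open>The meet of the relations selected by the mask. Selecting by position makes it possible
  to use the same mask for the lists on both sides of a map of boxes.\<close>

fun masked :: "bool list \<Rightarrow> ('o, 'm) obj list \<Rightarrow> (('o, 'm) obj \<times> 'm arr \<times> 'm arr) \<Rightarrow> bool" where
  "masked (b # bs) (r # rs) t \<longleftrightarrow> (b \<longrightarrow> t \<in> rho r) \<and> masked bs rs t"
| "masked _ _ t \<longleftrightarrow> True"

lemma masked_eq_rel: "E \<in> C.eq_rels A \<Longrightarrow> set rs \<subseteq> rels A \<Longrightarrow> {t \<in> E. masked bs rs t} \<in> C.eq_rels A"
\<comment> \<open>The triple is the same in all recursive calls; its place in the induction rule is
  filled with \<open>undefined\<close>.\<close>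
proof (induction bs rs "undefined :: (('o, 'm) obj \<times> 'm arr \<times> 'm arr)" rule: masked.induct)
  case (1 b bs r rs)
  then have "{t \<in> E. masked bs rs t} \<in> C.eq_rels A" "rho r \<in> C.eq_rels A" using relsD(9) by auto
  moreover have "{t \<in> E. masked (b # bs) (r # rs) t} = (if b then rho r \<inter> {t \<in> E. masked bs rs t} else {t \<in> E. masked bs rs t})" by auto
  ultimately show ?case using C.eq_rels_Int by simp
qed simp_all

lemma masked_lift:
  assumes "r \<in> rels A" "x \<in> HomB T (rtop r)" "y \<in> HomB T (rtop r)"
  shows "set rs \<subseteq> rels A \<Longrightarrow> masked bs (map (lift r) rs) (T, x, y) \<longleftrightarrow>
    masked bs rs (T, rd r \<bullet> x, rd r \<bullet> y) \<and> masked bs rs (T, rc r \<bullet> x, rc r \<bullet> y)"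
proof (induction bs rs "undefined :: (('o, 'm) obj \<times> 'm arr \<times> 'm arr)" rule: masked.induct)
  case (1 b bs s rs)
  have "(T, x, y) \<in> rho (lift r s) \<longleftrightarrow> (T, rd r \<bullet> x, rd r \<bullet> y) \<in> rho s \<and> (T, rc r \<bullet> x, rc r \<bullet> y) \<in> rho s"
    using lift(2)[OF assms(1), of s] "1.prems" assms(2,3) by (simp add: C.lift_rel_iff)
  then show ?case using 1 by auto
qed simp_all

lemma masked_refl:
  assumes "x \<in> HomB T A"
  shows "set rs \<subseteq> rels A \<Longrightarrow> masked bs rs (T, x, x)"
proof (induction bs rs "undefined :: (('o, 'm) obj \<times> 'm arr \<times> 'm arr)" rule: masked.induct)
  case (1 b bs s rs)
  then show ?case using C.eq_rels_refl[OF relsD(9) assms] by auto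
qed simp_all

lemma masked_stable:
  assumes "g \<in> HomB U T" "masked bs rs (T, x, y)" "set rs \<subseteq> rels A" "x \<in> HomB T A" "y \<in> HomB T A"
  shows "masked bs rs (U, x \<bullet> g, y \<bullet> g)"
proof -
  have A: "A \<in> Ob (base X)" using C.hom_ob assms(4) by blast
  have "{t \<in> C.all_rel A. masked bs rs t} \<in> C.eq_rels A" by (rule masked_eq_rel[OF C.eq_rels_all[OF A] assms(3)])
  then show ?thesis using C.eq_rels_stable[of "{t \<in> C.all_rel A. masked bs rs t}" A T x y g U] assms by (auto simp: C.all_rel_def)
qed

lemma masked_trans:
  assumes "masked bs rs (T, x, y)" "masked bs rs (T, y, z)" "set rs \<subseteq> rels A" "x \<in> HomB T A" "y \<in> HomB T A" "z \<in> HomB T A"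
  shows "masked bs rs (T, x, z)"
proof -
  have A: "A \<in> Ob (base X)" using C.hom_ob assms(4) by blast
  have "{t \<in> C.all_rel A. masked bs rs t} \<in> C.eq_rels A" by (rule masked_eq_rel[OF C.eq_rels_all[OF A] assms(3)])
  then show ?thesis using C.eq_rels_trans[of "{t \<in> C.all_rel A. masked bs rs t}" A T x y z] assms by (auto simp: C.all_rel_def)
qed

text \<open>
  A levelwise regular epimorphism between boxes preserves meets. In the inductive step one lifts the
  pair \<open>((b, b'), (b', b'))\<close> to a square of \<open>R\<close>-related elements and then replaces three sides of the
  square by one, using that \<open>R\<close> permutes with the other relations.
\<close>

lemma Box_meet:
  assumes "length bs = n" "length rs = n" "length ss = n" "set rs \<subseteq> rels A" "set ss \<subseteq> rels B" "A \<in> Ob (base X)" "B \<in> Ob (base X)"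
    and "m \<in> HomR n (Box A rs) (Box B ss)"
    and "\<And>a. length a = n \<Longrightarrow> regular_epi (base X) (gvertex a (Box A rs)) (gvertex a (Box B ss)) (gcomponent a m)"
    and "b \<in> HomB T B" "b' \<in> HomB T B" "masked bs ss (T, b, b')"
  shows "\<exists>U p x w. regular_epi (base X) U T p \<and> x \<in> HomB U A \<and> w \<in> HomB U A \<and>
    corner_arr m \<bullet> x = b \<bullet> p \<and> corner_arr m \<bullet> w = b' \<bullet> p \<and> masked bs rs (U, x, w)"
  using assms
proof (induction bs arbitrary: n A B rs ss m T b b')
  case Nil
  have f: "regular_epi (base X) A B (corner_arr m)"
    using regular_epi_corner[OF Nil.prems(8,6,4,7,5,2,3,9)] .
  note fh = C.regular_epi_hom[OF f]
  obtain U p x where x: "regular_epi (base X) U T p" "x \<in> HomB U A" "corner_arr m \<bullet> x = b \<bullet> p" using C.local_lift[OF f Nil.prems(10)] .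
  note ph = C.regular_epi_hom[OF x(1)]
  obtain V q w where w: "regular_epi (base X) V U q" "w \<in> HomB V A" "corner_arr m \<bullet> w = (b' \<bullet> p) \<bullet> q"
    using C.local_lift[OF f C.comp_hom[OF ph Nil.prems(11)]] .
  note qh = C.regular_epi_hom[OF w(1)]
  have "corner_arr m \<bullet> (x \<bullet> q) = b \<bullet> (p \<bullet> q)" using C.square_comp[OF x(2) fh ph Nil.prems(10) x(3) qh] .
  moreover have "corner_arr m \<bullet> w = b' \<bullet> (p \<bullet> q)" using w(3) C.comp_assoc[OF qh ph Nil.prems(11)] by simp
  ultimately show ?case
    using C.regular_epi_comp[OF w(1) x(1)] C.comp_hom[OF qh x(2)] w(2) by (intro exI[of _ V] exI[of _ "p \<bullet> q"] exI[of _ "x \<bullet> q"] exI[of _ w]) simp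
next
  case (Cons i bs)
  obtain l where l: "n = Suc l" "length bs = l" using Cons.prems(1) by (cases n) auto
  obtain r rs' where rs: "rs = r # rs'" "length rs' = l" using Cons.prems(2) l by (cases rs) auto
  obtain s ss' where ss: "ss = s # ss'" "length ss' = l" using Cons.prems(3) l by (cases ss) auto
  have r: "r \<in> rels A" "set rs' \<subseteq> rels A" and s: "s \<in> rels B" "set ss' \<subseteq> rels B"
    using Cons.prems(4,5) rs ss by auto
  note A = Cons.prems(6) note B = Cons.prems(7) note b = Cons.prems(10,11)
  note r' = relsD[OF r(1)] note s' = relsD[OF s(1)]
  let ?f = "corner_arr m"
  obtain m1 m2 where m: "m = RGA m1 m2" "m1 \<in> HomR l (Box A rs') (Box B ss')" "corner_arr m1 = ?f"
    "m2 \<in> HomR l (Box (rtop r) (map (lift r) rs')) (Box (rtop s) (map (lift s) ss'))"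
    "corner_arr m2 \<in> HomB (rtop r) (rtop s)" "rd s \<bullet> corner_arr m2 = ?f \<bullet> rd r" "rc s \<bullet> corner_arr m2 = ?f \<bullet> rc r"
    by (rule Box_hom_Cons[OF r'(10) r s'(10) s rs(2) ss(2) Cons.prems(8)[unfolded l(1) rs(1) ss(1)]])
  have lev1: "regular_epi (base X) (gvertex a (Box A rs')) (gvertex a (Box B ss')) (gcomponent a m1)" if "length a = l" for a
    using Cons.prems(9)[of "False # a"] that l(1) unfolding m(1) rs(1) ss(1) by simp
  have lev2: "regular_epi (base X) (gvertex a (Box (rtop r) (map (lift r) rs'))) (gvertex a (Box (rtop s) (map (lift s) ss'))) (gcomponent a m2)"
    if "length a = l" for a
    using Cons.prems(9)[of "True # a"] that l(1) unfolding m(1) rs(1) ss(1) by simp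
  have mb: "i \<longrightarrow> (T, b, b') \<in> rho s" "masked bs ss' (T, b, b')" using Cons.prems(12) ss(1) by auto
  have fh: "?f \<in> HomB A B"
    using corner_hom[OF m(2)] box_U(2)[OF A r(2)] box_U(2)[OF B s(2)] m(3) by simp
  show ?case
  proof (cases i)
    case False
    then show ?thesis
      using Cons.IH[OF l(2) rs(2) ss(2) r(2) s(2) A B m(2) lev1 b mb(2)] unfolding m(3) rs(1) by simp
  next
    case True
    let ?g = "corner_arr m2"
    \<comment> \<open>The elements \<open>z\<close> and \<open>z'\<close> of \<open>s\<close> are
      the pairs \<open>(b, b')\<close> and \<open>(b', b')\<close>. They are related by the lifts of
      the selected relations, so the induction hypothesis for \<open>m2\<close> lifts them to
      elements \<open>\<xi>\<close> and \<open>\<omega>\<close> of \<open>r\<close>.\<close>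
    obtain z where z: "z \<in> HomB T (rtop s)" "b = rd s \<bullet> z" "b' = rc s \<bullet> z" using mb(1) True by (auto simp: rho_def C.span_rel_def)
    have "(T, b', b') \<in> rho s" using C.eq_rels_refl[OF s'(9) b(2)] .
    then obtain z' where z': "z' \<in> HomB T (rtop s)" "b' = rd s \<bullet> z'" "b' = rc s \<bullet> z'" by (auto simp: rho_def C.span_rel_def)
    have "masked bs (map (lift s) ss') (T, z, z')"
      unfolding masked_lift[OF s(1) z(1) z'(1) s(2)] using mb(2) masked_refl[OF b(2) s(2)] z(2,3) z'(2,3) by metis
    then obtain U p \<xi> \<omega> where U: "regular_epi (base X) U T p" "\<xi> \<in> HomB U (rtop r)" "\<omega> \<in> HomB U (rtop r)"
      "?g \<bullet> \<xi> = z \<bullet> p" "?g \<bullet> \<omega> = z' \<bullet> p" "masked bs (map (lift r) rs') (U, \<xi>, \<omega>)"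
      using Cons.IH[OF l(2) _ _ lift_rels[OF r] lift_rels[OF s] r'(11) s'(11) m(4) lev2 z(1) z'(1)] rs(2) ss(2) by auto
    note ph = C.regular_epi_hom[OF U(1)]
    let ?x = "rd r \<bullet> \<xi>" and ?x' = "rc r \<bullet> \<xi>" and ?w = "rd r \<bullet> \<omega>" and ?w' = "rc r \<bullet> \<omega>"
    have h: "?x \<in> HomB U A" "?x' \<in> HomB U A" "?w \<in> HomB U A" "?w' \<in> HomB U A" using C.comp_hom U(2,3) r'(2,3) by blast+
    have fx: "?f \<bullet> ?x = b \<bullet> p" "?f \<bullet> ?x' = b' \<bullet> p" "?f \<bullet> ?w = b' \<bullet> p" "?f \<bullet> ?w' = b' \<bullet> p"
      using C.square_comp[OF m(5) s'(2) r'(2) fh m(6) U(2)] C.square_comp[OF m(5) s'(3) r'(3) fh m(7) U(2)]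
        C.square_comp[OF m(5) s'(2) r'(2) fh m(6) U(3)] C.square_comp[OF m(5) s'(3) r'(3) fh m(7) U(3)]
        U(4,5) C.comp_assoc[OF ph z(1) s'(2)] C.comp_assoc[OF ph z(1) s'(3)] C.comp_assoc[OF ph z'(1) s'(2)] C.comp_assoc[OF ph z'(1) s'(3)]
        z(2,3) z'(2,3) by simp_all
    have mx: "masked bs rs' (U, ?x, ?w)" "masked bs rs' (U, ?x', ?w')" using U(6) unfolding masked_lift[OF r(1) U(2,3) r(2)] by auto
    let ?K = "C.ker A ?f"
    have K: "?K \<in> C.eq_rels A" by (rule C.ker_eq_rels[OF fh])
    \<comment> \<open>In the square with horizontal edges \<open>?x\<close>, \<open>?x'\<close> and
      \<open>?w\<close>, \<open>?w'\<close> in \<open>r\<close>, only \<open>?x\<close> lies over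
      \<open>b\<close>. The path from \<open>?w\<close> over \<open>?w'\<close> to
      \<open>?x'\<close> stays in the kernel; exchanging its two steps gives \<open>v\<close> over
      \<open>b'\<close> that is reached from \<open>?w\<close> by the selected relations and from
      \<open>?x'\<close> by \<open>r\<close>. Then \<open>?x\<close> and \<open>v\<close> are
      related by all of them.\<close>
    let ?E = "rho r \<inter> ?K" and ?G = "{t \<in> ?K. masked bs rs' t}"
    have E: "?E \<in> C.eq_rels A" using C.eq_rels_Int[OF r'(9) K] .
    have G: "?G \<in> C.eq_rels A" by (rule masked_eq_rel[OF K r(2)])
    have "(U, ?w, ?w') \<in> ?E" using fx h U(3) by (auto simp: rho_def C.span_rel_def C.ker_def)
    moreover have "(U, ?x', ?w') \<in> ?G" using fx h mx(2) by (auto simp: C.ker_def)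
    then have "(U, ?w', ?x') \<in> ?G" by (rule C.eq_rels_sym[OF G])
    ultimately obtain V q v where v: "regular_epi (base X) V U q" "(V, ?w \<bullet> q, v) \<in> ?G" "(V, v, ?x' \<bullet> q) \<in> ?E" "v \<in> HomB V A"
      using C.permute[OF E G] by blast
    note qh = C.regular_epi_hom[OF v(1)]
    have xq: "?x \<bullet> q \<in> HomB V A" and wq: "?w \<bullet> q \<in> HomB V A" using C.comp_hom[OF qh] h by blast+
    have "masked bs rs' (V, ?x \<bullet> q, v)"
      using masked_trans[OF masked_stable[OF qh mx(1) r(2) h(1,3)] _ r(2) xq wq v(4)] v(2) by simp
    moreover have "(V, ?x \<bullet> q, v) \<in> rho r"
    proof -
      have "(U, ?x, ?x') \<in> rho r" using U(2) by (auto simp: rho_def C.span_rel_def)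
      then have "(V, ?x \<bullet> q, ?x' \<bullet> q) \<in> rho r" by (rule C.eq_rels_stable[OF r'(9) _ qh])
      then show ?thesis using C.eq_rels_trans[OF r'(9)] C.eq_rels_sym[OF r'(9)] v(3) by blast
    qed
    moreover have "?f \<bullet> (?x \<bullet> q) = b \<bullet> (p \<bullet> q)" using C.square_comp[OF h(1) fh ph b(1) fx(1) qh] .
    moreover have "?f \<bullet> v = b' \<bullet> (p \<bullet> q)"
      using v(2) C.square_comp[OF h(3) fh ph b(2) fx(3) qh] by (simp add: C.ker_def)
    ultimately show ?thesis
      using C.regular_epi_comp[OF v(1) U(1)] xq v(4) unfolding rs(1)
      by (intro exI[of _ V] exI[of _ "p \<bullet> q"] exI[of _ "?x \<bullet> q"] exI[of _ v]) simp
  qed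
qed

text \<open>For each direction, the vertex with coordinate 2 there and 1 elsewhere gives a regular
  epimorphism between the corresponding relations, so that the one in \<open>ss\<close> is the
  direct image of the one in \<open>rs\<close>.\<close>

lemma Box_inv:
  assumes "length rs = n" "length ss = n" "set rs \<subseteq> rels A" "set ss \<subseteq> rels B" "A \<in> Ob (base X)" "B \<in> Ob (base X)"
    and "m \<in> HomR n (Box A rs) (Box B ss)"
    and "\<And>a. length a = n \<Longrightarrow> regular_epi (base X) (gvertex a (Box A rs)) (gvertex a (Box B ss)) (gcomponent a m)"
  shows "map (\<lambda>s. C.inv_rel A (corner_arr m) (rho s)) ss = map (\<lambda>r. C.cl A (rho r \<union> C.ker A (corner_arr m))) rs"
  using assms
proof (induction rs arbitrary: n ss m)
  case (Cons r rs')
  note A = Cons.prems(5) note B = Cons.prems(6)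
  obtain l where l: "n = Suc l" "length rs' = l" using Cons.prems(1) by (cases n) auto
  obtain s ss' where ss: "ss = s # ss'" "length ss' = l" using Cons.prems(2) l by (cases ss) auto
  have r: "r \<in> rels A" "set rs' \<subseteq> rels A" and s: "s \<in> rels B" "set ss' \<subseteq> rels B"
    using Cons.prems(3,4) ss by auto
  note r' = relsD[OF r(1)] note s' = relsD[OF s(1)]
  let ?f = "corner_arr m"
  obtain m1 m2 where m: "m = RGA m1 m2" "m1 \<in> HomR l (Box A rs') (Box B ss')" "corner_arr m1 = ?f"
    "m2 \<in> HomR l (Box (rtop r) (map (lift r) rs')) (Box (rtop s) (map (lift s) ss'))"
    "corner_arr m2 \<in> HomB (rtop r) (rtop s)" "rd s \<bullet> corner_arr m2 = ?f \<bullet> rd r" "rc s \<bullet> corner_arr m2 = ?f \<bullet> rc r"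
    by (rule Box_hom_Cons[OF A r B s l(2) ss(2) Cons.prems(7)[unfolded l(1) ss(1)]])
  have lev1: "regular_epi (base X) (gvertex a (Box A rs')) (gvertex a (Box B ss')) (gcomponent a m1)" if "length a = l" for a
    using Cons.prems(8)[of "False # a"] that l(1) unfolding m(1) ss(1) by simp
  have lev2: "regular_epi (base X) (gvertex a (Box (rtop r) (map (lift r) rs'))) (gvertex a (Box (rtop s) (map (lift s) ss'))) (gcomponent a m2)"
    if "length a = l" for a
    using Cons.prems(8)[of "True # a"] that l(1) unfolding m(1) ss(1) by simp
  have fh: "?f \<in> HomB A B"
    using corner_hom[OF m(2)] box_U(2)[OF A r(2)] box_U(2)[OF B s(2)] m(3) by simp
  have g: "regular_epi (base X) (rtop r) (rtop s) (corner_arr m2)"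
    using regular_epi_corner[OF m(4) r'(11) lift_rels[OF r] s'(11) lift_rels[OF s] _ _ lev2] l(2) ss(2) by simp
  have "C.inv_rel A ?f (rho s) = C.cl A (rho r \<union> C.ker A ?f)"
    using C.regular_epi_relD[OF fh r'(7) s'(7) _ _ m(5-7) g] r'(9) s'(9) unfolding rho_def by blast
  moreover have "map (\<lambda>s. C.inv_rel A ?f (rho s)) ss' = map (\<lambda>r. C.cl A (rho r \<union> C.ker A ?f)) rs'"
    using Cons.IH[OF l(2) ss(2) r(2) s(2) A B m(2) lev1] unfolding m(3) by simp
  ultimately show ?case using ss(1) by simp
qed simp

lemma Box_dist:
  assumes n: "length rs = n" "length ss = n" and rs: "set rs \<subseteq> rels A" and ss: "set ss \<subseteq> rels B" and A: "A \<in> Ob (base X)" and B: "B \<in> Ob (base X)"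
    and m: "m \<in> HomR n (Box A rs) (Box B ss)"
    and lev: "\<And>a. length a = n \<Longrightarrow> regular_epi (base X) (gvertex a (Box A rs)) (gvertex a (Box B ss)) (gcomponent a m)"
    and DA: "C.dist A (rho ` set rs)" and DB: "C.dist B (rho ` set ss)"
  shows "C.dist A (insert (C.ker A (corner_arr m)) (rho ` set rs))"
proof -
  let ?f = "corner_arr m" and ?K = "C.ker A (corner_arr m)"
  interpret A: modular_set_lattice "C.eq_rels A" by (rule C.modular_eq_rels[OF A])
  interpret B: modular_set_lattice "C.eq_rels B" by (rule C.modular_eq_rels[OF B])
  have f: "regular_epi (base X) A B ?f" by (rule regular_epi_corner[OF m A rs B ss n lev])
  note fh = C.regular_epi_hom[OF f]
  note K = C.ker_eq_rels[OF fh]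
  note inv = Box_inv[OF n rs ss A B m lev]
  have inv_i: "C.inv_rel A ?f (rho (ss ! i)) = A.cl (rho (rs ! i) \<union> ?K)" if "i < n" for i
    using arg_cong[OF inv, of "\<lambda>z. z ! i"] that n by simp
  interpret H: modular_set_lattice_hom "C.eq_rels B" "C.eq_rels A" "C.inv_rel A ?f" "rho ` set ss"
    by (rule C.inv_rel_hom[OF f]) (use ss relsD(9) in auto)
  \<comment> \<open>Modulo \<open>?K\<close> the members of \<open>rs\<close> become the inverse
    images of those of \<open>ss\<close>. The condition of \<open>dist_insert\<close> on the
    quotient is thus the distributivity of \<open>ss\<close>.\<close>
  have "C.inv_rel A ?f ` rho ` set ss = (\<lambda>a. A.cl (a \<union> ?K)) ` rho ` set rs"
    using arg_cong[OF inv, of set] by (simp add: image_image)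
  then have DQ: "A.dist ((\<lambda>a. A.cl (a \<union> ?K)) ` rho ` set rs)" using H.dist_image[OF DB] by simp
  show ?thesis
  proof (rule A.dist_insert[OF DA K DQ])
    fix S assume S: "finite S" "S \<subseteq> rho ` set rs"
    have SL: "S \<subseteq> C.eq_rels A" using S(2) rs relsD(9) by auto
    have M: "A.mt S \<in> C.eq_rels A" by (rule A.mt_in[OF S(1) SL])
    have L: "A.cl (?K \<union> A.mt S) \<in> C.eq_rels A" by (rule A.cl_Un_in[OF K M])
    \<comment> \<open>The mask selects the positions whose relation belongs to \<open>S\<close>; the
      selected relations in \<open>ss\<close> are the direct images of the members of
      \<open>S\<close>.\<close>
    define bs where "bs = map (\<lambda>r. rho r \<in> S) rs"
    have masked_iff: "masked (map (\<lambda>r. rho r \<in> S) rs') ss' t \<longleftrightarrow> (\<forall>i<length rs'. rho (rs' ! i) \<in> S \<longrightarrow> t \<in> rho (ss' ! i))"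
      if "length rs' = length ss'" for rs' ss' t
      using that
    proof (induction rs' ss' rule: list_induct2)
      case (Cons x xs y ys)
      then show ?case by (auto simp: less_Suc_eq_0_disj)
    qed simp
    show "A.mt ((\<lambda>a. A.cl (a \<union> ?K)) ` S) \<subseteq> A.cl (?K \<union> A.mt S)"
    proof
      fix t assume t: "t \<in> A.mt ((\<lambda>a. A.cl (a \<union> ?K)) ` S)"
      then have "t \<in> C.all_rel A" unfolding A.mt_def C.Union_eq_rels[OF A] by blast
      then obtain T x y where xy: "t = (T, x, y)" "x \<in> HomB T A" "y \<in> HomB T A" by (auto simp: C.all_rel_def)
      have "(T, ?f \<bullet> x, ?f \<bullet> y) \<in> rho (ss ! i)" if "i < n" "rho (rs ! i) \<in> S" for i
      proof -
        have "t \<in> A.cl (rho (rs ! i) \<union> ?K)" using t that(2) unfolding A.mt_def by blast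
        then have "(T, x, y) \<in> C.inv_rel A ?f (rho (ss ! i))" unfolding inv_i[OF that(1)] xy(1) .
        then show ?thesis by (simp add: C.inv_rel_def)
      qed
      then have mk: "masked bs ss (T, ?f \<bullet> x, ?f \<bullet> y)"
        unfolding bs_def using masked_iff[of rs ss] n by simp
      \<comment> \<open>The images of \<open>x\<close> and \<open>y\<close> are related by all
        selected relations at once; the lifted pair is in the meet of \<open>S\<close> and differs
        from \<open>x\<close>, \<open>y\<close> by the kernel only.\<close>
      obtain U p u w where u: "regular_epi (base X) U T p" "u \<in> HomB U A" "w \<in> HomB U A"
        "?f \<bullet> u = (?f \<bullet> x) \<bullet> p" "?f \<bullet> w = (?f \<bullet> y) \<bullet> p" "masked bs rs (U, u, w)"
        using Box_meet[OF _ n rs ss A B m lev C.comp_hom[OF xy(2) fh] C.comp_hom[OF xy(3) fh] mk] n by (auto simp: bs_def)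
      note ph = C.regular_epi_hom[OF u(1)]
      have "(U, u, w) \<in> A.mt S"
        unfolding A.mt_def C.Union_eq_rels[OF A]
      proof (intro IntI InterI)
        show "(U, u, w) \<in> C.all_rel A" using u by (simp add: C.all_rel_def)
        fix k assume "k \<in> S"
        then obtain r where r: "r \<in> set rs" "k = rho r" using S(2) by blast
        then obtain i where i: "i < length rs" "rs ! i = r" using in_set_conv_nth[of r rs] by blast
        then show "(U, u, w) \<in> k" using u(6) masked_iff[of rs rs] \<open>k \<in> S\<close> r(2) unfolding bs_def by blast
      qed
      then have 1: "(U, u, w) \<in> A.cl (?K \<union> A.mt S)" using A.cl_extensive[of "?K \<union> A.mt S"] by blast
      have "(U, x \<bullet> p, u) \<in> ?K" "(U, w, y \<bullet> p) \<in> ?K"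
        using u C.comp_hom[OF ph xy(2)] C.comp_hom[OF ph xy(3)] C.comp_assoc[OF ph xy(2) fh] C.comp_assoc[OF ph xy(3) fh] by (auto simp: C.ker_def)
      then have "(U, x \<bullet> p, u) \<in> A.cl (?K \<union> A.mt S)" "(U, w, y \<bullet> p) \<in> A.cl (?K \<union> A.mt S)"
        using A.cl_extensive[of "?K \<union> A.mt S"] by auto
      then have "(U, x \<bullet> p, y \<bullet> p) \<in> A.cl (?K \<union> A.mt S)" using C.eq_rels_trans[OF L] 1 by blast
      then show "t \<in> A.cl (?K \<union> A.mt S)" using C.eq_rels_local[OF L u(1) xy(2,3)] xy(1) by simp
    qed
  qed
qed

section \<open>Distributivity\<close>

lemma erel_le_iff:
  assumes r: "r \<in> rels A" and s: "s \<in> rels A"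
  shows "erel_le (base X) r s \<longleftrightarrow> rho r \<subseteq> rho s"
proof -
  note r' = relsD[OF r] note s' = relsD[OF s]
  have "erel_le (base X) r s \<longleftrightarrow> (\<exists>h \<in> HomB (rtop r) (rtop s). rd s \<bullet> h = rd r \<and> rc s \<bullet> h = rc r)"
  proof
    assume "erel_le (base X) r s"
    then show "\<exists>h \<in> HomB (rtop r) (rtop s). rd s \<bullet> h = rd r \<and> rc s \<bullet> h = rc r" unfolding erel_le_def by auto
  next
    assume "\<exists>h \<in> HomB (rtop r) (rtop s). rd s \<bullet> h = rd r \<and> rc s \<bullet> h = rc r"
    then show "erel_le (base X) r s" unfolding erel_le_def using r'(1) s'(1) by blast
  qed
  also have "\<dots> \<longleftrightarrow> (rtop r, rd r, rc r) \<in> rho s" by (simp add: rho_def C.span_rel_def) metis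
  also have "\<dots> \<longleftrightarrow> rho r \<subseteq> rho s"
    using C.span_rel_span[OF r'(11,2,3)] C.span_rel_subset[of A "rho s"] s'(9) by (auto simp: rho_def[of r] C.eq_rels_def)
  finally show ?thesis .
qed

text \<open>In a preorder a meet is a chosen greatest lower bound, determined up to mutual
  inclusion. After applying \<open>rho\<close> this ambiguity is gone.\<close>

lemma erel_inf:
  assumes A: "A \<in> Ob (base X)" and I: "finite I" "I \<subseteq> rels A"
  shows "\<Sqinter>\<^bsub>erel_order (base X) A\<^esub> I \<in> rels A" "rho (\<Sqinter>\<^bsub>erel_order (base X) A\<^esub> I) = C.mt A (rho ` I)"
proof -
  let ?L = "erel_order (base X) A"
  interpret A: modular_set_lattice "C.eq_rels A" by (rule C.modular_eq_rels[OF A])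
  have carr: "carrier ?L = rels A" by (simp add: rels_def)
  have le: "x \<sqsubseteq>\<^bsub>?L\<^esub> y \<longleftrightarrow> rho x \<subseteq> rho y" if "x \<in> rels A" "y \<in> rels A" for x y
    using erel_le_iff[OF that] by (simp add: erel_order_def)
  have "A.mt (rho ` I) \<in> C.eq_rels A" using I relsD(9) by (intro A.mt_in) auto
  then obtain g where g: "g \<in> rels A" "rho g = A.mt (rho ` I)" by (rule ex_rels)
  have Lower: "x \<in> Lower ?L I \<longleftrightarrow> x \<in> rels A \<and> rho x \<subseteq> A.mt (rho ` I)" for x
  proof -
    have "x \<in> Lower ?L I \<longleftrightarrow> x \<in> rels A \<and> (\<forall>y \<in> I. rho x \<subseteq> rho y)" unfolding Lower_def carr using I(2) le by blast
    then show ?thesis using relsD(9)[of x A] unfolding A.mt_def by blast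
  qed
  have gr: "greatest ?L x (Lower ?L I) \<longleftrightarrow> x \<in> rels A \<and> rho x = A.mt (rho ` I)" for x
  proof
    assume x: "greatest ?L x (Lower ?L I)"
    then have "x \<in> Lower ?L I" "\<forall>y \<in> Lower ?L I. y \<sqsubseteq>\<^bsub>?L\<^esub> x" by (auto simp: greatest_def)
    moreover have "g \<in> Lower ?L I" using Lower[of g] g by simp
    ultimately have "x \<in> rels A" "rho x \<subseteq> A.mt (rho ` I)" "g \<sqsubseteq>\<^bsub>?L\<^esub> x" using Lower[of x] by simp_all
    then show "x \<in> rels A \<and> rho x = A.mt (rho ` I)" using le[OF g(1), of x] g(2) by simp
  next
    assume x: "x \<in> rels A \<and> rho x = A.mt (rho ` I)"
    then show "greatest ?L x (Lower ?L I)" unfolding greatest_def using Lower le by (auto simp: carr)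
  qed
  have "greatest ?L (\<Sqinter>\<^bsub>?L\<^esub> I) (Lower ?L I)" unfolding inf_def by (rule someI[of _ g]) (simp add: gr g)
  then show "\<Sqinter>\<^bsub>?L\<^esub> I \<in> rels A" "rho (\<Sqinter>\<^bsub>?L\<^esub> I) = A.mt (rho ` I)" using gr by auto
qed

lemma erel_sup:
  assumes A: "A \<in> Ob (base X)" and I: "finite I" "I \<subseteq> rels A"
  shows "\<Squnion>\<^bsub>erel_order (base X) A\<^esub> I \<in> rels A" "rho (\<Squnion>\<^bsub>erel_order (base X) A\<^esub> I) = C.cl A (\<Union>(rho ` I))"
proof -
  let ?L = "erel_order (base X) A"
  interpret A: modular_set_lattice "C.eq_rels A" by (rule C.modular_eq_rels[OF A])
  have carr: "carrier ?L = rels A" by (simp add: rels_def)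
  have le: "x \<sqsubseteq>\<^bsub>?L\<^esub> y \<longleftrightarrow> rho x \<subseteq> rho y" if "x \<in> rels A" "y \<in> rels A" for x y
    using erel_le_iff[OF that] by (simp add: erel_order_def)
  have "A.cl (\<Union>(rho ` I)) \<in> C.eq_rels A" using I relsD(9) by (intro A.cl_Union_in) auto
  then obtain g where g: "g \<in> rels A" "rho g = A.cl (\<Union>(rho ` I))" by (rule ex_rels)
  have Upper: "x \<in> Upper ?L I \<longleftrightarrow> x \<in> rels A \<and> A.cl (\<Union>(rho ` I)) \<subseteq> rho x" for x
  proof -
    have "x \<in> Upper ?L I \<longleftrightarrow> x \<in> rels A \<and> (\<forall>y \<in> I. rho y \<subseteq> rho x)" unfolding Upper_def carr using I(2) le by blast
    then have "x \<in> Upper ?L I \<longleftrightarrow> x \<in> rels A \<and> \<Union>(rho ` I) \<subseteq> rho x" by blast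
    then show ?thesis using A.cl_least[of "\<Union>(rho ` I)" "rho x"] A.cl_extensive[of "\<Union>(rho ` I)"] relsD(9)[of x A] by blast
  qed
  have gr: "least ?L x (Upper ?L I) \<longleftrightarrow> x \<in> rels A \<and> rho x = A.cl (\<Union>(rho ` I))" for x
  proof
    assume x: "least ?L x (Upper ?L I)"
    then have "x \<in> Upper ?L I" "\<forall>y \<in> Upper ?L I. x \<sqsubseteq>\<^bsub>?L\<^esub> y" by (auto simp: least_def)
    moreover have "g \<in> Upper ?L I" using Upper[of g] g by simp
    ultimately have "x \<in> rels A" "A.cl (\<Union>(rho ` I)) \<subseteq> rho x" "x \<sqsubseteq>\<^bsub>?L\<^esub> g" using Upper[of x] by simp_all
    then show "x \<in> rels A \<and> rho x = A.cl (\<Union>(rho ` I))" using le[OF _ g(1), of x] g(2) by simp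
  next
    assume x: "x \<in> rels A \<and> rho x = A.cl (\<Union>(rho ` I))"
    then show "least ?L x (Upper ?L I)" unfolding least_def using Upper le by (auto simp: carr)
  qed
  have "least ?L (\<Squnion>\<^bsub>?L\<^esub> I) (Upper ?L I)" unfolding sup_def by (rule someI[of _ g]) (simp add: gr g)
  then show "\<Squnion>\<^bsub>?L\<^esub> I \<in> rels A" "rho (\<Squnion>\<^bsub>?L\<^esub> I) = A.cl (\<Union>(rho ` I))" using gr by auto
qed

lemma distributive_eq:
  assumes A: "A \<in> Ob (base X)" and R: "\<And>i. i < n \<Longrightarrow> R i \<in> rels A"
  shows "distributive n (base X) A R \<longleftrightarrow> (\<forall>k\<ge>1. \<forall>J :: nat \<Rightarrow> nat set.
      (\<forall>i\<le>k. J i \<subseteq> {..<n}) \<and> (\<forall>i\<le>k. \<forall>j\<le>k. i \<noteq> j \<longrightarrow> J i \<inter> J j = {}) \<longrightarrow>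
      C.mt A (rho ` R ` J 0) \<inter> C.cl A (\<Union>i\<in>{1..k}. C.mt A (rho ` R ` J i)) = C.cl A (\<Union>i\<in>{1..k}. C.mt A (rho ` R ` (J 0 \<union> J i))))"
proof -
  let ?L = "erel_order (base X) A"
  interpret A: modular_set_lattice "C.eq_rels A" by (rule C.modular_eq_rels[OF A])
  have inf: "\<Sqinter>\<^bsub>?L\<^esub>(R ` J) \<in> rels A" "rho (\<Sqinter>\<^bsub>?L\<^esub>(R ` J)) = A.mt (rho ` R ` J)" if "J \<subseteq> {..<n}" for J
    using erel_inf[OF A, of "R ` J"] that R finite_subset[OF that] by auto
  have "((\<Sqinter>\<^bsub>?L\<^esub>(R ` J 0)) \<sqinter>\<^bsub>?L\<^esub> (\<Squnion>\<^bsub>?L\<^esub>((\<lambda>i. \<Sqinter>\<^bsub>?L\<^esub>(R ` J i)) ` {1..k}))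
        .=\<^bsub>?L\<^esub> (\<Squnion>\<^bsub>?L\<^esub>((\<lambda>i. \<Sqinter>\<^bsub>?L\<^esub>(R ` (J 0 \<union> J i))) ` {1..k}))) \<longleftrightarrow>
      A.mt (rho ` R ` J 0) \<inter> A.cl (\<Union>i\<in>{1..k}. A.mt (rho ` R ` J i)) = A.cl (\<Union>i\<in>{1..k}. A.mt (rho ` R ` (J 0 \<union> J i)))"
    if J: "\<forall>i\<le>k. J i \<subseteq> {..<n}" for J :: "nat \<Rightarrow> nat set" and k
  proof -
    let ?a = "\<Sqinter>\<^bsub>?L\<^esub>(R ` J 0)" and ?b = "\<Squnion>\<^bsub>?L\<^esub>((\<lambda>i. \<Sqinter>\<^bsub>?L\<^esub>(R ` J i)) ` {1..k})"
      and ?c = "\<Squnion>\<^bsub>?L\<^esub>((\<lambda>i. \<Sqinter>\<^bsub>?L\<^esub>(R ` (J 0 \<union> J i))) ` {1..k})"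
    have "J 0 \<subseteq> {..<n}" using J by blast
    note a = inf[OF this]
    have "(\<lambda>i. \<Sqinter>\<^bsub>?L\<^esub>(R ` J i)) ` {1..k} \<subseteq> rels A" using inf(1) J by auto
    note b = erel_sup[OF A _ this]
    have "\<Union>(rho ` (\<lambda>i. \<Sqinter>\<^bsub>?L\<^esub>(R ` J i)) ` {1..k}) = (\<Union>i\<in>{1..k}. A.mt (rho ` R ` J i))"
      unfolding image_image[of rho "\<lambda>i. \<Sqinter>\<^bsub>?L\<^esub>(R ` J i)"] using inf(2) J by (intro SUP_cong) auto
    then have b: "?b \<in> rels A" "rho ?b = A.cl (\<Union>i\<in>{1..k}. A.mt (rho ` R ` J i))" using b by auto
    have "(\<lambda>i. \<Sqinter>\<^bsub>?L\<^esub>(R ` (J 0 \<union> J i))) ` {1..k} \<subseteq> rels A" using inf(1) J by auto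
    note c = erel_sup[OF A _ this]
    have "\<Union>(rho ` (\<lambda>i. \<Sqinter>\<^bsub>?L\<^esub>(R ` (J 0 \<union> J i))) ` {1..k}) = (\<Union>i\<in>{1..k}. A.mt (rho ` R ` (J 0 \<union> J i)))"
      unfolding image_image
    proof (rule SUP_cong)
      fix i assume "i \<in> {1..k}"
      then have "J 0 \<union> J i \<subseteq> {..<n}" using J by auto
      then show "rho (\<Sqinter>\<^bsub>?L\<^esub>(R ` (J 0 \<union> J i))) = A.mt ((\<lambda>x. rho (R x)) ` (J 0 \<union> J i))" using inf(2) by (simp add: image_image)
    qed simp
    then have c: "?c \<in> rels A" "rho ?c = A.cl (\<Union>i\<in>{1..k}. A.mt (rho ` R ` (J 0 \<union> J i)))" using c by auto
    have ab: "?a \<sqinter>\<^bsub>?L\<^esub> ?b \<in> rels A" "rho (?a \<sqinter>\<^bsub>?L\<^esub> ?b) = rho ?a \<inter> rho ?b"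
    proof -
      have ab: "{?a, ?b} \<subseteq> rels A" using a(1) b(1) by simp
      have "A.mt (rho ` {?a, ?b}) = rho ?a \<inter> rho ?b"
        using A.mt_singleton[OF relsD(9)[OF b(1)]] by (simp add: A.mt_insert)
      then show "?a \<sqinter>\<^bsub>?L\<^esub> ?b \<in> rels A" "rho (?a \<sqinter>\<^bsub>?L\<^esub> ?b) = rho ?a \<inter> rho ?b"
        using erel_inf[OF A _ ab] unfolding meet_def by auto
    qed
    have "(?a \<sqinter>\<^bsub>?L\<^esub> ?b .=\<^bsub>?L\<^esub> ?c) \<longleftrightarrow> rho (?a \<sqinter>\<^bsub>?L\<^esub> ?b) = rho ?c"
      using erel_le_iff[OF ab(1) c(1)] erel_le_iff[OF c(1) ab(1)] by (auto simp: erel_order_def)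
    then show ?thesis using ab(2) a(2) b(2) c(2) by simp
  qed
  note eq = this
  show ?thesis unfolding distributive_def Let_def
    by (intro all_cong1 imp_cong refl) (rule eq, blast)
qed

text \<open>One direction takes the instance whose outer meet is a single member and whose joinands
  are single members and one meet. The other one applies the binary law after all meets of
  subfamilies have been adjoined to the family.\<close>

lemma distributive_iff:
  assumes A: "A \<in> Ob (base X)" and R: "\<And>i. i < n \<Longrightarrow> R i \<in> rels A"
  shows "distributive n (base X) A R \<longleftrightarrow> C.dist A (rho ` R ` {..<n})"
proof
  interpret A: modular_set_lattice "C.eq_rels A" by (rule C.modular_eq_rels[OF A])
  let ?F = "rho ` R ` {..<n}"
  have FL: "?F \<subseteq> C.eq_rels A" using R relsD(9) by auto
  { assume D: "distributive n (base X) A R"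
    show "A.dist ?F"
    proof (rule A.dist_from_meet_join[OF FL])
      fix m S Z assume m: "m \<in> ?F" and fin: "finite S" "finite Z" and S: "S \<subseteq> ?F" and Z: "Z \<subseteq> ?F" 
        and disj: "m \<notin> S" "m \<notin> Z" "S \<inter> Z = {}"
      have "\<forall>x \<in> ?F. \<exists>i. i < n \<and> rho (R i) = x" by auto
      \<comment> \<open>The family \<open>R\<close> may repeat a relation. The function
        \<open>g\<close> picks one index for each relation, so that disjoint sets of relations have
        disjoint sets of indices.\<close>
      then obtain g where g: "\<And>x. x \<in> ?F \<Longrightarrow> g x < n \<and> rho (R (g x)) = x" by metis
      obtain h where h: "bij_betw h {0..<card Z} Z" using ex_bij_betw_nat_finite[OF fin(2)] by blast
      \<comment> \<open>The positions from 1 to \<open>card Z\<close> hold the members of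
        \<open>Z\<close>, and the last position holds the meet of \<open>S\<close>. The additional
        position keeps \<open>k\<close> positive when \<open>Z\<close> is empty.\<close>
      define k where "k = Suc (card Z)"
      define J where "J i = (if i = 0 then {g m} else if i = k then g ` S else {g (h (i - 1))})" for i
      have hZ: "h (i - 1) \<in> Z" if "i \<noteq> 0" "i < k" for i
        using that h unfolding bij_betw_def k_def by auto
      have ginj: "x = y" if "g x = g y" "x \<in> ?F" "y \<in> ?F" for x y using g that by metis
      have hinj: "i = j" if "h (i - 1) = h (j - 1)" "i \<noteq> 0" "j \<noteq> 0" "i < k" "j < k" for i j
      proof -
        have "i - 1 \<in> {0..<card Z}" "j - 1 \<in> {0..<card Z}" using that(2-5) by (auto simp: k_def)
        then have "i - 1 = j - 1" using h that(1) unfolding bij_betw_def inj_on_def by blast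
        then show ?thesis using that(2,3) by simp
      qed
      have J_sub: "\<forall>i\<le>k. J i \<subseteq> {..<n}"
      proof (intro allI impI)
        fix i assume "i \<le> k"
        then consider "i = 0" | "i = k" | "i \<noteq> 0" "i < k" by linarith
        then show "J i \<subseteq> {..<n}"
        proof cases
          case 1
          then show ?thesis using g[OF m] by (simp add: J_def)
        next
          case 2
          then show ?thesis using g S unfolding J_def by (auto simp: k_def)
        next
          case 3
          then show ?thesis using g[of "h (i - 1)"] hZ[OF 3] Z by (auto simp: J_def)
        qed
      qed
      have "J i \<inter> J j = {}" if "i \<le> k" "j \<le> k" "i < j" for i j
      proof -
        have j: "j \<noteq> 0" using that by simp
        have mem: "x \<in> ?F" if "x \<in> S \<or> x \<in> Z" for x using that S Z by auto
        show ?thesis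
        proof (cases "i = 0")
          case True
          then show ?thesis
            using j that ginj[OF _ m mem] disj hZ[OF j] by (auto simp: J_def)
        next
          case False
          then show ?thesis
            using j that ginj[OF _ mem mem] disj hZ[OF j] hZ[OF False] hinj[OF _ False j] by (auto simp: J_def)
        qed
      qed
      then have J_disj: "\<forall>i\<le>k. \<forall>j\<le>k. i \<noteq> j \<longrightarrow> J i \<inter> J j = {}"
        by (metis inf_commute linorder_neqE_nat)
      have eq: "A.mt (rho ` R ` J 0) \<inter> A.cl (\<Union>i\<in>{1..k}. A.mt (rho ` R ` J i)) = A.cl (\<Union>i\<in>{1..k}. A.mt (rho ` R ` (J 0 \<union> J i)))"
        by (rule mp[OF spec[OF mp[OF spec[OF iffD1[OF distributive_eq[OF A R] D], of k]], of J] conjI[OF J_sub J_disj]])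
          (simp_all add: k_def)
      have J0: "A.mt (rho ` R ` J 0) = m" using g[OF m] A.mt_singleton[OF subsetD[OF FL m]] by (simp add: J_def)
      have Jk: "rho ` R ` J k = S" 
      proof -
        have "(\<lambda>x. rho (R (g x))) ` S = (\<lambda>x. x) ` S" using g S by (intro image_cong) auto
        then show ?thesis by (simp add: J_def k_def image_image)
      qed
      have Ji: "A.mt (rho ` R ` J i) = h (i - 1)" if "i \<noteq> 0" "i < k" for i
      proof -
        have F: "h (i - 1) \<in> ?F" using hZ[OF that] Z by blast
        then show ?thesis using that g[OF F] A.mt_singleton[OF subsetD[OF FL F]] by (simp add: J_def)
      qed
      have J0i: "A.mt (rho ` R ` (J 0 \<union> J i)) = m \<inter> A.mt (rho ` R ` J i)" for i
      proof -
        have "rho ` R ` (J 0 \<union> J i) = insert m (rho ` R ` J i)" using g[OF m] by (auto simp: J_def)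
        then show ?thesis by (simp add: A.mt_insert)
      qed
      have split: "{1..k} = insert k {1..card Z}" by (auto simp: k_def)
      have img: "(\<lambda>i. h (i - 1)) ` {1..card Z} = Z"
      proof -
        have "{1..card Z} = Suc ` {0..<card Z}" by (simp only: image_Suc_atLeastLessThan atLeastLessThanSuc_atLeastAtMost One_nat_def)
        then show ?thesis using h unfolding bij_betw_def by (metis (no_types, lifting) diff_Suc_1 image_cong image_image)
      qed
      have "(\<Union>i\<in>{1..card Z}. A.mt (rho ` R ` J i)) = (\<Union>i\<in>{1..card Z}. h (i - 1))"
        using Ji by (intro SUP_cong) (auto simp: k_def)
      then have U1: "(\<Union>i\<in>{1..k}. A.mt (rho ` R ` J i)) = \<Union>Z \<union> A.mt S" using Jk img unfolding split by auto
      have "(\<Union>i\<in>{1..card Z}. m \<inter> A.mt (rho ` R ` J i)) = (\<Union>i\<in>{1..card Z}. m \<inter> h (i - 1))"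
        using Ji by (intro SUP_cong) (auto simp: k_def)
      then have U2: "(\<Union>i\<in>{1..k}. A.mt (rho ` R ` (J 0 \<union> J i))) = (\<Union>z\<in>Z. m \<inter> z) \<union> (m \<inter> A.mt S)"
        using Jk img[symmetric] unfolding J0i split by auto
      show "m \<inter> A.cl (\<Union>Z \<union> A.mt S) \<subseteq> A.cl ((\<Union>z\<in>Z. m \<inter> z) \<union> (m \<inter> A.mt S))"
        using eq unfolding J0 U1 U2 by simp
    qed }
  { assume D: "A.dist ?F"
    show "distributive n (base X) A R"
    proof (rule iffD2[OF distributive_eq[OF A R]], assumption, intro allI impI, elim conjE)
      fix k :: nat and J :: "nat \<Rightarrow> nat set" assume J: "\<forall>i\<le>k. J i \<subseteq> {..<n}"
      let ?p = "\<lambda>i. A.mt (rho ` R ` J i)"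
      have sub: "rho ` R ` J i \<subseteq> ?F" "finite (rho ` R ` J i)" if "i \<le> k" for i
        using J that finite_subset[of "J i" "{..<n}"] by (blast, simp)
      \<comment> \<open>The meets over the \<open>J i\<close> become members themselves, which makes
        the binary law \<open>dist_meet_join\<close> applicable to them.\<close>
      have "A.dist (?p ` {0..k} \<union> ?F)"
        by (rule A.dist_meets[OF D]) (use sub in \<open>auto simp del: image_subset_iff\<close>)
      then have "?p 0 \<inter> A.cl (\<Union>(?p ` {1..k})) \<subseteq> A.cl (\<Union>w\<in>?p ` {1..k}. ?p 0 \<inter> w)"
        by (intro A.dist_meet_join) auto
      moreover have "(\<Union>w\<in>?p ` {1..k}. ?p 0 \<inter> w) = (\<Union>i\<in>{1..k}. A.mt (rho ` R ` (J 0 \<union> J i)))"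
        by (auto simp: A.mt_def)
      moreover have "?p 0 \<in> C.eq_rels A" using sub[of 0] FL by (intro A.mt_in) auto
      then have "A.cl (\<Union>i\<in>{1..k}. A.mt (rho ` R ` (J 0 \<union> J i))) \<subseteq> ?p 0"
        by (intro A.cl_least) (auto simp: A.mt_def)
      moreover have "A.cl (\<Union>i\<in>{1..k}. A.mt (rho ` R ` (J 0 \<union> J i))) \<subseteq> A.cl (\<Union>(?p ` {1..k}))"
        by (intro A.cl_mono) (auto simp: A.mt_def)
      ultimately show "?p 0 \<inter> A.cl (\<Union>(?p ` {1..k})) = A.cl (\<Union>i\<in>{1..k}. A.mt (rho ` R ` (J 0 \<union> J i)))"
        by auto
    qed }
qed

end

section \<open>Exact forks\<close>

lemma component_square:
  assumes "m \<in> Hom (ForkN n X) A B" "k \<in> Hom (ForkN n X) B D" "m' \<in> Hom (ForkN n X) A B'" "k' \<in> Hom (ForkN n X) B' D"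
    "k \<cdot>\<^bsub>ForkN n X\<^esub> m = k' \<cdot>\<^bsub>ForkN n X\<^esub> m'" "length a = n" "set a \<subseteq> {0, 1, 2}"
  shows "component a k \<cdot>\<^bsub>base X\<^esub> component a m = component a k' \<cdot>\<^bsub>base X\<^esub> component a m'"
  using component_comp[OF assms(1,2,6,7)] component_comp[OF assms(3,4,6,7)] assms(5) by simp

lemma grphN_Suc:
  "FOb (grphN (Suc n)) (Fk F0 F1 F2 d c e f) =
    RG (FOb (grphN n) F1) (FOb (grphN n) F2) (FAr (grphN n) F2 F1 d) (FAr (grphN n) F2 F1 c) (FAr (grphN n) F1 F2 e)"
  "FAr (grphN (Suc n)) (Fk F0 F1 F2 d c e f) (Fk H0 H1 H2 d' c' e' f') (FkA m0 m1 m2) =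
    RGA (FAr (grphN n) F1 H1 m1) (FAr (grphN n) F2 H2 m2)"
  by (simp_all add: comp_functor_def)

lemma vertex_grphN:
  "F \<in> Ob (ForkN n X) \<Longrightarrow> length b = n \<Longrightarrow> gvertex b (FOb (grphN n) F) = vertex (map (\<lambda>x. if x then 2 else 1) b) F"
proof (induction b arbitrary: n F)
  case (Cons x b)
  then obtain k where k: "n = Suc k" "length b = k" by (cases n) auto
  obtain F0 F1 F2 d c e f where F: "F = Fk F0 F1 F2 d c e f" "F1 \<in> Ob (ForkN k X)" "F2 \<in> Ob (ForkN k X)"
    using Cons.prems(1) unfolding k(1) ForkN_simps Fork_simps by (rule fork_obE)
  then show ?case using Cons.IH[OF _ k(2)] by (simp add: k(1) grphN_Suc del: grphN.simps)
qed (simp add: id_functor_def)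

lemma component_grphN:
  "m \<in> Hom (ForkN n X) F H \<Longrightarrow> length b = n \<Longrightarrow>
    gcomponent b (FAr (grphN n) F H m) = component (map (\<lambda>x. if x then 2 else 1) b) m"
proof (induction b arbitrary: n F H m)
  case (Cons x b)
  then obtain k where k: "n = Suc k" "length b = k" by (cases n) auto
  obtain m0 m1 m2 F0 F1 F2 d c e f H0 H1 H2 d' c' e' f' where F: "m = FkA m0 m1 m2" "F = Fk F0 F1 F2 d c e f" "H = Fk H0 H1 H2 d' c' e' f'"
    "m1 \<in> Hom (ForkN k X) F1 H1" "m2 \<in> Hom (ForkN k X) F2 H2"
    using Cons.prems(1) unfolding k(1) ForkN_simps Fork_simps by (rule fork_homE)
  then show ?case using Cons.IH[OF _ k(2)] by (simp add: k(1) grphN_Suc del: grphN.simps)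
qed (simp add: id_functor_def)

lemma positive_levels:
  assumes "set a \<subseteq> {1, 2 :: nat}"
  obtains b where "a = map (\<lambda>x. if x then 2 else 1) b" "length b = length a"
proof -
  have "map (\<lambda>x. if x then 2 else 1) (map (\<lambda>x. x = 2) a) = a" using assms by (induction a) auto
  then show ?thesis using that by (metis length_map)
qed

lemma coequaliser_RGrphN:
  assumes X: "category X" and "d \<in> Hom (RGrphN n X) G A" "c \<in> Hom (RGrphN n X) G A" "q \<in> Hom (RGrphN n X) A Q"
    "\<And>b. length b = n \<Longrightarrow> is_coequaliser (base X) (gvertex b G) (gvertex b A) (gcomponent b d) (gcomponent b c) (gvertex b Q) (gcomponent b q)"
  shows "is_coequaliser (RGrphN n X) G A d c Q q"
  using assms(2-)
proof (induction n arbitrary: G A d c Q q)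
  case 0
  then show ?case using 0(4)[of "[]"] by (simp add: RGrphN_simps)
next
  case (Suc n)
  obtain d1 d2 G1 G2 x y z A1 A2 x' y' z' where d: "d = RGA d1 d2" "G = RG G1 G2 x y z" "A = RG A1 A2 x' y' z'"
      "d1 \<in> Hom (RGrphN n X) G1 A1" "d2 \<in> Hom (RGrphN n X) G2 A2"
    using Suc.prems(1) unfolding RGrphN_simps RGrph_simps by (rule rgrph_homE)
  obtain c1 c2 where c: "c = RGA c1 c2" "c1 \<in> Hom (RGrphN n X) G1 A1" "c2 \<in> Hom (RGrphN n X) G2 A2"
    using Suc.prems(2) unfolding RGrphN_simps RGrph_simps d(2,3) by (auto elim: rgrph_homE)
  obtain q1 q2 Q1 Q2 u v w where q: "q = RGA q1 q2" "Q = RG Q1 Q2 u v w" "q1 \<in> Hom (RGrphN n X) A1 Q1" "q2 \<in> Hom (RGrphN n X) A2 Q2"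
    using Suc.prems(3) unfolding RGrphN_simps RGrph_simps d(3) by (auto elim: rgrph_homE)
  have 1: "is_coequaliser (RGrphN n X) G1 A1 d1 c1 Q1 q1"
    using Suc.prems(4)[of "False # b" for b] by (intro Suc.IH d c q) (simp add: d(1-3) c(1) q(1,2))
  have 2: "is_coequaliser (RGrphN n X) G2 A2 d2 c2 Q2 q2"
    using Suc.prems(4)[of "True # b" for b] by (intro Suc.IH d c q) (simp add: d(1-3) c(1) q(1,2))
  show ?case
    using coequaliser_RGrph[OF category_RGrphN[OF X] _ _ _ 1 2] Suc.prems(1-3) unfolding RGrphN_simps d(1-3) c(1) q(1,2) by simp
qed

context tower
begin

lemma line_outermost:
  assumes "Fk F0 F1 F2 d c e f \<in> fork_ob (ForkN n X)" "length a = n" "set a \<subseteq> {0, 1, 2}"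
  shows "line 0 a (Fk F0 F1 F2 d c e f) \<in> fork_ob (base X)"
  using functor_Fork_ob[OF functor_vertex[OF assms(2,3)] assms(1)] by (simp add: vertex_functor_def)

lemma exact_nfork_0: "exact_nfork 0 X F \<longleftrightarrow> F \<in> Ob (base X)"
  by (simp add: exact_nfork_def ForkN_simps)

lemma exact_nforkD: "exact_nfork n X F \<Longrightarrow> F \<in> Ob (ForkN n X)"
  by (simp add: exact_nfork_def)

text \<open>The recursive shape of exactness for inductions on \<open>n\<close>: a line in the
  outermost direction crosses the three slices, and any other line lies within one slice.\<close>

lemma exact_nfork_Suc:
  "exact_nfork (Suc n) X (Fk F0 F1 F2 d c e f) \<longleftrightarrow> Fk F0 F1 F2 d c e f \<in> fork_ob (ForkN n X) \<and>
    exact_nfork n X F0 \<and> exact_nfork n X F1 \<and> exact_nfork n X F2 \<and>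
    (\<forall>a. length a = n \<and> set a \<subseteq> {0, 1, 2} \<longrightarrow>
      C.exact_seq (vertex a F2) (vertex a F1) (vertex a F0) (component a d) (component a c) (component a f))"
    (is "?L \<longleftrightarrow> ?F \<and> ?E0 \<and> ?E1 \<and> ?E2 \<and> ?S")
proof (cases ?F)
  case True
  have outer: "(\<forall>a. length a = n \<and> set a \<subseteq> {0, 1, 2} \<longrightarrow> exact_fork (base X) (line 0 a (Fk F0 F1 F2 d c e f))) \<longleftrightarrow> ?S"
  proof (intro all_cong1 imp_cong refl)
    fix a :: "nat list" assume a: "length a = n \<and> set a \<subseteq> {0, 1, 2}"
    show "exact_fork (base X) (line 0 a (Fk F0 F1 F2 d c e f)) \<longleftrightarrow>
        C.exact_seq (vertex a F2) (vertex a F1) (vertex a F0) (component a d) (component a c) (component a f)"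
      using line_outermost[OF True] a unfolding exact_fork_def C.exact_seq_def by simp
  qed
  have inner: "(\<forall>a. length a = n \<and> set a \<subseteq> {0, 1, 2} \<longrightarrow> exact_fork (base X) (line (Suc i) a (Fk F0 F1 F2 d c e f))) \<longleftrightarrow>
      (\<forall>F \<in> {F0, F1, F2}. \<forall>a. length a = n - 1 \<and> set a \<subseteq> {0, 1, 2} \<longrightarrow> exact_fork (base X) (line i a F))" (is "?l \<longleftrightarrow> ?r") if "i < n" for i
  proof
    assume l: ?l
    have "exact_fork (base X) (line i a ([F0, F1, F2] ! x))" if "length a = n - 1 \<and> set a \<subseteq> {0, 1, 2}" "x \<in> {0, 1, 2}" for a x
      using l[rule_format, of "x # a"] that \<open>i < n\<close> by simp
    from this[of _ 0] this[of _ 1] this[of _ 2] show ?r by simp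
  next
    assume r: ?r
    show ?l
    proof (intro allI impI)
      fix a assume a: "length a = n \<and> set a \<subseteq> {0, 1, 2 :: nat}"
      then obtain x b where b: "a = x # b" using \<open>i < n\<close> by (cases a) auto
      have "[F0, F1, F2] ! x \<in> {F0, F1, F2}" using a b by auto
      then have "exact_fork (base X) (line i b ([F0, F1, F2] ! x))" using r a b by force
      then show "exact_fork (base X) (line (Suc i) a (Fk F0 F1 F2 d c e f))" unfolding b by simp
    qed
  qed
  have F: "F0 \<in> Ob (ForkN n X)" "F1 \<in> Ob (ForkN n X)" "F2 \<in> Ob (ForkN n X)" using True by (auto simp: Fk_ob_iff)
  have "?L \<longleftrightarrow> ?S \<and> (\<forall>i<n. \<forall>F \<in> {F0, F1, F2}. \<forall>a. length a = n - 1 \<and> set a \<subseteq> {0, 1, 2} \<longrightarrow> exact_fork (base X) (line i a F))"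
    unfolding exact_nfork_def ForkN_simps Fork_simps All_less_Suc2 diff_Suc_1 outer using True inner by (simp del: line.simps)
  also have "\<dots> \<longleftrightarrow> ?S \<and> ?E0 \<and> ?E1 \<and> ?E2" unfolding exact_nfork_def using F by blast
  finally show ?thesis using True by blast
next
  case False
  then show ?thesis by (simp add: exact_nfork_def ForkN_simps)
qed

text \<open>Once the three slices are exact, exactness in the outermost direction needs to be known
  at positive coordinates only. Each coordinate 0 is filled in by the \<open>3 \<times> 3\<close>
  lemma.\<close>

lemma exact_outer:
  assumes "Fk F0 F1 F2 d c e f \<in> fork_ob (ForkN n X)" "exact_nfork n X F0" "exact_nfork n X F1" "exact_nfork n X F2"
    and "\<And>a. length a = n \<Longrightarrow> set a \<subseteq> {1, 2} \<Longrightarrow>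
      C.exact_seq (vertex a F2) (vertex a F1) (vertex a F0) (component a d) (component a c) (component a f)"
    and "length a = n" "set a \<subseteq> {0, 1, 2}"
  shows "C.exact_seq (vertex a F2) (vertex a F1) (vertex a F0) (component a d) (component a c) (component a f)"
  using assms
proof (induction n arbitrary: F0 F1 F2 d c e f a)
  case 0
  then show ?case by simp
next
  case (Suc n)
  note F = Suc.prems(1)[unfolded Fk_ob_iff ForkN_simps Fork_simps]
  obtain d0 d1 d2 F20 F21 F22 x2 y2 z2 w2 F10 F11 F12 x1 y1 z1 w1
    where d: "d = FkA d0 d1 d2" "F2 = Fk F20 F21 F22 x2 y2 z2 w2" "F1 = Fk F10 F11 F12 x1 y1 z1 w1"
    using F by (auto elim: fork_homE)
  obtain c0 c1 c2 where c: "c = FkA c0 c1 c2" using F by (auto elim: fork_homE)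
  obtain e0 e1 e2 where e: "e = FkA e0 e1 e2" using F by (auto elim: fork_homE)
  obtain f0 f1 f2 F00 F01 F02 x0 y0 z0 w0 where f: "f = FkA f0 f1 f2" "F0 = Fk F00 F01 F02 x0 y0 z0 w0"
    using F d(3) by (auto elim: fork_homE)
  note FF = F[unfolded d c e f Fork_simps FkA_hom_iff arr.inject Fk_ob_iff, simplified]
  let ?ex = "\<lambda>F G H d c f a. C.exact_seq (vertex a F) (vertex a G) (vertex a H) (component a d) (component a c) (component a f)"
  have E0: "exact_nfork n X F00" "exact_nfork n X F01" "exact_nfork n X F02" "\<And>a. length a = n \<and> set a \<subseteq> {0, 1, 2} \<Longrightarrow> ?ex F02 F01 F00 x0 y0 w0 a"
    using Suc.prems(2) unfolding f(2) exact_nfork_Suc by blast+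
  have E1: "exact_nfork n X F10" "exact_nfork n X F11" "exact_nfork n X F12" "\<And>a. length a = n \<and> set a \<subseteq> {0, 1, 2} \<Longrightarrow> ?ex F12 F11 F10 x1 y1 w1 a"
    using Suc.prems(3) unfolding d(3) exact_nfork_Suc by blast+
  have E2: "exact_nfork n X F20" "exact_nfork n X F21" "exact_nfork n X F22" "\<And>a. length a = n \<and> set a \<subseteq> {0, 1, 2} \<Longrightarrow> ?ex F22 F21 F20 x2 y2 w2 a"
    using Suc.prems(4) unfolding d(2) exact_nfork_Suc by blast+
  have lev1: "?ex F21 F11 F01 d1 c1 f1 a" if "length a = n" "set a \<subseteq> {0, 1, 2}" for a
  proof (rule Suc.IH[OF _ E0(2) E1(2) E2(2) _ that])
    show "Fk F01 F11 F21 d1 c1 e1 f1 \<in> fork_ob (ForkN n X)" using FF by (simp add: Fk_ob_iff)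
    show "?ex F21 F11 F01 d1 c1 f1 b" if "length b = n" "set b \<subseteq> {1, 2}" for b
      using Suc.prems(5)[of "1 # b"] that by (simp add: d c f)
  qed
  have lev2: "?ex F22 F12 F02 d2 c2 f2 a" if "length a = n" "set a \<subseteq> {0, 1, 2}" for a
  proof (rule Suc.IH[OF _ E0(3) E1(3) E2(3) _ that])
    show "Fk F02 F12 F22 d2 c2 e2 f2 \<in> fork_ob (ForkN n X)" using FF by (simp add: Fk_ob_iff)
    show "?ex F22 F12 F02 d2 c2 f2 b" if "length b = n" "set b \<subseteq> {1, 2}" for b
      using Suc.prems(5)[of "2 # b"] that by (simp add: d c f)
  qed
  have lev0: "?ex F20 F10 F00 d0 c0 f0 a" if a: "length a = n" "set a \<subseteq> {0, 1, 2}" for a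
  \<comment> \<open>The rows are the outermost direction at next coordinate 1, 2 and 0; the columns
    are the next direction within the slices \<open>F0\<close>, \<open>F1\<close> and
    \<open>F2\<close>.\<close>
  proof (rule C.three_by_three[OF lev1[OF a] lev2[OF a] E0(4) E1(4) E2(4)])
    note hom = component_hom[OF _ a] note sq = component_square[OF _ _ _ _ _ a]
    show "component a d0 \<in> Hom (base X) (vertex a F20) (vertex a F10)" "component a c0 \<in> Hom (base X) (vertex a F20) (vertex a F10)"
      "component a e0 \<in> Hom (base X) (vertex a F10) (vertex a F20)" "component a f0 \<in> Hom (base X) (vertex a F10) (vertex a F00)"
      by (rule hom; use FF in simp)+
    have "component a (d0 \<cdot>\<^bsub>ForkN n X\<^esub> e0) = component a (Id (ForkN n X) F10)" "component a (c0 \<cdot>\<^bsub>ForkN n X\<^esub> e0) = component a (Id (ForkN n X) F10)"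
      using FF by simp_all
    moreover have "e0 \<in> Hom (ForkN n X) F10 F20" "d0 \<in> Hom (ForkN n X) F20 F10" "c0 \<in> Hom (ForkN n X) F20 F10" "F10 \<in> Ob (ForkN n X)"
      using FF by simp_all
    ultimately show "component a d0 \<cdot>\<^bsub>base X\<^esub> component a e0 = Id (base X) (vertex a F10)" "component a c0 \<cdot>\<^bsub>base X\<^esub> component a e0 = Id (base X) (vertex a F10)"
      using component_comp[OF _ _ a] component_Id[OF _ a] by metis+
    show "component a f0 \<cdot>\<^bsub>base X\<^esub> component a d0 = component a f0 \<cdot>\<^bsub>base X\<^esub> component a c0"
      by (rule sq[of _ X F20 F10 _ F00 _ F10]; use FF in simp)
    show "component a d1 \<cdot>\<^bsub>base X\<^esub> component a x2 = component a x1 \<cdot>\<^bsub>base X\<^esub> component a d2"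
      by (rule sq[of _ X F22 F21 _ F11 _ F12]; use FF in simp)
    show "component a d1 \<cdot>\<^bsub>base X\<^esub> component a y2 = component a y1 \<cdot>\<^bsub>base X\<^esub> component a d2"
      by (rule sq[of _ X F22 F21 _ F11 _ F12]; use FF in simp)
    show "component a c1 \<cdot>\<^bsub>base X\<^esub> component a x2 = component a x1 \<cdot>\<^bsub>base X\<^esub> component a c2"
      by (rule sq[of _ X F22 F21 _ F11 _ F12]; use FF in simp)
    show "component a c1 \<cdot>\<^bsub>base X\<^esub> component a y2 = component a y1 \<cdot>\<^bsub>base X\<^esub> component a c2"
      by (rule sq[of _ X F22 F21 _ F11 _ F12]; use FF in simp)
    show "component a d0 \<cdot>\<^bsub>base X\<^esub> component a w2 = component a w1 \<cdot>\<^bsub>base X\<^esub> component a d1"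
      by (rule sq[of _ X F21 F20 _ F10 _ F11]; use FF in simp)
    show "component a c0 \<cdot>\<^bsub>base X\<^esub> component a w2 = component a w1 \<cdot>\<^bsub>base X\<^esub> component a c1"
      by (rule sq[of _ X F21 F20 _ F10 _ F11]; use FF in simp)
    show "component a f1 \<cdot>\<^bsub>base X\<^esub> component a x1 = component a x0 \<cdot>\<^bsub>base X\<^esub> component a f2"
      by (rule sq[of _ X F12 F11 _ F01 _ F02]; use FF in simp)
    show "component a f1 \<cdot>\<^bsub>base X\<^esub> component a y1 = component a y0 \<cdot>\<^bsub>base X\<^esub> component a f2"
      by (rule sq[of _ X F12 F11 _ F01 _ F02]; use FF in simp)
    show "component a f0 \<cdot>\<^bsub>base X\<^esub> component a w1 = component a w0 \<cdot>\<^bsub>base X\<^esub> component a f1"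
      by (rule sq[of _ X F11 F10 _ F00 _ F01]; use FF in simp)
  qed (use a in simp_all)
  obtain x b where b: "a = x # b" "length b = n" "set b \<subseteq> {0, 1, 2}" "x \<in> {0, 1, 2}" using Suc.prems(6,7) by (cases a) auto
  then show ?case using lev0[of b] lev1[of b] lev2[of b] by (auto simp: d c f)
qed

section \<open>Maps and quotients of boxes\<close>

lemma compat_push:
  assumes f: "f \<in> HomB A B" and sub: "list_all2 (\<lambda>r s. rho r \<subseteq> C.inv_rel A f (rho s)) rs ss"
  shows "T \<in> Ob (RGrphN (length rs) X) \<Longrightarrow> g \<in> HomB (corner T) A \<Longrightarrow> compat T rs g \<Longrightarrow> compat T ss (f \<bullet> g)"
  using sub
proof (induction rs ss arbitrary: T rule: list_all2_induct)
  case (Cons r rs s ss)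
  from Cons.prems(1)[unfolded list.size add_0_right add_Suc_right] obtain T1 T2 d c e where T: "T = RG T1 T2 d c e"
    "T1 \<in> Ob (RGrphN (length rs) X)" "d \<in> HomR (length rs) T2 T1" "c \<in> HomR (length rs) T2 T1"
    by (rule RGrphN_SucE)
  have g: "g \<in> HomB (corner T1) A" "(corner T2, g \<bullet> corner_arr d, g \<bullet> corner_arr c) \<in> rho r" "compat T1 rs g"
    using Cons.prems(2,3) by (simp_all add: T(1))
  have "(corner T2, f \<bullet> (g \<bullet> corner_arr d), f \<bullet> (g \<bullet> corner_arr c)) \<in> rho s"
    using g(2) Cons.hyps(1) by (auto simp: C.inv_rel_def)
  then have "(corner T2, (f \<bullet> g) \<bullet> corner_arr d, (f \<bullet> g) \<bullet> corner_arr c) \<in> rho s"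
    using C.comp_assoc[OF corner_hom[OF T(3)] g(1) f] C.comp_assoc[OF corner_hom[OF T(4)] g(1) f] by simp
  then show ?case using Cons.IH[OF T(2) g(1,3)] by (simp add: T(1))
qed simp

lemma Box_push:
  assumes f: "f \<in> HomB A B" and rs: "set rs \<subseteq> rels A" and ss: "set ss \<subseteq> rels B"
    and sub: "list_all2 (\<lambda>r s. rho r \<subseteq> C.inv_rel A f (rho s)) rs ss"
  obtains m where "m \<in> HomR (length rs) (Box A rs) (Box B ss)" "corner_arr m = f"
proof -
  have AB: "A \<in> Ob (base X)" "B \<in> Ob (base X)" using C.hom_ob[OF f] by simp_all
  note b = box_universal_Box[OF AB(1) rs]
  have len: "length ss = length rs" using sub by (simp add: list_all2_lengthD)
  have "compat (Box A rs) ss (f \<bullet> IdB A)"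
    using box_universal_compat_Id[OF b] C.id_hom[OF AB(1)] box_U(1,2)[OF AB(1) rs] by (intro compat_push[OF f sub]) simp_all
  then have "compat (Box A rs) ss f" using C.comp_id_right[OF f] by simp
  then show ?thesis
    using box_U(4)[OF AB(2) ss, of "Box A rs" f] box_U(1,2)[OF AB(1) rs] f len that by auto
qed

lemma dist_image_quotient:
  assumes f: "regular_epi (base X) A B f" and F: "F \<subseteq> C.eq_rels B" and D: "C.dist A (C.inv_rel A f ` F)"
  shows "C.dist B F"
proof -
  interpret H: modular_set_lattice_hom "C.eq_rels B" "C.eq_rels A" "C.inv_rel A f" F by (rule C.inv_rel_hom[OF f F])
  show ?thesis using H.dist_reflect[OF D] C.inv_rel_reflect[OF f] by blast
qed

text \<open>Here \<open>B\<close> is the quotient of \<open>A\<close> by \<open>r\<close>, and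
  \<open>ss\<close> lists representatives of the direct images in the order of \<open>rs\<close>.
  The kernel of the quotient map is \<open>rho r\<close>, so the family extended by the kernel is
  the given one, as the regularity of the map at all levels requires.\<close>

lemma Box_quotient:
  assumes A: "A \<in> Ob (base X)" and r: "r \<in> rels A" and rs: "set rs \<subseteq> rels A" and D: "C.dist A (rho ` set (r # rs))"
    and B: "Box A (r # rs) = RG (Box A rs) (Box (rtop r) (map (lift r) rs)) \<delta> \<gamma> \<epsilon>"
  obtains B ss m where "B \<in> Ob (base X)" "set ss \<subseteq> rels B" "length ss = length rs" "C.dist B (rho ` set ss)"
    "m \<in> HomR (length rs) (Box A rs) (Box B ss)"
    "\<And>a. length a = length rs \<Longrightarrow> C.exact_seq (gvertex a (Box (rtop r) (map (lift r) rs))) (gvertex a (Box A rs)) (gvertex a (Box B ss))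
       (gcomponent a \<delta>) (gcomponent a \<gamma>) (gcomponent a m)"
proof -
  note r' = relsD[OF r]
  interpret A: modular_set_lattice "C.eq_rels A" by (rule C.modular_eq_rels[OF A])
  obtain B f where f: "regular_epi (base X) A B f" "C.ker A f = rho r" by (rule C.ex_quotient[OF r'(9)])
  note fh = C.regular_epi_hom[OF f(1)]
  have Bo: "B \<in> Ob (base X)" using C.hom_ob[OF fh] by simp
  have "\<exists>t. t \<in> rels B \<and> C.inv_rel A f (rho t) = A.cl (rho s \<union> C.ker A f)" if s: "s \<in> set rs" for s
  proof -
    have "rho s \<in> C.eq_rels A" using s rs relsD(9) by blast
    then obtain E where E: "E \<in> C.eq_rels B" "C.inv_rel A f E = A.cl (rho s \<union> C.ker A f)" by (rule C.ex_direct_image[OF f(1)])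
    then show ?thesis using ex_rels[OF E(1)] by metis
  qed
  then obtain g where g: "\<And>s. s \<in> set rs \<Longrightarrow> g s \<in> rels B \<and> C.inv_rel A f (rho (g s)) = A.cl (rho s \<union> C.ker A f)" by metis
  define ss where "ss = map g rs"
  have ss: "set ss \<subseteq> rels B" "length ss = length rs" using g by (auto simp: ss_def)
  have inv: "map (\<lambda>s. C.inv_rel A f (rho s)) ss = map (\<lambda>s. A.cl (rho s \<union> C.ker A f)) rs" using g by (simp add: ss_def)
  \<comment> \<open>Distributivity passes to the joins with \<open>r\<close>, which are the inverse
    images of the members of \<open>ss\<close>; from there it descends to \<open>B\<close>.\<close>
  have "C.dist A ((\<lambda>a. A.cl (a \<union> rho r)) ` rho ` set (r # rs))" using D by (rule A.dist_quotient) simp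
  moreover have "C.inv_rel A f ` rho ` set ss = (\<lambda>a. A.cl (a \<union> rho r)) ` rho ` set rs"
    using arg_cong[OF inv, of set] f(2) by (simp add: image_image)
  ultimately have "C.dist A (C.inv_rel A f ` rho ` set ss)" by (elim A.dist_mono) auto
  then have dB: "C.dist B (rho ` set ss)" using ss(1) relsD(9) by (intro dist_image_quotient[OF f(1)]) auto
  have "list_all2 (\<lambda>r s. rho r \<subseteq> C.inv_rel A f (rho s)) rs ss"
    unfolding ss_def list.rel_map using g A.cl_extensive by (intro list.rel_refl_strong) force
  then obtain m where m: "m \<in> HomR (length rs) (Box A rs) (Box B ss)" "corner_arr m = f" by (rule Box_push[OF fh rs ss(1)])
  obtain \<delta>' \<gamma>' \<epsilon>' where B': "Box A (r # rs) = RG (Box A rs) (Box (rtop r) (map (lift r) rs)) \<delta>' \<gamma>' \<epsilon>'"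
    "\<delta>' \<in> HomR (length rs) (Box (rtop r) (map (lift r) rs)) (Box A rs)" "corner_arr \<delta>' = rd r"
    "\<gamma>' \<in> HomR (length rs) (Box (rtop r) (map (lift r) rs)) (Box A rs)" "corner_arr \<gamma>' = rc r" by (rule Box_Cons[OF A r rs])
  have dc: "\<delta>' = \<delta>" "\<gamma>' = \<gamma>" using B B'(1) by simp_all
  note \<delta> = B'(2-5)[unfolded dc]
  have K: "is_kernel_pair (base X) A B (corner_arr m) (rtop r) (corner_arr \<delta>) (corner_arr \<gamma>)"
    using C.kernel_pairI[OF fh r'(7)] f(2) unfolding m(2) \<delta>(2,4) rho_def by simp
  have lm: "map rho (map (lift r) rs) = map (\<lambda>s. C.lift_rel (rtop r) (corner_arr \<delta>) (corner_arr \<gamma>) (rho s)) rs"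
    using lift(2)[OF r] rs unfolding \<delta>(2,4) by auto
  have D': "C.dist A (insert (C.ker A (corner_arr m)) (rho ` set rs))" using D unfolding m(2) f(2) by simp
  have "C.exact_seq (gvertex a (Box (rtop r) (map (lift r) rs))) (gvertex a (Box A rs)) (gvertex a (Box B ss))
       (gcomponent a \<delta>) (gcomponent a \<gamma>) (gcomponent a m)" if a: "length a = length rs" for a
    using Box_kernel_pair[OF a _ refl ss(2) lift_rels[OF r rs] rs ss(1) K lm m(1) \<delta>(1,3)]
      Box_regular_epi[OF a refl ss(2) rs ss(1) _ D' _ m(1)] f(1) inv unfolding m(2) by (intro C.exact_seqI) simp_all
  then show ?thesis using that[OF Bo ss dB m(1)] by blast
qed

section \<open>Completions of distributive boxes are exact\<close>

lemma reflexive_coequalisers_base: "reflexive_coequalisers (base X)"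
  unfolding reflexive_coequalisers_def using C.ex_coequaliser_reflexive by blast

lemmas strict_reflection_tower = strict_reflection_N[OF X.category_axioms reflexive_coequalisers_base]

lemma gcomponent_iso:
  assumes "iso (RGrphN n X) G H m" "length a = n"
  shows "iso (base X) (gvertex a G) (gvertex a H) (gcomponent a m)"
  using functor_iso[OF functor_gvertex[OF assms(2)] category_RGrphN[OF X.category_axioms] assms(1)] by (simp add: gvertex_functor_def)

lemma gcomponent_square:
  assumes "m \<in> HomR n A B" "k \<in> HomR n B D" "m' \<in> HomR n A B'" "k' \<in> HomR n B' D"
    "k \<cdot>\<^bsub>RGrphN n X\<^esub> m = k' \<cdot>\<^bsub>RGrphN n X\<^esub> m'" "length a = n"
  shows "gcomponent a k \<bullet> gcomponent a m = gcomponent a k' \<bullet> gcomponent a m'"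
  using gcomponent_comp[OF assms(1,2,6)] gcomponent_comp[OF assms(3,4,6)] assms(5) by simp

text \<open>The coequaliser used by \<open>CoeqFork\<close> is a choice and only isomorphic to the
  quotient \<open>Q\<close> at hand. Therefore \<open>E0\<close> asks for exactness of the
  completion of every object isomorphic to \<open>Q\<close>.\<close>

lemma exact_CoeqForkN_Suc:
  assumes G: "RG D1 D2 d c e \<in> rgrph_ob (RGrphN n X)"
    and q: "q \<in> HomR n D1 Q"
    and ex: "\<And>a. length a = n \<Longrightarrow> C.exact_seq (gvertex a D2) (gvertex a D1) (gvertex a Q) (gcomponent a d) (gcomponent a c) (gcomponent a q)"
    and E1: "exact_nfork n X (FOb (CoeqForkN n X) D1)" and E2: "exact_nfork n X (FOb (CoeqForkN n X) D2)"
    and E0: "\<And>Q' k. iso (RGrphN n X) Q Q' k \<Longrightarrow> exact_nfork n X (FOb (CoeqForkN n X) Q')"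
  shows "exact_nfork (Suc n) X (FOb (CoeqForkN (Suc n) X) (RG D1 D2 d c e))"
proof -
  let ?R = "RGrphN n X" and ?L = "CoeqForkN n X"
  interpret R: category ?R by (rule category_RGrphN[OF X.category_axioms])
  note S = strict_reflectionD[OF strict_reflection_tower[of n]]
  note L = functorD[OF S(3)]
  have G': "D1 \<in> Ob ?R" "D2 \<in> Ob ?R" "d \<in> Hom ?R D2 D1" "c \<in> Hom ?R D2 D1" "e \<in> Hom ?R D1 D2"
    "d \<cdot>\<^bsub>?R\<^esub> e = Id ?R D1" "c \<cdot>\<^bsub>?R\<^esub> e = Id ?R D1" using G by (auto simp: RG_ob_iff)
  define P p where "P = fst (coeq ?R D2 D1 d c)" and "p = snd (coeq ?R D2 D1 d c)"
  have P: "is_coequaliser ?R D2 D1 d c P p"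
    unfolding P_def p_def
    by (rule coeq_is_coequaliser[OF reflexive_coequalisers_RGrphN[OF X.category_axioms reflexive_coequalisers_base] G'(3-7)])
  note p = R.coequaliserD[OF P]
  have Q: "is_coequaliser ?R D2 D1 d c Q q"
    using C.exact_seqD(7)[OF ex] by (intro coequaliser_RGrphN[OF X.category_axioms G'(3,4) q])
  obtain k where k: "iso ?R Q P k" "k \<cdot>\<^bsub>?R\<^esub> q = p" by (rule R.coequaliser_unique[OF Q P])
  note kh = R.iso_hom[OF k(1)]
  \<comment> \<open>Both \<open>Q\<close> and \<open>P\<close> are coequalisers of \<open>d\<close>
    and \<open>c\<close>, so the levelwise exact sequences can be transported along the comparison
    \<open>k\<close>.\<close>
  have exP: "C.exact_seq (gvertex a D2) (gvertex a D1) (gvertex a P) (gcomponent a d) (gcomponent a c) (gcomponent a p)" if a: "length a = n" for a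
  proof (rule C.exact_seq_iso[OF ex[OF a] C.iso_id C.iso_id gcomponent_iso[OF k(1) a]])
    show "gvertex a D2 \<in> Ob (base X)" "gvertex a D1 \<in> Ob (base X)" using gvertex_Id(1) G'(1,2) a by blast+
    show h: "gcomponent a d \<in> HomB (gvertex a D2) (gvertex a D1)" "gcomponent a c \<in> HomB (gvertex a D2) (gvertex a D1)"
      "gcomponent a p \<in> HomB (gvertex a D1) (gvertex a P)" using gcomponent_hom[OF _ a] p(3) G'(3,4) by blast+
    show "gcomponent a d \<bullet> IdB (gvertex a D2) = IdB (gvertex a D1) \<bullet> gcomponent a d"
      "gcomponent a c \<bullet> IdB (gvertex a D2) = IdB (gvertex a D1) \<bullet> gcomponent a c"
      using C.comp_id_left[OF h(1)] C.comp_id_left[OF h(2)] C.comp_id_right[OF h(1)] C.comp_id_right[OF h(2)] by simp_all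
    show "gcomponent a p \<bullet> IdB (gvertex a D1) = gcomponent a k \<bullet> gcomponent a q"
      using C.comp_id_right[OF h(3)] gcomponent_comp[OF q kh a] k(2) by simp
  qed
  let ?F0 = "FOb ?L P" and ?F1 = "FOb ?L D1" and ?F2 = "FOb ?L D2"
    and ?d = "FAr ?L D2 D1 d" and ?c = "FAr ?L D2 D1 c" and ?e = "FAr ?L D1 D2 e" and ?f = "FAr ?L D1 P p"
  have F: "FOb (CoeqForkN (Suc n) X) (RG D1 D2 d c e) = Fk ?F0 ?F1 ?F2 ?d ?c ?e ?f"
    by (simp add: comp_functor_def CoeqFork_ob P_def p_def)
  have "Fk P D1 D2 d c e p \<in> fork_ob ?R" unfolding Fk_ob_iff using G' p R.hom_ob[OF p(3)] by simp
  from functor_Fork_ob[OF S(3) this] have Fo: "Fk ?F0 ?F1 ?F2 ?d ?c ?e ?f \<in> fork_ob (ForkN n X)" by simp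
  \<comment> \<open>At positive coordinates the completion has the same vertices and components as
    the graph, because its underlying graph is literally the given one.\<close>
  have pos: "C.exact_seq (vertex a ?F2) (vertex a ?F1) (vertex a ?F0) (component a ?d) (component a ?c) (component a ?f)"
    if a: "length a = n" "set a \<subseteq> {1, 2}" for a
  proof -
    obtain b where b: "a = map (\<lambda>x. if x then 2 else 1) b" "length b = n" using positive_levels[OF a(2)] a(1) by metis
    have v: "vertex a (FOb ?L D) = gvertex b D" if "D \<in> Ob ?R" for D
      using vertex_grphN[OF L(1)[OF that] b(2)] S(5)[OF that] b(1) by simp
    have w: "component a (FAr ?L D E h) = gcomponent b h" if "h \<in> Hom ?R D E" for D E h
      using component_grphN[OF L(2)[OF that] b(2)] S(6)[OF that] b(1) by simp
    show ?thesis using exP[OF b(2)] v[OF G'(1)] v[OF G'(2)] v[of P] R.hom_ob[OF p(3)] w[OF G'(3)] w[OF G'(4)] w[OF p(3)] by simp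
  qed
  have "C.exact_seq (vertex a ?F2) (vertex a ?F1) (vertex a ?F0) (component a ?d) (component a ?c) (component a ?f)"
    if "length a = n" "set a \<subseteq> {0, 1, 2}" for a
    by (rule exact_outer[OF Fo E0[OF k(1)] E1 E2 pos that])
  then show ?thesis unfolding F exact_nfork_Suc using Fo E0[OF k(1)] E1 E2 by blast
qed

text \<open>The induction hypothesis serves three objects, each isomorphic to a box with one
  relation less: the bottom, the top with the lifted relations, and the chosen quotient with the
  direct images. The last is a box up to isomorphism only, whence the arbitrary
  \<open>D\<close>.\<close>

lemma Box_iso_exact:
  assumes "A \<in> Ob (base X)" "length rs = n" "set rs \<subseteq> rels A" "C.dist A (rho ` set rs)" "iso (RGrphN n X) (Box A rs) D i"
  shows "exact_nfork n X (FOb (CoeqForkN n X) D)"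
  using assms
proof (induction n arbitrary: A rs D i)
  case 0
  interpret C0: category "RGrphN 0 X" by (rule category_RGrphN[OF X.category_axioms])
  have "D \<in> Ob (RGrphN 0 X)" using C0.hom_ob[OF C0.iso_hom[OF 0(5)]] by simp
  then show ?case by (simp add: exact_nfork_0 id_functor_def RGrphN_simps)
next
  case (Suc n)
  let ?R = "RGrphN n X"
  interpret R: category ?R by (rule category_RGrphN[OF X.category_axioms])
  interpret A: modular_set_lattice "C.eq_rels A" by (rule C.modular_eq_rels[OF Suc.prems(1)])
  obtain r rs' where rs: "rs = r # rs'" "length rs' = n" using Suc.prems(2) by (cases rs) auto
  have r: "r \<in> rels A" "set rs' \<subseteq> rels A" using Suc.prems(3) by (simp_all add: rs)
  note r' = relsD[OF r(1)]
  obtain \<delta> \<gamma> \<epsilon> where B: "Box A (r # rs') = RG (Box A rs') (Box (rtop r) (map (lift r) rs')) \<delta> \<gamma> \<epsilon>" by (rule Box_Cons[OF Suc.prems(1) r])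
  have "i \<in> HomR (Suc n) (Box A rs) D" using Suc.prems(5) by (simp add: iso_def)
  then obtain i1 i2 D1 D2 d c e where i: "i = RGA i1 i2" "D = RG D1 D2 d c e" "RG D1 D2 d c e \<in> rgrph_ob ?R"
    "i1 \<in> Hom ?R (Box A rs') D1" "i2 \<in> Hom ?R (Box (rtop r) (map (lift r) rs')) D2"
    "d \<cdot>\<^bsub>?R\<^esub> i2 = i1 \<cdot>\<^bsub>?R\<^esub> \<delta>" "c \<cdot>\<^bsub>?R\<^esub> i2 = i1 \<cdot>\<^bsub>?R\<^esub> \<gamma>"
    unfolding rs B RGrphN_simps RGrph_simps by (auto elim: rgrph_homE)
  have "RGA i1 i2 \<in> rgrph_hom ?R (RG (Box A rs') (Box (rtop r) (map (lift r) rs')) \<delta> \<gamma> \<epsilon>) (RG D1 D2 d c e)"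
    using \<open>i \<in> _\<close> unfolding rs B i(1,2) RGrphN_simps RGrph_simps .
  then have dg: "\<delta> \<in> Hom ?R (Box (rtop r) (map (lift r) rs')) (Box A rs')" "\<gamma> \<in> Hom ?R (Box (rtop r) (map (lift r) rs')) (Box A rs')"
    by (simp_all add: RGA_hom_iff RG_ob_iff)
  have iso: "iso ?R (Box A rs') D1 i1" "iso ?R (Box (rtop r) (map (lift r) rs')) D2 i2"
    using Suc.prems(5) unfolding rs B i(1,2) RGrphN_simps by (rule iso_RGrphD)+
  obtain j1 where j1: "j1 \<in> Hom ?R D1 (Box A rs')" "j1 \<cdot>\<^bsub>?R\<^esub> i1 = Id ?R (Box A rs')" by (rule R.isoE[OF iso(1)])
  note D = Suc.prems(4)[unfolded rs]
  obtain B ss m where Q: "B \<in> Ob (base X)" "set ss \<subseteq> rels B" "length ss = length rs'" "C.dist B (rho ` set ss)"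
    "m \<in> HomR (length rs') (Box A rs') (Box B ss)"
    "\<And>a. length a = length rs' \<Longrightarrow> C.exact_seq (gvertex a (Box (rtop r) (map (lift r) rs'))) (gvertex a (Box A rs')) (gvertex a (Box B ss))
       (gcomponent a \<delta>) (gcomponent a \<gamma>) (gcomponent a m)" by (rule Box_quotient[OF Suc.prems(1) r D B]) blast
  note m = Q(5)[unfolded rs(2)]
  note q = R.comp_hom[OF j1(1) m]
  have q_eq: "(m \<cdot>\<^bsub>?R\<^esub> j1) \<cdot>\<^bsub>?R\<^esub> i1 = m" using R.comp_assoc[OF i(4) j1(1) m] R.comp_id_right[OF m] j1(2) by simp
  note Do = i(3)[unfolded RG_ob_iff]
  have ex: "C.exact_seq (gvertex a D2) (gvertex a D1) (gvertex a (Box B ss)) (gcomponent a d) (gcomponent a c) (gcomponent a (m \<cdot>\<^bsub>?R\<^esub> j1))"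
    if a: "length a = n" for a
  proof (rule C.exact_seq_iso[OF Q(6) gcomponent_iso[OF iso(2) a] gcomponent_iso[OF iso(1) a] C.iso_id])
    show "length a = length rs'" using a rs(2) by simp
    show "gvertex a (Box B ss) \<in> Ob (base X)" using C.hom_ob[OF gcomponent_hom[OF m a]] by simp
    show "gcomponent a d \<in> HomB (gvertex a D2) (gvertex a D1)" "gcomponent a c \<in> HomB (gvertex a D2) (gvertex a D1)"
      "gcomponent a (m \<cdot>\<^bsub>?R\<^esub> j1) \<in> HomB (gvertex a D1) (gvertex a (Box B ss))"
      using gcomponent_hom[OF _ a] q Do by blast+
    show "gcomponent a d \<bullet> gcomponent a i2 = gcomponent a i1 \<bullet> gcomponent a \<delta>"
      using Do by (intro gcomponent_square[OF i(5) _ dg(1) i(4,6) a]) blast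
    show "gcomponent a c \<bullet> gcomponent a i2 = gcomponent a i1 \<bullet> gcomponent a \<gamma>"
      using Do by (intro gcomponent_square[OF i(5) _ dg(2) i(4,7) a]) blast
    show "gcomponent a (m \<cdot>\<^bsub>?R\<^esub> j1) \<bullet> gcomponent a i1 = IdB (gvertex a (Box B ss)) \<bullet> gcomponent a m"
      using gcomponent_comp[OF i(4) q a] q_eq C.comp_id_left[OF gcomponent_hom[OF m a]] by simp
  qed
  have E1: "exact_nfork n X (FOb (CoeqForkN n X) D1)"
    using A.dist_mono[OF D] by (intro Suc.IH[OF Suc.prems(1) rs(2) r(2) _ iso(1)]) auto
  have dist2: "C.dist (rtop r) (rho ` set (map (lift r) rs'))"
  proof -
    interpret T: modular_set_lattice "C.eq_rels (rtop r)" by (rule C.modular_eq_rels[OF r'(11)])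
    have "C.dist (rtop r) (C.lift_rel (rtop r) (rd r) (rc r) ` rho ` set (r # rs'))"
      by (rule C.dist_lift[OF r'(7) _ D Suc.prems(1)]) (simp add: rho_def)
    moreover have "rho ` set (map (lift r) rs') = C.lift_rel (rtop r) (rd r) (rc r) ` rho ` set rs'"
      using lift(2)[OF r(1)] r(2) by (auto simp: image_image intro!: image_cong)
    ultimately show ?thesis by (elim T.dist_mono) auto
  qed
  have E2: "exact_nfork n X (FOb (CoeqForkN n X) D2)"
    by (rule Suc.IH[OF r'(11) _ lift_rels[OF r] dist2 iso(2)]) (simp add: rs(2))
  show ?case
    unfolding i(2)
  proof (rule exact_CoeqForkN_Suc[OF i(3) q ex E1 E2])
    show "exact_nfork n X (FOb (CoeqForkN n X) Q')" if "iso ?R (Box B ss) Q' k" for Q' k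
      using Suc.IH[OF Q(1) _ Q(2,4) that] Q(3) rs(2) by simp
  qed
qed

section \<open>Exact forks have distributive boxes as underlying graphs\<close>

lemma dist_empty: "A \<in> Ob (base X) \<Longrightarrow> C.dist A {}"
  using modular_set_lattice.dist_from_meet_join[OF C.modular_eq_rels, of A "{}"] by simp

text \<open>The slices at 1 and 0 are boxes by induction. The slice at 2 is levelwise the kernel
  pair of the map between them, and this identifies it with the top of a box whose new outermost
  relation is the kernel of that map at the corner.\<close>

lemma ex_Box_iso:
  assumes "exact_nfork n X F"
  shows "\<exists>A rs i. A \<in> Ob (base X) \<and> length rs = n \<and> set rs \<subseteq> rels A \<and> C.dist A (rho ` set rs) \<and>
    iso (RGrphN n X) (FOb (grphN n) F) (Box A rs) i"
  using assms
proof (induction n arbitrary: F)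
  case 0
  then have "F \<in> Ob (base X)" by (simp add: exact_nfork_0)
  then show ?case using dist_empty[of F] C.iso_id[of F] by (intro exI[of _ F] exI[of _ "[]"] exI[of _ "IdB F"]) (simp add: RGrphN_simps id_functor_def)
next
  case (Suc n)
  let ?R = "RGrphN n X" and ?G = "FOb (grphN n)" and ?g = "FAr (grphN n)"
  interpret R: category ?R by (rule category_RGrphN[OF X.category_axioms])
  note fG = functorD[OF functor_grphN[of n X]]
  have "F \<in> fork_ob (ForkN n X)" using exact_nforkD[OF Suc.prems] by (simp add: ForkN_simps)
  then obtain F0 F1 F2 d c e f where F: "F = Fk F0 F1 F2 d c e f" "F0 \<in> Ob (ForkN n X)" "F1 \<in> Ob (ForkN n X)" "F2 \<in> Ob (ForkN n X)"
    "d \<in> Hom (ForkN n X) F2 F1" "c \<in> Hom (ForkN n X) F2 F1" "e \<in> Hom (ForkN n X) F1 F2" "f \<in> Hom (ForkN n X) F1 F0"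
    "f \<cdot>\<^bsub>ForkN n X\<^esub> d = f \<cdot>\<^bsub>ForkN n X\<^esub> c" "d \<cdot>\<^bsub>ForkN n X\<^esub> e = Id (ForkN n X) F1" "c \<cdot>\<^bsub>ForkN n X\<^esub> e = Id (ForkN n X) F1" by (rule fork_obE)
  note E = Suc.prems[unfolded F(1) exact_nfork_Suc]
  obtain A rs \<phi> where 1: "A \<in> Ob (base X)" "length rs = n" "set rs \<subseteq> rels A" "C.dist A (rho ` set rs)" "iso ?R (?G F1) (Box A rs) \<phi>"
    using Suc.IH[of F1] E by blast
  obtain B ss \<phi>0 where 0: "B \<in> Ob (base X)" "length ss = n" "set ss \<subseteq> rels B" "C.dist B (rho ` set ss)" "iso ?R (?G F0) (Box B ss) \<phi>0"
    using Suc.IH[of F0] E by blast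
  note \<phi> = R.iso_hom[OF 1(5)] note \<phi>0 = R.iso_hom[OF 0(5)]
  obtain \<phi>' where \<phi>': "\<phi>' \<in> Hom ?R (Box A rs) (?G F1)" "\<phi>' \<cdot>\<^bsub>?R\<^esub> \<phi> = Id ?R (?G F1)" by (rule R.isoE[OF 1(5)])
  define D C E' f' where "D = ?g F2 F1 d" and "C = ?g F2 F1 c" and "E' = ?g F1 F2 e" and "f' = ?g F1 F0 f"
  have arr: "D \<in> Hom ?R (?G F2) (?G F1)" "C \<in> Hom ?R (?G F2) (?G F1)" "E' \<in> Hom ?R (?G F1) (?G F2)" "f' \<in> Hom ?R (?G F1) (?G F0)"
    unfolding D_def C_def E'_def f'_def using fG(2) F by blast+
  have DE: "D \<cdot>\<^bsub>?R\<^esub> E' = Id ?R (?G F1)" "C \<cdot>\<^bsub>?R\<^esub> E' = Id ?R (?G F1)"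
    unfolding D_def C_def E'_def using fG(4)[OF F(7,5)] fG(4)[OF F(7,6)] F(10,11) fG(3)[OF F(3)] by simp_all
  \<comment> \<open>The arrow of the fork from the slice at 1 to the slice at 0, transported to the
    boxes.\<close>
  define m where "m = (\<phi>0 \<cdot>\<^bsub>?R\<^esub> f') \<cdot>\<^bsub>?R\<^esub> \<phi>'"
  note f0 = R.comp_hom[OF arr(4) \<phi>0]
  have m: "m \<in> Hom ?R (Box A rs) (Box B ss)" "m \<cdot>\<^bsub>?R\<^esub> \<phi> = \<phi>0 \<cdot>\<^bsub>?R\<^esub> f'"
    unfolding m_def using R.comp_hom[OF \<phi>'(1) f0] R.comp_assoc[OF \<phi> \<phi>'(1) f0] R.comp_id_right[OF f0] \<phi>'(2) by simp_all
  define u v where "u = \<phi> \<cdot>\<^bsub>?R\<^esub> D" and "v = \<phi> \<cdot>\<^bsub>?R\<^esub> C"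
  have uv: "u \<in> Hom ?R (?G F2) (Box A rs)" "v \<in> Hom ?R (?G F2) (Box A rs)" unfolding u_def v_def using R.comp_hom[OF _ \<phi>] arr by simp_all
  have F2o: "?G F2 \<in> Ob ?R" using R.hom_ob[OF arr(1)] by simp
  have ex: "C.exact_seq (gvertex b (?G F2)) (gvertex b (Box A rs)) (gvertex b (Box B ss)) (gcomponent b u) (gcomponent b v) (gcomponent b m)"
    if b: "length b = n" for b
  proof (rule C.exact_seq_iso[OF _ C.iso_id gcomponent_iso[OF 1(5) b] gcomponent_iso[OF 0(5) b]])
    let ?a = "map (\<lambda>x. if x then 2 else 1) b"
    have "C.exact_seq (vertex ?a F2) (vertex ?a F1) (vertex ?a F0) (component ?a d) (component ?a c) (component ?a f)"
      using conjunct2[OF conjunct2[OF conjunct2[OF conjunct2[OF E]]], rule_format, of ?a] b by force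
    then show "C.exact_seq (gvertex b (?G F2)) (gvertex b (?G F1)) (gvertex b (?G F0)) (gcomponent b D) (gcomponent b C) (gcomponent b f')"
      unfolding D_def C_def f'_def using vertex_grphN[OF _ b, of _ X] component_grphN[OF _ b, of _ X] F(2-8) by simp
    show "gvertex b (?G F2) \<in> Ob (base X)" using gvertex_Id(1)[OF F2o b] .
    show h: "gcomponent b u \<in> HomB (gvertex b (?G F2)) (gvertex b (Box A rs))" "gcomponent b v \<in> HomB (gvertex b (?G F2)) (gvertex b (Box A rs))"
      "gcomponent b m \<in> HomB (gvertex b (Box A rs)) (gvertex b (Box B ss))" using gcomponent_hom[OF _ b] uv m(1) by blast+
    show "gcomponent b u \<bullet> IdB (gvertex b (?G F2)) = gcomponent b \<phi> \<bullet> gcomponent b D"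
      "gcomponent b v \<bullet> IdB (gvertex b (?G F2)) = gcomponent b \<phi> \<bullet> gcomponent b C"
      using C.comp_id_right[OF h(1)] C.comp_id_right[OF h(2)] gcomponent_comp[OF arr(1) \<phi> b] gcomponent_comp[OF arr(2) \<phi> b] by (simp_all add: u_def v_def)
    show "gcomponent b m \<bullet> gcomponent b \<phi> = gcomponent b \<phi>0 \<bullet> gcomponent b f'" by (rule gcomponent_square[OF \<phi> m(1) arr(4) \<phi>0 m(2) b])
  qed
  have dist: "C.dist A (insert (C.ker A (corner_arr m)) (rho ` set rs))"
    by (rule Box_dist[OF 1(2) 0(2) 1(3) 0(3) 1(1) 0(1) m(1) C.exact_seqD(5)[OF ex] 1(4) 0(4)])
  note UA = box_U[OF 1(1,3), unfolded 1(2)] note UB = box_U[OF 0(1,3), unfolded 0(2)]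
  have mc: "corner_arr m \<in> HomB A B" using corner_hom[OF m(1)] UA(2) UB(2) by simp
  \<comment> \<open>This represents the kernel of \<open>m\<close> at the corner and is the relation
    to be put in front of \<open>rs\<close>; the distributivity of the longer list is the fact
    \<open>dist\<close>.\<close>
  obtain r where r: "r \<in> rels A" "rho r = C.ker A (corner_arr m)" by (rule ex_rels[OF C.ker_eq_rels[OF mc]])
  note r' = relsD[OF r(1)]
  let ?K = "Box (rtop r) (map (lift r) rs)"
  have "C.exact_seq (corner (?G F2)) A B (corner_arr u) (corner_arr v) (corner_arr m)"
    using ex[of "replicate n False"] corner_gvertex[OF F2o] corner_gvertex[OF UA(1)] corner_gvertex[OF UB(1)] UA(2) UB(2)
      corner_gcomponent[OF uv(1)] corner_gcomponent[OF uv(2)] corner_gcomponent[OF m(1)] by simp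
  note cex = C.exact_seqD[OF this]
  \<comment> \<open>The corner of the slice at 2 is a kernel pair of the same arrow, hence
    isomorphic to \<open>rtop r\<close> over \<open>A\<close>.\<close>
  have "C.span_rel (corner (?G F2)) (corner_arr u) (corner_arr v) = C.span_rel (rtop r) (rd r) (rc r)"
    using C.is_kernel_pair_span_rel[OF cex(6)] r(2) by (simp add: rho_def)
  then obtain g where g: "iso (base X) (corner (?G F2)) (rtop r) g" "rd r \<bullet> g = corner_arr u" "rc r \<bullet> g = corner_arr v"
    by (rule C.span_rel_iso[OF cex(8) r'(7)])
  note gh = C.iso_hom[OF g(1)]
  \<comment> \<open>Both composites of \<open>g\<close> with the legs of \<open>r\<close> are
    corners of morphisms into \<open>Box A rs\<close>, hence compatible. So \<open>g\<close> is
    compatible with the lifted relations and extends to a morphism \<open>\<psi>\<close> into the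
    top of the new box.\<close>
  have "compat (?G F2) (map (lift r) rs) g"
    using compat_lift[of "?G F2" rs r A g] F2o 1(2,3) r(1) gh g(2,3) UA(3)[OF uv(1)] UA(3)[OF uv(2)] by simp
  moreover note UK = box_U[OF r'(11) lift_rels[OF r(1) 1(3)], unfolded length_map 1(2)]
  ultimately obtain \<psi> where \<psi>: "\<psi> \<in> Hom ?R (?G F2) ?K" "corner_arr \<psi> = g" using UK(4)[OF F2o gh] by blast
  obtain \<delta> \<gamma> \<epsilon> where Box: "Box A (r # rs) = RG (Box A rs) ?K \<delta> \<gamma> \<epsilon>"
    "\<delta> \<in> Hom ?R ?K (Box A rs)" "corner_arr \<delta> = rd r" "\<gamma> \<in> Hom ?R ?K (Box A rs)" "corner_arr \<gamma> = rc r"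
    "\<epsilon> \<in> Hom ?R (Box A rs) ?K" "corner_arr \<epsilon> = re r" by (rule Box_Cons[OF 1(1) r(1) 1(3), unfolded 1(2)])
  have \<delta>\<psi>: "\<delta> \<cdot>\<^bsub>?R\<^esub> \<psi> = u" "\<gamma> \<cdot>\<^bsub>?R\<^esub> \<psi> = v"
    using UA(5)[OF R.comp_hom[OF \<psi>(1) Box(2)] uv(1)] UA(5)[OF R.comp_hom[OF \<psi>(1) Box(4)] uv(2)]
      corner_comp[OF \<psi>(1) Box(2)] corner_comp[OF \<psi>(1) Box(4)] \<psi>(2) g(2,3) Box(3,5) by simp_all
  have "\<epsilon> \<cdot>\<^bsub>?R\<^esub> \<phi> = \<psi> \<cdot>\<^bsub>?R\<^esub> E'"
  proof (rule UK(5)[OF R.comp_hom[OF \<phi> Box(6)] R.comp_hom[OF arr(3) \<psi>(1)]])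
    have uE: "u \<cdot>\<^bsub>?R\<^esub> E' = \<phi>" "v \<cdot>\<^bsub>?R\<^esub> E' = \<phi>"
      unfolding u_def v_def using R.comp_assoc[OF arr(3,1) \<phi>] R.comp_assoc[OF arr(3,2) \<phi>] DE R.comp_id_right[OF \<phi>] by simp_all
    have \<phi>c: "corner_arr \<phi> \<in> HomB (corner (?G F1)) A" using corner_hom[OF \<phi>] UA(2) by simp
    have Ec: "corner_arr E' \<in> HomB (corner (?G F1)) (corner (?G F2))" by (rule corner_hom[OF arr(3)])
    have "re r \<bullet> corner_arr \<phi> = g \<bullet> corner_arr E'"
    proof (rule C.jointly_monicD[OF r'(8) C.comp_hom[OF \<phi>c r'(4)] C.comp_hom[OF Ec gh]])
      show "rd r \<bullet> (re r \<bullet> corner_arr \<phi>) = rd r \<bullet> (g \<bullet> corner_arr E')"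
        using C.comp_assoc[OF \<phi>c r'(4,2)] r'(5) C.comp_id_left[OF \<phi>c] C.comp_assoc[OF Ec gh r'(2)] g(2) corner_comp[OF arr(3) uv(1)] uE(1) by simp
      show "rc r \<bullet> (re r \<bullet> corner_arr \<phi>) = rc r \<bullet> (g \<bullet> corner_arr E')"
        using C.comp_assoc[OF \<phi>c r'(4,3)] r'(6) C.comp_id_left[OF \<phi>c] C.comp_assoc[OF Ec gh r'(3)] g(3) corner_comp[OF arr(3) uv(2)] uE(2) by simp
    qed
    then show "corner_arr (\<epsilon> \<cdot>\<^bsub>?R\<^esub> \<phi>) = corner_arr (\<psi> \<cdot>\<^bsub>?R\<^esub> E')"
      using corner_comp[OF \<phi> Box(6)] corner_comp[OF arr(3) \<psi>(1)] Box(7) \<psi>(2) by simp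
  qed
  moreover have "RG (Box A rs) ?K \<delta> \<gamma> \<epsilon> \<in> rgrph_ob ?R"
    using box_U(1)[OF 1(1), of "r # rs"] r(1) 1(3) unfolding Box(1) list.size add_0_right add_Suc_right 1(2) RGrphN_simps RGrph_simps by simp
  ultimately have hom: "RGA \<phi> \<psi> \<in> rgrph_hom ?R (RG (?G F1) (?G F2) D C E') (RG (Box A rs) ?K \<delta> \<gamma> \<epsilon>)"
    using \<phi> \<psi>(1) \<delta>\<psi> arr DE F2o R.hom_ob[OF \<phi>] functorD(1)[OF functor_grphN, OF F(3)]
    unfolding RGA_hom_iff by (simp add: RG_ob_iff u_def v_def)
  \<comment> \<open>At every vertex source and target are kernel pairs of the same component of
    \<open>m\<close>, and \<open>\<psi>\<close> is the comparison between them.\<close>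
  have "iso ?R (?G F2) ?K \<psi>"
  proof (rule iso_RGrphN_levelwise[OF X.category_axioms \<psi>(1)])
    fix b :: "bool list" assume b: "length b = n"
    have K: "is_kernel_pair (base X) A B (corner_arr m) (rtop r) (corner_arr \<delta>) (corner_arr \<gamma>)"
      using C.kernel_pairI[OF mc r'(7)] r(2) by (simp add: Box(3,5) rho_def)
    have lm: "map rho (map (lift r) rs) = map (\<lambda>s. C.lift_rel (rtop r) (corner_arr \<delta>) (corner_arr \<gamma>) (rho s)) rs"
      using lift(2)[OF r(1)] 1(3) unfolding Box(3,5) by auto
    have Kb: "is_kernel_pair (base X) (gvertex b (Box A rs)) (gvertex b (Box B ss)) (gcomponent b m) (gvertex b ?K) (gcomponent b \<delta>) (gcomponent b \<gamma>)"
      using Box_kernel_pair[OF b _ 1(2) 0(2) lift_rels[OF r(1) 1(3)] 1(3) 0(3) K lm m(1) Box(2,4)] 1(2) by simp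
    note exb = C.exact_seqD[OF ex[OF b]] note Kr = C.kernel_pair_jointly_monic[OF Kb]
    have "C.span_rel (gvertex b (?G F2)) (gcomponent b u) (gcomponent b v) = C.span_rel (gvertex b ?K) (gcomponent b \<delta>) (gcomponent b \<gamma>)"
      using C.is_kernel_pair_span_rel[OF exb(6)] C.is_kernel_pair_span_rel[OF Kb] by simp
    then obtain h where h: "iso (base X) (gvertex b (?G F2)) (gvertex b ?K) h" "gcomponent b \<delta> \<bullet> h = gcomponent b u" "gcomponent b \<gamma> \<bullet> h = gcomponent b v"
      by (rule C.span_rel_iso[OF exb(8) Kr])
    have "jointly_monic (base X) (gvertex b ?K) (gcomponent b \<delta>) (gcomponent b \<gamma>)" using Kr by (simp add: is_relation_def)
    then have "h = gcomponent b \<psi>"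
      by (rule C.jointly_monicD[OF _ C.iso_hom[OF h(1)] gcomponent_hom[OF \<psi>(1) b]])
        (use h(2,3) gcomponent_comp[OF \<psi>(1) Box(2) b] gcomponent_comp[OF \<psi>(1) Box(4) b] \<delta>\<psi> in simp_all)
    then show "iso (base X) (gvertex b (?G F2)) (gvertex b ?K) (gcomponent b \<psi>)" using h(1) by simp
  qed
  then have "iso (RGrphN (Suc n) X) (FOb (grphN (Suc n)) F) (Box A (r # rs)) (RGA \<phi> \<psi>)"
    using iso_RGrphI[OF R.category_axioms hom 1(5)] unfolding F(1) grphN_Suc Box(1) RGrphN_simps D_def C_def E'_def by simp
  then show ?case using 1(1,2,3) r dist by (intro exI[of _ A] exI[of _ "r # rs"] exI[of _ "RGA \<phi> \<psi>"]) simp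
qed

end

section \<open>The equivalence\<close>

lemma full_subcategory_simps [simp]:
  "A \<in> Ob (full_subcategory C P) \<longleftrightarrow> A \<in> Ob C \<and> P A"
  "f \<in> Hom (full_subcategory C P) A B \<longleftrightarrow> f \<in> Hom C A B \<and> P A \<and> P B"
  "Id (full_subcategory C P) = Id C" "Comp (full_subcategory C P) = Comp C"
  by (simp_all add: full_subcategory_def)

section \<open>Full subcategories and invariance under isomorphism\<close>

lemma category_full_subcategory:
  assumes "category C"
  shows "category (full_subcategory C P)"
proof -
  interpret C: category C by fact
  show ?thesis
  proof (unfold_locales, goal_cases)
    case (6 f A B g D h E)
    then show ?case using C.comp_assoc[of f A B g D h E] by simp
  qed (auto dest: C.hom_ob intro: C.id_hom C.comp_hom C.comp_id_left C.comp_id_right)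
qed

lemma adjunction_full_subcategory:
  assumes adj: "adjunction C D L R \<eta> \<epsilon>"
    and L: "\<And>A. A \<in> Ob C \<Longrightarrow> P A \<Longrightarrow> Q (FOb L A)" and R: "\<And>B. B \<in> Ob D \<Longrightarrow> Q B \<Longrightarrow> P (FOb R B)"
  shows "adjunction (full_subcategory C P) (full_subcategory D Q) L R \<eta> \<epsilon>"
proof -
  have C: "category C" and D: "category D" and fL: "is_functor C D L" and fR: "is_functor D C R"
    using adj by (simp_all add: adjunction_def)
  have *: "is_functor (full_subcategory C' P') (full_subcategory D' Q') F"
    if "category C'" "is_functor C' D' F" "\<And>A. A \<in> Ob C' \<Longrightarrow> P' A \<Longrightarrow> Q' (FOb F A)"
    for C' :: "('e, 'f) category" and D' :: "('g, 'h) category" and F P' Q'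
    using functorD[OF that(2)] that(3) category.hom_ob[OF that(1)] unfolding is_functor_def by simp blast
  show ?thesis
    unfolding adjunction_def
  proof (intro conjI)
    show "is_functor (full_subcategory C P) (full_subcategory D Q) L" by (rule *[OF C fL]) (rule L)
    show "is_functor (full_subcategory D Q) (full_subcategory C P) R" by (rule *[OF D fR]) (rule R)
  qed (use adj L R functorD(1)[OF fL] functorD(1)[OF fR] category_full_subcategory C D in \<open>auto simp: adjunction_def natural_transformation_def comp_functor_def id_functor_def\<close>)
qed

lemma iso_full_subcategory: "iso C A B f \<Longrightarrow> P A \<Longrightarrow> P B \<Longrightarrow> iso (full_subcategory C P) A B f"
  by (auto simp: iso_def)

lemma equiv_inv_image:
  assumes "equiv A r" and "r' \<subseteq> A' \<times> A'" and "\<And>x. x \<in> A' \<Longrightarrow> h x \<in> A"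
    and iff: "\<And>x y. x \<in> A' \<Longrightarrow> y \<in> A' \<Longrightarrow> (x, y) \<in> r' \<longleftrightarrow> (h x, h y) \<in> r"
  shows "equiv A' r'"
proof (rule equivI)
  have r: "refl_on A r" "sym r" "trans r" using assms(1) by (auto simp: equiv_def)
  show "r' \<subseteq> A' \<times> A'" by fact
  show "refl_on A' r'" using assms(3) iff refl_onD[OF r(1)] by (auto intro: refl_onI)
  show "sym r'" using iff r(2) assms(2) by (auto simp: sym_def)
  show "trans r'"
  proof (rule transI)
    fix x y z assume xy: "(x, y) \<in> r'" "(y, z) \<in> r'"
    then have "x \<in> A'" "y \<in> A'" "z \<in> A'" using assms(2) by auto
    then show "(x, z) \<in> r'" using iff xy transD[OF r(3)] by metis
  qed
qed

lemma (in category) equivalence_relation_iso: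
  assumes E: "is_equivalence_relation C A R d c" and a: "iso C A' A a" and k: "iso C R' R k"
    and d': "d' \<in> Hom C R' A'" "c' \<in> Hom C R' A'" and eq: "d \<cdot> k = a \<cdot> d'" "c \<cdot> k = a \<cdot> c'"
  shows "is_equivalence_relation C A' R' d' c'"
proof -
  have d: "d \<in> Hom C R A" "c \<in> Hom C R A" and jm: "jointly_monic C R d c"
    and eqv: "\<And>T. T \<in> Ob C \<Longrightarrow> equiv (Hom C T A) ((\<lambda>x. (d \<cdot> x, c \<cdot> x)) ` Hom C T R)"
    using E by (auto simp: is_equivalence_relation_def is_relation_def)
  obtain k' where k': "k' \<in> Hom C R R'" "k \<cdot> k' = Id C R" by (rule isoE[OF k])
  note ah = iso_hom[OF a] note kh = iso_hom[OF k]
  note sq = square_comp[OF kh d(1) d'(1) ah eq(1)] square_comp[OF kh d(2) d'(2) ah eq(2)]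
  have "jointly_monic C R' d' c'"
    unfolding jointly_monic_def
  proof (intro allI ballI impI)
    fix T x y assume x: "x \<in> Hom C T R'" and y: "y \<in> Hom C T R'" and xy: "d' \<cdot> x = d' \<cdot> y \<and> c' \<cdot> x = c' \<cdot> y"
    have "k \<cdot> x = k \<cdot> y"
      by (rule jointly_monicD[OF jm comp_hom[OF x kh] comp_hom[OF y kh]]) (use sq[OF x] sq[OF y] xy in simp_all)
    then show "x = y" by (rule iso_cancel_left[OF k x y])
  qed
  moreover have "equiv (Hom C T A') ((\<lambda>x. (d' \<cdot> x, c' \<cdot> x)) ` Hom C T R')" (is "equiv _ ?r'") if T: "T \<in> Ob C" for T
  proof -
    let ?r = "(\<lambda>x. (d \<cdot> x, c \<cdot> x)) ` Hom C T R"
    have iff: "(x, y) \<in> ?r' \<longleftrightarrow> (a \<cdot> x, a \<cdot> y) \<in> ?r" if x: "x \<in> Hom C T A'" and y: "y \<in> Hom C T A'" for x y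
    proof
      assume "(x, y) \<in> ?r'"
      then obtain z where z: "z \<in> Hom C T R'" "x = d' \<cdot> z" "y = c' \<cdot> z" by auto
      then show "(a \<cdot> x, a \<cdot> y) \<in> ?r" using sq[OF z(1)] comp_hom[OF z(1) kh] by (intro image_eqI[of _ _ "k \<cdot> z"]) simp_all
    next
      assume "(a \<cdot> x, a \<cdot> y) \<in> ?r"
      then obtain w where w: "w \<in> Hom C T R" "a \<cdot> x = d \<cdot> w" "a \<cdot> y = c \<cdot> w" by auto
      note kw = comp_hom[OF w(1) k'(1)]
      have "k \<cdot> (k' \<cdot> w) = w" using comp_assoc[OF w(1) k'(1) kh] k'(2) comp_id_left[OF w(1)] by simp
      then have "a \<cdot> (d' \<cdot> (k' \<cdot> w)) = a \<cdot> x" "a \<cdot> (c' \<cdot> (k' \<cdot> w)) = a \<cdot> y" using sq[OF kw] w(2,3) by simp_all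
      then have "d' \<cdot> (k' \<cdot> w) = x" "c' \<cdot> (k' \<cdot> w) = y"
        using iso_cancel_left[OF a comp_hom[OF kw d'(1)] x] iso_cancel_left[OF a comp_hom[OF kw d'(2)] y] by simp_all
      then show "(x, y) \<in> ?r'" using kw by auto
    qed
    have sub: "?r' \<subseteq> Hom C T A' \<times> Hom C T A'" using comp_hom[OF _ d'(1)] comp_hom[OF _ d'(2)] by auto
    show ?thesis by (rule equiv_inv_image[OF eqv[OF T] sub _ iff]) (rule comp_hom[OF _ ah])
  qed
  ultimately show ?thesis using d' by (simp add: is_equivalence_relation_def is_relation_def)
qed

lemma category_ERelN: "category X \<Longrightarrow> category (ERelN n X)"
  by (induction n) (auto simp: ERelN_simps ERel_def intro!: category_base category_full_subcategory category_RGrph)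

text \<open>A distributive parallelistic object has to lie in \<open>ERelN n X\<close> itself,
  whereas an exact fork is only known to have an underlying graph isomorphic to a box; this lemma
  bridges the two.\<close>

lemma ERelN_iso:
  assumes X: "category X" and "E \<in> Ob (ERelN n X)" "iso (RGrphN n X) D E i"
  shows "D \<in> Ob (ERelN n X)"
  using assms(2,3)
proof (induction n arbitrary: D E i)
  case 0
  interpret C: category "RGrphN 0 X" by (rule category_RGrphN[OF X])
  show ?case using C.hom_ob[OF C.iso_hom[OF 0(2)]] by (simp add: RGrphN_simps ERelN_simps)
next
  case (Suc n)
  let ?R = "RGrphN n X" and ?E = "ERelN n X"
  interpret E: category ?E by (rule category_ERelN[OF X])
  interpret RS: category "RGrphN (Suc n) X" by (rule category_RGrphN[OF X])
  note full = ERelN_full[OF X, of n]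
  have ih: "i \<in> rgrph_hom ?R D E" using RS.iso_hom[OF Suc.prems(2)] by (simp add: RGrphN_simps)
  then obtain i1 i2 D1 D2 d c e E1 E2 d' c' e' where i: "i = RGA i1 i2" "D = RG D1 D2 d c e" "E = RG E1 E2 d' c' e'" 
    "RG D1 D2 d c e \<in> rgrph_ob ?R" "RG E1 E2 d' c' e' \<in> rgrph_ob ?R" "i1 \<in> Hom ?R D1 E1" "i2 \<in> Hom ?R D2 E2"
    "d' \<cdot>\<^bsub>?R\<^esub> i2 = i1 \<cdot>\<^bsub>?R\<^esub> d" "c' \<cdot>\<^bsub>?R\<^esub> i2 = i1 \<cdot>\<^bsub>?R\<^esub> c" by (rule rgrph_homE)
  have iso: "iso ?R D1 E1 i1" "iso ?R D2 E2 i2" using Suc.prems(2) unfolding i(1-3) RGrphN_simps by (rule iso_RGrphD)+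
  have E: "E1 \<in> Ob ?E" "E2 \<in> Ob ?E" "is_equivalence_relation ?E E1 E2 d' c'" using Suc.prems(1) unfolding i(3) ERelN_Suc_iff[OF X] by blast+
  have D: "D1 \<in> Ob ?E" "D2 \<in> Ob ?E" using Suc.IH E(1,2) iso by blast+
  have "iso ?E D1 E1 i1" "iso ?E D2 E2 i2" using iso D E(1,2) full unfolding iso_def by auto
  moreover have "d \<in> Hom ?E D2 D1" "c \<in> Hom ?E D2 D1" using i(4) D full by (auto simp: RG_ob_iff)
  ultimately have "is_equivalence_relation ?E D1 D2 d c" using E.equivalence_relation_iso[OF E(3)] i(8,9) full by simp
  then show ?case unfolding i(2) ERelN_Suc_iff[OF X] using D i(4) by (simp add: RGrphN_simps)
qed

section \<open>Exact forks against distributive parallelistic equivalence relations\<close>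

context tower
begin

text \<open>In an exact fork the object at 0 is the coequaliser of the rest, so invertibility at the
  coordinates 1 and 2 forces it at 0, one coordinate after another.\<close>

lemma exact_components_iso:
  assumes "g \<in> Hom (ForkN n X) F H" "exact_nfork n X F" "exact_nfork n X H"
    "\<And>b. length b = n \<Longrightarrow> set b \<subseteq> {1, 2} \<Longrightarrow> iso (base X) (vertex b F) (vertex b H) (component b g)"
    "length a = n" "set a \<subseteq> {0, 1, 2}"
  shows "iso (base X) (vertex a F) (vertex a H) (component a g)"
  using assms
proof (induction n arbitrary: F H g a)
  case (Suc n)
  obtain g0 g1 g2 F0 F1 F2 d c e f H0 H1 H2 d' c' e' f' where g: "g = FkA g0 g1 g2"
    "F = Fk F0 F1 F2 d c e f" "H = Fk H0 H1 H2 d' c' e' f'"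
    "Fk F0 F1 F2 d c e f \<in> fork_ob (ForkN n X)" "Fk H0 H1 H2 d' c' e' f' \<in> fork_ob (ForkN n X)"
    "g0 \<in> Hom (ForkN n X) F0 H0" "g1 \<in> Hom (ForkN n X) F1 H1" "g2 \<in> Hom (ForkN n X) F2 H2"
    "d' \<cdot>\<^bsub>ForkN n X\<^esub> g2 = g1 \<cdot>\<^bsub>ForkN n X\<^esub> d" "c' \<cdot>\<^bsub>ForkN n X\<^esub> g2 = g1 \<cdot>\<^bsub>ForkN n X\<^esub> c"
    "f' \<cdot>\<^bsub>ForkN n X\<^esub> g1 = g0 \<cdot>\<^bsub>ForkN n X\<^esub> f"
    using Suc.prems(1) unfolding ForkN_simps Fork_simps by (rule fork_homE)
  note EF = Suc.prems(2)[unfolded g(2) exact_nfork_Suc] note EH = Suc.prems(3)[unfolded g(3) exact_nfork_Suc]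
  have 1: "iso (base X) (vertex b F1) (vertex b H1) (component b g1)" if b: "length b = n" "set b \<subseteq> {0, 1, 2}" for b
    using EF EH Suc.prems(4)[of "1 # _"] by (intro Suc.IH[OF g(7) _ _ _ b]) (auto simp: g(1-3))
  have 2: "iso (base X) (vertex b F2) (vertex b H2) (component b g2)" if b: "length b = n" "set b \<subseteq> {0, 1, 2}" for b
    using EF EH Suc.prems(4)[of "2 # _"] by (intro Suc.IH[OF g(8) _ _ _ b]) (auto simp: g(1-3))
  have 0: "iso (base X) (vertex b F0) (vertex b H0) (component b g0)" if b: "length b = n" "set b \<subseteq> {0, 1, 2}" for b
  proof -
    note arr = g(4)[unfolded Fk_ob_iff] g(5)[unfolded Fk_ob_iff]
    have ex: "C.exact_seq (vertex b F2) (vertex b F1) (vertex b F0) (component b d) (component b c) (component b f)"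
      "C.exact_seq (vertex b H2) (vertex b H1) (vertex b H0) (component b d') (component b c') (component b f')"
      using EF EH b by blast+
    note xF = C.exact_seqD[OF ex(1)] note xH = C.exact_seqD[OF ex(2)]
    note i1 = 1[OF b] note i2 = 2[OF b]
    obtain h where h: "h \<in> HomB (vertex b H1) (vertex b F1)" "h \<bullet> component b g1 = IdB (vertex b F1)" by (rule C.isoE[OF i1])
    have sq: "component b d' \<bullet> component b g2 = component b g1 \<bullet> component b d" "component b c' \<bullet> component b g2 = component b g1 \<bullet> component b c"
      "component b f' \<bullet> component b g1 = component b g0 \<bullet> component b f"
      using component_square[OF g(8) _ _ g(7) g(9) b] component_square[OF g(8) _ _ g(7) g(10) b] component_square[OF g(7) _ _ g(6) g(11) b] arr by blast+
    note g1 = C.iso_hom[OF i1] note q = C.comp_hom[OF h(1) xF(3)]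
    have q1: "(component b f \<bullet> h) \<bullet> component b g1 = component b f"
      using C.comp_assoc[OF g1 h(1) xF(3)] h(2) C.comp_id_right[OF xF(3)] by simp
    have F0: "vertex b F0 \<in> Ob (base X)" using C.hom_ob[OF xF(3)] by simp
    \<comment> \<open>Transport along the isomorphisms at 1 and 2 exhibits \<open>F0\<close> as a
      second coequaliser of the pair belonging to \<open>H\<close>. The resulting isomorphism agrees
      with the component of \<open>g0\<close> after the epimorphism \<open>f\<close>, and therefore
      equals it.\<close>
    have "C.exact_seq (vertex b H2) (vertex b H1) (vertex b F0) (component b d') (component b c') (component b f \<bullet> h)"
      by (rule C.exact_seq_iso[OF ex(1) i2 i1 C.iso_id[OF F0] xH(1,2) q sq(1,2)]) (use q1 C.comp_id_left[OF xF(3)] in simp)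
    then obtain k where k: "iso (base X) (vertex b F0) (vertex b H0) k" "k \<bullet> (component b f \<bullet> h) = component b f'"
      by (rule C.coequaliser_unique[OF C.exact_seqD(7) xH(7)])
    note kh = C.iso_hom[OF k(1)]
    have "k \<bullet> component b f = component b g0 \<bullet> component b f"
      using k(2) C.comp_assoc[OF g1 q kh] q1 sq(3) by simp
    then have "k = component b g0"
      by (rule C.regular_epi_epi[OF xF(5) kh component_hom[OF g(6) b]])
    then show ?thesis using k(1) by simp
  qed
  obtain x b where b: "a = x # b" "length b = n" "set b \<subseteq> {0, 1, 2}" "x \<in> {0, 1, 2}" using Suc.prems(5,6) by (cases a) auto
  then show ?case using 0[of b] 1[of b] 2[of b] by (auto simp: g(1-3))
qed simp

lemma exact_grphN_reflects_iso:
  assumes g: "g \<in> Hom (ForkN n X) F H" and ex: "exact_nfork n X F" "exact_nfork n X H"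
    and i: "iso (RGrphN n X) (FOb (grphN n) F) (FOb (grphN n) H) (FAr (grphN n) F H g)"
  shows "iso (ForkN n X) F H g"
proof (rule iso_ForkN_levelwise[OF X.category_axioms g exact_components_iso[OF g ex]])
  fix b assume b: "length b = n" "set b \<subseteq> {1, 2 :: nat}"
  then obtain b' where b': "b = map (\<lambda>x. if x then 2 else 1) b'" "length b' = n" using positive_levels[OF b(2)] by metis
  show "iso (base X) (vertex b F) (vertex b H) (component b g)"
    using gcomponent_iso[OF i b'(2)] vertex_grphN[OF exact_nforkD[OF ex(1)] b'(2)] vertex_grphN[OF exact_nforkD[OF ex(2)] b'(2)]
      component_grphN[OF g b'(2)] by (simp add: b'(1))
qed

lemma exact_distributive_parallelistic:
  assumes n: "0 < n" and F: "exact_nfork n X F"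
  shows "distributive_parallelistic n X (FOb (grphN n) F)"
proof -
  obtain A rs i where B: "A \<in> Ob (base X)" "length rs = n" "set rs \<subseteq> rels A" "C.dist A (rho ` set rs)"
    "iso (RGrphN n X) (FOb (grphN n) F) (Box A rs) i" using ex_Box_iso[OF F] by blast
  have R: "rs ! i \<in> rels A" if "i < n" for i using B(2,3) that by (meson nth_mem subsetD)
  have rs: "map ((!) rs) [0..<n] = rs" using B(2) map_nth by blast
  have "rho ` (!) rs ` {..<n} = rho ` set rs" using rs by (metis atLeast_upt list.set_map)
  then have "distributive n (base X) A ((!) rs)" using distributive_iff[OF B(1), of n "(!) rs"] R B(4) by simp
  moreover have "is_box n X ((!) rs) (Box A rs)" using is_box_Box[OF n, of "(!) rs" A] R rs by simp
  moreover have "FOb (grphN n) F \<in> Ob (ERelN n X)"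
    by (rule ERelN_iso[OF X.category_axioms _ B(5)]) (use Box_ERelN[OF B(1,3)] B(2) in simp)
  ultimately show ?thesis
    unfolding distributive_parallelistic_def isomorphic_def using B(5) R unfolding rels_def by blast
qed

text \<open>The object \<open>D\<close> is isomorphic to a box \<open>E\<close> that is known by its
  maximality alone; \<open>is_box_iso\<close> replaces \<open>E\<close> by the constructed
  box.\<close>

lemma distributive_parallelistic_exact:
  assumes n: "0 < n" and D: "distributive_parallelistic n X D"
  shows "exact_nfork n X (FOb (CoeqForkN n X) D)"
proof -
  interpret R: category "RGrphN n X" by (rule category_RGrphN[OF X.category_axioms])
  obtain A R E where E: "\<forall>i<n. R i \<in> rels A" "distributive n (base X) A R" "is_box n X R E" "isomorphic (RGrphN n X) D E"
    using D unfolding distributive_parallelistic_def rels_def by blast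
  have R: "R i \<in> rels A" if "i < n" for i using E(1) that by blast
  have A: "A \<in> Ob (base X)" using relsD(10)[OF R[OF n]] .
  obtain i where "iso (RGrphN n X) D E i" using E(4) by (auto simp: isomorphic_def)
  moreover obtain j where "iso (RGrphN n X) E (Box A (map R [0..<n])) j" using is_box_iso[OF n R E(3)] by (auto simp: isomorphic_def)
  ultimately obtain k where "iso (RGrphN n X) D (Box A (map R [0..<n])) k" using R.iso_comp by blast
  then obtain l where "iso (RGrphN n X) (Box A (map R [0..<n])) D l" by (rule R.isoE)
  moreover have "C.dist A (rho ` set (map R [0..<n]))" using iffD1[OF distributive_iff[OF A R] E(2)] by (simp add: atLeast0LessThan)
  moreover have "set (map R [0..<n]) \<subseteq> rels A" using R by auto
  ultimately show ?thesis by (intro Box_iso_exact[OF A]) simp_all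
qed

end

text \<open>The second conjunct covers every adjunction between the two functors, with arbitrary
  unit and counit.\<close>

theorem theorem3p15:
  fixes X :: "('o, 'm) category" and n :: nat
  assumes "exact_maltsev_category X" and "n \<ge> 1"
  shows "(\<exists>\<eta> \<epsilon>. adjunction (RGrphN n X) (ForkN n X) (CoeqForkN n X) (grphN n) \<eta> \<epsilon>) \<and>
    (\<forall>\<eta> \<epsilon>. adjunction (RGrphN n X) (ForkN n X) (CoeqForkN n X) (grphN n) \<eta> \<epsilon> \<longrightarrow>
      adjoint_equivalence (DPERel n X) (EFork n X) (CoeqForkN n X) (grphN n) \<eta> \<epsilon>)"
proof -
  interpret tower X using assms(1) by (simp add: tower_def)
  note S = strict_reflection_tower[of n]
  have n: "0 < n" using assms(2) by simp
  have "adjoint_equivalence (DPERel n X) (EFork n X) (CoeqForkN n X) (grphN n) \<eta> \<epsilon>"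
    if adj: "adjunction (RGrphN n X) (ForkN n X) (CoeqForkN n X) (grphN n) \<eta> \<epsilon>" for \<eta> \<epsilon>
    unfolding adjoint_equivalence_def DPERel_def EFork_def
  proof (intro conjI ballI)
    show "adjunction (full_subcategory (RGrphN n X) (distributive_parallelistic n X)) (full_subcategory (ForkN n X) (exact_nfork n X))
        (CoeqForkN n X) (grphN n) \<eta> \<epsilon>"
      using distributive_parallelistic_exact[OF n] exact_distributive_parallelistic[OF n] by (intro adjunction_full_subcategory[OF adj])
  next
    fix D assume "D \<in> Ob (full_subcategory (RGrphN n X) (distributive_parallelistic n X))"
    then have D: "D \<in> Ob (RGrphN n X)" "distributive_parallelistic n X D" by simp_all
    show "iso (full_subcategory (RGrphN n X) (distributive_parallelistic n X)) D (FOb (grphN n) (FOb (CoeqForkN n X) D)) (\<eta> D)"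
      using iso_full_subcategory[OF strict_reflection_unit_iso[OF S adj D(1)], where P = "distributive_parallelistic n X"]
        strict_reflectionD(5)[OF S D(1)] D(2) by simp
  next
    fix F assume "F \<in> Ob (full_subcategory (ForkN n X) (exact_nfork n X))"
    then have F: "F \<in> Ob (ForkN n X)" "exact_nfork n X F" by simp_all
    \<comment> \<open>For the counit to be an arrow between exact forks, its source must be exact;
      this combines both directions of the correspondence.\<close>
    have LRF: "exact_nfork n X (FOb (CoeqForkN n X) (FOb (grphN n) F))"
      by (rule distributive_parallelistic_exact[OF n exact_distributive_parallelistic[OF n F(2)]])
    show "iso (full_subcategory (ForkN n X) (exact_nfork n X)) (FOb (CoeqForkN n X) (FOb (grphN n) F)) F (\<epsilon> F)"
      using iso_full_subcategory[OF exact_grphN_reflects_iso[OF strict_reflection_counit_iso(1)[OF S adj F(1)] LRF F(2)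
        strict_reflection_counit_iso(2)[OF S adj F(1)]], where P = "exact_nfork n X"] LRF F(2) by blast
  qed
  then show ?thesis using strict_reflection_adjunction[OF S] by blast
qed

end
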